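(* Let $n\geqslant2$, $\sigma>0$, $s\in\mathbb{R}$. Given an initial condition $f_0\in H^s(\mathbb{S})$ (a real distribution, not necessarily nonnegative), there exists a unique weak solution $f$ of the Doi equation $\partial_t f=-\nabla_\omega\cdot((\mathrm{Id}-\omega\otimes\omega)J[f]f)+\sigma\Delta_\omega f$, $J[f]=\int_{\mathbb{S}}\omega f\,\mathrm d\omega$, such that $f(0)=f_0$. This solution is global in time (a weak solution on $[0,T]$ for every $T>0$). Moreover $f$ is a classical solution belonging to $C^\infty((0,+\infty)\times\mathbb{S})$, and for each $t>0$ the function $f(t,\cdot)$ is real analytic on $\mathbb{S}$.
   Context: $\mathbb{S}$ is the unit sphere of $\mathbb{R}^n$ with the rotation-invariant probability measure $\mathrm d\omega$; $\nabla_\omega,\nabla_\omega\cdot,\Delta_\omega$ are the tangential gradient, divergence and Laplace–Beltrami operator. Sobolev spaces are defined spectrally: for mean-zero $g=\sum_{\ell\ge1}g_\ell$ (degree-$\ell$ spherical harmonic components), $\|g\|^2_{\dot H^s}=\sum_{\ell\ge1}(\ell(\ell+n-2))^s\|g_\ell\|^2_{L^2}$, and $H^s$ consists of $f$ with $f-\langle f,1\rangle\in\dot H^s$. Weak solution on $[0,T]$: $f\in L^2((0,T),H^{s+1})\cap H^1((0,T),H^{s-1})$ such that for a.e. $t$ and all $h\in H^{-s+1}(\mathbb{S})$, $\langle\partial_tf,h\rangle=-\sigma\langle\nabla_\omega f,\nabla_\omega h\rangle+\langle f,J[f]\cdot\nabla_\omega h\rangle$ (duality pairing of distributions); such $f$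 lies in $C([0,T],H^s)$. *)

theory Defs
  imports "HOL-Analysis.Analysis"
begin

fun Ck :: "nat \<Rightarrow> ('a::real_normed_vector \<Rightarrow> 'b::real_normed_vector) \<Rightarrow> 'a set \<Rightarrow> bool" where
  "Ck 0 f S = continuous_on S f"
| "Ck (Suc k) f S =
     ((\<forall>x\<in>S. f differentiable (at x)) \<and> (\<forall>v. Ck k (\<lambda>x. frechet_derivative f (at x) v) S))"

definition smooth_on :: "'a::real_normed_vector set \<Rightarrow> ('a \<Rightarrow> 'b::real_normed_vector) \<Rightarrow> bool" where
  "smooth_on S f \<longleftrightarrow> (\<forall>k. Ck k f S)"

definition real_analytic_on :: "(real^'n) set \<Rightarrow> (real^'n \<Rightarrow> real) \<Rightarrow> bool" where
  "real_analytic_on S f \<longleftrightarrow>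
     (\<forall>x0\<in>S. \<exists>r>0. \<exists>c :: ('n \<Rightarrow> nat) \<Rightarrow> real.
        \<forall>x\<in>ball x0 r. ((\<lambda>\<alpha>. c \<alpha> * (\<Prod>i\<in>UNIV. (x$i - x0$i) ^ \<alpha> i)) has_sum f x) UNIV)"

section \<open>Calculus on the unit sphere, via the 0-homogeneous extension\<close>

definition zext :: "(real^'n \<Rightarrow> 'b) \<Rightarrow> real^'n \<Rightarrow> 'b" where
  "zext g x = g (x /\<^sub>R norm x)"

definition grad :: "(real^'n \<Rightarrow> real) \<Rightarrow> real^'n \<Rightarrow> real^'n" where
  "grad G x = (\<chi> i. deriv (\<lambda>u. G (x + u *\<^sub>R axis i 1)) 0)"

definition lap :: "(real^'n \<Rightarrow> real) \<Rightarrow> real^'n \<Rightarrow> real" where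
  "lap G x = (\<Sum>i\<in>UNIV. deriv (deriv (\<lambda>v. G (x + v *\<^sub>R axis i 1))) 0)"

definition tgrad :: "(real^'n \<Rightarrow> real) \<Rightarrow> real^'n \<Rightarrow> real^'n" where
  "tgrad g \<omega> = grad (zext g) \<omega>"

definition tdiv :: "(real^'n \<Rightarrow> real^'n) \<Rightarrow> real^'n \<Rightarrow> real" where
  "tdiv V \<omega> = (\<Sum>i\<in>UNIV. deriv (\<lambda>u. zext V (\<omega> + u *\<^sub>R axis i 1) $ i) 0)"

definition lapS :: "(real^'n \<Rightarrow> real) \<Rightarrow> real^'n \<Rightarrow> real" where
  "lapS g \<omega> = lap (zext g) \<omega>"

text \<open>rotation-invariant probability measure on the unit sphere: image of the uniform
  probability on the punctured unit ball under radial projection\<close>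
definition sphere_measure :: "(real^'n) measure" where
  "sphere_measure = distr (uniform_measure lborel (ball 0 1 - {0}))
                          (restrict_space borel (sphere 0 1)) (\<lambda>x. x /\<^sub>R norm x)"

definition sph_int :: "(real^'n \<Rightarrow> real) \<Rightarrow> real" where
  "sph_int g = integral\<^sup>L sphere_measure g"

definition sph_harm :: "nat \<Rightarrow> (real^'n \<Rightarrow> real) \<Rightarrow> bool" where
  "sph_harm l P \<longleftrightarrow> real_polynomial_function P \<and>
     (\<forall>c x. P (c *\<^sub>R x) = c ^ l * P x) \<and> (\<forall>x. lap P x = 0)"

text \<open>A distribution on the sphere is represented by its sequence of spherical harmonic
  components u l (of degree l).\<close>
type_synonym ('n) sdist = "nat \<Rightarrow> (real, 'n::finite) vec \<Rightarrow> real"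

definition sqn :: "(real^'n \<Rightarrow> real) \<Rightarrow> real" where
  "sqn g = sph_int (\<lambda>x. (g x)\<^sup>2)"

definition hs_weight :: "real \<Rightarrow> 'n::finite sdist \<Rightarrow> nat \<Rightarrow> real" where
  "hs_weight s u l = (if l = 0 then 1 else (real l * (real l + real CARD('n) - 2)) powr s)"

definition in_Hs :: "real \<Rightarrow> 'n::finite sdist \<Rightarrow> bool" where
  "in_Hs s u \<longleftrightarrow> (\<forall>l. sph_harm l (u l)) \<and> summable (\<lambda>l. hs_weight s u l * sqn (u l))"

definition hs_sq :: "real \<Rightarrow> 'n::finite sdist \<Rightarrow> real" where
  "hs_sq s u = (\<Sum>l. hs_weight s u l * sqn (u l))"

definition tpair :: "'n::finite sdist \<Rightarrow> (real^'n \<Rightarrow> real) \<Rightarrow> real" where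
  "tpair u \<phi> = (\<Sum>l. sph_int (\<lambda>x. u l x * \<phi> x))"

definition dpair :: "'n::finite sdist \<Rightarrow> 'n::finite sdist \<Rightarrow> real" where
  "dpair u h = (\<Sum>k. tpair u (h k))"

definition gpair :: "'n::finite sdist \<Rightarrow> 'n::finite sdist \<Rightarrow> real" where
  "gpair u h = (\<Sum>k. \<Sum>l. sph_int (\<lambda>x. tgrad (u l) x \<bullet> tgrad (h k) x))"

definition Jv :: "'n::finite sdist \<Rightarrow> real^'n" where
  "Jv u = (\<chi> i. tpair u (\<lambda>x. x $ i))"

definition jpair :: "'n::finite sdist \<Rightarrow> 'n::finite sdist \<Rightarrow> real" where
  "jpair u h = (\<Sum>k. tpair u (\<lambda>x. Jv u \<bullet> tgrad (h k) x))"

definition L2H :: "real \<Rightarrow> real \<Rightarrow> (real \<Rightarrow> 'n::finite sdist) \<Rightarrow> bool" where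
  "L2H r T u \<longleftrightarrow> (\<forall>l x. (\<lambda>t. u t l x) \<in> borel_measurable borel) \<and>
     (AE t in lborel. t \<in> {0<..<T} \<longrightarrow> in_Hs r (u t)) \<and>
     set_integrable lborel {0<..<T} (\<lambda>t. hs_sq r (u t))"

definition test_fun :: "real \<Rightarrow> (real \<Rightarrow> real) \<Rightarrow> bool" where
  "test_fun T \<phi> \<longleftrightarrow> smooth_on UNIV \<phi> \<and>
     (\<exists>a b. 0 < a \<and> b < T \<and> (\<forall>t. t \<notin> {a..b} \<longrightarrow> \<phi> t = 0))"

definition weak_tderiv :: "real \<Rightarrow> (real \<Rightarrow> 'n::finite sdist) \<Rightarrow> (real \<Rightarrow> 'n::finite sdist) \<Rightarrow> bool" where
  "weak_tderiv T u g \<longleftrightarrow> (\<forall>l x \<phi>. test_fun T \<phi> \<longrightarrow>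
     (LBINT t:{0<..<T}. u t l x * deriv \<phi> t) = - (LBINT t:{0<..<T}. g t l x * \<phi> t))"

definition weak_sol :: "real \<Rightarrow> real \<Rightarrow> real \<Rightarrow> (real \<Rightarrow> 'n::finite sdist) \<Rightarrow> bool" where
  "weak_sol \<sigma> s T f \<longleftrightarrow> L2H (s + 1) T f \<and>
     (\<exists>g. L2H (s - 1) T g \<and> weak_tderiv T f g \<and>
        (AE t in lborel. t \<in> {0<..<T} \<longrightarrow>
           (\<forall>h. in_Hs (1 - s) h \<longrightarrow>
              dpair (g t) h = - \<sigma> * gpair (f t) h + jpair (f t) h)))"

definition cont_Hs :: "real \<Rightarrow> real set \<Rightarrow> (real \<Rightarrow> 'n::finite sdist) \<Rightarrow> bool" where
  "cont_Hs s A f \<longleftrightarrow> (\<forall>t\<in>A. in_Hs s (f t)) \<and>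
     (\<forall>t0\<in>A. ((\<lambda>t. hs_sq s (\<lambda>l. f t l - f t0 l)) \<longlongrightarrow> 0) (at t0 within A))"

end

theory Submission
  imports Defs "HOL-Real_Asymp.Real_Asymp"
begin

text \<open>
  Multiplication by \<open>v \<bullet> \<omega>\<close> maps harmonics of degree \<open>k\<close> to degrees \<open>k + 1\<close> and \<open>k - 1\<close>, through two operators \<open>Up\<close>
  and \<open>Dn\<close> that are adjoint to each other. In components the Doi equation is therefore the system
  \<open>f\<^sub>k' = - \<sigma> k(k+n-2) f\<^sub>k + (k+n-2) Up\<^sub>J f\<^sub>k\<^sub>-\<^sub>1 - k Dn\<^sub>J f\<^sub>k\<^sub>+\<^sub>1\<close>, in which \<open>J\<close> is a linear function of \<open>f\<^sub>1\<close>.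
  The dissipation controls the drift by the energy estimate of each component, even with the weights
  \<open>exp((2ak - 2a\<^sup>2/\<sigma>)t)\<close>. If \<open>J\<close> is truncated, the Picard iteration converges, and since \<open>a\<close> is arbitrary, for \<open>t > 0\<close>
  the components decay faster than every exponential in \<open>k\<close>. An energy with weights that make the drift telescope
  bounds \<open>J\<close> independently of the truncation, which is thus removed.

  The decay is inherited by time derivatives and by tangential derivatives, so the series of the components is smooth
  and satisfies the equation pointwise. It dominates the geometric growth, given by Euler's identity, of the
  majorants of a harmonic composed with \<open>x / |x|\<close>, whence analyticity. A weak solution solves
  the same system of ordinary differential equations by the du Bois-Reymond lemma, and iterating the energy estimate for the
  difference of two solutions gives uniqueness.
\<close>

section \<open>Polynomials, directional derivatives and spherical harmonics\<close>

text \<open>Since \<open>f0\<close> may be signed and s very negative, neither positivity nor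
  entropy bounds J. What controls J for all time is the energy with the weights \<open>cw\<close>,
  which decay like a power of the degree; for small s it can be infinite at time 0. A short time
  \<open>t0\<close> is therefore crossed first, with a weighted H^s bound that does not see the
  cut-off (\<open>pic_bound_small\<close>); from \<open>t0\<close> on the energy is finite and can
  be followed (\<open>apriori\<close>). The resulting bound is free of the cut-off radius, so it may
  itself be taken as the radius, and the cut-off is then never active (\<open>doi_solution\<close>).

  Estimates are made for partial sums over the degrees up to K. The drift couples K to K + 1, so the
  inequalities do not close at fixed K and Gronwall's lemma does not apply to them; iteration from K
  to K + 1, with bounds uniform in K, replaces it and produces the terms of an exponential series.
  Constants may be crude: bounding a harmonic of degree k pointwise by its L2 norm loses n^(2k)
  here, but the decay beats every exponential.\<close>

abbreviation rpf :: "('a::real_normed_vector => real) => bool" where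
  "rpf \<equiv> real_polynomial_function"

lemmas rpf_linear = real_polynomial_function.intros(1)
  and rpf_const = real_polynomial_function.intros(2)
  and rpf_add = real_polynomial_function.intros(3)
  and rpf_mult = real_polynomial_function.intros(4)

definition dd :: "'a::real_normed_vector => ('a => real) => 'a => real" where
  "dd v P x = frechet_derivative P (at x) v"

lemma dd_eq: "(P has_derivative D) (at x) ==> dd v P x = D v"
  unfolding dd_def by (metis frechet_derivative_at)

lemma rpf_differentiable: "rpf P ==> P differentiable (at x)"
  by (induction rule: real_polynomial_function.induct)
    (auto intro: bounded_linear_imp_differentiable)

lemma rpf_has_derivative: "rpf P ==> (P has_derivative (%v. dd v P x)) (at x)"
  using rpf_differentiable[of P x] unfolding dd_def
  by (metis eta_contract_eq frechet_derivative_works)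

lemma rpf_continuous_on: "rpf P ==> continuous_on S P"
  by (meson continuous_at_imp_continuous_on differentiable_imp_continuous_within rpf_differentiable)

lemma dd_const [simp]: "dd v (%_. c) x = 0"
  by (rule dd_eq) simp

lemma dd_blinear: "bounded_linear f ==> dd v f x = f v"
  by (rule dd_eq) (simp add: bounded_linear_imp_has_derivative)

lemma dd_add: "rpf P ==> rpf Q ==> dd v (%x. P x + Q x) x = dd v P x + dd v Q x"
  by (rule dd_eq) (intro has_derivative_add rpf_has_derivative)

lemma dd_diff: "rpf P ==> rpf Q ==> dd v (%x. P x - Q x) x = dd v P x - dd v Q x"
  by (rule dd_eq) (intro has_derivative_diff rpf_has_derivative)

lemma dd_mult: "rpf P ==> rpf Q ==> dd v (%x. P x * Q x) x = P x * dd v Q x + dd v P x * Q x"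
  by (rule dd_eq) (intro has_derivative_mult rpf_has_derivative)

lemma dd_cmult: "rpf P ==> dd v (%x. c * P x) x = c * dd v P x"
  by (rule dd_eq) (intro has_derivative_mult_right rpf_has_derivative)

lemma dd_sum: "(!!i. i : I ==> rpf (P i)) ==> dd v (%x. \<Sum>i\<in>I. P i x) x = (\<Sum>i\<in>I. dd v (P i) x)"
  by (rule dd_eq) (intro has_derivative_sum rpf_has_derivative)

lemma dd_linear: "rpf P ==> bounded_linear (%v. dd v P x)"
  using rpf_has_derivative has_derivative_bounded_linear by blast

lemma dd_v_add: "rpf P ==> dd (v + w) P x = dd v P x + dd w P x"
  using linear_add[OF bounded_linear.linear[OF dd_linear]] .

lemma dd_v_diff: "rpf P ==> dd (v - w) P x = dd v P x - dd w P x"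
  using linear_diff[OF bounded_linear.linear[OF dd_linear]] .

lemma dd_v_scale: "rpf P ==> dd (c *\<^sub>R v) P x = c * dd v P x"
proof -
  assume "rpf P"
  then have "linear (%v. dd v P x)" by (rule bounded_linear.linear[OF dd_linear])
  from linear_cmul[OF this, of c v] show ?thesis by simp
qed

lemma dd_v_coord:
  fixes v :: "real^'n"
  assumes "rpf P" shows "dd v P x = (\<Sum>i\<in>UNIV. v $ i * dd (axis i 1) P x)"
proof -
  have "dd v P x = dd (\<Sum>i\<in>UNIV. v $ i *\<^sub>R axis i 1) P x"
    by (simp add: basis_expansion flip: scalar_mult_eq_scaleR)
  also have "... = (\<Sum>i\<in>UNIV. v $ i * dd (axis i 1) P x)"
    using linear_sum[OF bounded_linear.linear[OF dd_linear[OF assms, of x]], of "%i. v $ i *\<^sub>R axis i 1" UNIV]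
    by (simp add: dd_v_scale assms)
  finally show ?thesis .
qed

lemma rpf_dd: "rpf P ==> rpf (dd v P)"
proof (induction rule: real_polynomial_function.induct)
  case (linear f) then have "dd v f = (%_. f v)" by (auto simp: dd_blinear)
  then show ?case by auto
next
  case (const c) have "dd v (%_::'a. c) = (%_. 0)" by auto
  then show ?case by auto
next
  case (add f g)
  then have "dd v (%x. f x + g x) = (%x. dd v f x + dd v g x)" by (auto simp: dd_add)
  then show ?case using add by auto
next
  case (mult f g)
  then have "dd v (%x. f x * g x) = (%x. f x * dd v g x + dd v f x * g x)" by (auto simp: dd_mult)
  then show ?case using mult by auto
qed

lemma dd_commute: "rpf P ==> dd v (dd w P) x = dd w (dd v P) x"
proof (induction arbitrary: x rule: real_polynomial_function.induct)
  case (linear f) then have "dd v f = (%_. f v)" "dd w f = (%_. f w)" by (auto simp: dd_blinear)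
  then show ?case by simp
next
  case (const c) have "dd v (%_::'a. c) = (%_. 0)" for v by auto
  then show ?case by simp
next
  case (add f g)
  then have "dd v (%x. f x + g x) = (%x. dd v f x + dd v g x)" for v by (auto simp: dd_add)
  then show ?case using add by (simp add: dd_add rpf_dd)
next
  case (mult f g)
  then have e: "dd v (%x. f x * g x) = (%x. f x * dd v g x + dd v f x * g x)" for v by (auto simp: dd_mult)
  have "rpf (%x. f x * dd v g x)" "rpf (%x. dd v f x * g x)" for v
    using mult.hyps by (auto intro!: rpf_mult rpf_dd)
  then show ?case unfolding e using mult by (simp add: dd_add dd_mult rpf_dd)
qed

lemma deriv_line:
  assumes "(G has_derivative D) (at (x + u *\<^sub>R v))"
  shows "((%u. G (x + u *\<^sub>R v)) has_real_derivative D v) (at u)"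
proof -
  have "((%u. G (x + u *\<^sub>R v)) has_derivative (%h. D (h *\<^sub>R v))) (at u)"
    by (rule has_derivative_compose[of "%u. x + u *\<^sub>R v" _ _ _ G D, OF _ assms]) (auto intro!: derivative_eq_intros)
  moreover have "(%h. D (h *\<^sub>R v)) = (%h. D v * h)"
    using has_derivative_linear[OF assms] by (simp add: linear_cmul mult.commute)
  ultimately show ?thesis by (simp add: has_field_derivative_def)
qed

lemma grad_eq: "(G has_derivative D) (at x) ==> grad G x $ i = D (axis i 1)"
  unfolding grad_def using deriv_line[of G D x 0 "axis i 1"] by (simp add: DERIV_imp_deriv)

lemma lap_rpf: "rpf P ==> lap P x = (\<Sum>i\<in>UNIV. dd (axis i 1) (dd (axis i 1) P) x)"
proof -
  assume P: "rpf P"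
  have "deriv (%v. P (x + v *\<^sub>R axis i 1)) = (%v. dd (axis i 1) P (x + v *\<^sub>R axis i 1))" for i
    by (rule ext) (intro DERIV_imp_deriv deriv_line rpf_has_derivative P)
  moreover have "deriv (%v. dd (axis i 1) P (x + v *\<^sub>R axis i 1)) 0 = dd (axis i 1) (dd (axis i 1) P) x" for i
    using deriv_line[of "dd (axis i 1) P" _ x 0 "axis i 1", OF rpf_has_derivative, OF rpf_dd[OF P]]
    by (simp add: DERIV_imp_deriv)
  ultimately show ?thesis unfolding lap_def by simp
qed

definition homog :: "nat => ('a::real_normed_vector => real) => bool" where
  "homog k P \<longleftrightarrow> (\<forall>c x. P (c *\<^sub>R x) = c ^ k * P x)"

lemma homog_0: "homog 0 P ==> P x = P 0"
  unfolding homog_def by (metis mult_1 power_0 scaleR_zero_left)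

lemma homog_0_dd: "homog 0 P ==> dd v P x = 0"
proof -
  assume "homog 0 P"
  then have "P = (%_. P 0)" using homog_0 by blast
  then show ?thesis by (metis dd_const)
qed

lemma homog_dd:
  assumes P: "rpf P" and h: "homog (Suc k) P" shows "homog k (dd v P)"
proof -
  have ne: "dd v P (c *\<^sub>R x) = c ^ k * dd v P x" if "c ~= 0" for c x
  proof -
    have 1: "((%x. P (c *\<^sub>R x)) has_derivative (%w. dd (c *\<^sub>R w) P (c *\<^sub>R x))) (at x)"
      by (rule has_derivative_compose[of "%x. c *\<^sub>R x", OF _ rpf_has_derivative[OF P]]) (auto intro!: derivative_eq_intros)
    have 2: "((%x. c ^ Suc k * P x) has_derivative (%w. c ^ Suc k * dd w P x)) (at x)"
      by (intro has_derivative_mult_right rpf_has_derivative P)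
    have "(%x. P (c *\<^sub>R x)) = (%x. c ^ Suc k * P x)" using h unfolding homog_def by blast
    then have "dd (c *\<^sub>R v) P (c *\<^sub>R x) = c ^ Suc k * dd v P x"
      using 1 2 dd_eq by metis
    then show ?thesis using that by (simp add: dd_v_scale P)
  qed
  \<comment> \<open>For c = 0 the chain rule gives nothing, as it only determines the derivative
    times c. Both sides are continuous in c and agree elsewhere.\<close>
  have "dd v P (0 *\<^sub>R x) = 0 ^ k * dd v P x" for x
  proof -
    let ?g = "%c::real. dd v P (c *\<^sub>R x) - c ^ k * dd v P x"
    have "continuous_on UNIV ?g"
      by (intro continuous_intros continuous_on_compose2[OF rpf_continuous_on[OF rpf_dd[OF P], of UNIV]]) auto
    then have "isCont ?g 0" by (simp add: continuous_on_eq_continuous_at)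
    then have "(?g \<longlongrightarrow> ?g 0) (at 0)" unfolding isCont_def .
    moreover have "(?g \<longlongrightarrow> 0) (at 0)"
      by (rule tendsto_eventually) (auto simp: eventually_at_filter ne)
    ultimately have "?g 0 = 0" by (rule tendsto_unique[OF trivial_limit_at])
    then show ?thesis by simp
  qed
  with ne show ?thesis unfolding homog_def by metis
qed

lemma Euler_homog:
  assumes P: "rpf P" and h: "homog k P" shows "dd x P x = real k * P x"
proof -
  have "((%c. P (0 + c *\<^sub>R x)) has_real_derivative dd x P x) (at 1)"
    by (rule deriv_line) (use rpf_has_derivative[OF P, of x] in simp)
  moreover have "(%c. P (0 + c *\<^sub>R x)) = (%c. c ^ k * P x)"
    using h by (auto simp: homog_def)
  moreover have "((%c. c ^ k * P x) has_real_derivative real k * P x) (at 1)"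
    by (auto intro!: derivative_eq_intros)
  ultimately show ?thesis using DERIV_unique by metis
qed

lemma sph_harm_iff:
  "sph_harm k P \<longleftrightarrow> rpf P & homog k P & (\<forall>x. (\<Sum>i\<in>UNIV. dd (axis i 1) (dd (axis i 1) P) x) = 0)"
  unfolding sph_harm_def homog_def by (auto simp: lap_rpf)

lemma sph_harm_rpf: "sph_harm k P ==> rpf P" and sph_harm_homog: "sph_harm k P ==> homog k P"
  by (auto simp: sph_harm_iff)

lemma sph_harm_zero: "sph_harm k (%_. 0)"
proof -
  have *: "dd v (%_::real^'n. 0::real) = (%_. 0)" for v by auto
  show ?thesis unfolding sph_harm_iff homog_def * by auto
qed

lemma rpf_inner: "rpf (%x::real^'n. v \<bullet> x)"
  by (simp add: bounded_linear_inner_right rpf_linear)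

lemma dd_inner: "dd w (%x::real^'n. v \<bullet> x) = (%_. v \<bullet> w)"
  by (rule ext, rule dd_blinear) (rule bounded_linear_inner_right)

lemma sph_harm_inner: "sph_harm 1 (%x::real^'n. v \<bullet> x)"
  using rpf_inner by (auto simp: sph_harm_iff homog_def dd_inner)

lemma dd_cmult': "rpf P ==> dd v (%x. c * P x) = (%x. c * dd v P x)"
  and dd_add': "rpf P ==> rpf Q ==> dd v (%x. P x + Q x) = (%x. dd v P x + dd v Q x)"
  and dd_diff': "rpf P ==> rpf Q ==> dd v (%x. P x - Q x) = (%x. dd v P x - dd v Q x)"
  and dd_mult': "rpf P ==> rpf Q ==> dd v (%x. P x * Q x) = (%x. P x * dd v Q x + dd v P x * Q x)"
  by (auto simp: dd_cmult dd_add dd_mult dd_diff)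

lemma rpf_cmult: "rpf P ==> rpf (%x. c * P x)"
  using rpf_mult rpf_const by blast

lemma sph_harm_add: "sph_harm k P ==> sph_harm k Q ==> sph_harm k (%x. P x + Q x)"
  unfolding sph_harm_iff homog_def
  by (auto simp: dd_add' rpf_dd sum.distrib algebra_simps)

lemma sph_harm_cmult: "sph_harm k P ==> sph_harm k (%x. c * P x)"
  unfolding sph_harm_iff homog_def
  by (auto simp: dd_cmult' rpf_dd rpf_cmult simp flip: sum_distrib_left)

lemma sph_harm_diff: "sph_harm k P ==> sph_harm k Q ==> sph_harm k (%x. P x - Q x)"
  using sph_harm_add[of k P "%x. (-1) * Q x"] sph_harm_cmult[of k Q "-1"] by simp

lemma sph_harm_sum: "(!!i. i : I ==> sph_harm k (P i)) ==> sph_harm k (%x. \<Sum>i\<in>I. P i x)"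
  by (induction I rule: infinite_finite_induct) (auto intro: sph_harm_zero sph_harm_add)

text \<open>Derivatives with constant coefficients commute with the Laplacian. The drop of one
  degree drives the later inductions on the degree.\<close>

lemma sph_harm_dd:
  assumes "sph_harm (Suc k) P" shows "sph_harm k (dd v P)"
proof -
  have P: "rpf P" "homog (Suc k) P" and L: "!!x. (\<Sum>i\<in>UNIV. dd (axis i 1) (dd (axis i 1) P) x) = 0"
    using assms by (auto simp: sph_harm_iff)
  have "dd w (dd v P) = dd v (dd w P)" for w using dd_commute[OF P(1)] by auto
  then have "(\<Sum>i\<in>UNIV. dd (axis i 1) (dd (axis i 1) (dd v P)) x)
      = (\<Sum>i\<in>UNIV. dd v (dd (axis i 1) (dd (axis i 1) P)) x)" for x
    by (metis (no_types, lifting) dd_commute P(1) rpf_dd)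
  also have "... x = dd v (%x. \<Sum>i\<in>UNIV. dd (axis i 1) (dd (axis i 1) P) x) x" for x
    by (simp add: dd_sum rpf_dd P(1))
  finally show ?thesis using P L by (simp add: sph_harm_iff rpf_dd homog_dd)
qed

lemma sph_harm_0_eq: "sph_harm 0 P ==> P = (%_. P 0)"
  using homog_0 sph_harm_homog by blast

section \<open>Products with linear and quadratic forms\<close>

lemma rpf_coord: "rpf (%x::real^'n. x $ i)"
  using rpf_inner[of "axis i 1"] by (simp add: inner_axis' )

lemma rpf_sq: "rpf (%x::real^'n. x \<bullet> x)"
  unfolding inner_vec_def inner_real_def
  by (intro real_polynomial_function_sum rpf_mult rpf_coord) auto

lemma dd_sq: "dd v (%x::real^'n. x \<bullet> x) = (%x. 2 * (x \<bullet> v))"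
  by (rule ext, rule dd_eq) (auto intro!: derivative_eq_intros simp: inner_commute)

lemma sum_axis_sq: "(\<Sum>i\<in>UNIV. (v \<bullet> axis i 1) * dd (axis i 1) P x) = dd v P x" if "rpf P" for v :: "real^'n"
  using dd_v_coord[OF that, of v x] by (simp add: inner_axis)

text \<open>On the sphere, multiplication by \<open>v \<bullet> x\<close> splits as \<open>Up + Dn\<close> into the harmonic
  components of degree \<open>k + 1\<close> and \<open>k - 1\<close>.\<close>

definition Dn :: "real^'n => nat => (real^'n => real) => real^'n => real" where
  "Dn v k P x = dd v P x / (2 * real k + real CARD('n) - 2)"

definition Up :: "real^'n => nat => (real^'n => real) => real^'n => real" where
  "Up v k P x = (v \<bullet> x) * P x - (x \<bullet> x) * Dn v k P x"

lemma Up_plus_Dn: "norm x = 1 ==> (v \<bullet> x) * P x = Up v k P x + Dn v k P x"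
  by (simp add: Up_def dot_square_norm)

lemma sph_harm_Dn: "sph_harm (Suc k) P ==> sph_harm k (Dn v (Suc k) P)"
  unfolding Dn_def using sph_harm_cmult[OF sph_harm_dd, of k P "1 / (2 * real (Suc k) + real CARD('n) - 2)" v] by simp

lemma Dn_0: "sph_harm 0 P ==> Dn v k P x = 0"
  by (simp add: Dn_def homog_0_dd sph_harm_homog)

lemma lap_inner_mult:
  assumes P: "rpf P"
  shows "(\<Sum>i\<in>UNIV. dd (axis i 1) (dd (axis i 1) (%x::real^'n. (v \<bullet> x) * P x)) x)
     = (v \<bullet> x) * (\<Sum>i\<in>UNIV. dd (axis i 1) (dd (axis i 1) P) x) + 2 * dd v P x"
proof -
  have "dd w (%x. (v \<bullet> x) * P x) = (%x. (v \<bullet> x) * dd w P x + (v \<bullet> w) * P x)" for w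
    by (simp add: dd_mult'[OF rpf_inner P] dd_inner)
  moreover have "dd w (%x. (v \<bullet> x) * dd w P x + (v \<bullet> w) * P x) x
     = (v \<bullet> x) * dd w (dd w P) x + 2 * ((v \<bullet> w) * dd w P x)" for w x
    by (subst dd_add) (auto simp: dd_mult dd_inner dd_cmult P rpf_dd rpf_inner rpf_cmult)
  ultimately show ?thesis
    by (simp add: sum.distrib sum_axis_sq[OF P] flip: sum_distrib_left)
qed

lemma lap_sq_mult:
  assumes P: "rpf P"
  shows "(\<Sum>i\<in>UNIV. dd (axis i 1) (dd (axis i 1) (%x::real^'n. (x \<bullet> x) * P x)) x)
     = (x \<bullet> x) * (\<Sum>i\<in>UNIV. dd (axis i 1) (dd (axis i 1) P) x) + 4 * dd x P x + 2 * real CARD('n) * P x"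
proof -
  have 1: "dd w (%x. (x \<bullet> x) * P x) = (%x. (x \<bullet> x) * dd w P x + 2 * ((w \<bullet> x) * P x))" for w
    by (auto simp: dd_mult'[OF rpf_sq P] dd_sq inner_commute)
  have 2: "dd w (%x. (x \<bullet> x) * dd w P x + 2 * ((w \<bullet> x) * P x)) x
     = (x \<bullet> x) * dd w (dd w P) x + 4 * ((x \<bullet> w) * dd w P x) + 2 * (w \<bullet> w) * P x" for w x
    by (subst dd_add) (auto simp: dd_mult dd_inner dd_sq dd_cmult P rpf_dd rpf_inner rpf_sq rpf_cmult
        rpf_mult inner_commute[of x w])
  show ?thesis unfolding 1 2
    by (simp add: sum.distrib sum_axis_sq[OF P] inner_axis_axis flip: sum_distrib_left)
qed

text \<open>The Laplacian of (v . x) P is 2 \<open>dd v P\<close>, and that of |x|^2 D, with D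
  harmonic of degree k - 1, is 2 (2k + n - 2) D. The denominator in \<open>Dn\<close> is chosen so
  that the two cancel. Degree 0 is split off because there the denominator vanishes for n =
  2.\<close>

lemma sph_harm_Up:
  fixes P :: "real^'n => real"
  assumes h: "sph_harm k P" and n: "CARD('n) >= 2" shows "sph_harm (Suc k) (Up v k P)"
proof (cases k)
  case 0
  then have "Up v k P = (%x. P 0 * (v \<bullet> x))"
    using h Dn_0[of P] homog_0[OF sph_harm_homog, of P] by (auto simp: Up_def)
  then show ?thesis using sph_harm_cmult[OF sph_harm_inner[of v], of "P 0"] 0 by simp
next
  case (Suc l)
  have P: "rpf P" "homog k P" and L: "!!x. (\<Sum>i\<in>UNIV. dd (axis i 1) (dd (axis i 1) P) x) = 0"
    using h by (auto simp: sph_harm_iff)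
  have D: "sph_harm l (Dn v k P)" using sph_harm_Dn h Suc by blast
  let ?D = "Dn v k P"
  have L2: "!!x. (\<Sum>i\<in>UNIV. dd (axis i 1) (dd (axis i 1) ?D) x) = 0" and D': "rpf ?D" "homog l ?D"
    using D by (auto simp: sph_harm_iff)
  have r1: "rpf (%x. (v \<bullet> x) * P x)" "rpf (%x. (x \<bullet> x) * ?D x)"
    using rpf_inner P rpf_sq D' by (auto intro!: rpf_mult)
  have e: "Up v k P = (%x. (v \<bullet> x) * P x - (x \<bullet> x) * ?D x)" by (auto simp: Up_def)
  have "rpf (Up v k P)" unfolding e using r1 by auto
  moreover have "homog (Suc k) (Up v k P)"
    using P(2) D'(2) unfolding homog_def e by (simp add: Suc algebra_simps)
  moreover have "(\<Sum>i\<in>UNIV. dd (axis i 1) (dd (axis i 1) (Up v k P)) x) = 0" for x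
  proof -
    have "(\<Sum>i\<in>UNIV. dd (axis i 1) (dd (axis i 1) (Up v k P)) x)
      = 2 * dd v P x - (4 * dd x ?D x + 2 * real CARD('n) * ?D x)"
      unfolding e using r1
      by (simp add: dd_diff' dd_diff rpf_dd sum_subtractf lap_inner_mult lap_sq_mult P D' L L2)
    also have "... = 2 * dd v P x - (4 * real l + 2 * real CARD('n)) * ?D x"
      using Euler_homog[OF D', of x] by (simp add: algebra_simps)
    also have "... = 0"
      using n by (simp add: Dn_def Suc field_simps)
    finally show ?thesis .
  qed
  ultimately show ?thesis by (simp add: sph_harm_iff)
qed

section \<open>Integration over the sphere\<close>

abbreviation B0 :: "(real^'n) set" where "B0 \<equiv> ball 0 1 - {0}"

text \<open>The radial projection with a value on the sphere also at 0, which makes it a measurable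
  map into the sphere.\<close>

definition sproj :: "real^'n => real^'n" where
  "sproj x = (if x = 0 then axis undefined 1 else x /\<^sub>R norm x)"

lemma sphere_normalized: "x ~= 0 ==> norm (x /\<^sub>R norm x) = 1" by simp

lemma norm_sproj [simp]: "norm (sproj x) = 1"
  by (simp add: sproj_def)

lemma vol_B0: "0 < measure lborel (B0 :: (real^'n) set)" "emeasure lborel (B0 :: (real^'n) set) = ennreal (measure lborel (B0 :: (real^'n) set))"
proof -
  have "emeasure lborel (B0 :: (real^'n) set) < \<infinity>"
    by (rule le_less_trans[OF emeasure_mono[of _ "ball 0 1"] emeasure_lborel_ball_finite]) auto
  then show e: "emeasure lborel (B0 :: (real^'n) set) = ennreal (measure lborel (B0 :: (real^'n) set))"
    using emeasure_eq_ennreal_measure by (metis infinity_ennreal_def less_irrefl)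
  have "open (B0 :: (real^'n) set)" by (intro open_Diff) auto
  moreover have "(1/2) *\<^sub>R axis undefined 1 : (B0 :: (real^'n) set)" by (auto simp: axis_eq_0_iff)
  ultimately have "\<not> negligible (B0 :: (real^'n) set)" using open_not_negligible by blast
  then have "emeasure lborel (B0 :: (real^'n) set) ~= 0"
    by (simp add: negligible_iff_emeasure0 emeasure_completion)
  then show "0 < measure lborel (B0 :: (real^'n) set)" using e
    by (metis ennreal_0 measure_nonneg order_less_le)
qed

lemma sproj_measurable [measurable]: "sproj : borel_measurable borel"
  unfolding sproj_def by measurable

lemma sproj_measurable': "sproj : measurable (uniform_measure lborel B0) (restrict_space borel (sphere 0 1))"
  by (rule measurable_restrict_space2) (auto simp: uniform_measure_def)

text \<open>The map x / |x| sends 0 to 0 and so leaves the sphere; it is not measurable into it. The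
  two image measures are therefore compared through \<open>measure_of\<close>: on the punctured ball
  all preimages coincide.\<close>

lemma sphere_measure_eq:
  "(sphere_measure :: (real^'n) measure) = distr (uniform_measure lborel B0) (restrict_space borel (sphere 0 1)) sproj"
  unfolding sphere_measure_def distr_def
proof (rule measure_of_eq)
  show "sets (restrict_space borel (sphere 0 1)) \<subseteq> Pow (space (restrict_space borel (sphere (0::real^'n) 1)))"
    by (rule sets.space_closed)
  fix X :: "(real^'n) set"
  assume "X : sigma_sets (space (restrict_space borel (sphere 0 1))) (sets (restrict_space borel (sphere 0 1)))"
  then have "X : sets (restrict_space borel (sphere 0 1))" by (simp only: sets.sigma_sets_eq)
  then have [measurable]: "X : sets borel" by (simp add: sets_restrict_space_iff)
  have [measurable]: "(%x::real^'n. x /\<^sub>R norm x) : borel_measurable borel" by measurable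
  let ?f = "%x::real^'n. x /\<^sub>R norm x"
  have m: "?f -` X : sets lborel" "sproj -` X : sets lborel"
    using measurable_sets[of ?f borel borel X] measurable_sets[of sproj borel borel X] by auto
  have "B0 \<inter> ?f -` X = B0 \<inter> sproj -` X" by (auto simp: sproj_def)
  then show "emeasure (uniform_measure lborel B0) (?f -` X \<inter> space (uniform_measure lborel B0))
    = emeasure (uniform_measure lborel B0) (sproj -` X \<inter> space (uniform_measure lborel B0))"
    using m by (simp add: space_uniform_measure)
qed

lemma space_sphere_measure [simp]: "space sphere_measure = sphere 0 1"
  by (simp add: sphere_measure_eq space_restrict_space)

lemma sph_meas: "continuous_on (sphere 0 1) g ==> g : borel_measurable (sphere_measure :: (real^'n) measure)"
  for g :: "real^'n => real"
  unfolding sphere_measure_eq measurable_distr_eq1 by (rule borel_measurable_continuous_on_restrict)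

lemma sphere_measure_prob: "emeasure (sphere_measure :: (real^'n) measure) (space sphere_measure) = 1"
proof -
  have "emeasure (uniform_measure lborel B0 :: (real^'n) measure) UNIV = 1"
    using vol_B0[where 'n='n] by (subst emeasure_uniform_measure) (auto intro!: ennreal_divide_self)
  moreover have "sproj -` sphere 0 1 = (UNIV :: (real^'n) set)" by auto
  ultimately show ?thesis unfolding sphere_measure_eq
    by (subst emeasure_distr[OF sproj_measurable']) (auto simp: space_restrict_space sets_restrict_space_iff)
qed

interpretation sph: finite_measure "sphere_measure :: (real^'n) measure"
  by standard (simp add: sphere_measure_prob[unfolded space_sphere_measure])

lemma sph_integrable:
  fixes g :: "real^'n => real"
  assumes "continuous_on (sphere 0 1) g" shows "integrable sphere_measure g"
proof -
  have "compact (g ` sphere 0 1)" using assms by (intro compact_continuous_image) auto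
  then obtain M where "\<forall>y\<in>g ` sphere 0 1. norm y <= M" using compact_imp_bounded bounded_iff by metis
  then show ?thesis by (intro sph.integrable_const_bound[of _ M] sph_meas assms) auto
qed

lemma sph_int_ball:
  fixes g :: "real^'n => real"
  assumes g: "continuous_on (sphere 0 1) g"
  shows "sph_int g = (\<integral>x. indicator B0 x * g (sproj x) \<partial>lborel) / measure lborel (B0 :: (real^'n) set)"
proof -
  let ?V = "measure lborel (B0 :: (real^'n) set)"
  have gm: "(%x. g (sproj x)) : borel_measurable lborel"
    using measurable_compose[OF sproj_measurable' borel_measurable_continuous_on_restrict[OF g]]
    by (simp add: uniform_measure_def)
  have "sph_int g = (\<integral>x. g (sproj x) \<partial>uniform_measure lborel B0)"
    unfolding sph_int_def sphere_measure_eq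
    by (rule integral_distr[OF sproj_measurable' borel_measurable_continuous_on_restrict[OF g]])
  also have "uniform_measure lborel (B0 :: (real^'n) set) = density lborel (%x. ennreal (indicator B0 x / ?V))"
    unfolding uniform_measure_def
    by (intro density_cong) (auto simp: vol_B0 divide_ennreal indicator_def simp flip: ennreal_1)
  also have "(\<integral>x. g (sproj x) \<partial>density lborel (%x. ennreal (indicator B0 x / ?V)))
      = (\<integral>x. (indicator B0 x / ?V) *\<^sub>R g (sproj x) \<partial>lborel)"
    by (rule integral_density[OF gm]) (auto intro!: borel_measurable_divide borel_measurable_indicator)
  also have "... = (\<integral>x. indicator B0 x * g (sproj x) \<partial>lborel) / ?V"
    by (simp add: mult.commute flip: integral_divide_zero)
  finally show ?thesis .
qed

lemma sph_int_cong: "(!!x. norm x = 1 ==> f x = g x) ==> sph_int f = sph_int g"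
  unfolding sph_int_def by (rule Bochner_Integration.integral_cong) auto

lemma sph_int_add: "continuous_on (sphere 0 1) f ==> continuous_on (sphere 0 1) g ==> sph_int (%x. f x + g x) = sph_int f + sph_int g"
  unfolding sph_int_def by (simp add: sph_integrable)

lemma sph_int_diff: "continuous_on (sphere 0 1) f ==> continuous_on (sphere 0 1) g ==> sph_int (%x. f x - g x) = sph_int f - sph_int g"
  unfolding sph_int_def by (simp add: sph_integrable)

lemma sph_int_cmult: "sph_int (%x. c * f x) = c * sph_int f"
  unfolding sph_int_def by simp

lemma sph_int_zero [simp]: "sph_int (%x. 0) = 0"
  unfolding sph_int_def by simp

lemma sph_int_const: "sph_int (%x::real^'n. c) = c"
  unfolding sph_int_def using sphere_measure_prob[where 'n='n] by (simp add: measure_def)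

lemma sph_int_sum: "(!!i. i : I ==> continuous_on (sphere 0 1) (f i)) ==> sph_int (%x. \<Sum>i\<in>I. f i x) = (\<Sum>i\<in>I. sph_int (f i))"
  unfolding sph_int_def by (rule Bochner_Integration.integral_sum) (simp add: sph_integrable)

lemma sph_int_mono:
  "continuous_on (sphere 0 1) f ==> continuous_on (sphere 0 1) g ==> (!!x. norm x = 1 ==> f x <= g x) ==> sph_int f <= sph_int g"
  unfolding sph_int_def by (rule integral_mono) (auto simp: sph_integrable)

text \<open>If g were positive at w, it would be so near w, and the part of the ball that projects
  to this neighbourhood is open, hence of positive Lebesgue measure.\<close>

lemma sph_int_eq_0:
  fixes g :: "real^'n => real"
  assumes g: "continuous_on (sphere 0 1) g" and nn: "!!x. norm x = 1 ==> 0 <= g x" and 0: "sph_int g = 0" and w: "norm w = 1"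
  shows "g w = 0"
proof (rule ccontr)
  assume "g w ~= 0"
  then have gw: "g w > 0" using nn[OF w] by simp
  have gm: "(%x. g (sproj x)) : borel_measurable lborel"
    using measurable_compose[OF sproj_measurable' borel_measurable_continuous_on_restrict[OF g]]
    by (simp add: uniform_measure_def)
  obtain M where M: "!!y. norm y = 1 ==> \<bar>g y\<bar> <= M"
  proof -
    have "compact (g ` sphere 0 1)" using g by (intro compact_continuous_image) auto
    then obtain M where "\<forall>y\<in>g ` sphere 0 1. norm y <= M" using compact_imp_bounded bounded_iff by metis
    then show ?thesis using that[of M] by auto
  qed
  let ?f = "%x. indicator B0 x * g (sproj x)"
  have fin: "emeasure lborel (B0 :: (real^'n) set) < \<infinity>" by (simp add: vol_B0(2))
  have i: "integrable lborel ?f"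
    by (rule Bochner_Integration.integrable_bound[of lborel "%x. indicator B0 x * M"])
      (use gm M fin in \<open>auto simp: abs_mult intro!: integrable_mult_left integrable_real_indicator borel_measurable_times borel_measurable_indicator AE_I2 order_trans[OF M] split: split_indicator\<close>)
  have "integral\<^sup>L lborel ?f = 0"
    using sph_int_ball[OF g] 0 vol_B0(1)[where 'n='n] by simp
  then have ae: "AE x in lborel. ?f x = 0"
    using integral_nonneg_eq_0_iff_AE[OF i] nn by (auto simp: indicator_def)
  let ?h = "%x::real^'n. x /\<^sub>R norm x"
  have ch: "continuous_on B0 (%x. g (?h x))"
    by (rule continuous_on_compose2[OF g]) (use sphere_normalized in \<open>force intro!: continuous_intros\<close>)+
  have op: "open (B0::(real^'n) set)" by (intro open_Diff) auto
  define U where "U = (%x. g (?h x)) -` {0<..} \<inter> B0"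
  have "open U" unfolding U_def using ch op continuous_open_preimage[of B0 "%x. g (?h x)" "{0<..}"] by (simp add: Int_commute)
  moreover have "(1/2) *\<^sub>R w : U" using gw w by (auto simp: U_def)
  ultimately have "\<not> negligible U" using open_not_negligible by blast
  moreover have "emeasure lborel U = 0"
  proof -
    have "AE x in lborel. x \<notin> U" using ae
      by eventually_elim (auto simp: U_def indicator_def sproj_def split: if_splits)
    then show ?thesis using \<open>open U\<close> by (subst (asm) AE_iff_measurable[of U]) auto
  qed
  ultimately show False using \<open>open U\<close> by (simp add: negligible_iff_emeasure0 emeasure_completion)
qed

section \<open>Radial integration over the ball\<close>

lemma lborel_integral_scale:
  fixes g :: "real^'n => real"
  assumes c: "c > 0" and [measurable]: "g : borel_measurable borel"
  shows "(\<integral>x. g x \<partial>lborel) = c ^ CARD('n) * (\<integral>x. g (c *\<^sub>R x) \<partial>lborel)"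
proof -
  have "(lborel :: (real^'n) measure) = density (distr lborel borel (%x. 0 + c *\<^sub>R x)) (%_. ennreal (\<bar>c\<bar> ^ DIM(real^'n)))"
    by (rule lborel_affine) (use c in auto)
  then have "(\<integral>x. g x \<partial>lborel) = (\<integral>x. g x \<partial>density (distr lborel borel (%x::real^'n. 0 + c *\<^sub>R x)) (%_. ennreal (\<bar>c\<bar> ^ DIM(real^'n))))"
    by metis
  also have "... = (\<integral>x. (\<bar>c\<bar> ^ DIM(real^'n)) *\<^sub>R g x \<partial>distr lborel borel (%x::real^'n. 0 + c *\<^sub>R x))"
    by (rule integral_density) (use c in auto)
  also have "... = (\<integral>x. (\<bar>c\<bar> ^ DIM(real^'n)) *\<^sub>R g (0 + c *\<^sub>R x) \<partial>lborel)"
    by (rule integral_distr) auto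
  finally show ?thesis using c by simp
qed

text \<open>Polar coordinates for radial powers, obtained by comparing the thin shell
  \<open>c <= |x| < 1\<close> with its scaling as \<open>c\<close> tends to 1.\<close>

lemma radial_moment:
  fixes h :: "real^'n => real"
  assumes [measurable]: "h : borel_measurable borel" and M: "!!x. \<bar>h x\<bar> <= M"
    and hom: "!!c x. c > 0 ==> x ~= 0 ==> h (c *\<^sub>R x) = h x"
  shows "(real CARD('n) + real p) * (\<integral>x. indicator B0 x * (norm x ^ p * h x) \<partial>lborel)
     = real CARD('n) * (\<integral>x. indicator B0 x * h x \<partial>lborel)"
proof -
  let ?n = "CARD('n)"
  have [simp, measurable]: "B0 : sets (borel :: (real^'n) measure)" by auto
  define A where "A = (%q. \<integral>x. indicator B0 x * (norm x ^ q * h x) \<partial>lborel)"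
  let ?S = "%c. B0 \<inter> {x::real^'n. c <= norm x}"
  let ?V = "measure lborel (B0 :: (real^'n) set)"
  have M0: "0 <= M" using M[of 0] by linarith
  have I: "integrable lborel (%x. indicator T x * (norm x ^ q * h' x))"
    if "T : sets borel" "T \<subseteq> B0" "h' : borel_measurable borel" "!!x. \<bar>h' x\<bar> <= K" for T q K and h' :: "real^'n => real"
  proof (rule Bochner_Integration.integrable_bound[of lborel "%x. indicator B0 x * K"])
    show "integrable lborel (%x. indicator B0 x * K :: real)"
      by (intro integrable_mult_left integrable_real_indicator) (auto simp: vol_B0(2))
    show "AE x in lborel. norm (indicator T x * (norm x ^ q * h' x)) <= norm (indicator B0 x * K)"
    proof (rule AE_I2)
      fix x
      have K: "0 <= K" using that(4)[of 0] by linarith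
      have "norm x ^ q * \<bar>h' x\<bar> <= 1 * K" if "x : B0"
        using that(1) by (intro mult_mono power_le_one) (auto simp: \<open>!!x. \<bar>h' x\<bar> <= K\<close> K)
      then show "norm (indicator T x * (norm x ^ q * h' x)) <= norm (indicator B0 x * K)"
        using that(2) K by (auto simp: indicator_def abs_mult)
    qed
    note [measurable] = that(1,3)
    show "(%x. indicator T x * (norm x ^ q * h' x)) : borel_measurable lborel" by measurable
  qed
  have shell: "(\<integral>x. indicator (?S c) x * (norm x ^ q * h' x) \<partial>lborel) = (1 - c ^ (?n + q)) * (\<integral>x. indicator B0 x * (norm x ^ q * h' x) \<partial>lborel)"
    if c: "0 < c" "c < 1" and hm [measurable]: "h' : borel_measurable borel" and hb: "!!x. \<bar>h' x\<bar> <= K"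
     and hh: "!!c x. c > 0 ==> x ~= 0 ==> h' (c *\<^sub>R x) = h' x" for c q K and h' :: "real^'n => real"
  proof -
    \<comment> \<open>The inner ball is the unit ball scaled by c, so it carries the fraction c^(n +
      q) of the integral and the shell the rest.\<close>
    let ?C = "B0 \<inter> {x::real^'n. norm x < c}"
    have [measurable]: "?C : sets borel" "?S c : sets borel" by measurable
    have "(\<integral>x. indicator B0 x * (norm x ^ q * h' x) \<partial>lborel) = (\<integral>x. indicator ?C x * (norm x ^ q * h' x) + indicator (?S c) x * (norm x ^ q * h' x) \<partial>lborel)"
      by (intro Bochner_Integration.integral_cong) (auto simp: indicator_def)
    also have "... = (\<integral>x. indicator ?C x * (norm x ^ q * h' x) \<partial>lborel) + (\<integral>x. indicator (?S c) x * (norm x ^ q * h' x) \<partial>lborel)"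
      by (rule Bochner_Integration.integral_add; rule I[OF _ _ hm hb]) auto
    also have "(\<integral>x. indicator ?C x * (norm x ^ q * h' x) \<partial>lborel) = c ^ ?n * (\<integral>x. indicator ?C (c *\<^sub>R x) * (norm (c *\<^sub>R x) ^ q * h' (c *\<^sub>R x)) \<partial>lborel)"
      by (rule lborel_integral_scale[OF c(1)]) measurable
    also have "(\<integral>x. indicator ?C (c *\<^sub>R x) * (norm (c *\<^sub>R x) ^ q * h' (c *\<^sub>R x)) \<partial>lborel) = (\<integral>x. c ^ q * (indicator B0 x * (norm x ^ q * h' x)) \<partial>lborel)"
    proof (rule Bochner_Integration.integral_cong[OF refl])
      fix x :: "real^'n"
      have "c * norm x < c \<longleftrightarrow> norm x < 1" using c by simp
      moreover have "norm x < 1 ==> c * norm x < 1" using c by (smt (verit) mult_less_cancel_left2 norm_ge_zero mult_strict_mono')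
      ultimately show "indicator ?C (c *\<^sub>R x) * (norm (c *\<^sub>R x) ^ q * h' (c *\<^sub>R x)) = c ^ q * (indicator B0 x * (norm x ^ q * h' x))"
        using c hh[of c x] by (auto simp: indicator_def power_mult_distrib)
    qed
    also have "... = c ^ q * (\<integral>x. indicator B0 x * (norm x ^ q * h' x) \<partial>lborel)" by simp
    finally show ?thesis by (simp add: algebra_simps power_add)
  qed
  \<comment> \<open>On the shell \<open>norm x ^ p\<close> differs from 1 by at most 1 - c^p, while
    the shell itself has volume of order 1 - c; the error is of second order.\<close>
  have est: "\<bar>(1 - c ^ (?n + p)) * A p - (1 - c ^ ?n) * A 0\<bar> <= M * (1 - c ^ p) * ((1 - c ^ ?n) * ?V)" if c: "0 < c" "c < 1" for c
  proof -
    have [measurable]: "?S c : sets borel" by measurable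
    have s0: "(\<integral>x. indicator (?S c) x * (norm x ^ 0 * h x) \<partial>lborel) = (1 - c ^ (?n + 0)) * A 0"
      unfolding A_def by (rule shell[OF c _ M hom]) auto
    have sp: "(\<integral>x. indicator (?S c) x * (norm x ^ p * h x) \<partial>lborel) = (1 - c ^ (?n + p)) * A p"
      unfolding A_def by (rule shell[OF c _ M hom]) auto
    have sv: "(\<integral>x. indicator (?S c) x * (norm x ^ 0 * 1) \<partial>lborel) = (1 - c ^ (?n + 0)) * ?V"
      using shell[OF c, of "%_. 1" 1 0] by simp
    have eq: "(1 - c ^ (?n + p)) * A p - (1 - c ^ (?n + 0)) * A 0 = (\<integral>x. indicator (?S c) x * (norm x ^ p * h x) - indicator (?S c) x * (norm x ^ 0 * h x) \<partial>lborel)"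
      unfolding s0[symmetric] sp[symmetric]
      by (rule Bochner_Integration.integral_diff[symmetric]; rule I[OF _ _ _ M]) auto
    have le: "\<bar>\<integral>x. indicator (?S c) x * (norm x ^ p * h x) - indicator (?S c) x * (norm x ^ 0 * h x) \<partial>lborel\<bar> <= (\<integral>x. M * (1 - c ^ p) * (indicator (?S c) x * (norm x ^ 0 * 1)) \<partial>lborel)"
      unfolding real_norm_def[symmetric]
    proof (rule Bochner_Integration.integral_norm_bound_integral)
      show "integrable lborel (%x. indicator (?S c) x * (norm x ^ p * h x) - indicator (?S c) x * (norm x ^ 0 * h x))"
        by (rule Bochner_Integration.integrable_diff; rule I[OF _ _ _ M]) auto
      show "integrable lborel (%x. M * (1 - c ^ p) * (indicator (?S c) x * (norm x ^ 0 * 1)))"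
        by (rule integrable_mult_right, rule I[of _ _ 1]) auto
      fix x :: "real^'n"
      have "\<bar>norm x ^ p * h x - h x\<bar> <= M * (1 - c ^ p)" if "c <= norm x" "norm x < 1"
      proof -
        have "norm x ^ p * h x - h x = - (h x * (1 - norm x ^ p))" by (simp add: algebra_simps)
        then have "\<bar>norm x ^ p * h x - h x\<bar> = \<bar>h x\<bar> * (1 - norm x ^ p)"
          using that by (simp add: abs_mult power_le_one)
        also have "... <= M * (1 - c ^ p)"
          using that c M[of x] M0 by (intro mult_mono) (auto simp: power_mono power_le_one)
        finally show ?thesis .
      qed
      then show "norm (indicator (?S c) x * (norm x ^ p * h x) - indicator (?S c) x * (norm x ^ 0 * h x)) <= M * (1 - c ^ p) * (indicator (?S c) x * (norm x ^ 0 * 1))"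
        by (auto simp: indicator_def)
    qed
    show ?thesis using le unfolding eq[symmetric] integral_mult_right_zero sv by simp
  qed
  \<comment> \<open>Division by 1 - c turns 1 - c^m into this geometric sum, whose value at c = 1 is
    m.\<close>
  let ?g = "%m c. \<Sum>i<m. c ^ i :: real"
  have est2: "\<bar>?g (?n + p) c * A p - ?g ?n c * A 0\<bar> <= M * (1 - c ^ p) * (?g ?n c * ?V)" if c: "0 < c" "c < 1" for c
  proof -
    have e: "1 - c ^ m = (1 - c) * ?g m c" for m by (rule one_diff_power_eq)
    have "(1 - c) * \<bar>?g (?n + p) c * A p - ?g ?n c * A 0\<bar> = \<bar>(1 - c) * (?g (?n + p) c * A p - ?g ?n c * A 0)\<bar>"
      using c by (simp only: abs_mult abs_of_pos)
    also have "... = \<bar>(1 - c ^ (?n + p)) * A p - (1 - c ^ ?n) * A 0\<bar>"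
      unfolding e by (simp only: right_diff_distrib mult.assoc)
    also have "... <= M * (1 - c ^ p) * ((1 - c ^ ?n) * ?V)" by (rule est[OF c])
    also have "... = (1 - c) * (M * (1 - c ^ p) * (?g ?n c * ?V))" unfolding e[of ?n] by (simp only: mult_ac)
    finally show ?thesis using c by simp
  qed
  have "\<bar>?g (?n + p) 1 * A p - ?g ?n 1 * A 0\<bar> <= M * (1 - 1 ^ p) * (?g ?n 1 * ?V)"
  proof (rule tendsto_le[of "at_left (1::real)"])
    show "\<forall>\<^sub>F c in at_left 1. \<bar>?g (?n + p) c * A p - ?g ?n c * A 0\<bar> <= M * (1 - c ^ p) * (?g ?n c * ?V)"
      unfolding eventually_at_left_field using est2 by (intro exI[of _ 0]) auto
    show "((%c. \<bar>?g (?n + p) c * A p - ?g ?n c * A 0\<bar>) \<longlongrightarrow> \<bar>?g (?n + p) 1 * A p - ?g ?n 1 * A 0\<bar>) (at_left 1)"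
      by (intro tendsto_intros)
    show "((%c. M * (1 - c ^ p) * (?g ?n c * ?V)) \<longlongrightarrow> M * (1 - 1 ^ p) * (?g ?n 1 * ?V)) (at_left 1)"
      by (intro tendsto_intros)
    show "at_left (1::real) ~= bot" by simp
  qed
  then show ?thesis unfolding A_def by simp
qed

lemma sproj_scale: "c > 0 ==> sproj (c *\<^sub>R x) = sproj x"
  by (simp add: sproj_def field_simps)

text \<open>This is \<open>radial_moment\<close> for the 0-homogeneous function H o
  \<open>sproj\<close> with exponent d + q: the factor |x|^d restores H.\<close>

lemma sph_int_homog:
  fixes H :: "real^'n => real"
  assumes H: "rpf H" "homog d H"
  shows "(real CARD('n) + real (d + q)) * (\<integral>x. indicator B0 x * (norm x ^ q * H x) \<partial>lborel)
     = real CARD('n) * measure lborel (B0 :: (real^'n) set) * sph_int H"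
proof -
  have cH: "continuous_on (sphere 0 1) H" using H rpf_continuous_on by blast
  obtain M where M: "!!y. norm y = 1 ==> \<bar>H y\<bar> <= M"
  proof -
    have "compact (H ` sphere 0 1)" using cH by (intro compact_continuous_image) auto
    then obtain M where "\<forall>y\<in>H ` sphere 0 1. norm y <= M" using compact_imp_bounded bounded_iff by metis
    then show ?thesis using that[of M] by auto
  qed
  have Hm [measurable]: "H : borel_measurable borel"
    by (rule borel_measurable_continuous_onI[OF rpf_continuous_on[OF H(1)]])
  have eq: "norm x ^ d * H (sproj x) = H x" if "x ~= 0" for x
  proof -
    have "H x = H (norm x *\<^sub>R sproj x)" using that by (simp add: sproj_def)
    also have "... = norm x ^ d * H (sproj x)" using H(2) unfolding homog_def by blast
    finally show ?thesis by simp
  qed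
  have "(real CARD('n) + real (d + q)) * (\<integral>x. indicator B0 x * (norm x ^ (d + q) * H (sproj x)) \<partial>lborel)
     = real CARD('n) * (\<integral>x. indicator B0 x * H (sproj x) \<partial>lborel)"
    by (rule radial_moment[of _ M]) (use M in \<open>auto simp: sproj_scale\<close>)
  also have "(\<integral>x. indicator B0 x * (norm x ^ (d + q) * H (sproj x)) \<partial>lborel) = (\<integral>x. indicator B0 x * (norm x ^ q * H x) \<partial>lborel)"
    by (rule Bochner_Integration.integral_cong) (auto simp: indicator_def power_add eq[symmetric])
  also have "(\<integral>x. indicator B0 x * H (sproj x) \<partial>lborel) = measure lborel (B0 :: (real^'n) set) * sph_int H"
    using sph_int_ball[OF cH] vol_B0(1)[where 'n='n] by simp
  finally show ?thesis by (simp add: mult.assoc)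
qed

section \<open>Integration by parts on the ball and on the sphere\<close>

lemma relu_sq_deriv: "((%y::real. (max 0 y)\<^sup>2) has_real_derivative 2 * max 0 y) (at y)"
proof -
  consider "y > 0" | "y < 0" | "y = 0" by linarith
  then show ?thesis
  proof cases
    case 1
    have "((%y::real. y\<^sup>2) has_real_derivative 2 * max 0 y) (at y)" using 1 by (auto intro!: derivative_eq_intros)
    then show ?thesis by (rule has_field_derivative_transform_within_open[of _ _ _ "{0<..}"]) (use 1 in auto)
  next
    case 2
    have "((%y::real. 0) has_real_derivative 2 * max 0 y) (at y)" using 2 by simp
    then show ?thesis by (rule has_field_derivative_transform_within_open[of _ _ _ "{..<0}"]) (use 2 in auto)
  next
    case 3
    have "((%h::real. ((max 0 (0 + h))\<^sup>2 - (max 0 0)\<^sup>2) / h) \<longlongrightarrow> 0) (at 0)"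
    proof (rule Lim_null_comparison[of _ "%h. \<bar>h\<bar>"])
      show "\<forall>\<^sub>F h in at 0. norm (((max 0 (0 + h))\<^sup>2 - (max 0 0)\<^sup>2) / h) <= \<bar>h::real\<bar>"
        by (rule always_eventually) (auto simp: max_def power2_eq_square)
      show "((%h::real. \<bar>h\<bar>) \<longlongrightarrow> 0) (at 0)" using tendsto_rabs_zero[OF tendsto_ident_at[of 0 UNIV]] by simp
    qed
    then show ?thesis unfolding DERIV_def 3 by simp
  qed
qed

lemma integrable_cball_supp:
  fixes f :: "real^'n => real"
  assumes "continuous_on UNIV f" "!!x. norm x > 1 ==> f x = 0"
  shows "integrable lborel f"
proof -
  have "integrable lborel (%x. indicator (cball 0 1) x *\<^sub>R f x)"
    by (rule borel_integrable_compact) (use assms(1) continuous_on_subset in auto)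
  moreover have "(%x. indicator (cball 0 1) x *\<^sub>R f x) = f"
    using assms(2) by (auto simp: indicator_def fun_eq_iff not_le)
  ultimately show ?thesis by simp
qed

text \<open>Difference quotients have integral 0 by translation invariance, and dominated
  convergence passes to the derivative. The mean value theorem provides the domination.\<close>

lemma integral_dir_deriv_zero:
  fixes u u' :: "real^'n => real"
  assumes c: "continuous_on UNIV u" "continuous_on UNIV u'"
    and s: "!!x. norm x > 1 ==> u x = 0" "!!x. norm x > 1 ==> u' x = 0"
    and v: "norm v = 1"
    and d: "!!x t. ((%t. u (x + t *\<^sub>R v)) has_real_derivative u' (x + t *\<^sub>R v)) (at t)"
  shows "(\<integral>x. u' x \<partial>lborel) = 0"
proof -
  have "compact (u' ` cball 0 1)" using c(2) continuous_on_subset by (intro compact_continuous_image) auto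
  then obtain L where L: "\<forall>y\<in>u' ` cball 0 1. norm y <= L" using compact_imp_bounded bounded_iff by metis
  have L0: "0 <= L" using L[rule_format, of "u' 0"] by force
  have L': "\<bar>u' x\<bar> <= L" for x using L s(2)[of x] L0 by (cases "norm x > 1") auto
  have [measurable]: "u : borel_measurable borel" "u' : borel_measurable borel"
    using c by (auto intro: borel_measurable_continuous_onI)
  define q where "q = (%j x. real (Suc j) * (u (x + (1 / real (Suc j)) *\<^sub>R v) - u x))"
  have lip: "\<bar>u (x + h *\<^sub>R v) - u x\<bar> <= L * h" if h0: "h > 0" for x h
  proof -
    obtain z where "u (x + h *\<^sub>R v) - u (x + 0 *\<^sub>R v) = (h - 0) * u' (x + z *\<^sub>R v)"
      using MVT2[of 0 h "%t. u (x + t *\<^sub>R v)" "%t. u' (x + t *\<^sub>R v)"] d h0 by blast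
    then have "\<bar>u (x + h *\<^sub>R v) - u x\<bar> = h * \<bar>u' (x + z *\<^sub>R v)\<bar>" using h0 by (simp add: abs_mult)
    also have "... <= h * L" using L' h0 by (intro mult_left_mono) auto
    finally show ?thesis by (simp add: mult.commute)
  qed
  have "(%j. integral\<^sup>L lborel (q j)) \<longlonglongrightarrow> integral\<^sup>L lborel u'"
  proof (rule integral_dominated_convergence[where w="%x. indicator (cball 0 2) x * L"])
    show "integrable lborel (%x::real^'n. indicator (cball 0 2) x * L :: real)"
      using emeasure_lborel_cball_finite[of "0::real^'n" 2]
      by (intro integrable_mult_left integrable_real_indicator) auto
    show "AE x in lborel. (%j. q j x) \<longlonglongrightarrow> u' x"
    proof (rule AE_I2)
      fix x
      have "((%h. (u (x + (0 + h) *\<^sub>R v) - u (x + 0 *\<^sub>R v)) / h) \<longlongrightarrow> u' (x + 0 *\<^sub>R v)) (at 0)"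
        using d[of x 0] unfolding DERIV_def .
      then have "((%h. (u (x + h *\<^sub>R v) - u x) / h) \<longlongrightarrow> u' x) (at 0)" by simp
      moreover have "filterlim (%j. 1 / real (Suc j)) (at 0) sequentially"
        using LIMSEQ_inverse_real_of_nat by (auto simp: filterlim_at inverse_eq_divide)
      ultimately have "(%j. (u (x + (1 / real (Suc j)) *\<^sub>R v) - u x) / (1 / real (Suc j))) \<longlonglongrightarrow> u' x"
        by (rule filterlim_compose)
      then show "(%j. q j x) \<longlonglongrightarrow> u' x" by (simp add: q_def mult.commute del: of_nat_Suc)
    qed
    \<comment> \<open>Steps of length at most 1 keep the quotients supported in the ball of radius
      2.\<close>
    show "AE x in lborel. norm (q j x) <= indicator (cball 0 2) x * L" for j
    proof (rule AE_I2)
      fix x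
      have h: "0 < 1 / real (Suc j)" "1 / real (Suc j) <= 1" by auto
      have "norm (q j x) = real (Suc j) * \<bar>u (x + (1 / real (Suc j)) *\<^sub>R v) - u x\<bar>" by (simp add: q_def abs_mult)
      also have "... <= real (Suc j) * (L * (1 / real (Suc j)))" by (intro mult_left_mono lip h) auto
      finally have 1: "norm (q j x) <= L" by (simp del: of_nat_Suc)
      show "norm (q j x) <= indicator (cball 0 2) x * L"
      proof (cases "norm x <= 2")
        case False
        have "norm x <= norm (x + (1 / real (Suc j)) *\<^sub>R v) + norm ((1 / real (Suc j)) *\<^sub>R v)"
          using norm_triangle_ineq4[of "x + (1 / real (Suc j)) *\<^sub>R v" "(1 / real (Suc j)) *\<^sub>R v"] by simp
        moreover have "norm ((1 / real (Suc j)) *\<^sub>R v) <= 1" using v h(2) by simp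
        ultimately have "norm (x + (1 / real (Suc j)) *\<^sub>R v) > 1" using False by linarith
        then show ?thesis using False by (simp add: q_def s)
      qed (use 1 in auto)
    qed
    show "q j : borel_measurable lborel" for j unfolding q_def by measurable
  qed measurable
  moreover have "integral\<^sup>L lborel (q j) = 0" for j
  proof -
    have iu: "integrable lborel u" by (rule integrable_cball_supp[OF c(1) s(1)])
    have "integral\<^sup>L (distr lborel borel ((+) w)) u = (\<integral>x. u (w + x) \<partial>lborel)"
      "integrable (distr lborel borel ((+) w)) u \<longleftrightarrow> integrable lborel (%x. u (w + x))" for w :: "real^'n"
      by (rule integral_distr, auto intro!: integrable_distr_eq)
    then have 1: "(\<integral>x. u (w + x) \<partial>lborel) = integral\<^sup>L lborel u" "integrable lborel (%x. u (w + x))" for w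
      using iu by (auto simp: lborel_distr_plus)
    have "integral\<^sup>L lborel (q j) = real (Suc j) * ((\<integral>x. u (x + (1 / real (Suc j)) *\<^sub>R v) \<partial>lborel) - integral\<^sup>L lborel u)"
      unfolding q_def using 1(2)[of "(1 / real (Suc j)) *\<^sub>R v"] iu by (simp add: add.commute)
    then show ?thesis using 1(1)[of "(1 / real (Suc j)) *\<^sub>R v"] by (simp add: add.commute)
  qed
  ultimately show ?thesis using LIMSEQ_unique[of "%_. 0::real"] by auto
qed

text \<open>The field is Q times the square of the positive part of 1 - |x|^2. The square makes it
  continuously differentiable across the unit sphere, so no boundary term appears.\<close>

lemma ball_div_identity:
  fixes Q :: "real^'n => real"
  assumes Q: "rpf Q" and v: "norm v = 1"
  shows "(\<integral>x. indicator B0 x * (dd v Q x * (1 - x \<bullet> x)\<^sup>2) \<partial>lborel)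
     = 4 * (\<integral>x. indicator B0 x * ((x \<bullet> v) * Q x * (1 - x \<bullet> x)) \<partial>lborel)"
proof -
  let ?m = "%x::real^'n. max 0 (1 - x \<bullet> x)"
  define f where "f = (%x. dd v Q x * (?m x)\<^sup>2)"
  define g where "g = (%x. (x \<bullet> v) * Q x * ?m x)"
  have cQ: "continuous_on UNIV Q" "continuous_on UNIV (dd v Q)" using Q rpf_dd rpf_continuous_on by blast+
  have m0: "?m x = 0" if "norm x > 1" for x
    using that by (simp add: dot_square_norm power2_eq_square) (smt (verit) mult_le_cancel_left1)
  have cf: "continuous_on UNIV f" "continuous_on UNIV g" unfolding f_def g_def
    by (intro continuous_intros cQ)+
  have i: "integrable lborel f" "integrable lborel g"
    by (rule integrable_cball_supp, rule cf, simp add: f_def g_def m0)+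
  have "(\<integral>x. f x - 4 * g x \<partial>lborel) = 0"
  proof (rule integral_dir_deriv_zero[of "%x. Q x * (?m x)\<^sup>2", OF _ _ _ _ v])
    show "continuous_on UNIV (%x. Q x * (?m x)\<^sup>2)" by (intro continuous_intros cQ)
    show "continuous_on UNIV (%x. f x - 4 * g x)" by (intro continuous_intros cf)
    show "Q x * (?m x)\<^sup>2 = 0" if "norm x > 1" for x using m0[OF that] by simp
    show "f x - 4 * g x = 0" if "norm x > 1" for x using m0[OF that] by (simp add: f_def g_def)
    fix x t
    let ?y = "x + t *\<^sub>R v"
    have 1: "((%t. Q (x + t *\<^sub>R v)) has_real_derivative dd v Q ?y) (at t)"
      by (rule deriv_line[OF rpf_has_derivative[OF Q]])
    have 2: "((%t. 1 - (x + t *\<^sub>R v) \<bullet> (x + t *\<^sub>R v)) has_real_derivative - 2 * (?y \<bullet> v)) (at t)"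
    proof -
      have "((%y. y \<bullet> y) has_derivative (%h. 2 * (?y \<bullet> h))) (at ?y)"
        by (auto intro!: derivative_eq_intros simp: inner_commute)
      from deriv_line[OF this] show ?thesis by (auto intro!: derivative_eq_intros)
    qed
    have 3: "((%t. (?m (x + t *\<^sub>R v))\<^sup>2) has_real_derivative (2 * ?m ?y) * (- 2 * (?y \<bullet> v))) (at t)"
      by (rule DERIV_chain2[OF relu_sq_deriv 2])
    have "((%t. Q (x + t *\<^sub>R v) * (?m (x + t *\<^sub>R v))\<^sup>2) has_real_derivative
        dd v Q ?y * (?m ?y)\<^sup>2 + ((2 * ?m ?y) * (- 2 * (?y \<bullet> v))) * Q ?y) (at t)"
      by (rule DERIV_mult[OF 1 3])
    moreover have "dd v Q ?y * (?m ?y)\<^sup>2 + ((2 * ?m ?y) * (- 2 * (?y \<bullet> v))) * Q ?y = f ?y - 4 * g ?y"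
      unfolding f_def g_def by (simp add: algebra_simps)
    ultimately show "((%t. Q (x + t *\<^sub>R v) * (?m (x + t *\<^sub>R v))\<^sup>2) has_real_derivative f ?y - 4 * g ?y) (at t)"
      by (rule DERIV_cong)
  qed
  then have "integral\<^sup>L lborel f = 4 * integral\<^sup>L lborel g" using i by simp
  moreover have n0: "AE x in lborel. (x::real^'n) ~= 0"
    by (rule AE_I'[of "{0}"]) (auto simp: null_sets_def)
  have mb: "?m x = (if norm x < 1 then 1 - x \<bullet> x else 0)" for x
    by (simp add: dot_square_norm max_def abs_square_le_1 abs_square_less_1 not_le)
  have [measurable]: "Q : borel_measurable borel" "dd v Q : borel_measurable borel"
    using cQ by (auto intro: borel_measurable_continuous_onI)
  have [measurable]: "f : borel_measurable borel" "g : borel_measurable borel"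
    using cf by (auto intro: borel_measurable_continuous_onI)
  have [measurable]: "B0 : sets (borel :: (real^'n) measure)" by auto
  have "integral\<^sup>L lborel f = (\<integral>x. indicator B0 x * (dd v Q x * (1 - x \<bullet> x)\<^sup>2) \<partial>lborel)"
    by (rule integral_cong_AE) (use n0 in \<open>auto elim!: eventually_mono simp: f_def mb indicator_def\<close>)
  moreover have "integral\<^sup>L lborel g = (\<integral>x. indicator B0 x * ((x \<bullet> v) * Q x * (1 - x \<bullet> x)) \<partial>lborel)"
    by (rule integral_cong_AE) (use n0 in \<open>auto elim!: eventually_mono simp: g_def mb indicator_def\<close>)
  ultimately show ?thesis by simp
qed

lemma homog_mult: "homog k P ==> homog l Q ==> homog (k + l) (%x. P x * Q x)"
  by (simp add: homog_def power_add mult_ac)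

lemma homog_inner: "homog 1 (%x::real^'n. x \<bullet> v)"
  by (simp add: homog_def)

lemma rpf_integrable_B0:
  fixes H :: "real^'n => real" assumes "rpf H" shows "integrable lborel (%x. indicator B0 x * H x)"
proof -
  have c: "continuous_on (cball 0 1) H" using assms rpf_continuous_on by blast
  have "integrable lborel (%x. indicator (cball 0 1) x *\<^sub>R H x)"
    by (rule borel_integrable_compact[OF _ c]) auto
  then have "integrable lborel (%x. indicator B0 x *\<^sub>R (indicator (cball 0 1) x *\<^sub>R H x))"
    by (rule integrable_mult_indicator[rotated]) auto
  moreover have "(%x. indicator B0 x *\<^sub>R (indicator (cball 0 1) x *\<^sub>R H x)) = (%x. indicator B0 x * H x)"
    by (auto simp: indicator_def fun_eq_iff)
  ultimately show ?thesis by simp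
qed

text \<open>Every ball integral in \<open>ball_div_identity\<close> is, by
  \<open>sph_int_homog\<close>, a rational multiple of one of the two spherical integrals. The
  rational factors share 8 / ((N + 2)(N + 4)) with N = n + m - 1 and leave the ratio N. All
  integration by parts on the sphere comes from here.\<close>

lemma sph_int_dd:
  fixes Q :: "real^'n => real"
  assumes n: "CARD('n) >= 2" and Q: "rpf Q" "homog m Q" and v: "norm v = 1"
  shows "sph_int (dd v Q) = (real CARD('n) + real m - 1) * sph_int (%x. (x \<bullet> v) * Q x)"
proof -
  let ?n = "real CARD('n)"
  let ?V = "measure lborel (B0 :: (real^'n) set)"
  let ?G = "%x. (x \<bullet> v) * Q x"
  let ?N = "?n + real m - 1"
  have V: "?V > 0" by (rule vol_B0)
  have G: "rpf ?G" "homog (m + 1) ?G"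
    using Q rpf_inner[of v] homog_mult[OF homog_inner[of v] Q(2)]
    by (auto simp: inner_commute intro!: rpf_mult)
  have D: "rpf (dd v Q)" using Q rpf_dd by blast
  have N: "?N > 0" using n by simp
  define I where "I = (%q (H :: real^'n => real). \<integral>x. indicator B0 x * (norm x ^ q * H x) \<partial>lborel)"
  have rs: "rpf (%x. norm x ^ (2*q) * H x)" if "rpf H" for q and H :: "real^'n => real"
  proof -
    have "rpf (%x. (x \<bullet> x) ^ q * H x)" using that rpf_sq by (intro rpf_mult real_polynomial_function_power)
    then show ?thesis by (simp add: dot_square_norm power_mult)
  qed
  have Iint: "integrable lborel (%x. indicator B0 x * (norm x ^ (2*q) * H x))" if "rpf H" for q and H :: "real^'n => real"
    by (rule rpf_integrable_B0[OF rs[OF that]])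
  have lhs: "(\<integral>x. indicator B0 x * (dd v Q x * (1 - x \<bullet> x)\<^sup>2) \<partial>lborel) = I 0 (dd v Q) - 2 * I 2 (dd v Q) + I 4 (dd v Q)"
  proof -
    have "(%x. indicator B0 x * (dd v Q x * (1 - x \<bullet> x)\<^sup>2)) = (%x. (indicator B0 x * (norm x ^ (2*0) * dd v Q x) - 2 * (indicator B0 x * (norm x ^ (2*1) * dd v Q x))) + indicator B0 x * (norm x ^ (2*2) * dd v Q x))"
      by (auto simp: dot_square_norm fun_eq_iff algebra_simps power2_eq_square power4_eq_xxxx)
    then show ?thesis using Iint[OF D, of 0] Iint[OF D, of 1] Iint[OF D, of 2] unfolding I_def by simp
  qed
  have rhs: "(\<integral>x. indicator B0 x * (?G x * (1 - x \<bullet> x)) \<partial>lborel) = I 0 ?G - I 2 ?G"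
  proof -
    have "(%x. indicator B0 x * (?G x * (1 - x \<bullet> x))) = (%x. indicator B0 x * (norm x ^ (2*0) * ?G x) - indicator B0 x * (norm x ^ (2*1) * ?G x))"
      by (auto simp: dot_square_norm fun_eq_iff algebra_simps power2_eq_square)
    then show ?thesis using Iint[OF G(1), of 0] Iint[OF G(1), of 1] unfolding I_def by simp
  qed
  have main: "I 0 (dd v Q) - 2 * I 2 (dd v Q) + I 4 (dd v Q) = 4 * (I 0 ?G - I 2 ?G)"
    using ball_div_identity[OF Q(1) v] lhs rhs by simp
  have g0: "I 0 ?G = ?n * ?V * sph_int ?G / (?N + 2)" and g2: "I 2 ?G = ?n * ?V * sph_int ?G / (?N + 4)"
    using sph_int_homog[OF G, of 0] sph_int_homog[OF G, of 2] N by (simp_all add: I_def field_simps)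
  have "I 0 (dd v Q) = ?n * ?V * sph_int (dd v Q) / ?N & I 2 (dd v Q) = ?n * ?V * sph_int (dd v Q) / (?N + 2)
     & I 4 (dd v Q) = ?n * ?V * sph_int (dd v Q) / (?N + 4)"
  proof (cases m)
    case 0
    then have "dd v Q = (%_. 0)" using Q homog_0_dd by blast
    then show ?thesis by (simp add: I_def)
  next
    case (Suc l)
    have h: "homog l (dd v Q)" using homog_dd Q Suc by blast
    show ?thesis
      using sph_int_homog[OF D h, of 0] sph_int_homog[OF D h, of 2] sph_int_homog[OF D h, of 4] N Suc
      by (simp add: I_def field_simps)
  qed
  then have "?n * ?V * sph_int (dd v Q) * (1 / ?N - 2 / (?N + 2) + 1 / (?N + 4)) = ?n * ?V * sph_int ?G * (4 * (1 / (?N + 2) - 1 / (?N + 4)))"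
    using main unfolding g0 g2 by (simp add: algebra_simps add_divide_distrib diff_divide_distrib)
  moreover have "1 / ?N - 2 / (?N + 2) + 1 / (?N + 4) = 8 / ((?N + 2) * (?N + 4)) * (1 / ?N)"
    "4 * (1 / (?N + 2) - 1 / (?N + 4)) = 8 / ((?N + 2) * (?N + 4))"
    using N by (simp_all add: divide_simps) (simp_all add: algebra_simps)
  ultimately have "(?n * ?V * (8 / ((?N + 2) * (?N + 4)))) * (sph_int (dd v Q) / ?N) = (?n * ?V * (8 / ((?N + 2) * (?N + 4)))) * sph_int ?G"
    by (simp only: mult_ac) (simp add: mult_ac)
  moreover have "?n * ?V * (8 / ((?N + 2) * (?N + 4))) ~= 0" using N V n by simp
  ultimately have "sph_int (dd v Q) / ?N = sph_int ?G" using mult_cancel_left by blast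
  then show ?thesis using N by (simp add: field_simps)
qed

section \<open>The L2 product, orthogonality and the tangential gradient\<close>

definition ip :: "(real^'n => real) => (real^'n => real) => real" where
  "ip P Q = sph_int (%x. P x * Q x)"

lemma rpf_inner': "rpf (%x::real^'n. x \<bullet> v)"
  using rpf_inner[of v] by (simp add: inner_commute)

lemma rpf_cs: "rpf P ==> continuous_on (sphere 0 1) P"
  by (rule rpf_continuous_on)

lemma ip_commute: "ip P Q = ip Q P"
  unfolding ip_def by (simp add: mult.commute)

lemma ip_add_left: "rpf P ==> rpf P' ==> rpf Q ==> ip (%x. P x + P' x) Q = ip P Q + ip P' Q"
  unfolding ip_def distrib_right by (rule sph_int_add) (auto intro!: rpf_cs rpf_mult)

lemma ip_diff_left: "rpf P ==> rpf P' ==> rpf Q ==> ip (%x. P x - P' x) Q = ip P Q - ip P' Q"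
  unfolding ip_def left_diff_distrib by (rule sph_int_diff) (auto intro!: rpf_cs rpf_mult)

lemma ip_cmult_left: "ip (%x. c * P x) Q = c * ip P Q"
  unfolding ip_def mult.assoc by (rule sph_int_cmult)

lemma ip_zero_left [simp]: "ip (%x. 0) Q = 0"
  unfolding ip_def by simp

lemma ip_sum_left: "(!!i. i : I ==> rpf (P i)) ==> rpf Q ==> ip (%x. \<Sum>i\<in>I. P i x) Q = (\<Sum>i\<in>I. ip (P i) Q)"
  unfolding ip_def sum_distrib_right by (rule sph_int_sum) (auto intro!: rpf_cs rpf_mult)

lemma ip_add_right: "rpf P ==> rpf P' ==> rpf Q ==> ip Q (%x. P x + P' x) = ip Q P + ip Q P'"
  and ip_diff_right: "rpf P ==> rpf P' ==> rpf Q ==> ip Q (%x. P x - P' x) = ip Q P - ip Q P'"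
  and ip_cmult_right: "ip Q (%x. c * P x) = c * ip Q P"
  and ip_zero_right [simp]: "ip Q (%x. 0) = 0"
  and ip_sum_right: "(!!i. i : I ==> rpf (R i)) ==> rpf Q ==> ip Q (%x. \<Sum>i\<in>I. R i x) = (\<Sum>i\<in>I. ip Q (R i))"
  by (simp_all add: ip_commute[of Q] ip_add_left ip_diff_left ip_cmult_left ip_sum_left)

lemma sqn_ip: "sqn P = ip P P"
  unfolding sqn_def ip_def by (simp add: power2_eq_square)

lemma sqn_nonneg: "rpf P ==> 0 <= sqn P"
  unfolding sqn_def sph_int_def by simp

lemma sqn_cmult: "sqn (%x. c * P x) = c\<^sup>2 * sqn P"
  by (simp add: sqn_ip ip_cmult_left ip_cmult_right power2_eq_square)

lemma sqn_zero [simp]: "sqn (%x. 0) = 0"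
  by (simp add: sqn_ip)

lemma sqn_eq_0:
  fixes P :: "real^'n => real"
  assumes P: "rpf P" "homog k P" and 0: "sqn P = 0" shows "P = (%x. 0)"
proof
  fix x
  have s: "P w = 0" if "norm w = 1" for w
    using sph_int_eq_0[of "%x. (P x)\<^sup>2" w] 0 that rpf_cs[OF P(1)] unfolding sqn_def
    by (auto intro!: continuous_intros)
  have nz: "P y = 0" if "y ~= 0" for y
  proof -
    have "P y = P (norm y *\<^sub>R (y /\<^sub>R norm y))" using that by simp
    also have "... = norm y ^ k * P (y /\<^sub>R norm y)" using P(2) unfolding homog_def by blast
    finally show ?thesis using s[OF sphere_normalized[OF that]] by simp
  qed
  \<comment> \<open>This form covers k = 0 too, where 0 ^ 0 = 1 and P is constant.\<close>
  have "P 0 = 0 ^ k * P (axis undefined 1)" using P(2) unfolding homog_def by (metis scaleR_zero_left)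
  then show "P x = 0" using nz s by (cases "x = 0") auto
qed

lemma sqn_add_smult:
  assumes "rpf P" "rpf Q" shows "sqn (%x. P x + c * Q x) = sqn P + 2 * c * ip P Q + c\<^sup>2 * sqn Q"
  using assms by (simp add: sqn_ip ip_add_left ip_add_right ip_cmult_left ip_cmult_right rpf_cmult rpf_add
      ip_commute[of Q P] power2_eq_square algebra_simps)

lemma ip_CS:
  assumes P: "rpf P" and Q: "rpf Q" shows "(ip P Q)\<^sup>2 <= sqn P * sqn Q"
proof (cases "sqn Q = 0")
  case True
  have rr: "rpf (%x. P x + c * Q x)" for c using P Q rpf_cmult rpf_add by blast
  have "0 <= sqn P + 2 * c * ip P Q" for c
    using sqn_nonneg[OF rr[of c]] sqn_add_smult[OF P Q, of c] True by simp
  from this[of "- (sqn P + 1) / (2 * ip P Q)"] have "ip P Q = 0" by (cases "ip P Q = 0") (auto simp: field_simps)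
  then show ?thesis using True by simp
next
  case False
  then have q: "sqn Q > 0" using sqn_nonneg[OF Q] by simp
  let ?c = "- ip P Q / sqn Q"
  have rr: "rpf (%x. P x + ?c * Q x)" using P Q rpf_cmult rpf_add by blast
  have "0 <= sqn P + 2 * ?c * ip P Q + ?c\<^sup>2 * sqn Q"
    using sqn_nonneg[OF rr] unfolding sqn_add_smult[OF P Q, of ?c] .
  also have "... = sqn P - (ip P Q)\<^sup>2 / sqn Q" using q by (simp add: power2_eq_square)
  finally show ?thesis using q by (simp add: field_simps)
qed

lemma ip_CS_abs: "rpf P ==> rpf Q ==> \<bar>ip P Q\<bar> <= sqrt (sqn P) * sqrt (sqn Q)"
  using real_sqrt_le_mono[OF ip_CS[of P Q]] by (simp add: real_sqrt_mult)

lemma sqn_add_le: "rpf P ==> rpf Q ==> sqn (%x. P x + Q x) <= 2 * sqn P + 2 * sqn Q"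
  using sqn_add_smult[of P Q 1] sqn_add_smult[of P Q "-1"] sqn_nonneg[of "%x. P x + (-1) * Q x"] rpf_cmult[of Q "-1"] rpf_add[of P "%x. -1 * Q x"]
  by simp

lemma sqn_diff_le: "rpf P ==> rpf Q ==> sqn (%x. P x - Q x) <= 2 * sqn P + 2 * sqn Q"
  using sqn_add_le[of P "%x. (-1) * Q x"] rpf_cmult[of Q "-1"] sqn_cmult[of "-1" Q] by simp

text \<open>Apply \<open>sph_int_dd\<close> to P times the i-th derivative of Q and sum over i: the
  Laplacian of Q drops out, and Euler's identity turns the sum of x_i times the derivatives of Q
  into l Q.\<close>

lemma ip_grad_grad:
  fixes P Q :: "real^'n => real"
  assumes n: "CARD('n) >= 2" and P: "sph_harm k P" and Q: "sph_harm l Q"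
  shows "(\<Sum>i\<in>UNIV. ip (dd (axis i 1) P) (dd (axis i 1) Q)) = real l * (real CARD('n) + real k + real l - 2) * ip P Q"
proof (cases l)
  case 0
  then have "dd v Q = (%_. 0)" for v using Q homog_0_dd sph_harm_homog by blast
  then show ?thesis using 0 by simp
next
  case (Suc m)
  note rp = sph_harm_rpf[OF P] and rq = sph_harm_rpf[OF Q]
  let ?D = "%i. dd (axis i 1)"
  have h: "homog (k + m) (%x. P x * ?D i Q x)" for i
    using homog_mult[OF sph_harm_homog[OF P] homog_dd[OF rq]] sph_harm_homog[OF Q] Suc by simp
  have 1: "sph_int (?D i (%x. P x * ?D i Q x)) = (real CARD('n) + real (k + m) - 1) * sph_int (%x. (x \<bullet> axis i 1) * (P x * ?D i Q x))" for i
    by (rule sph_int_dd[OF n _ h]) (auto intro!: rpf_mult rp rpf_dd rq)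
  have 2: "sph_int (?D i (%x. P x * ?D i Q x)) = ip P (?D i (?D i Q)) + ip (?D i P) (?D i Q)" for i
    unfolding ip_def dd_mult'[OF rp rpf_dd[OF rq]]
    by (rule sph_int_add) (auto intro!: rpf_cs rpf_mult rpf_dd rp rq)
  have "(\<Sum>i\<in>UNIV. ip P (?D i (?D i Q))) = ip P (%x. \<Sum>i\<in>UNIV. ?D i (?D i Q) x)"
    by (subst ip_sum_right) (auto intro!: rpf_dd rp rq)
  also have "... = 0" using Q unfolding sph_harm_iff by simp
  finally have 3: "(\<Sum>i\<in>UNIV. ip P (?D i (?D i Q))) = 0" .
  have "(\<Sum>i\<in>UNIV. sph_int (%x. (x \<bullet> axis i 1) * (P x * ?D i Q x))) = sph_int (%x. \<Sum>i\<in>UNIV. (x \<bullet> axis i 1) * (P x * ?D i Q x))"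
    by (subst sph_int_sum) (auto intro!: rpf_cs rpf_mult rpf_inner' rpf_dd rp rq)
  also have "... = sph_int (%x. real l * (P x * Q x))"
  proof (rule sph_int_cong)
    fix x :: "real^'n"
    have "(\<Sum>i\<in>UNIV. (x \<bullet> axis i 1) * (P x * ?D i Q x)) = P x * (\<Sum>i\<in>UNIV. (x \<bullet> axis i 1) * ?D i Q x)"
      unfolding sum_distrib_left by (intro sum.cong) auto
    then show "(\<Sum>i\<in>UNIV. (x \<bullet> axis i 1) * (P x * ?D i Q x)) = real l * (P x * Q x)"
      by (simp add: sum_axis_sq[OF rq] Euler_homog[OF rq sph_harm_homog[OF Q]])
  qed
  also have "... = real l * ip P Q" by (simp add: sph_int_cmult ip_def)
  finally have 4: "(\<Sum>i\<in>UNIV. sph_int (%x. (x \<bullet> axis i 1) * (P x * ?D i Q x))) = real l * ip P Q" .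
  have "(\<Sum>i\<in>UNIV. ip (?D i P) (?D i Q)) = (\<Sum>i\<in>UNIV. sph_int (?D i (%x. P x * ?D i Q x)))"
    unfolding 2 using 3 by (simp add: sum.distrib)
  also have "... = (real CARD('n) + real (k + m) - 1) * (real l * ip P Q)"
    unfolding 1 sum_distrib_left[symmetric] 4 ..
  finally show ?thesis using Suc by (simp add: algebra_simps)
qed

text \<open>The left side of \<open>ip_grad_grad\<close> is symmetric in P and Q, the right side is
  not; the difference is (l - k)(n + k + l - 2) times the product.\<close>

lemma ip_orth:
  fixes P Q :: "real^'n => real"
  assumes n: "CARD('n) >= 2" and P: "sph_harm k P" and Q: "sph_harm l Q" and kl: "k ~= l"
  shows "ip P Q = 0"
proof -
  have "real l * (real CARD('n) + real k + real l - 2) * ip P Q = real k * (real CARD('n) + real l + real k - 2) * ip Q P"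
    using ip_grad_grad[OF n P Q] ip_grad_grad[OF n Q P] by (simp add: ip_commute)
  then have "(real l - real k) * (real CARD('n) + real k + real l - 2) * ip P Q = 0"
    by (simp add: ip_commute[of Q P] algebra_simps)
  moreover have "real CARD('n) + real k + real l - 2 ~= 0" using n kl by auto
  ultimately show ?thesis using kl by simp
qed

lemma has_derivative_normalize:
  fixes x :: "real^'n" assumes "x ~= 0"
  shows "((%y. y /\<^sub>R norm y) has_derivative (%v. (v - ((x /\<^sub>R norm x) \<bullet> v) *\<^sub>R (x /\<^sub>R norm x)) /\<^sub>R norm x)) (at x)"
proof -
  have 1: "(norm has_derivative (%h. h \<bullet> sgn x)) (at x)" by (rule has_derivative_norm[OF assms])
  have 2: "((%y. inverse (norm y)) has_derivative (%h. - (inverse (norm x) * (h \<bullet> sgn x) * inverse (norm x)))) (at x)"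
    by (rule Deriv.has_derivative_inverse[OF _ 1]) (use assms in auto)
  have 3: "((%y. y /\<^sub>R norm y) has_derivative (%h. inverse (norm x) *\<^sub>R h + (- (inverse (norm x) * (h \<bullet> sgn x) * inverse (norm x))) *\<^sub>R x)) (at x)"
    by (rule has_derivative_scaleR[OF 2 has_derivative_ident])
  have "(%h. inverse (norm x) *\<^sub>R h + (- (inverse (norm x) * (h \<bullet> sgn x) * inverse (norm x))) *\<^sub>R x)
     = (%v. (v - ((x /\<^sub>R norm x) \<bullet> v) *\<^sub>R (x /\<^sub>R norm x)) /\<^sub>R norm x)"
    by (auto simp: fun_eq_iff sgn_div_norm inner_commute algebra_simps)
  with 3 show ?thesis by simp
qed

text \<open>Only the part of v orthogonal to x moves the projected point; by Euler's identity the
  removed radial derivative of P is k P.\<close>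

lemma zext_has_derivative:
  fixes x :: "real^'n"
  assumes P: "rpf P" "homog k P" and x: "x ~= 0"
  shows "(zext P has_derivative (%v. (dd v P (x /\<^sub>R norm x) - real k * ((v \<bullet> (x /\<^sub>R norm x)) * P (x /\<^sub>R norm x))) / norm x)) (at x)"
proof -
  let ?y = "x /\<^sub>R norm x"
  have "((%x. P (x /\<^sub>R norm x)) has_derivative (%v. dd ((v - (?y \<bullet> v) *\<^sub>R ?y) /\<^sub>R norm x) P ?y)) (at x)"
    by (rule has_derivative_compose[OF has_derivative_normalize[OF x] rpf_has_derivative[OF P(1)]])
  moreover have "dd ((v - (?y \<bullet> v) *\<^sub>R ?y) /\<^sub>R norm x) P ?y = (dd v P ?y - real k * ((v \<bullet> ?y) * P ?y)) / norm x" for v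
    unfolding dd_v_scale[OF P(1)] dd_v_diff[OF P(1)] Euler_homog[OF P]
    by (simp add: inner_commute divide_inverse mult_ac)
  ultimately show ?thesis unfolding zext_def by simp
qed

lemma tgrad_inner:
  fixes P :: "real^'n => real"
  assumes P: "rpf P" "homog k P" and x: "norm x = 1"
  shows "v \<bullet> tgrad P x = dd v P x - real k * ((v \<bullet> x) * P x)"
proof -
  have x0: "x ~= 0" using x by auto
  have c: "tgrad P x $ i = dd (axis i 1) P x - real k * (x $ i * P x)" for i
    unfolding tgrad_def using grad_eq[OF zext_has_derivative[OF P x0], of i] x by (simp add: inner_axis')
  have "v \<bullet> tgrad P x = (\<Sum>i\<in>UNIV. v $ i * dd (axis i 1) P x) - real k * ((\<Sum>i\<in>UNIV. v $ i * x $ i) * P x)"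
    unfolding inner_vec_def c
    by (simp add: right_diff_distrib sum_subtractf sum_distrib_left sum_distrib_right mult_ac)
  then show ?thesis by (simp add: dd_v_coord[OF P(1), of v] inner_vec_def)
qed

lemma dd_Dn:
  fixes P :: "real^'n => real"
  assumes n: "CARD('n) >= 2" and P: "sph_harm k P"
  shows "dd v P x = (2 * real k + real CARD('n) - 2) * Dn v k P x"
proof (cases k)
  case 0
  then show ?thesis using P Dn_0[of P v k x] homog_0_dd[OF sph_harm_homog, of P v x] by simp
next
  case (Suc m)
  have "2 * real k + real CARD('n) - 2 > 0" using n Suc by simp
  then show ?thesis by (simp add: Dn_def)
qed

lemma tgrad_Up_Dn:
  fixes P :: "real^'n => real"
  assumes n: "CARD('n) >= 2" and P: "sph_harm k P" and x: "norm x = 1"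
  shows "v \<bullet> tgrad P x = (real k + real CARD('n) - 2) * Dn v k P x - real k * Up v k P x"
  unfolding tgrad_inner[OF sph_harm_rpf[OF P] sph_harm_homog[OF P] x] dd_Dn[OF n P] Up_plus_Dn[OF x, of v P k]
  by (simp add: algebra_simps)

text \<open>Removing the radial parts of both gradients subtracts k l P Q on the sphere; the ambient
  gradients are covered by \<open>ip_grad_grad\<close>.\<close>

lemma tgrad_tgrad:
  fixes P Q :: "real^'n => real"
  assumes n: "CARD('n) >= 2" and P: "sph_harm k P" and Q: "sph_harm l Q"
  shows "sph_int (%x. tgrad P x \<bullet> tgrad Q x) = (if k = l then real k * (real k + real CARD('n) - 2) * ip P Q else 0)"
proof -
  note rp = sph_harm_rpf[OF P] and rq = sph_harm_rpf[OF Q] and hp = sph_harm_homog[OF P] and hq = sph_harm_homog[OF Q]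
  let ?D = "%i. dd (axis i 1)"
  have "sph_int (%x. tgrad P x \<bullet> tgrad Q x) = sph_int (%x. (\<Sum>i\<in>UNIV. ?D i P x * ?D i Q x) - real k * real l * (P x * Q x))"
  proof (rule sph_int_cong)
    fix x :: "real^'n" assume x: "norm x = 1"
    have t: "tgrad P x = (\<chi> i. ?D i P x) - (real k * P x) *\<^sub>R x"
      using tgrad_inner[OF rp hp x, of "axis _ 1"] by (simp add: vec_eq_iff inner_axis')
    have "tgrad P x \<bullet> tgrad Q x = dd (tgrad P x) Q x - real l * ((tgrad P x \<bullet> x) * Q x)"
      by (rule tgrad_inner[OF rq hq x])
    moreover have "tgrad P x \<bullet> x = 0"
      using tgrad_inner[OF rp hp x, of x] x by (simp add: inner_commute Euler_homog[OF rp hp] dot_square_norm)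
    moreover have "dd (tgrad P x) Q x = (\<Sum>i\<in>UNIV. ?D i P x * ?D i Q x) - real k * P x * (real l * Q x)"
      unfolding t dd_v_diff[OF rq] dd_v_scale[OF rq] Euler_homog[OF rq hq] by (simp add: dd_v_coord[OF rq, of "\<chi> i. ?D i P x"])
    ultimately show "tgrad P x \<bullet> tgrad Q x = (\<Sum>i\<in>UNIV. ?D i P x * ?D i Q x) - real k * real l * (P x * Q x)"
      by simp
  qed
  also have "... = (\<Sum>i\<in>UNIV. ip (?D i P) (?D i Q)) - real k * real l * ip P Q"
    unfolding ip_def
    by (subst sph_int_diff, (auto intro!: continuous_intros rpf_cs rpf_dd rp rq)[2], subst sph_int_sum,
        auto intro!: continuous_intros rpf_cs rpf_dd rp rq simp: sph_int_cmult)
  also have "... = (real l * (real CARD('n) + real k + real l - 2) - real k * real l) * ip P Q"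
    unfolding ip_grad_grad[OF n P Q] by (simp add: algebra_simps)
  finally show ?thesis using ip_orth[OF n P Q] by (auto simp: algebra_simps)
qed

lemma rpf_Dn: "rpf P ==> rpf (Dn v k P)"
  unfolding Dn_def by (intro real_polynomial_function_divide rpf_dd)

lemma rpf_Up: "rpf P ==> rpf (Up v k P)"
  unfolding Up_def by (intro real_polynomial_function_diff rpf_mult rpf_inner rpf_sq rpf_Dn)

lemma ip_inner_split:
  fixes P Q :: "real^'n => real"
  assumes "rpf P" "rpf Q"
  shows "sph_int (%x. (v \<bullet> x) * P x * Q x) = ip (Up v k P) Q + ip (Dn v k P) Q"
proof -
  have "sph_int (%x. (v \<bullet> x) * P x * Q x) = ip (%x. Up v k P x + Dn v k P x) Q"
    unfolding ip_def by (rule sph_int_cong) (simp add: Up_plus_Dn[of _ v P k])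
  then show ?thesis using assms by (simp add: ip_add_left rpf_Up rpf_Dn)
qed

lemma Dn_orth:
  fixes P Q :: "real^'n => real"
  assumes n: "CARD('n) >= 2" and P: "sph_harm k P" and Q: "sph_harm l Q" and kl: "k ~= Suc l"
  shows "ip (Dn v k P) Q = 0"
proof (cases k)
  case 0 then have "Dn v k P = (%x. 0)" using P Dn_0 by blast
  then show ?thesis by simp
next
  case (Suc m) then show ?thesis using ip_orth[OF n sph_harm_Dn Q, of m P] P kl by auto
qed

text \<open>Both sides equal the integral of (v . x) P Q, which is symmetric in P and Q:
  orthogonality deletes the other half of the splitting in each case.\<close>

lemma ip_Up_Dn:
  fixes P Q :: "real^'n => real"
  assumes n: "CARD('n) >= 2" and P: "sph_harm k P" and Q: "sph_harm (Suc k) Q"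
  shows "ip (Up v k P) Q = ip P (Dn v (Suc k) Q)"
proof -
  note rp = sph_harm_rpf[OF P] and rq = sph_harm_rpf[OF Q]
  have "ip (Up v k P) Q = sph_int (%x. (v \<bullet> x) * P x * Q x)"
    using ip_inner_split[OF rp rq, of v k] Dn_orth[OF n P Q] by simp
  also have "... = sph_int (%x. (v \<bullet> x) * Q x * P x)" by (simp add: mult_ac)
  also have "... = ip (Dn v (Suc k) Q) P"
    using ip_inner_split[OF rq rp, of v "Suc k"] ip_orth[OF n sph_harm_Up[OF Q n] P] by simp
  finally show ?thesis by (simp add: ip_commute)
qed

text \<open>\<open>Up\<close> and \<open>Dn\<close> are the orthogonal parts of multiplication by v
  . x, a function bounded by |v| on the sphere.\<close>

lemma sqn_Up_Dn:
  fixes P :: "real^'n => real"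
  assumes n: "CARD('n) >= 2" and P: "sph_harm k P"
  shows "sqn (Up v k P) <= (norm v)\<^sup>2 * sqn P" "sqn (Dn v k P) <= (norm v)\<^sup>2 * sqn P"
proof -
  note rp = sph_harm_rpf[OF P]
  have U: "sph_harm (Suc k) (Up v k P)" by (rule sph_harm_Up[OF P n])
  have o: "ip (Up v k P) (Dn v k P) = 0"
    using Dn_orth[OF n P U] by (simp add: ip_commute)
  have "sph_int (%x. ((v \<bullet> x) * P x)\<^sup>2) = sqn (%x. Up v k P x + 1 * Dn v k P x)"
    unfolding sqn_def by (rule sph_int_cong) (simp add: Up_plus_Dn[of _ v P k])
  also have "... = sqn (Up v k P) + sqn (Dn v k P)"
    unfolding sqn_add_smult[OF rpf_Up[OF rp] rpf_Dn[OF rp]] o by simp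
  finally have e: "sph_int (%x. ((v \<bullet> x) * P x)\<^sup>2) = sqn (Up v k P) + sqn (Dn v k P)" .
  have "sph_int (%x. ((v \<bullet> x) * P x)\<^sup>2) <= sph_int (%x. (norm v)\<^sup>2 * (P x)\<^sup>2)"
  proof (rule sph_int_mono)
    show "continuous_on (sphere 0 1) (%x. ((v \<bullet> x) * P x)\<^sup>2)" "continuous_on (sphere 0 1) (%x. (norm v)\<^sup>2 * (P x)\<^sup>2)"
      by (intro continuous_intros rpf_cs rp)+
    fix x :: "real^'n" assume "norm x = 1"
    then have "\<bar>v \<bullet> x\<bar> <= norm v" using Cauchy_Schwarz_ineq2[of v x] by simp
    then show "((v \<bullet> x) * P x)\<^sup>2 <= (norm v)\<^sup>2 * (P x)\<^sup>2"
      unfolding power_mult_distrib by (intro mult_right_mono) (simp_all add: abs_le_square_iff[symmetric])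
  qed
  then have "sqn (Up v k P) + sqn (Dn v k P) <= (norm v)\<^sup>2 * sqn P"
    unfolding e by (simp add: sph_int_cmult sqn_def)
  then show "sqn (Up v k P) <= (norm v)\<^sup>2 * sqn P" "sqn (Dn v k P) <= (norm v)\<^sup>2 * sqn P"
    using sqn_nonneg[OF rpf_Up[OF rp, of v k]] sqn_nonneg[OF rpf_Dn[OF rp, of v k]] by linarith+
qed

lemma Dn_v_add: "rpf P ==> Dn (v + w) k P x = Dn v k P x + Dn w k P x"
  and Dn_v_diff: "rpf P ==> Dn (v - w) k P x = Dn v k P x - Dn w k P x"
  and Dn_add: "rpf P ==> rpf Q ==> Dn v k (%x. P x + Q x) x = Dn v k P x + Dn v k Q x"
  and Dn_diff: "rpf P ==> rpf Q ==> Dn v k (%x. P x - Q x) x = Dn v k P x - Dn v k Q x"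
  and Dn_cmult: "rpf P ==> Dn v k (%x. c * P x) x = c * Dn v k P x"
  unfolding Dn_def by (simp_all add: dd_v_add dd_v_diff dd_add dd_diff dd_cmult add_divide_distrib diff_divide_distrib)

lemma Up_v_add: "rpf P ==> Up (v + w) k P x = Up v k P x + Up w k P x"
  and Up_v_diff: "rpf P ==> Up (v - w) k P x = Up v k P x - Up w k P x"
  and Up_add: "rpf P ==> rpf Q ==> Up v k (%x. P x + Q x) x = Up v k P x + Up v k Q x"
  and Up_diff: "rpf P ==> rpf Q ==> Up v k (%x. P x - Q x) x = Up v k P x - Up v k Q x"
  and Up_cmult: "rpf P ==> Up v k (%x. c * P x) x = c * Up v k P x"
  unfolding Up_def by (simp_all add: Dn_v_add Dn_v_diff Dn_add Dn_diff Dn_cmult inner_add_left inner_diff_left algebra_simps)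

lemma Dn_v_coord: "rpf P ==> Dn v k P x = (\<Sum>i\<in>UNIV. v $ i * Dn (axis i 1) k P x)"
  unfolding Dn_def by (subst dd_v_coord) (auto simp: sum_divide_distrib)

lemma Up_v_coord:
  fixes P :: "real^'n => real"
  assumes "rpf P" shows "Up v k P x = (\<Sum>i\<in>UNIV. v $ i * Up (axis i 1) k P x)"
proof -
  have "v \<bullet> x = (\<Sum>i\<in>UNIV. v $ i * (axis i 1 \<bullet> x))" by (simp add: inner_axis') (simp add: inner_vec_def)
  then have 1: "(v \<bullet> x) * P x = (\<Sum>i\<in>UNIV. v $ i * ((axis i 1 \<bullet> x) * P x))"
    by (simp add: sum_distrib_right mult.assoc)
  have 2: "(x \<bullet> x) * Dn v k P x = (\<Sum>i\<in>UNIV. v $ i * ((x \<bullet> x) * Dn (axis i 1) k P x))"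
    unfolding Dn_v_coord[OF assms, of v k x] sum_distrib_left by (intro sum.cong) (simp_all only: mult_ac)
  show ?thesis unfolding Up_def 1 2 by (simp only: right_diff_distrib sum_subtractf)
qed

section \<open>Orthonormal bases and the reproducing kernel\<close>

text \<open>The linear span of W, built one summand at a time so that a generator can be split off
  by induction.\<close>

inductive spn :: "('a => real) set => ('a => real) => bool" for W where
  spn_zero: "spn W (%x. 0)"
| spn_step: "w : W ==> spn W f ==> spn W (%x. c * w x + f x)"

lemma spn_add: "spn W f ==> spn W g ==> spn W (%x. f x + g x)"
proof (induction rule: spn.induct)
  case (spn_step w f c)
  then have "spn W (%x. c * w x + (f x + g x))" by (intro spn.spn_step)
  then show ?case by (simp add: add.assoc)
qed simp

lemma spn_cmult: "spn W f ==> spn W (%x. a * f x)"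
proof (induction rule: spn.induct)
  case (spn_step w f c)
  then have "spn W (%x. (a * c) * w x + a * f x)" by (intro spn.spn_step)
  then show ?case by (simp add: algebra_simps)
qed (simp add: spn.spn_zero)

lemma spn_sum: "(!!i. i : I ==> spn W (f i)) ==> spn W (%x. \<Sum>i\<in>I. f i x)"
  by (induction I rule: infinite_finite_induct) (auto intro: spn_zero spn_add)

lemma spn_insert: "spn (insert t W) f ==> \<exists>c g. spn W g & f = (%x. c * t x + g x)"
proof (induction rule: spn.induct)
  case spn_zero
  show ?case by (rule exI[of _ 0], rule exI[of _ "%x. 0"]) (auto intro: spn.spn_zero)
next
  case (spn_step w f c)
  then obtain d g where g: "spn W g" "f = (%x. d * t x + g x)" by blast
  show ?case
  proof (cases "w = t")
    case True
    then have "(%x. c * w x + f x) = (%x. (c + d) * t x + g x)" using g by (auto simp: algebra_simps)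
    then show ?thesis using g by blast
  next
    case False
    then have "spn W (%x. c * w x + g x)" using g spn_step by (auto intro: spn.spn_step)
    moreover have "(%x. c * w x + f x) = (%x. d * t x + (c * w x + g x))" using g by auto
    ultimately show ?thesis by (metis (no_types))
  qed
qed

definition ons :: "nat => (real^'n => real) set => bool" where
  "ons k E \<longleftrightarrow> finite E & (\<forall>e\<in>E. sph_harm k e) & (\<forall>e\<in>E. \<forall>e'\<in>E. ip e e' = (if e = e' then 1 else 0))"

lemma ons_coeff:
  assumes E: "ons k E" and e: "e : E" shows "ip (%x. \<Sum>e\<in>E. c e * e x) e = c e"
proof -
  have r: "rpf e" if "e : E" for e using E that sph_harm_rpf unfolding ons_def by blast
  have "ip (%x. \<Sum>e\<in>E. c e * e x) e = (\<Sum>e'\<in>E. c e' * ip e' e)"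
    by (subst ip_sum_left, erule rpf_cmult[OF r], rule r[OF e], simp add: ip_cmult_left)
  also have "... = (\<Sum>e'\<in>E. if e' = e then c e' else 0)"
    using E e unfolding ons_def by (intro sum.cong) auto
  finally show ?thesis using E e unfolding ons_def by simp
qed

text \<open>Gram-Schmidt by induction on a spanning set. Without the generator t there remains the
  subspace of the elements of V in the span of W, of codimension at most one; a basis of it needs at
  most one further vector, obtained from any v outside it.\<close>

lemma ons_exists:
  fixes W :: "(real^'n => real) set"
  assumes "finite W"
  shows "[|!!f. V f ==> sph_harm k f; V (%x. 0); !!f g. V f ==> V g ==> V (%x. f x + g x);
     !!c f. V f ==> V (%x. c * f x); !!f. V f ==> spn W f|]
   ==> \<exists>E. ons k E & (\<forall>e\<in>E. V e) & (\<forall>f. V f --> f = (%x. \<Sum>e\<in>E. ip f e * e x))"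
  using assms
proof (induction W arbitrary: V rule: finite_induct)
  case empty
  have "f = (%x. 0)" if "V f" for f
    using empty(5)[OF that] by (cases rule: spn.cases) auto
  then show ?case by (intro exI[of _ "{}"]) (auto simp: ons_def)
next
  case (insert t W)
  note Vh = insert.prems(1) and V0 = insert.prems(2) and Va = insert.prems(3) and Vc = insert.prems(4) and Vs = insert.prems(5)
  let ?V' = "%f. V f & spn W f"
  have "\<exists>E. ons k E & (\<forall>e\<in>E. ?V' e) & (\<forall>f. ?V' f --> f = (%x. \<Sum>e\<in>E. ip f e * e x))"
    by (rule insert.IH) (auto intro: Vh V0 Va Vc spn_zero spn_add spn_cmult)
  then obtain E where E: "ons k E" "!!e. e : E ==> ?V' e" "!!f. ?V' f ==> f = (%x. \<Sum>e\<in>E. ip f e * e x)" by blast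
  have finE: "finite E" using E(1) by (simp add: ons_def)
  show ?case
  proof (cases "\<forall>f. V f --> spn W f")
    case True then show ?thesis using E by blast
  next
    case False
    then obtain v where v: "V v" "\<not> spn W v" by blast
    obtain c g where g: "spn W g" "v = (%x. c * t x + g x)" using spn_insert[OF Vs[OF v(1)]] by blast
    have c: "c ~= 0" using g v(2) by auto
    let ?S = "%x. \<Sum>e\<in>E. ip v e * e x"
    have VS: "?V' (%x. \<Sum>e\<in>E. d e * e x)" for d
    proof -
      have "V (%x. \<Sum>e\<in>F. d e * e x)" if "F \<subseteq> E" for F
        using finite_subset[OF that finE] that
      proof (induction rule: finite_induct)
        case (insert x F)
        then have "V (%y. d x * x y + (\<Sum>e\<in>F. d e * e y))" by (intro Va Vc) (auto dest: E(2))
        then show ?case using insert.hyps by simp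
      qed (simp add: V0)
      then show ?thesis using E(2) by (auto intro!: spn_sum spn_cmult)
    qed
    define e0 where "e0 = (%x. v x + (-1) * ?S x)"
    have Ve0: "V e0" unfolding e0_def using v(1) VS by (intro Va Vc) auto
    have hS: "sph_harm k ?S" using VS Vh by blast
    have "sqn e0 ~= 0"
    proof
      assume "sqn e0 = 0"
      then have "e0 = (%x. 0)" using sqn_eq_0 Vh[OF Ve0] sph_harm_rpf sph_harm_homog by blast
      then have "v = ?S" unfolding e0_def by (auto simp: fun_eq_iff)
      then have "spn W v" by (subst \<open>v = ?S\<close>) (use VS in blast)
      then show False using v(2) by blast
    qed
    then have q: "sqn e0 > 0" using sqn_nonneg[of e0] sph_harm_rpf[OF Vh[OF Ve0]] by simp
    have re: "rpf e" if "e : E" for e using E(2) Vh sph_harm_rpf that by blast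
    have oe: "ip e0 e = 0" if "e : E" for e
    proof -
      have "ip e0 e = ip v e + (-1) * ip ?S e" unfolding e0_def
        by (subst ip_add_left, rule sph_harm_rpf[OF Vh[OF v(1)]], rule rpf_cmult, rule sph_harm_rpf[OF hS], rule re[OF that], simp only: ip_cmult_left)
      then show ?thesis using ons_coeff[OF E(1) that, of "ip v"] by simp
    qed
    define e1 where "e1 = (%x. (1 / sqrt (sqn e0)) * e0 x)"
    have Ve1: "V e1" unfolding e1_def using Ve0 by (rule Vc)
    have n1: "ip e1 e1 = 1" unfolding e1_def ip_cmult_left ip_cmult_right sqn_ip[symmetric] using q by simp
    have o1: "ip e1 e = 0" if "e : E" for e unfolding e1_def ip_cmult_left oe[OF that] by simp
    have e1E: "e1 \<notin> E" using o1 n1 by force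
    have o2: "ip e e1 = 0" if "e : E" for e using o1[OF that] by (simp add: ip_commute)
    have onE: "ip e e' = (if e = e' then 1 else 0)" if "e : E" "e' : E" for e e'
      using E(1) that unfolding ons_def by blast
    have ons: "ons k (insert e1 E)" unfolding ons_def
      using finE E(2) Vh Ve1 e1E by (auto simp: n1 o1 o2 onE)
    have "f = (%x. \<Sum>e\<in>insert e1 E. ip f e * e x)" if f: "V f" for f
    proof -
      obtain cf gf where gf: "spn W gf" "f = (%x. cf * t x + gf x)" using spn_insert[OF Vs[OF f]] by blast
      \<comment> \<open>The multiple of v cancels the coefficient of t, so that r lies in the
        smaller subspace.\<close>
      define r where "r = (%x. f x + (- (cf / c)) * v x)"
      have req: "r = (%x. gf x + (- (cf / c)) * g x)" unfolding r_def gf g(2) using c by (auto simp: field_simps)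
      have "V r" unfolding r_def by (intro Va Vc f v(1))
      moreover have "spn W r" unfolding req by (intro spn_add spn_cmult gf(1) g(1))
      ultimately have "?V' r" by blast
      then have r: "r = (%x. \<Sum>e\<in>E. ip r e * e x)" by (rule E(3))
      have vx: "v x = sqrt (sqn e0) * e1 x + ?S x" for x unfolding e1_def e0_def using q by (simp add: e0_def)
      define d where "d = (%e. if e = e1 then (cf / c) * sqrt (sqn e0) else ip r e + (cf / c) * ip v e)"
      have "f x = (\<Sum>e\<in>insert e1 E. d e * e x)" for x
      proof -
        have "f x = r x + (cf / c) * v x" unfolding r_def by simp
        also have "... = (\<Sum>e\<in>E. ip r e * e x) + (cf / c) * (sqrt (sqn e0) * e1 x + ?S x)"
          using vx[of x] fun_cong[OF r, of x] by simp
        also have "... = (cf / c) * sqrt (sqn e0) * e1 x + (\<Sum>e\<in>E. (ip r e + (cf / c) * ip v e) * e x)"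
          by (simp add: algebra_simps sum.distrib sum_distrib_left)
        also have "(\<Sum>e\<in>E. (ip r e + (cf / c) * ip v e) * e x) = (\<Sum>e\<in>E. d e * e x)"
          unfolding d_def using e1E by (intro sum.cong) auto
        finally show ?thesis using e1E finE by (simp add: d_def)
      qed
      then have fd: "f = (%x. \<Sum>e\<in>insert e1 E. d e * e x)" by blast
      have "ip f e = d e" if "e : insert e1 E" for e unfolding fd by (rule ons_coeff[OF ons that])
      then show ?thesis by (subst fd) (auto intro!: sum.cong)
    qed
    then show ?thesis using ons Ve1 E(2) by (intro exI[of _ "insert e1 E"]) auto
  qed
qed

fun wordmon :: "nat => (real^'n => real) set" where
  "wordmon 0 = {%x. 1}"
| "wordmon (Suc k) = (%(i, w) x. x $ i * w x) ` (UNIV \<times> wordmon k)"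

lemma finite_wordmon: "finite (wordmon k)"
  by (induction k) auto

lemma spn_mult_coord: "spn (wordmon k) f ==> spn (wordmon (Suc k)) (%x. x $ i * f x)"
proof (induction rule: spn.induct)
  case (spn_step w f c)
  have "(%x. x $ i * w x) : wordmon (Suc k)" using spn_step by (auto intro!: image_eqI[of _ _ "(i, w)"])
  then have "spn (wordmon (Suc k)) (%x. c * (x $ i * w x) + x $ i * f x)" using spn_step.IH by (rule spn.spn_step)
  then show ?case by (simp add: algebra_simps)
qed (simp add: spn_zero)

text \<open>Euler's identity writes P as a combination of coordinates times its derivatives, which
  have one degree less.\<close>

lemma homog_spn:
  fixes P :: "real^'n => real"
  shows "rpf P ==> homog k P ==> spn (wordmon k) P"
proof (induction k arbitrary: P)
  case 0
  then have "P = (%x. P 0 * (%x. 1) x + 0)" using homog_0 by auto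
  moreover have "spn (wordmon 0) (%x::real^'n. P 0 * (%x. 1) x + 0)" by (rule spn_step) (auto intro: spn_zero)
  ultimately show ?case by metis
next
  case (Suc k)
  have "P x = (1 / real (Suc k)) * (\<Sum>i\<in>UNIV. x $ i * dd (axis i 1) P x)" for x
    using Euler_homog[OF Suc.prems, of x] dd_v_coord[OF Suc.prems(1), of x x] by simp
  then have e: "P = (%x. (1 / real (Suc k)) * (\<Sum>i\<in>UNIV. x $ i * dd (axis i 1) P x))" by blast
  have "spn (wordmon (Suc k)) (%x. (1 / real (Suc k)) * (\<Sum>i\<in>UNIV. x $ i * dd (axis i 1) P x))"
    by (intro spn_cmult spn_sum spn_mult_coord Suc.IH rpf_dd homog_dd Suc.prems)
  then show ?case using e by metis
qed

definition hbasis :: "nat => (real^'n => real) set" where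
  "hbasis k = (SOME E. ons k E & (\<forall>f. sph_harm k f --> f = (%x. \<Sum>e\<in>E. ip f e * e x)))"

lemma hbasis: "ons k (hbasis k)" and hbasis_expand': "sph_harm k f ==> f = (%x. \<Sum>e\<in>hbasis k. ip f e * e x)"
proof -
  have "\<exists>E::(real^'n => real) set. ons k E & (\<forall>e\<in>E. sph_harm k e) & (\<forall>f. sph_harm k f --> f = (%x. \<Sum>e\<in>E. ip f e * e x))"
    by (rule ons_exists[OF finite_wordmon[of k]])
      (auto intro: sph_harm_zero sph_harm_add sph_harm_cmult homog_spn sph_harm_rpf sph_harm_homog)
  then have "\<exists>E::(real^'n => real) set. ons k E & (\<forall>f. sph_harm k f --> f = (%x. \<Sum>e\<in>E. ip f e * e x))" by blast
  from someI_ex[OF this] show "ons k (hbasis k :: (real^'n => real) set)" "sph_harm k f ==> f = (%x. \<Sum>e\<in>hbasis k. ip f e * e x)" for f :: "real^'n => real"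
    unfolding hbasis_def by blast+
qed

lemma hbasis_harm: "e : hbasis k ==> sph_harm k e" and finite_hbasis: "finite (hbasis k)"
  using hbasis unfolding ons_def by blast+

lemma hbasis_expand: "sph_harm k f ==> f x = (\<Sum>e\<in>hbasis k. ip f e * e x)"
  using hbasis_expand' by (rule fun_cong)

lemma hbasis_rpf: "e : hbasis k ==> rpf e"
  using hbasis_harm sph_harm_rpf by blast

lemma ip_hbasis: "sph_harm k P ==> rpf Q ==> ip P Q = (\<Sum>e\<in>hbasis k. ip P e * ip e Q)"
  by (subst hbasis_expand'[of k P], assumption, subst ip_sum_left, erule rpf_cmult[OF hbasis_rpf], assumption)
    (simp add: ip_cmult_left)

lemma sqn_hbasis: "sph_harm k P ==> sqn P = (\<Sum>e\<in>hbasis k. (ip P e)\<^sup>2)"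
  unfolding sqn_ip by (subst ip_hbasis) (auto intro: sph_harm_rpf simp: power2_eq_square ip_commute)

lemma ip_hbasis_sum: "e : hbasis k ==> ip (%x. \<Sum>e\<in>hbasis k. c e * e x) e = c e"
  by (rule ons_coeff[OF hbasis])

lemma sph_harm_hbasis_sum: "sph_harm k (%x. \<Sum>e\<in>hbasis k. c e * e x)"
  by (intro sph_harm_sum sph_harm_cmult hbasis_harm)

text \<open>The evaluation functional at a point is represented by a spherical harmonic, so pointwise
  statements in \<open>x\<close> are special cases of statements about \<open>ip\<close>.\<close>

definition reprod :: "nat => real^'n => real^'n => real" where
  "reprod k x = (%y. \<Sum>e\<in>hbasis k. e x * e y)"

lemma sph_harm_reprod: "sph_harm k (reprod k x)"
  unfolding reprod_def by (rule sph_harm_hbasis_sum)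

lemma ip_reprod: "sph_harm k P ==> ip P (reprod k x) = P x"
  unfolding reprod_def
  by (subst ip_sum_right, erule rpf_cmult[OF hbasis_rpf], erule sph_harm_rpf)
    (simp only: ip_cmult_right, simp add: hbasis_expand[of k P x] mult.commute)

section \<open>Bounds for derivatives and values of harmonics\<close>

lemma sqn_dd:
  fixes P :: "real^'n => real"
  assumes n: "CARD('n) >= 2" and P: "sph_harm (Suc k) P"
  shows "sqrt (sqn (dd (axis i 1) P)) <= (real CARD('n) * real (Suc k)) * sqrt (sqn P)"
proof -
  have e: "dd (axis i 1) P = (%x. (2 * real (Suc k) + real CARD('n) - 2) * Dn (axis i 1) (Suc k) P x)"
    using dd_Dn[OF n P] by blast
  have "sqn (Dn (axis i 1) (Suc k) P) <= sqn P" using sqn_Up_Dn(2)[OF n P, of "axis i 1"] by simp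
  then have "sqrt (sqn (dd (axis i 1) P)) <= (2 * real (Suc k) + real CARD('n) - 2) * sqrt (sqn P)"
    unfolding e sqn_cmult using n by (auto simp: real_sqrt_mult intro!: mult_left_mono)
  also have "... <= (real CARD('n) * real (Suc k)) * sqrt (sqn P)"
  proof (rule mult_right_mono)
    have "0 <= (real CARD('n) - 2) * real k" using n by simp
    then show "2 * real (Suc k) + real CARD('n) - 2 <= real CARD('n) * real (Suc k)" by (simp add: algebra_simps)
    show "0 <= sqrt (sqn P)" using sqn_nonneg[OF sph_harm_rpf[OF P]] by simp
  qed
  finally show ?thesis .
qed

text \<open>Each degree costs a factor n from the sum over the coordinates and another n from
  \<open>sqn_dd\<close>. The k + 1 in \<open>sqn_dd\<close> is cancelled by the k + 1 in Euler's
  identity, so the growth is only geometric.\<close>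

lemma harm_sup_bound:
  fixes P :: "real^'n => real"
  assumes n: "CARD('n) >= 2"
  shows "sph_harm k P ==> \<bar>P x\<bar> <= (real CARD('n))^(2*k) * sqrt (sqn P) * norm x ^ k"
proof (induction k arbitrary: P)
  case 0
  then obtain c where "P = (%_. c)" using sph_harm_0_eq by blast
  then show ?case by (simp add: sqn_def sph_int_const)
next
  case (Suc k)
  note P = Suc.prems and rp = sph_harm_rpf[OF Suc.prems]
  let ?n = "real CARD('n)" let ?N = "?n ^ (2 * k)"
  have "real (Suc k) * \<bar>P x\<bar> = \<bar>\<Sum>i\<in>UNIV. x $ i * dd (axis i 1) P x\<bar>"
    using Euler_homog[OF rp sph_harm_homog[OF P], of x] dd_v_coord[OF rp, of x x] by (simp add: abs_mult)
  also have "... <= (\<Sum>i\<in>UNIV. \<bar>x $ i * dd (axis i 1) P x\<bar>)" by (rule sum_abs)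
  also have "... <= (\<Sum>i\<in>(UNIV::'n set). norm x * (?N * (?n * real (Suc k) * sqrt (sqn P)) * norm x ^ k))"
  proof (rule sum_mono)
    fix i :: 'n
    have "\<bar>dd (axis i 1) P x\<bar> <= ?N * sqrt (sqn (dd (axis i 1) P)) * norm x ^ k"
      by (rule Suc.IH[OF sph_harm_dd[OF P]])
    also have "... <= ?N * (?n * real (Suc k) * sqrt (sqn P)) * norm x ^ k"
      by (intro mult_right_mono mult_left_mono sqn_dd[OF n P]) auto
    finally show "\<bar>x $ i * dd (axis i 1) P x\<bar> <= norm x * (?N * (?n * real (Suc k) * sqrt (sqn P)) * norm x ^ k)"
      unfolding abs_mult by (intro mult_mono component_le_norm_cart) auto
  qed
  also have "... = real (Suc k) * (?n ^ (2 * Suc k) * sqrt (sqn P) * norm x ^ Suc k)"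
    by (simp add: power2_eq_square mult_ac)
  finally show ?case by (simp only: mult_le_cancel_left_pos of_nat_0_less_iff zero_less_Suc)
qed

section \<open>Energy estimates for the coupled system of components\<close>

definition lam :: "'n::finite itself => nat => real" where
  "lam _ k = real k * (real k + real CARD('n) - 2)"

definition hw :: "'n::finite itself => real => nat => real" where
  "hw T r k = (if k = 0 then 1 else lam T k powr r)"

lemma hs_weight_hw: "hs_weight r (u :: 'n::finite sdist) k = hw TYPE('n) r k"
  by (simp add: hs_weight_def hw_def lam_def)

lemma lam_0 [simp]: "lam T 0 = 0" by (simp add: lam_def)

lemma lam_ge: "CARD('n::finite) >= 2 ==> (real k)\<^sup>2 <= lam TYPE('n) k"
  unfolding lam_def power2_eq_square by (intro mult_left_mono) auto

lemma lam_pos: "CARD('n::finite) >= 2 ==> k >= 1 ==> lam TYPE('n) k >= 1"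
  using lam_ge[of k, where 'n='n] one_le_power[of "real k" 2] by linarith

lemma lam_nonneg: "CARD('n::finite) >= 2 ==> lam TYPE('n) k >= 0"
  using lam_pos[of k, where 'n='n] by (cases k) auto

lemma hw_pos: "CARD('n::finite) >= 2 ==> hw TYPE('n) r k > 0"
  using lam_pos[of k, where 'n='n] by (auto simp: hw_def)

lemma hw_Suc_r: "CARD('n::finite) >= 2 ==> k >= 1 ==> hw TYPE('n) (r + 1) k = lam TYPE('n) k * hw TYPE('n) r k"
  using lam_pos[of k, where 'n='n] by (auto simp: hw_def powr_add)

lemma powr_ratio:
  assumes "x > 0" "y > 0" "x <= K * y" "y <= K * x" "K >= 1" shows "x powr s <= K powr \<bar>s\<bar> * y powr (s::real)"
proof (cases "s >= 0")
  case True
  have "x powr s <= (K * y) powr s" using assms True by (intro powr_mono2) auto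
  then show ?thesis using assms True by (simp add: powr_mult)
next
  case False
  have "(K * x) powr s <= y powr s" using assms False by (intro powr_mono2') auto
  then have "K powr s * x powr s <= y powr s" using assms by (simp add: powr_mult)
  then have "K powr (- s) * (K powr s * x powr s) <= K powr (- s) * y powr s" by (intro mult_left_mono) auto
  moreover have "K powr (- s) * K powr s = 1" using assms by (simp flip: powr_add)
  ultimately show ?thesis using False by (simp add: mult.assoc[symmetric])
qed

definition hwC :: "'n::finite itself => real => real" where
  "hwC _ r = (4 * real CARD('n)) powr \<bar>r\<bar>"

lemma hwC_ge1: "CARD('n::finite) >= 2 ==> hwC TYPE('n) r >= 1"
  unfolding hwC_def by (intro ge_one_powr_ge_zero) auto

text \<open>Neighbouring eigenvalues, with 1 in place of 0 in degree 0, differ by a factor of at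
  most 4n in either direction. Since the drift couples only neighbours, Sobolev weights of any
  order, also negative, can be carried through the estimates.\<close>

lemma hw_ratio:
  assumes n: "CARD('n::finite) >= 2"
  shows "hw TYPE('n) r (Suc k) <= hwC TYPE('n) r * hw TYPE('n) r k" "hw TYPE('n) r k <= hwC TYPE('n) r * hw TYPE('n) r (Suc k)"
proof -
  let ?N = "real CARD('n)" let ?l = "lam TYPE('n)"
  define y where "y = (if k = 0 then 1 else ?l k)"
  have e: "hw TYPE('n) r k = y powr r" "hw TYPE('n) r (Suc k) = ?l (Suc k) powr r" by (auto simp: hw_def y_def)
  have p: "y > 0" "?l (Suc k) > 0" using lam_pos[OF n, of k] lam_pos[OF n, of "Suc k"] by (auto simp: y_def)
  have 1: "?l (Suc k) <= (4 * ?N) * y"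
  proof (cases k)
    case 0 then show ?thesis by (simp add: y_def lam_def)
  next
    case (Suc j)
    have "?l (Suc k) <= (2 * real k) * (2 * (real k + ?N - 2))"
      unfolding lam_def using Suc n by (intro mult_mono) auto
    also have "... = 4 * ?l k" by (simp add: lam_def)
    also have "... <= (4 * ?N) * ?l k" using lam_nonneg[OF n, of k] n by (intro mult_right_mono) auto
    finally show ?thesis using Suc by (simp add: y_def)
  qed
  have 2: "y <= (4 * ?N) * ?l (Suc k)"
  proof -
    have "y <= ?l (Suc k)"
    proof (cases k)
      case 0 then show ?thesis using lam_pos[OF n, of 1] by (simp add: y_def)
    next
      case (Suc j) then show ?thesis unfolding y_def lam_def using n by (auto intro!: mult_mono)
    qed
    also have "... <= (4 * ?N) * ?l (Suc k)" using p n by (simp add: mult_le_cancel_right1)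
    finally show ?thesis .
  qed
  have K: "4 * ?N >= 1" using n by simp
  show "hw TYPE('n) r (Suc k) <= hwC TYPE('n) r * hw TYPE('n) r k" "hw TYPE('n) r k <= hwC TYPE('n) r * hw TYPE('n) r (Suc k)"
    unfolding e hwC_def using powr_ratio[OF p(2,1) 1 2 K] powr_ratio[OF p 2 1 K] by auto
qed

text \<open>The drift term: \<open>bt v f k\<close> is the degree-\<open>k\<close> component of
  \<open>-\<nabla>\<^sub>\<omega> \<cdot> ((Id - \<omega> \<otimes> \<omega>) v f)\<close>.\<close>

definition bt :: "real^'n => 'n::finite sdist => nat => real^'n => real" where
  "bt v f k = (case k of 0 => (%x. 0) | Suc j =>
     (%x. (real k + real CARD('n) - 2) * Up v j (f j) x - real k * Dn v (Suc k) (f (Suc k)) x))"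

abbreviation hseq :: "'n::finite sdist => bool" where "hseq f \<equiv> (\<forall>l. sph_harm l (f l))"

lemma bt_0 [simp]: "bt v f 0 = (%x. 0)" by (simp add: bt_def)

lemma bt_Suc: "bt v f (Suc j) = (%x. (real (Suc j) + real CARD('n) - 2) * Up v j (f j) x - real (Suc j) * Dn v (Suc (Suc j)) (f (Suc (Suc j))) x)"
  for f :: "'n::finite sdist" by (simp add: bt_def)

lemma sph_harm_bt:
  fixes f :: "'n::finite sdist"
  assumes n: "CARD('n) >= 2" and f: "hseq f" shows "sph_harm k (bt v f k)"
proof (cases k)
  case (Suc j)
  show ?thesis unfolding Suc bt_Suc using f
    by (intro sph_harm_diff sph_harm_cmult sph_harm_Up n sph_harm_Dn) auto
qed (simp add: sph_harm_zero)

text \<open>All operators act on the fixed Q and v enters through its coordinates, so continuity and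
  limits in time of the drift reduce to those of v and of the coefficients of f.\<close>

lemma ip_bt:
  fixes f :: "'n::finite sdist"
  assumes n: "CARD('n) >= 2" and f: "hseq f" and Q: "sph_harm (Suc j) Q"
  shows "ip (bt v f (Suc j)) Q = (\<Sum>i\<in>UNIV. v $ i * ((real (Suc j) + real CARD('n) - 2) * ip (f j) (Dn (axis i 1) (Suc j) Q)
      - real (Suc j) * ip (f (Suc (Suc j))) (Up (axis i 1) (Suc j) Q)))"
proof -
  let ?A = "real (Suc j) + real CARD('n) - 2" let ?B = "real (Suc j)"
  note rq = sph_harm_rpf[OF Q]
  have f1: "sph_harm j (f j)" and f2: "sph_harm (Suc (Suc j)) (f (Suc (Suc j)))" using f by auto
  have "ip (bt v f (Suc j)) Q = ?A * ip (Up v j (f j)) Q - ?B * ip (Dn v (Suc (Suc j)) (f (Suc (Suc j)))) Q"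
    unfolding bt_Suc using sph_harm_rpf[OF f1] sph_harm_rpf[OF f2] rq
    by (subst ip_diff_left) (auto intro!: rpf_cmult rpf_Up rpf_Dn simp: ip_cmult_left)
  also have "ip (Up v j (f j)) Q = ip (f j) (Dn v (Suc j) Q)" by (rule ip_Up_Dn[OF n f1 Q])
  also have "ip (Dn v (Suc (Suc j)) (f (Suc (Suc j)))) Q = ip (f (Suc (Suc j))) (Up v (Suc j) Q)"
    using ip_Up_Dn[OF n Q f2, of v] by (simp add: ip_commute)
  also have "Dn v (Suc j) Q = (%x. \<Sum>i\<in>UNIV. v $ i * Dn (axis i 1) (Suc j) Q x)" using Dn_v_coord[OF rq] by blast
  also have "ip (f j) ... = (\<Sum>i\<in>UNIV. v $ i * ip (f j) (Dn (axis i 1) (Suc j) Q))"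
    by (subst ip_sum_right) (auto intro!: rpf_cmult rpf_Dn rq sph_harm_rpf[OF f1] simp: ip_cmult_right)
  also have "Up v (Suc j) Q = (%x. \<Sum>i\<in>UNIV. v $ i * Up (axis i 1) (Suc j) Q x)" using Up_v_coord[OF rq] by blast
  also have "ip (f (Suc (Suc j))) ... = (\<Sum>i\<in>UNIV. v $ i * ip (f (Suc (Suc j))) (Up (axis i 1) (Suc j) Q))"
    by (subst ip_sum_right) (auto intro!: rpf_cmult rpf_Up rq sph_harm_rpf[OF f2] simp: ip_cmult_right)
  finally show ?thesis by (simp add: sum_distrib_left sum_subtractf right_diff_distrib mult_ac)
qed

text \<open>The squares of both coefficients, (k + n - 2)^2 and k^2, are at most n
  \<open>lam\<close> k. This loss of one derivative is exactly what the division by the dissipation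
  rate in \<open>energy1\<close> regains.\<close>

lemma sqn_bt:
  fixes f :: "'n::finite sdist"
  assumes n: "CARD('n) >= 2" and f: "hseq f" and k: "k >= 1"
  shows "sqn (bt v f k) <= lam TYPE('n) k * (2 * real CARD('n) * (norm v)\<^sup>2 * sqn (f (k - 1)) + 2 * real CARD('n) * (norm v)\<^sup>2 * sqn (f (k + 1)))"
proof -
  let ?n = "real CARD('n)" let ?l = "lam TYPE('n) k"
  obtain j where j: "k = Suc j" using k by (cases k) auto
  let ?A = "real k + ?n - 2" let ?q1 = "(norm v)\<^sup>2 * sqn (f j)" let ?q2 = "(norm v)\<^sup>2 * sqn (f (Suc (Suc j)))"
  have f1: "sph_harm j (f j)" and f2: "sph_harm (Suc (Suc j)) (f (Suc (Suc j)))" using f by auto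
  have A: "?A\<^sup>2 <= ?n * ?l"
  proof -
    have "0 <= (?n - 1) * (real k - 1)" using n k by simp
    then have "?A <= ?n * real k" by (simp add: algebra_simps)
    then have "?A * ?A <= (?n * real k) * ?A" using n k by (intro mult_right_mono) auto
    then show ?thesis by (simp add: power2_eq_square lam_def mult_ac)
  qed
  have B: "(real k)\<^sup>2 <= ?n * ?l"
  proof -
    have "1 * ?l <= ?n * ?l" using n lam_nonneg[OF n, of k] by (intro mult_right_mono) auto
    then show ?thesis using lam_ge[OF n, of k] by simp
  qed
  have "sqn (bt v f k) <= 2 * sqn (%x. ?A * Up v j (f j) x) + 2 * sqn (%x. real k * Dn v (Suc k) (f (Suc k)) x)"
    unfolding j bt_Suc using sph_harm_rpf[OF f1] sph_harm_rpf[OF f2] by (intro sqn_diff_le rpf_cmult rpf_Up rpf_Dn)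
  also have "... = 2 * ?A\<^sup>2 * sqn (Up v j (f j)) + 2 * (real k)\<^sup>2 * sqn (Dn v (Suc (Suc j)) (f (Suc (Suc j))))"
    by (simp add: sqn_cmult j)
  also have "... <= 2 * (?n * ?l) * ?q1 + 2 * (?n * ?l) * ?q2"
    using sqn_Up_Dn(1)[OF n f1, of v] sqn_Up_Dn(2)[OF n f2, of v] A B
    by (intro add_mono mult_mono) (auto intro!: sqn_nonneg rpf_Up rpf_Dn sph_harm_rpf[OF f1] sph_harm_rpf[OF f2] simp: lam_nonneg[OF n])
  finally show ?thesis by (simp add: j algebra_simps)
qed

definition jv :: "(real^'n => real) => real^'n" where "jv P = (\<chi> i. ip P (%x. x $ i))"

lemma rpf_jc: "sph_harm 1 (%x::real^'n. x $ i)"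
  using sph_harm_inner[of "axis i 1"] by (simp add: inner_axis')

lemma Jv_jv:
  fixes f :: "'n::finite sdist"
  assumes n: "CARD('n) >= 2" and f: "hseq f" shows "Jv f = jv (f 1)"
proof -
  have "tpair f (%x. x $ i) = ip (f 1) (%x. x $ i)" for i
  proof -
    have "(%l. ip (f l) (%x. x $ i)) = (%l. if l = 1 then ip (f 1) (%x. x $ i) else 0)"
      using ip_orth[OF n _ rpf_jc] f by (auto simp: fun_eq_iff)
    then have "tpair f (%x. x $ i) = (\<Sum>l. if l = 1 then ip (f 1) (%x. x $ i) else 0)"
      unfolding tpair_def ip_def[symmetric] by simp
    also have "... = ip (f 1) (%x. x $ i)" by (subst suminf_finite[of "{1}"]) auto
    finally show ?thesis .
  qed
  then show ?thesis by (simp add: Jv_def jv_def vec_eq_iff)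
qed

lemma sqn_coord_le: "sqn (%x::real^'n. x $ i) <= 1"
proof -
  have "sqn (%x::real^'n. x $ i) <= sph_int (%x::real^'n. 1)" unfolding sqn_def
  proof (rule sph_int_mono)
    fix x :: "real^'n" assume "norm x = 1"
    then have "\<bar>x $ i\<bar> <= 1" using component_le_norm_cart[of x i] by simp
    then show "(x $ i)\<^sup>2 <= 1" by (simp add: abs_square_le_1)
  qed (intro continuous_intros)+
  then show ?thesis by (simp add: sph_int_const)
qed

lemma norm_jv_le:
  fixes P :: "real^'n => real"
  assumes "rpf P" shows "(norm (jv P))\<^sup>2 <= real CARD('n) * sqn P"
proof -
  have "(norm (jv P))\<^sup>2 = (\<Sum>i\<in>UNIV. (ip P (%x. x $ i))\<^sup>2)"
    unfolding norm_vec_def L2_set_def jv_def by (simp add: sum_nonneg)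
  also have "... <= (\<Sum>i\<in>(UNIV::'n set). sqn P)"
  proof (rule sum_mono)
    fix i :: 'n
    have "(ip P (%x. x $ i))\<^sup>2 <= sqn P * sqn (%x::real^'n. x $ i)" by (rule ip_CS[OF assms rpf_coord])
    also have "... <= sqn P * 1" using sqn_nonneg[OF assms] sqn_coord_le by (intro mult_left_mono) auto
    finally show "(ip P (%x. x $ i))\<^sup>2 <= sqn P" by simp
  qed
  finally show ?thesis by simp
qed

lemma jv_diff: "rpf P ==> rpf Q ==> jv (%x. P x - Q x) = jv P - jv Q"
  by (simp add: jv_def vec_eq_iff ip_diff_left rpf_coord)

text \<open>For r > 0 this is the radial retraction onto the closed ball of radius r.\<close>

definition radcut :: "real => 'a::real_normed_vector => 'a" where "radcut r v = (r / max r (norm v)) *\<^sub>R v"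

lemma radcut_le: "r > 0 ==> norm (radcut r v) <= r" "r > 0 ==> norm (radcut r v) <= norm v"
  unfolding radcut_def by (auto simp: max_def divide_simps mult_left_mono mult_right_mono)

lemma radcut_eq: "r > 0 ==> norm v <= r ==> radcut r v = v"
  unfolding radcut_def by (simp add: max_def)

lemma radcut_lip:
  assumes r: "r > 0" shows "norm (radcut r v - radcut r w) <= 2 * norm (v - w)"
proof -
  let ?a = "max r (norm v)" let ?b = "max r (norm w)"
  have pos: "?a > 0" "?b > 0" using r by auto
  have "radcut r v - radcut r w = (r / ?a) *\<^sub>R (v - w) + (r / ?a - r / ?b) *\<^sub>R w"
    unfolding radcut_def by (simp add: algebra_simps)
  then have "norm (radcut r v - radcut r w) <= norm ((r / ?a) *\<^sub>R (v - w)) + norm ((r / ?a - r / ?b) *\<^sub>R w)"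
    using norm_triangle_ineq by metis
  also have "norm ((r / ?a) *\<^sub>R (v - w)) <= 1 * norm (v - w)"
    unfolding norm_scaleR using r by (intro mult_right_mono) auto
  also have "norm ((r / ?a - r / ?b) *\<^sub>R w) <= norm (v - w)"
  proof -
    have "r / ?a - r / ?b = (r / ?a) * ((?b - ?a) / ?b)" using pos by (simp add: divide_simps right_diff_distrib)
    then have "norm ((r / ?a - r / ?b) *\<^sub>R w) = (r / ?a) * (\<bar>?b - ?a\<bar> * (norm w / ?b))"
      using pos r by (simp add: abs_mult)
    also have "... <= 1 * (\<bar>?b - ?a\<bar> * 1)" using pos r by (intro mult_mono) auto
    also have "\<bar>?b - ?a\<bar> <= \<bar>norm w - norm v\<bar>" by linarith
    also have "... <= norm (v - w)" by (metis norm_minus_commute norm_triangle_ineq3)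
    finally show ?thesis by simp
  qed
  finally show ?thesis by simp
qed

lemma continuous_on_radcut:
  assumes "continuous_on A r" "continuous_on A v" "!!t. t : A ==> r t > 0"
  shows "continuous_on A (%t. radcut (r t) (v t))"
proof -
  have "max (r t) (norm (v t)) ~= 0" if "t : A" for t using assms(3)[OF that] by linarith
  then show ?thesis unfolding radcut_def by (intro continuous_intros assms) auto
qed

text \<open>The linear equation u' = - \<mu> u + b in the finite-dimensional space of harmonics of
  degree k. It is expressed by products with fixed harmonics, so that only real derivatives occur,
  one-sided at the ends of the interval.\<close>

definition solves :: "real => nat => real => (real => real^'n => real) => (real => real^'n => real) => bool" where
  "solves T k \<mu> u b \<longleftrightarrow> (\<forall>t\<in>{0..T}. sph_harm k (u t) & sph_harm k (b t)) \<and>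
     (\<forall>Q. sph_harm k Q --> continuous_on {0..T} (%t. ip (b t) Q) \<and>
        (\<forall>t\<in>{0..T}. ((%t. ip (u t) Q) has_real_derivative - \<mu> * ip (u t) Q + ip (b t) Q) (at t within {0..T})))"

lemma solves_cont: "solves T k \<mu> u b ==> sph_harm k Q ==> continuous_on {0..T} (%t. ip (u t) Q)"
  unfolding solves_def by (meson DERIV_continuous_on)

lemma cont_sqn:
  assumes "!!t. t : A ==> sph_harm k (u t)" "!!Q. sph_harm k Q ==> continuous_on A (%t. ip (u t) Q)"
  shows "continuous_on A (%t. sqn (u t))"
proof -
  have "continuous_on A (%t. \<Sum>e\<in>hbasis k. (ip (u t) e)\<^sup>2)"
    by (intro continuous_intros assms(2) hbasis_harm)
  then show ?thesis by (rule continuous_on_eq) (rule sqn_hbasis[OF assms(1), symmetric])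
qed

section \<open>Energy estimates in one degree and in all degrees\<close>

lemma decreasing_on:
  fixes y :: "real => real"
  assumes "0 <= t" "!!x. x : {0..t} ==> (y has_real_derivative y' x) (at x within {0..t})" "!!x. x : {0..t} ==> y' x <= 0"
  shows "y t <= y 0"
proof -
  have "\<exists>x\<in>{0..t}. y t - y 0 = y' x * (t - 0)"
    by (rule mvt_very_simple[of 0 t y "%x h. y' x * h"]) (use assms(1,2) in \<open>auto simp: has_field_derivative_def\<close>)
  then obtain x where "x : {0..t}" "y t - y 0 = y' x * t" by auto
  moreover have "y' x * t <= 0" using assms(1) assms(3)[OF calculation(1)] by (simp add: mult_nonpos_nonneg)
  ultimately show ?thesis by simp
qed

lemma solves_sqn_deriv:
  assumes s: "solves T k \<mu> u b" and x: "x : {0..T}"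
  shows "((%t. sqn (u t)) has_real_derivative - 2 * \<mu> * sqn (u x) + 2 * ip (u x) (b x)) (at x within {0..T})"
proof -
  have hu: "sph_harm k (u t)" "sph_harm k (b t)" if "t : {0..T}" for t using s that unfolding solves_def by auto
  have du: "((%t. ip (u t) Q) has_real_derivative - \<mu> * ip (u t) Q + ip (b t) Q) (at t within {0..T})"
    if "sph_harm k Q" "t : {0..T}" for Q t using s that unfolding solves_def by blast
  show ?thesis
  proof -
    have "((%t. \<Sum>e\<in>hbasis k. (ip (u t) e)\<^sup>2) has_real_derivative (\<Sum>e\<in>hbasis k. 2 * ip (u x) e * (- \<mu> * ip (u x) e + ip (b x) e))) (at x within {0..T})"
    proof (rule DERIV_sum)
      fix e :: "real^'a => real" assume "e : hbasis k"
      then have "((%t. ip (u t) e) has_real_derivative - \<mu> * ip (u x) e + ip (b x) e) (at x within {0..T})"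
        using du hbasis_harm x by blast
      from DERIV_power[OF this, of 2] show "((%t. (ip (u t) e)\<^sup>2) has_real_derivative 2 * ip (u x) e * (- \<mu> * ip (u x) e + ip (b x) e)) (at x within {0..T})"
        by (simp add: mult_ac)
    qed
    moreover have "(\<Sum>e\<in>hbasis k. 2 * ip (u x) e * (- \<mu> * ip (u x) e + ip (b x) e)) = - 2 * \<mu> * sqn (u x) + 2 * ip (u x) (b x)"
      unfolding sqn_hbasis[OF hu(1)[OF x]] ip_hbasis[OF hu(1)[OF x] sph_harm_rpf[OF hu(2)[OF x]]]
      unfolding sum_distrib_left sum.distrib[symmetric]
      by (intro sum.cong) (simp_all add: ip_commute[of _ "b x"] algebra_simps power2_eq_square)
    ultimately have "((%t. \<Sum>e\<in>hbasis k. (ip (u t) e)\<^sup>2) has_real_derivative - 2 * \<mu> * sqn (u x) + 2 * ip (u x) (b x)) (at x within {0..T})" by simp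
    then show ?thesis by (rule has_field_derivative_transform_within[of _ _ _ _ 1]) (use x sqn_hbasis[OF hu(1), symmetric] in auto)
  qed
qed

text \<open>Of the dissipation 2 \<mu> in the derivative of the squared norm, \<mu> absorbs the
  source by Young's inequality, \<mu> / 2 the growth d of the weight, and the last \<mu> / 2 is kept
  as the integral on the left.\<close>

lemma energy1:
  assumes s: "solves T k \<mu> u b" and \<mu>: "\<mu> > 0" and d: "d <= \<mu> / 2" and t: "t : {0..T}"
  shows "exp (d * t) * sqn (u t) + (\<mu> / 2) * integral {0..t} (%ta. exp (d * ta) * sqn (u ta))
    <= sqn (u 0) + integral {0..t} (%ta. exp (d * ta) * sqn (b ta)) / \<mu>"
proof -
  have hu: "sph_harm k (u t)" "sph_harm k (b t)" if "t : {0..T}" for t using s that unfolding solves_def by auto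
  have cu: "continuous_on {0..T} (%t. sqn (u t))" by (rule cont_sqn[OF hu(1) solves_cont[OF s]])
  have cb: "continuous_on {0..T} (%t. sqn (b t))" by (rule cont_sqn[OF hu(2)]) (use s in \<open>auto simp: solves_def\<close>)
  have sub: "{0..t} \<subseteq> {0..T}" using t by auto
  have \<mu>': "\<mu> ~= 0" using \<mu> by simp
  define y where "y = (%t. exp (d * t) * sqn (u t) + (\<mu> / 2) * integral {0..t} (%ta. exp (d * ta) * sqn (u ta))
     - integral {0..t} (%ta. exp (d * ta) * sqn (b ta)) / \<mu>)"
  have "y t <= y 0"
  proof (rule decreasing_on)
    fix x assume x: "x : {0..t}"
    then have xT: "x : {0..T}" using t by auto
    have i: "((%t. integral {0..t} (%ta. exp (d * ta) * sqn (w ta))) has_real_derivative exp (d * x) * sqn (w x)) (at x within {0..t})"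
      if "continuous_on {0..T} (%t. sqn (w t))" for w :: "real => real^'a => real"
      by (rule integral_has_real_derivative[OF _ x]) (intro continuous_intros continuous_on_subset[OF that sub])
    have ds': "((%t. sqn (u t)) has_real_derivative - 2 * \<mu> * sqn (u x) + 2 * ip (u x) (b x)) (at x within {0..t})"
      by (rule DERIV_subset[OF solves_sqn_deriv[OF s xT] sub])
    show "(y has_real_derivative (exp (d * x) * (- 2 * \<mu> * sqn (u x) + 2 * ip (u x) (b x)) + d * exp (d * x) * sqn (u x))
        + (\<mu> / 2) * (exp (d * x) * sqn (u x)) - exp (d * x) * sqn (b x) / \<mu>) (at x within {0..t})"
      unfolding y_def
      by (rule derivative_eq_intros ds' i[OF cu] i[OF cb] refl | simp add: mult_ac \<mu>')+
    have "0 <= sqn (%y. b x y + (- \<mu>) * u x y)"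
      using hu[OF xT] sph_harm_rpf by (intro sqn_nonneg rpf_add rpf_cmult) blast+
    also have "... = sqn (b x) - 2 * \<mu> * ip (u x) (b x) + \<mu>\<^sup>2 * sqn (u x)"
      using hu[OF xT] by (subst sqn_add_smult) (auto intro: sph_harm_rpf simp: ip_commute[of "b x"])
    finally have "2 * ip (u x) (b x) <= sqn (b x) / \<mu> + \<mu> * sqn (u x)"
      using \<mu> by (simp add: field_simps power2_eq_square)
    moreover have "d * sqn (u x) <= \<mu> / 2 * sqn (u x)"
      using d sqn_nonneg[OF sph_harm_rpf[OF hu(1)[OF xT]]] by (intro mult_right_mono)
    ultimately have "- 2 * \<mu> * sqn (u x) + 2 * ip (u x) (b x) + d * sqn (u x) + (\<mu> / 2) * sqn (u x) - sqn (b x) / \<mu> <= 0"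
      by (simp add: algebra_simps)
    then have "exp (d * x) * (- 2 * \<mu> * sqn (u x) + 2 * ip (u x) (b x) + d * sqn (u x) + (\<mu> / 2) * sqn (u x) - sqn (b x) / \<mu>) <= 0"
      by (intro mult_nonneg_nonpos) auto
    then show "(exp (d * x) * (- 2 * \<mu> * sqn (u x) + 2 * ip (u x) (b x)) + d * exp (d * x) * sqn (u x))
        + (\<mu> / 2) * (exp (d * x) * sqn (u x)) - exp (d * x) * sqn (b x) / \<mu> <= 0"
      by (simp add: algebra_simps)
  qed (use t in auto)
  then show ?thesis unfolding y_def by simp
qed

text \<open>The rate \<open>2ak - 2a\<^sup>2/\<sigma>\<close> is at most \<open>\<sigma>k\<^sup>2/2\<close>, so the growth of this weight is absorbed in half of the dissipation,
  whatever \<open>a\<close> is.\<close>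

definition th :: "real => real => nat => real => real" where
  "th \<sigma> a k t = exp ((2 * a * real k - 2 * a\<^sup>2 / \<sigma>) * t)"

lemma th_pos: "th \<sigma> a k t > 0" by (simp add: th_def)

lemma th_0 [simp]: "th \<sigma> 0 k t = 1" "th \<sigma> a k 0 = 1" by (simp_all add: th_def)

lemma continuous_on_th [continuous_intros]: "continuous_on A (th \<sigma> a k)"
  unfolding th_def by (intro continuous_intros)

lemma th_Suc: "th \<sigma> a (Suc k) t = exp (2 * a * t) * th \<sigma> a k t"
  by (simp add: th_def exp_add[symmetric] algebra_simps)

lemma th_rate:
  assumes n: "CARD('n::finite) >= 2" and "\<sigma> > 0"
  shows "2 * a * real k - 2 * a\<^sup>2 / \<sigma> <= \<sigma> * lam TYPE('n) k / 2"
proof -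
  have "0 <= (\<sigma> * real k - 2 * a)\<^sup>2 / (2 * \<sigma>)" using assms by simp
  also have "... = \<sigma> * (real k)\<^sup>2 / 2 - (2 * a * real k - 2 * a\<^sup>2 / \<sigma>)"
    using assms by (simp add: power2_eq_square field_simps)
  finally have "2 * a * real k - 2 * a\<^sup>2 / \<sigma> <= \<sigma> * (real k)\<^sup>2 / 2" by simp
  also have "... <= \<sigma> * lam TYPE('n) k / 2" using lam_ge[OF n, of k] assms by (simp add: mult_left_mono)
  finally show ?thesis .
qed

text \<open>The factor \<open>lam\<close> in the bound of the source cancels against 1 / (\<sigma>
  \<open>lam\<close>) from \<open>energy1\<close>. Transferring the weights of degree j + 1 to the
  neighbours j and j + 2 costs \<open>hwC\<close> for the Sobolev weight and exp(2aT) for the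
  exponential one.\<close>

lemma energy_k:
  fixes u b :: "real => real^'n => real"
  assumes n: "CARD('n) >= 2" and sg: "\<sigma> > 0" and a: "a >= 0"
    and s: "solves T (Suc j) (\<sigma> * lam TYPE('n) (Suc j)) u b"
    and g: "!!k. continuous_on {0..T} (%t. g t k)" "!!t k. t : {0..T} ==> 0 <= g t k"
    and bd: "!!t. t : {0..T} ==> sqn (b t) <= lam TYPE('n) (Suc j) * (g t j + g t (Suc (Suc j)))"
    and t: "t : {0..T}"
  shows "hw TYPE('n) r (Suc j) * (th \<sigma> a (Suc j) t * sqn (u t))
      + (\<sigma> / 2) * (lam TYPE('n) (Suc j) * hw TYPE('n) r (Suc j)) * integral {0..t} (%ta. th \<sigma> a (Suc j) ta * sqn (u ta))
    <= hw TYPE('n) r (Suc j) * sqn (u 0) + hwC TYPE('n) r * exp (2 * a * T) / \<sigma> *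
       integral {0..t} (%ta. hw TYPE('n) r j * (th \<sigma> a j ta * g ta j) + hw TYPE('n) r (Suc (Suc j)) * (th \<sigma> a (Suc (Suc j)) ta * g ta (Suc (Suc j))))"
proof -
  let ?l = "lam TYPE('n) (Suc j)" let ?h = "hw TYPE('n) r" let ?C = "hwC TYPE('n) r" let ?t = "th \<sigma> a"
  have l: "?l >= 1" using lam_pos[OF n] by simp
  have mu: "\<sigma> * ?l > 0" using l sg by (intro mult_pos_pos) auto
  have hp: "?h k > 0" for k by (rule hw_pos[OF n])
  have T: "0 <= T" "{0..t} \<subseteq> {0..T}" using t by auto
  let ?I = "integral {0..t} (%ta. ?t (Suc j) ta * sqn (b ta))"
  have "?t (Suc j) t * sqn (u t) + (\<sigma> * ?l / 2) * integral {0..t} (%ta. ?t (Suc j) ta * sqn (u ta)) <= sqn (u 0) + ?I / (\<sigma> * ?l)"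
    using energy1[OF s mu th_rate[OF n sg, of a "Suc j"] t] unfolding th_def .
  then have "?h (Suc j) * (?t (Suc j) t * sqn (u t) + (\<sigma> * ?l / 2) * integral {0..t} (%ta. ?t (Suc j) ta * sqn (u ta)))
      <= ?h (Suc j) * (sqn (u 0) + ?I / (\<sigma> * ?l))"
    using hp[of "Suc j"] by (intro mult_left_mono) auto
  then have 1: "?h (Suc j) * (?t (Suc j) t * sqn (u t)) + (\<sigma> / 2) * (?l * ?h (Suc j)) * integral {0..t} (%ta. ?t (Suc j) ta * sqn (u ta))
     <= ?h (Suc j) * sqn (u 0) + ?h (Suc j) / (\<sigma> * ?l) * ?I"
    by (simp add: distrib_left mult_ac)
  have cb: "continuous_on {0..T} (%t. sqn (b t))"
    by (rule cont_sqn[of _ "Suc j"]) (use s in \<open>auto simp: solves_def\<close>)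
  have ci: "(%ta. ?t (Suc j) ta * sqn (b ta)) integrable_on {0..t}"
    by (intro integrable_continuous_interval continuous_intros continuous_on_subset[OF cb T(2)])
  let ?G = "%ta. ?h j * (?t j ta * g ta j) + ?h (Suc (Suc j)) * (?t (Suc (Suc j)) ta * g ta (Suc (Suc j)))"
  have cG: "?G integrable_on {0..t}"
    by (intro integrable_continuous_interval continuous_intros continuous_on_subset[OF g(1) T(2)])
  have "?h (Suc j) / (\<sigma> * ?l) * ?I = integral {0..t} (%ta. ?h (Suc j) / (\<sigma> * ?l) * (?t (Suc j) ta * sqn (b ta)))"
    by simp
  also have "... <= integral {0..t} (%ta. ?C * exp (2 * a * T) / \<sigma> * ?G ta)"
  proof (rule integral_le)
    fix ta assume ta: "ta : {0..t}"
    then have taT: "ta : {0..T}" using T by auto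
    have g0: "0 <= g ta j" "0 <= g ta (Suc (Suc j))" using g(2)[OF taT] by auto
    have "?h (Suc j) / (\<sigma> * ?l) * (?t (Suc j) ta * sqn (b ta)) <= ?h (Suc j) / (\<sigma> * ?l) * (?t (Suc j) ta * (?l * (g ta j + g ta (Suc (Suc j)))))"
      using bd[OF taT] hp[of "Suc j"] mu th_pos[of \<sigma> a "Suc j" ta] by (intro mult_left_mono) auto
    also have "... = (1 / \<sigma>) * (?h (Suc j) * ?t (Suc j) ta * g ta j + ?h (Suc j) * ?t (Suc j) ta * g ta (Suc (Suc j)))"
      using l sg by (simp add: field_simps)
    also have "... <= (1 / \<sigma>) * (?C * exp (2 * a * T) * (?h j * (?t j ta * g ta j)) + ?C * exp (2 * a * T) * (?h (Suc (Suc j)) * (?t (Suc (Suc j)) ta * g ta (Suc (Suc j)))))"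
    proof (intro mult_left_mono add_mono)
      have "?t (Suc j) ta <= exp (2 * a * T) * ?t j ta" unfolding th_Suc
        using a taT by (intro mult_right_mono) (auto intro: mult_left_mono less_imp_le[OF th_pos])
      then have "?h (Suc j) * ?t (Suc j) ta <= (?C * ?h j) * (exp (2 * a * T) * ?t j ta)"
        using hw_ratio(1)[OF n, of r j] hp[of j] hwC_ge1[OF n, of r] by (intro mult_mono) (auto intro: less_imp_le[OF th_pos])
      from mult_right_mono[OF this g0(1)]
      show "?h (Suc j) * ?t (Suc j) ta * g ta j <= ?C * exp (2 * a * T) * (?h j * (?t j ta * g ta j))" by (simp add: mult_ac)
      \<comment> \<open>Towards the higher degree the exponential weight only grows; the factor
        exp(2aT) is inserted to have one constant for both neighbours.\<close>
      have "1 * ?t (Suc j) ta <= exp (2 * a * T) * (exp (2 * a * ta) * ?t (Suc j) ta)" unfolding mult.assoc[symmetric]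
        using a taT T by (intro mult_right_mono) (auto intro!: less_imp_le[OF th_pos] simp flip: exp_add)
      then have "?t (Suc j) ta <= exp (2 * a * T) * ?t (Suc (Suc j)) ta" unfolding th_Suc[of _ _ "Suc j"] by simp
      then have "?h (Suc j) * ?t (Suc j) ta <= (?C * ?h (Suc (Suc j))) * (exp (2 * a * T) * ?t (Suc (Suc j)) ta)"
        using hw_ratio(2)[OF n, of r "Suc j"] hp[of "Suc (Suc j)"] hwC_ge1[OF n, of r] by (intro mult_mono) (auto intro: less_imp_le[OF th_pos])
      from mult_right_mono[OF this g0(2)]
      show "?h (Suc j) * ?t (Suc j) ta * g ta (Suc (Suc j)) <= ?C * exp (2 * a * T) * (?h (Suc (Suc j)) * (?t (Suc (Suc j)) ta * g ta (Suc (Suc j))))" by (simp add: mult_ac)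
    qed (use sg in auto)
    also have "... = ?C * exp (2 * a * T) / \<sigma> * ?G ta" by (simp add: algebra_simps)
    finally show "?h (Suc j) / (\<sigma> * ?l) * (?t (Suc j) ta * sqn (b ta)) <= ?C * exp (2 * a * T) / \<sigma> * ?G ta" .
  next
    show "(%ta. ?h (Suc j) / (\<sigma> * ?l) * (?t (Suc j) ta * sqn (b ta))) integrable_on {0..t}"
      by (rule integrable_on_mult_right[OF ci])
    show "(%ta. ?C * exp (2 * a * T) / \<sigma> * ?G ta) integrable_on {0..t}"
      by (rule integrable_on_mult_right[OF cG])
  qed
  also have "... = ?C * exp (2 * a * T) / \<sigma> * integral {0..t} ?G" by (rule Henstock_Kurzweil_Integration.integral_mult_right)
  finally show ?thesis using 1 by linarith
qed

lemma solves_0_const: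
  assumes s: "solves T 0 0 u b" and b: "!!t. t : {0..T} ==> b t = (%x. 0)" and t: "t : {0..T}"
  shows "u t = u 0"
proof -
  have 0: "0 : {0..T}" using t by auto
  have hu: "sph_harm 0 (u t)" if "t : {0..T}" for t using s that unfolding solves_def by auto
  have "ip (u t) Q = ip (u 0) Q" if Q: "sph_harm 0 Q" for Q
  proof -
    have "((%t. ip (u t) Q) has_real_derivative 0) (at x within {0..T})" if "x : {0..T}" for x
      using s Q that b[OF that] unfolding solves_def by fastforce
    then have "\<exists>c. \<forall>x\<in>{0..T}. ip (u x) Q = c"
      by (intro has_field_derivative_zero_constant) auto
    then show ?thesis using t 0 by metis
  qed
  then show ?thesis by (metis ext ip_reprod[OF hu[OF t]] ip_reprod[OF hu[OF 0]] sph_harm_reprod)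
qed

text \<open>Each degree up to K receives from its two neighbours, so the right-hand side reaches
  \<open>Suc K\<close>, and every degree occurs at most twice; this is the 2 in the constant. Degree
  0 has neither diffusion nor drift, and its weight does not grow.\<close>

lemma energy_sum:
  fixes F B :: "real => 'n::finite sdist"
  assumes n: "CARD('n) >= 2" and sg: "\<sigma> > 0" and a: "a >= 0"
    and s: "!!k. solves T k (\<sigma> * lam TYPE('n) k) (%t. F t k) (%t. B t k)"
    and g: "!!k. continuous_on {0..T} (%t. g t k)" "!!t k. t : {0..T} ==> 0 <= g t k"
    and B0: "!!t. t : {0..T} ==> B t 0 = (%x. 0)"
    and bd: "!!t j. t : {0..T} ==> sqn (B t (Suc j)) <= lam TYPE('n) (Suc j) * (g t j + g t (Suc (Suc j)))"
    and t: "t : {0..T}"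
  shows "(\<Sum>k\<le>K. hw TYPE('n) r k * (th \<sigma> a k t * sqn (F t k)))
    <= (\<Sum>k\<le>K. hw TYPE('n) r k * sqn (F 0 k)) + 2 * hwC TYPE('n) r * exp (2 * a * T) / \<sigma> *
       integral {0..t} (%ta. \<Sum>k\<le>Suc K. hw TYPE('n) r k * (th \<sigma> a k ta * g ta k))"
proof -
  let ?l = "lam TYPE('n)" let ?h = "hw TYPE('n) r" let ?c = "hwC TYPE('n) r * exp (2 * a * T) / \<sigma>" let ?t = "th \<sigma> a"
  let ?G = "%k ta. ?h k * (?t k ta * g ta k)"
  have hp: "?h k > 0" for k by (rule hw_pos[OF n])
  have T: "0 <= T" "{0..t} \<subseteq> {0..T}" using t by auto
  have c0: "?c >= 0" using hwC_ge1[OF n, of r] sg by simp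
  have hF: "sph_harm k (F t k)" if "t : {0..T}" for t k using s[of k] that unfolding solves_def by auto
  have cF: "continuous_on {0..T} (%t. sqn (F t k))" for k by (rule cont_sqn[OF hF solves_cont[OF s]])
  have st: "?h (Suc j) * (?t (Suc j) t * sqn (F t (Suc j))) <= ?h (Suc j) * sqn (F 0 (Suc j)) + ?c * integral {0..t} (%ta. ?G j ta + ?G (Suc (Suc j)) ta)" for j
  proof -
    have "0 <= (\<sigma> / 2) * (?l (Suc j) * ?h (Suc j)) * integral {0..t} (%ta. ?t (Suc j) ta * sqn (F ta (Suc j)))"
    proof (intro mult_nonneg_nonneg Henstock_Kurzweil_Integration.integral_nonneg)
      show "(%ta. ?t (Suc j) ta * sqn (F ta (Suc j))) integrable_on {0..t}"
        by (intro integrable_continuous_interval continuous_intros continuous_on_subset[OF cF T(2)])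
      show "0 <= sqn (F ta (Suc j))" if "ta : {0..t}" for ta
        using sqn_nonneg[OF sph_harm_rpf[OF hF]] that T(2) by blast
    qed (use sg lam_nonneg[OF n] hp in \<open>auto intro: less_imp_le th_pos\<close>)
    then show ?thesis using energy_k[OF n sg a s[of "Suc j"] g bd t, of r] by simp
  qed
  have cG: "continuous_on {0..t} (?G k)" for k
    by (intro continuous_intros continuous_on_subset[OF g(1) T(2)])
  have iG: "?G k integrable_on {0..t}" for k by (rule integrable_continuous_interval[OF cG])
  have s0: "?h 0 * (?t 0 t * sqn (F t 0)) <= ?h 0 * sqn (F 0 0)"
  proof -
    have "solves T 0 0 (%t. F t 0) (%t. B t 0)" using s[of 0] by (simp only: lam_0 mult_zero_right)
    from solves_0_const[OF this B0 t] have "F t 0 = F 0 0" .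
    moreover have "?t 0 t <= 1" using sg t by (simp add: th_def)
    ultimately show ?thesis using sqn_nonneg[OF sph_harm_rpf[OF hF[of 0 0]]] T
      by (simp add: hw_def mult_left_le_one_le less_imp_le th_pos)
  qed
  have "(\<Sum>k\<le>K. ?h k * (?t k t * sqn (F t k))) = ?h 0 * (?t 0 t * sqn (F t 0)) + (\<Sum>j<K. ?h (Suc j) * (?t (Suc j) t * sqn (F t (Suc j))))"
    by (rule sum.atMost_shift)
  also have "... <= ?h 0 * sqn (F 0 0) + (\<Sum>j<K. ?h (Suc j) * sqn (F 0 (Suc j)) + ?c * integral {0..t} (%ta. ?G j ta + ?G (Suc (Suc j)) ta))"
    by (intro add_mono sum_mono s0 st)
  also have "... = (\<Sum>k\<le>K. ?h k * sqn (F 0 k)) + ?c * (\<Sum>j<K. integral {0..t} (%ta. ?G j ta + ?G (Suc (Suc j)) ta))"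
    unfolding sum.distrib sum_distrib_left sum.atMost_shift[of "%k. ?h k * sqn (F 0 k)"] by (simp only: add.assoc)
  also have "(\<Sum>j<K. integral {0..t} (%ta. ?G j ta + ?G (Suc (Suc j)) ta)) = integral {0..t} (%ta. \<Sum>j<K. ?G j ta + ?G (Suc (Suc j)) ta)"
    by (rule Henstock_Kurzweil_Integration.integral_sum[symmetric]) (auto intro!: Henstock_Kurzweil_Integration.integrable_add iG)
  also have "?c * ... <= ?c * integral {0..t} (%ta. 2 * (\<Sum>k\<le>Suc K. ?G k ta))"
  proof (intro mult_left_mono integral_le c0)
    fix ta assume "ta : {0..t}"
    then have nn: "0 <= ?G k ta" for k using g(2) T hp by (auto intro!: mult_nonneg_nonneg less_imp_le[OF th_pos] less_imp_le[OF hp])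
    have "(\<Sum>j<K. ?G j ta) <= (\<Sum>k\<le>Suc K. ?G k ta)" by (rule sum_mono2) (use nn in auto)
    moreover have "(\<Sum>j<K. ?G (Suc (Suc j)) ta) <= (\<Sum>k\<le>Suc K. ?G k ta)"
      unfolding sum.atMost_shift[of _ "Suc K"] sum.lessThan_Suc_shift using nn[of 0] nn[of 1] by simp
    ultimately show "(\<Sum>j<K. ?G j ta + ?G (Suc (Suc j)) ta) <= 2 * (\<Sum>k\<le>Suc K. ?G k ta)"
      unfolding sum.distrib by linarith
  qed (intro Henstock_Kurzweil_Integration.integrable_sum Henstock_Kurzweil_Integration.integrable_add integrable_on_mult_right iG finite_lessThan finite_atMost)+
  also have "... = 2 * hwC TYPE('n) r * exp (2 * a * T) / \<sigma> * integral {0..t} (%ta. \<Sum>k\<le>Suc K. ?G k ta)"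
    unfolding Henstock_Kurzweil_Integration.integral_mult_right by simp
  finally show ?thesis by simp
qed

lemma cont_Ici:
  fixes f :: "real => 'a::topological_space"
  assumes "!!T. 0 <= T ==> continuous_on {0..T} f" shows "continuous_on {0..} f"
  unfolding continuous_on_eq_continuous_within
proof
  fix t :: real assume t: "t : {0..}"
  have "at t within {0..} = at t within {0..t + 1}"
    by (rule at_within_nhd[of t "{..<t + 1}"]) auto
  then show "continuous (at t within {0..}) f"
    using assms[of "t + 1"] t unfolding continuous_on_eq_continuous_within by auto
qed

section \<open>Variation of constants and differences of two solutions\<close>

lemma harm_integral:
  fixes b :: "real => real^'n => real"
  assumes h: "!!ta. ta : {0..t} ==> sph_harm k (b ta)"
    and c: "!!Q. sph_harm k Q ==> continuous_on {0..t} (%ta. ip (b ta) Q)" and e: "continuous_on {0..t} e"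
  shows "sph_harm k (%x. integral {0..t} (%ta. e ta * b ta x))"
    "rpf Q ==> sph_harm k Q ==> ip (%x. integral {0..t} (%ta. e ta * b ta x)) Q = integral {0..t} (%ta. e ta * ip (b ta) Q)"
proof -
  have i: "(%ta. e ta * ip (b ta) q) integrable_on {0..t}" if "q : hbasis k" for q
    by (intro integrable_continuous_interval continuous_intros e c hbasis_harm[OF that])
  let ?d = "%q. integral {0..t} (%ta. e ta * ip (b ta) q)"
  have eq: "(%x. integral {0..t} (%ta. e ta * b ta x)) = (%x. \<Sum>q\<in>hbasis k. ?d q * q x)"
  proof
    fix x
    have "integral {0..t} (%ta. e ta * b ta x) = integral {0..t} (%ta. \<Sum>q\<in>hbasis k. (e ta * ip (b ta) q) * q x)"
      by (rule Henstock_Kurzweil_Integration.integral_cong) (simp add: hbasis_expand[OF h] sum_distrib_left mult.assoc)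
    also have "... = (\<Sum>q\<in>hbasis k. integral {0..t} (%ta. (e ta * ip (b ta) q) * q x))"
      by (rule Henstock_Kurzweil_Integration.integral_sum[OF finite_hbasis]) (intro integrable_on_mult_left i)
    finally show "integral {0..t} (%ta. e ta * b ta x) = (\<Sum>q\<in>hbasis k. ?d q * q x)" by simp
  qed
  show "sph_harm k (%x. integral {0..t} (%ta. e ta * b ta x))" unfolding eq by (rule sph_harm_hbasis_sum)
  assume Q: "rpf Q" "sph_harm k Q"
  have "ip (%x. \<Sum>q\<in>hbasis k. ?d q * q x) Q = (\<Sum>q\<in>hbasis k. ?d q * ip q Q)"
    by (subst ip_sum_left, erule rpf_cmult[OF hbasis_rpf], rule Q, simp add: ip_cmult_left)
  also have "... = (\<Sum>q\<in>hbasis k. integral {0..t} (%ta. (e ta * ip (b ta) q) * ip q Q))" by simp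
  also have "... = integral {0..t} (%ta. \<Sum>q\<in>hbasis k. (e ta * ip (b ta) q) * ip q Q)"
    by (rule Henstock_Kurzweil_Integration.integral_sum[OF finite_hbasis, symmetric]) (intro integrable_on_mult_left i)
  also have "... = integral {0..t} (%ta. e ta * ip (b ta) Q)"
    by (rule Henstock_Kurzweil_Integration.integral_cong) (simp add: ip_hbasis[OF h Q(1)] sum_distrib_left mult.assoc)
  finally show "ip (%x. integral {0..t} (%ta. e ta * b ta x)) Q = integral {0..t} (%ta. e ta * ip (b ta) Q)"
    unfolding eq .
qed

lemma duhamel:
  fixes \<mu> :: real and b :: "real => real^'n => real"
  assumes h0: "sph_harm k u0" and h: "!!ta. 0 <= ta ==> sph_harm k (b ta)"
    and c: "!!Q. sph_harm k Q ==> continuous_on {0..} (%ta. ip (b ta) Q)"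
  defines "u \<equiv> %t x. exp (- \<mu> * t) * (u0 x + integral {0..t} (%ta. exp (\<mu> * ta) * b ta x))"
  shows "!!t. 0 <= t ==> sph_harm k (u t)" "solves T k \<mu> u b" "u 0 = u0"
    "!!t Q. 0 <= t ==> sph_harm k Q ==> ip (u t) Q = exp (- \<mu> * t) * (ip u0 Q + integral {0..t} (%ta. exp (\<mu> * ta) * ip (b ta) Q))"
proof -
  have c': "continuous_on {0..t} (%ta. ip (b ta) Q)" if "sph_harm k Q" for t Q
    by (rule continuous_on_subset[OF c[OF that]]) auto
  have ce: "continuous_on {0..t} (%ta. exp (\<mu> * ta))" for t by (intro continuous_intros)
  have hi: "sph_harm k (%x. integral {0..t} (%ta. exp (\<mu> * ta) * b ta x))" for t
    by (rule harm_integral(1)[OF _ c' ce]) (use h in auto)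
  show hu: "sph_harm k (u t)" if "0 <= t" for t
    unfolding u_def by (intro sph_harm_cmult sph_harm_add h0 hi)
  show u0: "u 0 = u0" by (simp add: u_def)
  show ipu: "ip (u t) Q = exp (- \<mu> * t) * (ip u0 Q + integral {0..t} (%ta. exp (\<mu> * ta) * ip (b ta) Q))" if "0 <= t" "sph_harm k Q" for t Q
    unfolding u_def ip_cmult_left
  proof -
    have "ip (%x. integral {0..t} (%ta. exp (\<mu> * ta) * b ta x)) Q = integral {0..t} (%ta. exp (\<mu> * ta) * ip (b ta) Q)"
      by (rule harm_integral(2)[OF _ c' ce]) (use h that sph_harm_rpf in auto)
    then show "exp (- \<mu> * t) * ip (%x. u0 x + integral {0..t} (%ta. exp (\<mu> * ta) * b ta x)) Q
       = exp (- \<mu> * t) * (ip u0 Q + integral {0..t} (%ta. exp (\<mu> * ta) * ip (b ta) Q))"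
      using ip_add_left[OF sph_harm_rpf[OF h0] sph_harm_rpf[OF hi] sph_harm_rpf[OF that(2)]] by simp
  qed
  show "solves T k \<mu> u b" unfolding solves_def
  proof (intro conjI ballI allI impI)
    fix t and Q :: "real^'n => real" assume t: "t : {0..T}" and Q: "sph_harm k Q"
    let ?I = "%t. integral {0..t} (%ta. exp (\<mu> * ta) * ip (b ta) Q)"
    have "(?I has_real_derivative exp (\<mu> * t) * ip (b t) Q) (at t within {0..T})"
      by (rule integral_has_real_derivative[OF _ t]) (intro continuous_intros c'[OF Q])
    then have "((%t. exp (- \<mu> * t) * (ip u0 Q + ?I t)) has_real_derivative
        exp (- \<mu> * t) * (exp (\<mu> * t) * ip (b t) Q) + (- \<mu> * exp (- \<mu> * t)) * (ip u0 Q + ?I t)) (at t within {0..T})"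
      by (auto intro!: derivative_eq_intros)
    moreover have "exp (- \<mu> * t) * (exp (\<mu> * t) * ip (b t) Q) + (- \<mu> * exp (- \<mu> * t)) * (ip u0 Q + ?I t) = - \<mu> * ip (u t) Q + ip (b t) Q"
      using ipu[OF _ Q, of t] t by (simp add: mult.assoc[symmetric] exp_minus_inverse mult.commute[of "exp (- (\<mu> * t))"] flip: exp_add)
    ultimately have "((%t. exp (- \<mu> * t) * (ip u0 Q + ?I t)) has_real_derivative - \<mu> * ip (u t) Q + ip (b t) Q) (at t within {0..T})"
      by simp
    then show "((%t. ip (u t) Q) has_real_derivative - \<mu> * ip (u t) Q + ip (b t) Q) (at t within {0..T})"
      by (rule has_field_derivative_transform_within[of _ _ _ _ 1]) (use t ipu[OF _ Q] in auto)
  qed (use hu h c' in auto)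
qed

lemma bt_cont:
  fixes f :: "real => 'n::finite sdist"
  assumes n: "CARD('n) >= 2" and v: "continuous_on A v" and f: "!!t. t : A ==> hseq (f t)"
    and c: "!!k Q. sph_harm k Q ==> continuous_on A (%t. ip (f t k) Q)" and Q: "sph_harm k Q"
  shows "continuous_on A (%t. ip (bt (v t) (f t) k) Q)"
proof (cases k)
  case (Suc j)
  have Q': "sph_harm (Suc j) Q" using Q Suc by simp
  have "continuous_on A (%t. \<Sum>i\<in>UNIV. v t $ i * ((real (Suc j) + real CARD('n) - 2) * ip (f t j) (Dn (axis i 1) (Suc j) Q)
      - real (Suc j) * ip (f t (Suc (Suc j))) (Up (axis i 1) (Suc j) Q)))"
    by (intro continuous_intros v c sph_harm_Dn sph_harm_Up n Q')
  then show ?thesis unfolding Suc by (rule continuous_on_eq) (rule ip_bt[OF n f Q', symmetric])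
qed simp

lemma jv_cont:
  assumes c: "!!Q. sph_harm 1 Q ==> continuous_on A (%t. ip (u t) Q)"
  shows "continuous_on A (%t. jv (u t))"
  unfolding jv_def by (intro continuous_on_vec_lambda c rpf_jc)

lemma solves_diff:
  assumes "solves T k \<mu> u b" "solves T k \<mu> u' b'"
  shows "solves T k \<mu> (%t x. u t x - u' t x) (%t x. b t x - b' t x)"
proof -
  have h: "sph_harm k (u t)" "sph_harm k (b t)" "sph_harm k (u' t)" "sph_harm k (b' t)" if "t : {0..T}" for t
    using assms that unfolding solves_def by auto
  have r: "rpf (u t)" "rpf (b t)" "rpf (u' t)" "rpf (b' t)" if "t : {0..T}" for t
    using h[OF that] sph_harm_rpf by blast+
  show ?thesis unfolding solves_def
  proof (intro conjI ballI allI impI)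
    fix t assume t: "t : {0..T}"
    show "sph_harm k (%x. u t x - u' t x)" "sph_harm k (%x. b t x - b' t x)" using h[OF t] sph_harm_diff by blast+
  next
    fix Q :: "real^'a => real" assume Q: "sph_harm k Q"
    have "continuous_on {0..T} (%t. ip (b t) Q - ip (b' t) Q)"
      using assms Q unfolding solves_def by (intro continuous_intros) auto
    then show "continuous_on {0..T} (%t. ip (%x. b t x - b' t x) Q)"
      by (rule continuous_on_eq) (simp add: ip_diff_left r sph_harm_rpf[OF Q])
    fix t assume t: "t : {0..T}"
    have "((%t. ip (u t) Q - ip (u' t) Q) has_real_derivative (- \<mu> * ip (u t) Q + ip (b t) Q) - (- \<mu> * ip (u' t) Q + ip (b' t) Q)) (at t within {0..T})"
      using assms Q t unfolding solves_def by (intro DERIV_diff) auto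
    then have "((%t. ip (u t) Q - ip (u' t) Q) has_real_derivative - \<mu> * ip (%x. u t x - u' t x) Q + ip (%x. b t x - b' t x) Q) (at t within {0..T})"
      by (rule DERIV_cong) (use t in \<open>simp add: ip_diff_left r sph_harm_rpf[OF Q] algebra_simps\<close>)
    then show "((%t. ip (%x. u t x - u' t x) Q) has_real_derivative - \<mu> * ip (%x. u t x - u' t x) Q + ip (%x. b t x - b' t x) Q) (at t within {0..T})"
      by (rule has_field_derivative_transform_within[of _ _ _ _ 1]) (use t in \<open>auto simp: ip_diff_left r sph_harm_rpf[OF Q]\<close>)
  qed
qed

lemma bt_diff:
  fixes f g :: "'n::finite sdist"
  assumes f: "hseq f" and g: "hseq g"
  shows "bt v f k x - bt w g k x = bt v (%l x. f l x - g l x) k x + bt (v - w) g k x"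
proof (cases k)
  case (Suc j)
  have r: "rpf (f l)" "rpf (g l)" for l using f g sph_harm_rpf by blast+
  show ?thesis unfolding Suc bt_Suc by (simp add: Up_diff Dn_diff Up_v_diff Dn_v_diff r algebra_simps)
qed simp

lemma sqn_bt_diff:
  fixes f g :: "'n::finite sdist" and v w :: "real^'n"
  assumes n: "CARD('n) >= 2" and f: "hseq f" and g: "hseq g"
  defines "G \<equiv> %k. 4 * real CARD('n) * ((norm v)\<^sup>2 * sqn (%x. f k x - g k x) + (norm (v - w))\<^sup>2 * sqn (g k))"
  shows "sqn (%x. bt v f (Suc j) x - bt w g (Suc j) x) <= lam TYPE('n) (Suc j) * (G j + G (Suc (Suc j)))"
proof -
  let ?d = "%l x. f l x - g l x"
  have d: "hseq ?d" using f g sph_harm_diff by blast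
  have "sqn (%x. bt v f (Suc j) x - bt w g (Suc j) x) <= 2 * sqn (bt v ?d (Suc j)) + 2 * sqn (bt (v - w) g (Suc j))"
    unfolding bt_diff[OF f g] by (intro sqn_add_le sph_harm_rpf[OF sph_harm_bt[OF n d]] sph_harm_rpf[OF sph_harm_bt[OF n g]])
  also have "... <= lam TYPE('n) (Suc j) * (G j + G (Suc (Suc j)))"
    using sqn_bt[OF n d, of "Suc j" v] sqn_bt[OF n g, of "Suc j" "v - w"] unfolding G_def by (simp add: algebra_simps)
  finally show ?thesis .
qed

text \<open>In the difference of the drifts, \<open>v1\<close> acts on G1 - G2 and is bounded by RR;
  \<open>v1 - v2\<close> acts on G2, whose norm is bounded by N, and is itself controlled through L
  by the degree-1 part of G1 - G2. The same estimate gives convergence of the Picard iteration and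
  uniqueness.\<close>

lemma diff_energy:
  fixes F1 F2 G1 G2 :: "real => 'n::finite sdist"
  assumes n: "CARD('n) >= 2" and sg: "\<sigma> > 0"
    and s1: "!!k. solves T k (\<sigma> * lam TYPE('n) k) (%t. F1 t k) (%t. bt (v1 t) (G1 t) k)"
    and s2: "!!k. solves T k (\<sigma> * lam TYPE('n) k) (%t. F2 t k) (%t. bt (v2 t) (G2 t) k)"
    and i: "F1 0 = F2 0"
    and h1: "!!t. t : {0..T} ==> hseq (G1 t)" and h2: "!!t. t : {0..T} ==> hseq (G2 t)"
    and c1: "!!k Q. sph_harm k Q ==> continuous_on {0..T} (%t. ip (G1 t k) Q)"
    and c2: "!!k Q. sph_harm k Q ==> continuous_on {0..T} (%t. ip (G2 t k) Q)"
    and v: "continuous_on {0..T} v1" "continuous_on {0..T} v2"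
    and RR: "!!t. t : {0..T} ==> (norm (v1 t))\<^sup>2 <= RR"
    and L: "0 <= L" "!!t. t : {0..T} ==> (norm (v1 t - v2 t))\<^sup>2 <= L * sqn (%x. G1 t 1 x - G2 t 1 x)"
    and N: "0 <= N" "!!t K. t : {0..T} ==> (\<Sum>k\<le>K. hw TYPE('n) r k * sqn (G2 t k)) <= N"
    and t: "t : {0..T}"
  shows "(\<Sum>k\<le>K. hw TYPE('n) r k * sqn (%x. F1 t k x - F2 t k x))
     <= 2 * hwC TYPE('n) r / \<sigma> * (4 * real CARD('n) * (RR + L * N / hw TYPE('n) r 1))
        * integral {0..t} (%ta. \<Sum>k\<le>Suc K. hw TYPE('n) r k * sqn (%x. G1 ta k x - G2 ta k x))"
proof -
  let ?h = "hw TYPE('n) r" let ?n = "real CARD('n)"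
  have hp: "?h k > 0" for k by (rule hw_pos[OF n])
  let ?D = "%ta K. \<Sum>k\<le>K. ?h k * sqn (%x. G1 ta k x - G2 ta k x)"
  have T: "0 <= T" "{0..t} \<subseteq> {0..T}" using t by auto
  have hd: "sph_harm k (%x. G1 t k x - G2 t k x)" if "t : {0..T}" for t k
    using h1[OF that] h2[OF that] sph_harm_diff by blast
  have cd: "continuous_on {0..T} (%t. sqn (%x. G1 t k x - G2 t k x))" for k
  proof (rule cont_sqn[OF hd])
    fix Q :: "real^'n => real" assume Q: "sph_harm k Q"
    have "continuous_on {0..T} (%t. ip (G1 t k) Q - ip (G2 t k) Q)" by (intro continuous_intros c1 c2 Q)
    then show "continuous_on {0..T} (%t. ip (%x. G1 t k x - G2 t k x) Q)"
    proof (rule continuous_on_eq)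
      fix t assume "t : {0..T}"
      then show "ip (G1 t k) Q - ip (G2 t k) Q = ip (%x. G1 t k x - G2 t k x) Q"
        using h1 h2 sph_harm_rpf Q by (subst ip_diff_left) blast+
    qed
  qed
  have c2': "continuous_on {0..T} (%t. sqn (G2 t k))" for k
    by (rule cont_sqn[of _ k]) (use h2 c2 in auto)
  define g where "g = (%t k. 4 * ?n * ((norm (v1 t))\<^sup>2 * sqn (%x. G1 t k x - G2 t k x) + (norm (v1 t - v2 t))\<^sup>2 * sqn (G2 t k)))"
  have cg: "continuous_on {0..T} (%t. g t k)" for k unfolding g_def by (intro continuous_intros v cd c2')
  have nd: "0 <= sqn (%x. G1 t k x - G2 t k x)" "0 <= sqn (G2 t k)" if "t : {0..T}" for t k
    using sqn_nonneg[OF sph_harm_rpf[OF hd[OF that]]] h2[OF that] sqn_nonneg sph_harm_rpf by blast+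
  have g0: "0 <= g t k" if "t : {0..T}" for t k unfolding g_def using nd[OF that] by simp
  let ?F = "%t k x. F1 t k x - F2 t k x" and ?B = "%t k x. bt (v1 t) (G1 t) k x - bt (v2 t) (G2 t) k x"
  have "(\<Sum>k\<le>K. ?h k * (th \<sigma> 0 k t * sqn (?F t k)))
    <= (\<Sum>k\<le>K. ?h k * sqn (?F 0 k)) + 2 * hwC TYPE('n) r * exp (2 * 0 * T) / \<sigma> *
       integral {0..t} (%ta. \<Sum>k\<le>Suc K. ?h k * (th \<sigma> 0 k ta * g ta k))"
  proof (rule energy_sum[OF n sg order_refl, of T ?F ?B, OF _ cg g0 _ _ t])
    show "solves T k (\<sigma> * lam TYPE('n) k) (%t. ?F t k) (%t. ?B t k)" for k by (rule solves_diff[OF s1 s2])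
    show "?B t 0 = (%x. 0)" for t by simp
    show "sqn (?B t (Suc j)) <= lam TYPE('n) (Suc j) * (g t j + g t (Suc (Suc j)))" if "t : {0..T}" for t j
      unfolding g_def by (rule sqn_bt_diff[OF n h1[OF that] h2[OF that]])
  qed
  then have 1: "(\<Sum>k\<le>K. ?h k * sqn (?F t k)) <= 2 * hwC TYPE('n) r / \<sigma> * integral {0..t} (%ta. \<Sum>k\<le>Suc K. ?h k * g ta k)"
    unfolding i by simp
  have "integral {0..t} (%ta. \<Sum>k\<le>Suc K. ?h k * g ta k) <= integral {0..t} (%ta. 4 * ?n * (RR + L * N / ?h 1) * ?D ta (Suc K))"
  proof (rule integral_le)
    show "(%ta. \<Sum>k\<le>Suc K. ?h k * g ta k) integrable_on {0..t}"
      by (intro integrable_continuous_interval continuous_intros continuous_on_subset[OF cg T(2)])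
    show "(%ta. 4 * ?n * (RR + L * N / ?h 1) * ?D ta (Suc K)) integrable_on {0..t}"
      by (intro integrable_continuous_interval continuous_intros continuous_on_subset[OF cd T(2)])
    fix ta assume "ta : {0..t}"
    then have ta: "ta : {0..T}" using T by auto
    let ?s = "\<Sum>k\<le>Suc K. ?h k * sqn (G2 ta k)"
    \<comment> \<open>The sum runs to \<open>Suc K\<close>, so degree 1 occurs in it even for K =
      0.\<close>
    have D1: "?h 1 * sqn (%x. G1 ta 1 x - G2 ta 1 x) <= ?D ta (Suc K)"
      using nd[OF ta] hp by (intro member_le_sum) (auto intro!: mult_nonneg_nonneg less_imp_le[OF hp])
    have D0: "0 <= ?D ta (Suc K)" using nd[OF ta] by (intro sum_nonneg mult_nonneg_nonneg less_imp_le[OF hp]) auto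
    have s0: "0 <= ?s" using nd[OF ta] by (intro sum_nonneg mult_nonneg_nonneg less_imp_le[OF hp]) auto
    have "(norm (v1 ta - v2 ta))\<^sup>2 <= L * sqn (%x. G1 ta 1 x - G2 ta 1 x)" by (rule L(2)[OF ta])
    also have "... <= L * (?D ta (Suc K) / ?h 1)" using D1 hp[of 1] L(1) by (intro mult_left_mono) (auto simp: field_simps)
    finally have V: "(norm (v1 ta - v2 ta))\<^sup>2 <= L * (?D ta (Suc K) / ?h 1)" .
    have "(\<Sum>k\<le>Suc K. ?h k * g ta k) = 4 * ?n * ((norm (v1 ta))\<^sup>2 * ?D ta (Suc K) + (norm (v1 ta - v2 ta))\<^sup>2 * ?s)"
      unfolding g_def sum_distrib_left sum.distrib[symmetric] by (rule sum.cong) (auto simp: algebra_simps)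
    also have "... <= 4 * ?n * (RR * ?D ta (Suc K) + (L * (?D ta (Suc K) / ?h 1)) * N)"
      using RR[OF ta] N(2)[OF ta, of "Suc K"] V D0 s0 L(1) hp[of 1]
      by (intro mult_left_mono add_mono mult_right_mono mult_mono) auto
    also have "... = 4 * ?n * (RR + L * N / ?h 1) * ?D ta (Suc K)"
      by (simp add: algebra_simps add_divide_distrib del: sum.atMost_Suc)
    finally show "(\<Sum>k\<le>Suc K. ?h k * g ta k) <= 4 * ?n * (RR + L * N / ?h 1) * ?D ta (Suc K)" .
  qed
  also have "... = 4 * ?n * (RR + L * N / ?h 1) * integral {0..t} (%ta. ?D ta (Suc K))"
    by (rule Henstock_Kurzweil_Integration.integral_mult_right)
  finally have "2 * hwC TYPE('n) r / \<sigma> * integral {0..t} (%ta. \<Sum>k\<le>Suc K. ?h k * g ta k)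
     <= 2 * hwC TYPE('n) r / \<sigma> * (4 * ?n * (RR + L * N / ?h 1) * integral {0..t} (%ta. ?D ta (Suc K)))"
    using hwC_ge1[OF n, of r] sg by (intro mult_left_mono) auto
  with 1 show ?thesis by (simp add: mult.assoc)
qed

lemma integral_pow: "0 <= t ==> integral {0..t} (%ta. ta ^ m) = t ^ Suc m / real (Suc m)"
proof (rule integral_unique)
  assume t: "0 <= t"
  have "((%ta. ta ^ m) has_integral t ^ Suc m / real (Suc m) - 0 ^ Suc m / real (Suc m)) {0..t}"
    by (rule fundamental_theorem_of_calculus[OF t])
      (auto intro!: derivative_eq_intros simp: has_real_derivative_iff_has_vector_derivative[symmetric] simp del: power_Suc of_nat_Suc)
  then show "((%ta. ta ^ m) has_integral t ^ Suc m / real (Suc m)) {0..t}" by simp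
qed

text \<open>Each application raises both m and the truncation K, and the uniform bound M is used
  only at m = 0; the m nested time integrals produce the factorial.\<close>

lemma factorial_iteration:
  fixes D :: "nat => nat => real => real"
  assumes c: "!!m K. continuous_on {0..T} (D m K)" and \<kappa>: "0 <= \<kappa>" and M: "!!K t. t : {0..T} ==> D 0 K t <= M"
    and st: "!!m K t. t : {0..T} ==> D (Suc m) K t <= \<kappa> * integral {0..t} (D m (Suc K))"
    and t: "t : {0..T}"
  shows "D m K t <= M * ((\<kappa> * t) ^ m / fact m)"
  using t
proof (induction m arbitrary: K t)
  case 0 then show ?case using M by simp
next
  case (Suc m)
  have sub: "{0..t} \<subseteq> {0..T}" using Suc.prems by auto
  have "D (Suc m) K t <= \<kappa> * integral {0..t} (D m (Suc K))" by (rule st[OF Suc.prems])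
  also have "... <= \<kappa> * integral {0..t} (%ta. M * \<kappa> ^ m / fact m * ta ^ m)"
  proof (intro mult_left_mono integral_le \<kappa>)
    show "D m (Suc K) integrable_on {0..t}" by (rule integrable_continuous_interval[OF continuous_on_subset[OF c sub]])
    show "(%ta. M * \<kappa> ^ m / fact m * ta ^ m) integrable_on {0..t}" by (intro integrable_continuous_interval continuous_intros)
    fix ta assume "ta : {0..t}"
    then show "D m (Suc K) ta <= M * \<kappa> ^ m / fact m * ta ^ m"
      using Suc.IH[of ta "Suc K"] sub by (auto simp: power_mult_distrib mult_ac)
  qed
  also have "... = \<kappa> * (M * \<kappa> ^ m / fact m * (t ^ Suc m / real (Suc m)))"
    using Suc.prems by (simp only: Henstock_Kurzweil_Integration.integral_mult_right integral_pow atLeastAtMost_iff)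
  also have "... = M * ((\<kappa> * t) ^ Suc m / fact (Suc m))"
    by (simp add: power_mult_distrib field_simps)
  finally show ?case .
qed

text \<open>This linearises the square root in \<open>pic_uniform\<close>: for x of order c^m / m!
  both terms on the right are summable in m.\<close>

lemma sqrt_le_amgm: "0 <= x ==> sqrt x <= 2 ^ m * x + (1 / 2) ^ m"
proof -
  assume x: "0 <= x"
  define y where "y = sqrt x"
  have y: "y >= 0" "x = y\<^sup>2" using x by (auto simp: y_def)
  have pq: "(p * y - 1)\<^sup>2 * q = p * y\<^sup>2 - 2 * y + q" if "q * p = 1" for p q :: real
  proof -
    have "(p * y - 1)\<^sup>2 * q = (q * p) * (p * y\<^sup>2) - 2 * (q * p) * y + q"
      by (simp add: power2_eq_square algebra_simps)
    then show ?thesis unfolding that by simp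
  qed
  have "(2 ^ m * y - 1)\<^sup>2 * (1/2) ^ m = 2 ^ m * y\<^sup>2 - 2 * y + (1/2) ^ m"
    by (rule pq) (simp flip: power_mult_distrib)
  moreover have "0 <= (2 ^ m * y - 1)\<^sup>2 * (1/2) ^ m" by simp
  ultimately show ?thesis unfolding y_def[symmetric] y(2)[symmetric] using y by linarith
qed

section \<open>Picard iteration for the truncated system\<close>

definition good :: "(real => 'n::finite sdist) => bool" where
  "good f \<longleftrightarrow> (\<forall>t\<ge>0. hseq (f t)) & (\<forall>k Q. sph_harm k Q --> continuous_on {0..} (%t. ip (f t k) Q))"

lemma good_hseq: "good f ==> 0 <= t ==> hseq (f t)"
  and good_cont: "good f ==> sph_harm k Q ==> continuous_on {0..} (%t. ip (f t k) Q)"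
  by (auto simp: good_def)

lemma good_contT: "good f ==> sph_harm k Q ==> continuous_on {0..T} (%t. ip (f t k) Q)"
  by (rule continuous_on_subset[OF good_cont]) auto

lemma good_sqn_cont: "good f ==> continuous_on {0..T} (%t. sqn (f t k))"
  by (rule cont_sqn[of _ k]) (auto simp: good_hseq intro: good_contT)

lemma good_sqn_nonneg: "good f ==> 0 <= t ==> 0 <= sqn (f t k)"
  using good_hseq sph_harm_rpf sqn_nonneg by blast

definition wsum :: "real => real => real => (real => 'n::finite sdist) => nat => real => real" where
  "wsum r \<sigma> a f K t = (\<Sum>k\<le>K. hw TYPE('n) r k * (th \<sigma> a k t * sqn (f t k)))"

text \<open>The radius depends on time because the a priori bound that finally takes its place grows
  exponentially in t.\<close>

locale doi_cut =
  fixes \<sigma> s :: real and f0 :: "'n::finite sdist" and R :: "real => real"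
  assumes n2: "CARD('n) >= 2" and sg: "\<sigma> > 0" and f0: "in_Hs s f0"
    and Rpos: "!!t. R t > 0" and Rcont: "continuous_on UNIV R"
begin

definition vj :: "(real => 'n sdist) => real => real^'n" where
  "vj f t = radcut (R t) (jv (f t 1))"

definition pstep :: "(real => 'n sdist) => real => 'n sdist" where
  "pstep f t k x = exp (- (\<sigma> * lam TYPE('n) k) * t) * (f0 k x + integral {0..t} (%ta. exp ((\<sigma> * lam TYPE('n) k) * ta) * bt (vj f ta) (f ta) k x))"

text \<open>The start is 0, not \<open>f0\<close>: the first iterate is then the heat flow of
  \<open>f0\<close>, and every iterate is the sum of the preceding differences.\<close>

definition pic :: "nat => real => 'n sdist" where
  "pic m = (pstep ^^ m) (%_ _ _. 0)"

definition S0 :: real where "S0 = hs_sq s f0"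

lemma f0_harm: "hseq f0" using f0 by (simp add: in_Hs_def)

lemma pic_0: "pic 0 t k = (%x. 0)" by (simp add: pic_def)

lemma pic_Suc: "pic (Suc m) = pstep (pic m)" by (simp add: pic_def)

lemma vj_cont: "good f ==> continuous_on {0..} (vj f)"
  unfolding vj_def by (intro continuous_on_radcut jv_cont good_cont continuous_on_subset[OF Rcont] Rpos) auto

lemma vj_contT: "good f ==> continuous_on {0..T} (vj f)"
  by (rule continuous_on_subset[OF vj_cont]) auto

lemma bt_good:
  assumes f: "good f" and t: "0 <= t" shows "sph_harm k (bt (vj f t) (f t) k)"
  using sph_harm_bt[OF n2 good_hseq[OF f t]] .

lemma bt_good_cont:
  assumes f: "good f" and Q: "sph_harm k Q" shows "continuous_on {0..} (%t. ip (bt (vj f t) (f t) k) Q)"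
  by (rule bt_cont[OF n2 vj_cont[OF f] _ good_cont[OF f] Q]) (use good_hseq[OF f] in auto)

lemma pstep_props:
  assumes f: "good f"
  shows "good (pstep f)" "solves T k (\<sigma> * lam TYPE('n) k) (%t. pstep f t k) (%t. bt (vj f t) (f t) k)" "pstep f 0 = f0"
    "!!t Q. 0 <= t ==> sph_harm k Q ==> ip (pstep f t k) Q = exp (- (\<sigma> * lam TYPE('n) k) * t) * (ip (f0 k) Q + integral {0..t} (%ta. exp ((\<sigma> * lam TYPE('n) k) * ta) * ip (bt (vj f ta) (f ta) k) Q))"
proof -
  have h0: "sph_harm k (f0 k)" for k using f0_harm by blast
  have e: "(%t. pstep f t k) = (%t x. exp (- (\<sigma> * lam TYPE('n) k) * t) * (f0 k x + integral {0..t} (%ta. exp ((\<sigma> * lam TYPE('n) k) * ta) * bt (vj f ta) (f ta) k x)))" for k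
    by (auto simp: pstep_def fun_eq_iff)
  have hb: "sph_harm k (bt (vj f ta) (f ta) k)" if "0 <= ta" for ta k using bt_good[OF f that] .
  have cb: "continuous_on {0..} (%t. ip (bt (vj f t) (f t) k) Q)" if "sph_harm k Q" for k Q using bt_good_cont[OF f that] .
  show sv: "solves T k (\<sigma> * lam TYPE('n) k) (%t. pstep f t k) (%t. bt (vj f t) (f t) k)" for T k
    unfolding e by (rule duhamel(2)) (use h0 hb cb in auto)
  have hh: "sph_harm k (pstep f t k)" if "0 <= t" for t k
    using sv[of t k] that unfolding solves_def by auto
  show "good (pstep f)" unfolding good_def
    using hh solves_cont[OF sv] by (auto intro!: cont_Ici)
  show "pstep f 0 = f0" by (rule ext, rule ext) (simp add: pstep_def)
  fix t :: real and Q :: "real^'n => real" assume tQ: "0 <= t" "sph_harm k Q"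
  show "ip (pstep f t k) Q = exp (- (\<sigma> * lam TYPE('n) k) * t) * (ip (f0 k) Q + integral {0..t} (%ta. exp ((\<sigma> * lam TYPE('n) k) * ta) * ip (bt (vj f ta) (f ta) k) Q))"
    unfolding fun_cong[OF e[of k], of t] by (rule duhamel(4)) (use h0 hb cb tQ in auto)
qed

lemma pic_good: "good (pic m)"
proof (induction m)
  case 0 show ?case by (auto simp: good_def pic_0 sph_harm_zero)
next
  case (Suc m) then show ?case unfolding pic_Suc by (rule pstep_props(1))
qed

lemma f0_partial: "(\<Sum>k\<le>K. hw TYPE('n) s k * sqn (f0 k)) <= S0" and S0_nonneg: "0 <= S0"
proof -
  have nn: "0 <= hw TYPE('n) s k * sqn (f0 k)" for k
    using f0_harm sph_harm_rpf by (intro mult_nonneg_nonneg less_imp_le[OF hw_pos[OF n2]] sqn_nonneg) blast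
  have sm: "summable (%k. hw TYPE('n) s k * sqn (f0 k))" using f0 unfolding in_Hs_def hs_weight_hw by blast
  show "(\<Sum>k\<le>K. hw TYPE('n) s k * sqn (f0 k)) <= S0"
    unfolding S0_def hs_sq_def hs_weight_hw by (rule sum_le_suminf[OF sm]) (use nn in auto)
  show "0 <= S0" unfolding S0_def hs_sq_def hs_weight_hw by (rule suminf_nonneg[OF sm nn])
qed

lemma wsum_cont: "good (f :: real => 'n sdist) ==> continuous_on {0..T} (wsum r \<sigma> a f K)"
  unfolding wsum_def by (intro continuous_intros good_sqn_cont)

lemma wsum_nonneg: "good (f :: real => 'n sdist) ==> 0 <= t ==> 0 <= wsum r \<sigma> a f K t"
  unfolding wsum_def by (intro sum_nonneg mult_nonneg_nonneg less_imp_le[OF hw_pos[OF n2]] less_imp_le[OF th_pos] good_sqn_nonneg)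

text \<open>The constant 2 \<open>hwC\<close> exp(2aT) / \<sigma> of \<open>energy_sum\<close> times
  the 2n from \<open>sqn_bt\<close>.\<close>

definition kap :: "real => real => real" where
  "kap a T = 4 * real CARD('n) * hwC TYPE('n) s * exp (2 * a * T) / \<sigma>"

lemma kap_pos: "0 < kap a T"
  unfolding kap_def using hwC_ge1[OF n2, of s] sg n2 by (intro divide_pos_pos mult_pos_pos) auto

lemma step_energy:
  fixes F f :: "real => 'n sdist"
  assumes f: "good f" and i: "F 0 = f0" and a: "0 <= a" and t: "t : {0..T}"
   and s: "!!k. solves T k (\<sigma> * lam TYPE('n) k) (%t. F t k) (%t. bt (vj f t) (f t) k)"
  shows "wsum s \<sigma> a F K t <= S0 + kap a T * integral {0..t} (%ta. (norm (vj f ta))\<^sup>2 * wsum s \<sigma> a f (Suc K) ta)"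
proof -
  let ?n = "real CARD('n)"
  let ?g = "%t k. 2 * ?n * (norm (vj f t))\<^sup>2 * sqn (f t k)"
  have "wsum s \<sigma> a F K t <= (\<Sum>k\<le>K. hw TYPE('n) s k * sqn (F 0 k)) + 2 * hwC TYPE('n) s * exp (2 * a * T) / \<sigma> *
       integral {0..t} (%ta. \<Sum>k\<le>Suc K. hw TYPE('n) s k * (th \<sigma> a k ta * ?g ta k))"
    unfolding wsum_def
  proof (rule energy_sum[OF n2 sg a s _ _ _ _ t])
    show "continuous_on {0..T} (%t. ?g t k)" for k by (intro continuous_intros vj_contT good_sqn_cont f)
    show "0 <= ?g t k" if "t : {0..T}" for t k using good_sqn_nonneg[OF f] that by simp
    show "bt (vj f t) (f t) 0 = (%x. 0)" for t by simp
    show "sqn (bt (vj f t) (f t) (Suc j)) <= lam TYPE('n) (Suc j) * (?g t j + ?g t (Suc (Suc j)))" if "t : {0..T}" for t j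
      using sqn_bt[OF n2 good_hseq[OF f], of t "Suc j" "vj f t"] that by simp
  qed
  also have "(%ta. \<Sum>k\<le>Suc K. hw TYPE('n) s k * (th \<sigma> a k ta * ?g ta k)) = (%ta. (2 * ?n) * ((norm (vj f ta))\<^sup>2 * wsum s \<sigma> a f (Suc K) ta))"
    unfolding wsum_def sum_distrib_left by (intro ext sum.cong) (auto simp: mult_ac)
  finally show ?thesis using f0_partial[of K] unfolding i kap_def Henstock_Kurzweil_Integration.integral_mult_right
    by (simp add: mult_ac)
qed

lemma pic_step_energy:
  assumes "0 <= a" "t : {0..T}"
  shows "wsum s \<sigma> a (pic (Suc m)) K t <= S0 + kap a T * integral {0..t} (%ta. (norm (vj (pic m) ta))\<^sup>2 * wsum s \<sigma> a (pic m) (Suc K) ta)"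
  by (rule step_energy[OF pic_good _ assms]) (simp_all add: pic_Suc pstep_props pic_good)

lemma R_bound: "\<exists>B>0. \<forall>t\<in>{0..T}. R t <= B"
proof -
  have "compact (R ` {0..T})" using Rcont by (intro compact_continuous_image continuous_on_subset[OF Rcont]) auto
  then obtain B where "\<forall>y\<in>R ` {0..T}. norm y <= B" using compact_imp_bounded bounded_iff by metis
  then show ?thesis by (intro exI[of _ "max B 1"]) force
qed

lemma vj_le: "norm (vj f t) <= R t" "norm (vj f t) <= norm (jv (f t 1))"
  unfolding vj_def using radcut_le[OF Rpos] by auto

text \<open>The cut-off bounds |v| by B, and the exponential on the right solves y(t) = S0 +
  \<open>kap\<close> B^2 times the integral of y; so the bound reproduces itself from m to m + 1,
  for all K at once.\<close>

lemma pic_bound: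
  assumes a: "0 <= a" and B: "!!t. t : {0..T} ==> R t <= B" and t: "t : {0..T}"
  shows "wsum s \<sigma> a (pic m) K t <= S0 * exp (kap a T * B\<^sup>2 * t)"
  using t
proof (induction m arbitrary: K t)
  case 0 then show ?case using S0_nonneg by (simp add: wsum_def pic_0)
next
  case (Suc m)
  let ?c = "kap a T * B\<^sup>2"
  have sub: "{0..t} \<subseteq> {0..T}" using Suc.prems by auto
  have "wsum s \<sigma> a (pic (Suc m)) K t <= S0 + kap a T * integral {0..t} (%ta. (norm (vj (pic m) ta))\<^sup>2 * wsum s \<sigma> a (pic m) (Suc K) ta)"
    by (rule pic_step_energy[OF a Suc.prems])
  also have "... <= S0 + kap a T * integral {0..t} (%ta. B\<^sup>2 * (S0 * exp (?c * ta)))"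
  proof (intro add_left_mono mult_left_mono integral_le)
    show "(%ta. (norm (vj (pic m) ta))\<^sup>2 * wsum s \<sigma> a (pic m) (Suc K) ta) integrable_on {0..t}"
      by (intro integrable_continuous_interval continuous_intros vj_contT wsum_cont pic_good)
    show "(%ta. B\<^sup>2 * (S0 * exp (?c * ta))) integrable_on {0..t}" by (intro integrable_continuous_interval continuous_intros)
    fix ta assume ta: "ta : {0..t}"
    then have "norm (vj (pic m) ta) <= B" using vj_le(1)[of "pic m" ta] B[of ta] sub by auto
    then show "(norm (vj (pic m) ta))\<^sup>2 * wsum s \<sigma> a (pic m) (Suc K) ta <= B\<^sup>2 * (S0 * exp (?c * ta))"
      using Suc.IH[of ta "Suc K"] ta sub wsum_nonneg[OF pic_good] by (intro mult_mono power_mono) auto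
  qed (use kap_pos less_imp_le in auto)
  also have "kap a T * integral {0..t} (%ta. B\<^sup>2 * (S0 * exp (?c * ta))) = S0 * (exp (?c * t) - 1)"
  proof -
    have "((%ta. ?c * exp (?c * ta)) has_integral exp (?c * t) - exp (?c * 0)) {0..t}"
      by (rule fundamental_theorem_of_calculus) (use Suc.prems in \<open>auto intro!: derivative_eq_intros simp: has_real_derivative_iff_has_vector_derivative[symmetric]\<close>)
    from integral_unique[OF this] have "integral {0..t} (%ta. ?c * exp (?c * ta)) = exp (?c * t) - 1"
      unfolding mult_zero_right exp_zero .
    then have "S0 * integral {0..t} (%ta. ?c * exp (?c * ta)) = S0 * (exp (?c * t) - 1)" by simp
    then show ?thesis unfolding Henstock_Kurzweil_Integration.integral_mult_right by (simp add: mult_ac)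
  qed
  also have "S0 + S0 * (exp (?c * t) - 1) = S0 * exp (?c * t)" by (simp add: right_diff_distrib)
  finally show ?case .
qed

lemma sqn1_le_wsum:
  fixes f :: "real => 'n sdist"
  assumes f: "good f" and t: "0 <= t"
  shows "(norm (jv (f t 1)))\<^sup>2 <= real CARD('n) * (wsum s \<sigma> a f (Suc K) t / (hw TYPE('n) s 1 * th \<sigma> a 1 t))"
proof -
  have p: "0 < hw TYPE('n) s 1 * th \<sigma> a 1 t" using hw_pos[OF n2] th_pos by (intro mult_pos_pos)
  have "hw TYPE('n) s 1 * (th \<sigma> a 1 t * sqn (f t 1)) <= wsum s \<sigma> a f (Suc K) t"
    unfolding wsum_def using good_sqn_nonneg[OF f t]
    by (intro member_le_sum) (auto intro!: mult_nonneg_nonneg less_imp_le[OF hw_pos[OF n2]] less_imp_le[OF th_pos])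
  then have "sqn (f t 1) <= wsum s \<sigma> a f (Suc K) t / (hw TYPE('n) s 1 * th \<sigma> a 1 t)"
    using p by (simp add: pos_le_divide_eq mult_ac)
  then have "real CARD('n) * sqn (f t 1) <= real CARD('n) * (wsum s \<sigma> a f (Suc K) t / (hw TYPE('n) s 1 * th \<sigma> a 1 t))"
    by (intro mult_left_mono) auto
  moreover have "(norm (jv (f t 1)))\<^sup>2 <= real CARD('n) * sqn (f t 1)"
    by (rule norm_jv_le[OF sph_harm_rpf[of 1]]) (use good_hseq[OF f t] in blast)
  ultimately show ?thesis by linarith
qed

text \<open>T is so short that the bound A = 2 \<open>S0\<close> + 1 reproduces itself: the degree-1
  component bounds |J|^2 by a multiple of A, so the source is of order A^2, and its contribution
  over the time T must not exceed \<open>S0\<close> + 1.\<close>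

definition tcond :: "real => real => bool" where
  "tcond a T \<longleftrightarrow> kap a T * (real CARD('n) * exp (2 * a\<^sup>2 / \<sigma> * T) / hw TYPE('n) s 1 * (2 * S0 + 1)\<^sup>2) * T <= S0 + 1"

text \<open>This bound does not depend on the cut-off \<open>R\<close>.\<close>

lemma pic_bound_small:
  assumes a: "0 <= a" and T: "0 <= T" "tcond a T" and t: "t : {0..T}"
  shows "wsum s \<sigma> a (pic m) K t <= 2 * S0 + 1"
  using t
proof (induction m arbitrary: K t)
  case 0 then show ?case using S0_nonneg by (simp add: wsum_def pic_0)
next
  case (Suc m)
  let ?E = "real CARD('n) * exp (2 * a\<^sup>2 / \<sigma> * T) / hw TYPE('n) s 1" let ?A = "2 * S0 + 1"
  have sub: "{0..t} \<subseteq> {0..T}" using Suc.prems by auto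
  have "wsum s \<sigma> a (pic (Suc m)) K t <= S0 + kap a T * integral {0..t} (%ta. (norm (vj (pic m) ta))\<^sup>2 * wsum s \<sigma> a (pic m) (Suc K) ta)"
    by (rule pic_step_energy[OF a Suc.prems])
  also have "... <= S0 + kap a T * integral {0..t} (%ta. ?E * ?A\<^sup>2)"
  proof (intro add_left_mono mult_left_mono integral_le)
    show "(%ta. (norm (vj (pic m) ta))\<^sup>2 * wsum s \<sigma> a (pic m) (Suc K) ta) integrable_on {0..t}"
      by (intro integrable_continuous_interval continuous_intros vj_contT wsum_cont pic_good)
    show "(%ta. ?E * ?A\<^sup>2) integrable_on {0..t}" by (intro integrable_continuous_interval continuous_intros)
    fix ta assume ta: "ta : {0..t}"
    let ?w = "wsum s \<sigma> a (pic m) (Suc K) ta"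
    have w: "0 <= ?w" "?w <= ?A" using wsum_nonneg[OF pic_good] Suc.IH[of ta "Suc K"] ta sub by auto
    \<comment> \<open>In degree 1 the weight could only drop through - 2 a^2 / \<sigma>; the factor
      exp(2 a ta) is at least 1.\<close>
    have th: "exp (- (2 * a\<^sup>2 / \<sigma> * T)) <= th \<sigma> a 1 ta"
    proof -
      have "2 * a\<^sup>2 / \<sigma> * ta <= 2 * a\<^sup>2 / \<sigma> * T" using ta sub sg by (intro mult_left_mono) auto
      moreover have "0 <= 2 * a * ta" using a ta by simp
      ultimately show ?thesis unfolding th_def by (simp add: algebra_simps)
    qed
    have "(norm (vj (pic m) ta))\<^sup>2 <= (norm (jv (pic m ta 1)))\<^sup>2" using vj_le(2) by (intro power_mono) auto
    also have "... <= real CARD('n) * (?w / (hw TYPE('n) s 1 * th \<sigma> a 1 ta))"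
      using ta by (intro sqn1_le_wsum pic_good) auto
    also have "... <= real CARD('n) * (?A / (hw TYPE('n) s 1 * exp (- (2 * a\<^sup>2 / \<sigma> * T))))"
      using w th hw_pos[OF n2, of s 1] by (intro mult_left_mono frac_le mult_pos_pos mult_left_mono) auto
    also have "... = ?E * ?A" by (simp add: exp_minus field_simps)
    finally have "(norm (vj (pic m) ta))\<^sup>2 <= ?E * ?A" .
    then have "(norm (vj (pic m) ta))\<^sup>2 * ?w <= (?E * ?A) * ?A" using w hw_pos[OF n2, of s 1] by (intro mult_mono) auto
    then show "(norm (vj (pic m) ta))\<^sup>2 * ?w <= ?E * ?A\<^sup>2" by (simp add: power2_eq_square mult.assoc)
  qed (use kap_pos less_imp_le in auto)
  also have "kap a T * integral {0..t} (%ta. ?E * ?A\<^sup>2) = kap a T * (?E * ?A\<^sup>2) * t" using Suc.prems by simp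
  also have "S0 + ... <= S0 + kap a T * (?E * ?A\<^sup>2) * T"
    using Suc.prems kap_pos[of a T] hw_pos[OF n2, of s 1] by (intro add_left_mono mult_left_mono mult_nonneg_nonneg) auto
  also have "... <= S0 + (S0 + 1)" using T(2) unfolding tcond_def by (intro add_left_mono)
  finally show ?case by simp
qed

lemma pic_diff:
  assumes "0 <= T"
  shows "\<exists>M c. 0 <= M & 0 <= c & (\<forall>m k. \<forall>t\<in>{0..T}. sqn (%x. pic (Suc m) t k x - pic m t k x) <= M * (c ^ m / fact m) / hw TYPE('n) s k)"
proof -
  obtain B where B: "B > 0" "!!t. t : {0..T} ==> R t <= B" using R_bound by blast
  let ?N = "S0 * exp (kap 0 T * B\<^sup>2 * T)" let ?n = "real CARD('n)" let ?h = "hw TYPE('n) s"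
  have hp: "0 < ?h k" for k by (rule hw_pos[OF n2])
  have N0: "0 <= ?N" using S0_nonneg by simp
  have N: "(\<Sum>k\<le>K. ?h k * sqn (pic m t k)) <= ?N" if "t : {0..T}" for m K t
  proof -
    have "wsum s \<sigma> 0 (pic m) K t <= S0 * exp (kap 0 T * B\<^sup>2 * t)" by (rule pic_bound[OF order_refl B(2) that])
    also have "... <= ?N" using that S0_nonneg kap_pos[of 0 T] by (intro mult_left_mono) (auto intro!: mult_left_mono)
    finally show ?thesis by (simp add: wsum_def)
  qed
  define D where "D = (%m K t. \<Sum>k\<le>K. ?h k * sqn (%x. pic (Suc m) t k x - pic m t k x))"
  \<comment> \<open>The 4n next to ?N is L: the square of the Lipschitz constant 2 of
    \<open>radcut\<close> times the n of \<open>norm_jv_le\<close>.\<close>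
  define \<kappa> where "\<kappa> = 2 * hwC TYPE('n) s / \<sigma> * (4 * ?n * (B\<^sup>2 + (4 * ?n) * ?N / ?h 1))"
  have rp: "rpf (pic m t k)" if "0 <= t" for m t k using good_hseq[OF pic_good that] sph_harm_rpf by blast
  have hd: "sph_harm k (%x. pic (Suc m) t k x - pic m t k x)" if "0 <= t" for m t k
    using good_hseq[OF pic_good that] sph_harm_diff by blast
  have c: "continuous_on {0..T} (D m K)" for m K unfolding D_def
  proof (intro continuous_intros cont_sqn)
    fix k t assume "t : {0..T}" then show "sph_harm k (%x. pic (Suc m) t k x - pic m t k x)" using hd by auto
  next
    fix k and Q :: "real^'n => real" assume Q: "sph_harm k Q"
    have "continuous_on {0..T} (%t. ip (pic (Suc m) t k) Q - ip (pic m t k) Q)" by (intro continuous_intros good_contT pic_good Q)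
    then show "continuous_on {0..T} (%t. ip (%x. pic (Suc m) t k x - pic m t k x) Q)"
      by (rule continuous_on_eq) (auto simp: ip_diff_left rp sph_harm_rpf[OF Q])
  qed
  have \<kappa>0: "0 <= \<kappa>" unfolding \<kappa>_def using hwC_ge1[OF n2, of s] sg hp[of 1] S0_nonneg by (intro mult_nonneg_nonneg add_nonneg_nonneg divide_nonneg_nonneg) auto
  have st: "D (Suc m) K t <= \<kappa> * integral {0..t} (D m (Suc K))" if t: "t : {0..T}" for m K t
    unfolding D_def \<kappa>_def
  proof (rule diff_energy[OF n2 sg _ _ _ _ _ _ _ _ _ _ _ _ N0 _ t, where ?v1.0 = "vj (pic (Suc m))" and ?v2.0 = "vj (pic m)"])
    show "solves T k (\<sigma> * lam TYPE('n) k) (%t. pic (Suc (Suc m)) t k) (%t. bt (vj (pic (Suc m)) t) (pic (Suc m) t) k)"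
      "solves T k (\<sigma> * lam TYPE('n) k) (%t. pic (Suc m) t k) (%t. bt (vj (pic m) t) (pic m t) k)" for k
      using pstep_props(2)[OF pic_good] unfolding pic_Suc[symmetric] by blast+
    show "pic (Suc (Suc m)) 0 = pic (Suc m) 0" using pstep_props(3)[OF pic_good] by (simp add: pic_Suc[symmetric])
    show "(norm (vj (pic (Suc m)) t))\<^sup>2 <= B\<^sup>2" if "t : {0..T}" for t
      using vj_le(1)[of "pic (Suc m)" t] B(2)[OF that] by (intro power_mono) auto
    show "0 <= 4 * ?n" by simp
    show "(norm (vj (pic (Suc m)) t - vj (pic m) t))\<^sup>2 <= 4 * ?n * sqn (%x. pic (Suc m) t 1 x - pic m t 1 x)" if "t : {0..T}" for t
    proof -
      have t0: "0 <= t" using that by simp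
      have "norm (vj (pic (Suc m)) t - vj (pic m) t) <= 2 * norm (jv (pic (Suc m) t 1) - jv (pic m t 1))"
        unfolding vj_def by (rule radcut_lip[OF Rpos])
      also have "jv (pic (Suc m) t 1) - jv (pic m t 1) = jv (%x. pic (Suc m) t 1 x - pic m t 1 x)"
        using jv_diff[OF rp[OF t0] rp[OF t0]] by simp
      finally have "(norm (vj (pic (Suc m)) t - vj (pic m) t))\<^sup>2 <= (2 * norm (jv (%x. pic (Suc m) t 1 x - pic m t 1 x)))\<^sup>2"
        by (intro power_mono) auto
      also have "... = 4 * (norm (jv (%x. pic (Suc m) t 1 x - pic m t 1 x)))\<^sup>2" by (simp add: power_mult_distrib)
      also have "... <= 4 * (?n * sqn (%x. pic (Suc m) t 1 x - pic m t 1 x))"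
        by (intro mult_left_mono norm_jv_le sph_harm_rpf[OF hd[OF t0]]) auto
      finally show ?thesis by simp
    qed
    show "(\<Sum>k\<le>K. ?h k * sqn (pic m t k)) <= ?N" if "t : {0..T}" for t K by (rule N[OF that])
  qed (auto intro!: good_contT pic_good vj_contT simp: good_hseq[OF pic_good])
  have M: "D 0 K t <= ?N" if "t : {0..T}" for K t using N[OF that, of "Suc 0" K] by (simp add: D_def pic_0)
  have main: "D m K t <= ?N * ((\<kappa> * t) ^ m / fact m)" if "t : {0..T}" for m K t
    by (rule factorial_iteration[of T D \<kappa> ?N t m K]) (use c \<kappa>0 M st that in blast)+
  show ?thesis
  proof (rule exI[of _ ?N], rule exI[of _ "\<kappa> * T"], intro conjI allI ballI)
    show "0 <= ?N" by (rule N0)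
    show "0 <= \<kappa> * T" using \<kappa>0 assms by (rule mult_nonneg_nonneg)
    fix m k t assume t: "t : {0..T}"
    have "?h k * sqn (%x. pic (Suc m) t k x - pic m t k x) <= D m k t"
      unfolding D_def using sqn_nonneg[OF sph_harm_rpf[OF hd]] t
      by (intro member_le_sum) (auto intro!: mult_nonneg_nonneg less_imp_le[OF hp])
    also have "... <= ?N * ((\<kappa> * t) ^ m / fact m)" by (rule main[OF t])
    also have "... <= ?N * ((\<kappa> * T) ^ m / fact m)"
    proof -
      have "0 <= \<kappa> * t" "\<kappa> * t <= \<kappa> * T" using t by (simp_all add: \<kappa>0 mult_left_mono)
      then have "(\<kappa> * t) ^ m / fact m <= (\<kappa> * T) ^ m / fact m" by (intro divide_right_mono power_mono) simp_all
      then show ?thesis by (rule mult_left_mono[OF _ N0])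
    qed
    finally show "sqn (%x. pic (Suc m) t k x - pic m t k x) <= ?N * ((\<kappa> * T) ^ m / fact m) / ?h k"
      using hp[of k] by (simp add: pos_le_divide_eq mult.commute)
  qed
qed

end

section \<open>Passage to the limit in the Picard iteration\<close>

lemma solves_cong:
  assumes s: "solves T k \<mu> u b" and u: "!!t. t : {0..T} ==> u' t = u t"
  shows "solves T k \<mu> u' b"
  unfolding solves_def
proof (intro conjI ballI allI impI)
  fix t assume "t : {0..T}"
  then show "sph_harm k (u' t)" "sph_harm k (b t)" using s u unfolding solves_def by auto
next
  fix Q :: "real^'a => real" assume Q: "sph_harm k Q"
  show "continuous_on {0..T} (%t. ip (b t) Q)" using s Q unfolding solves_def by auto
  fix t assume t: "t : {0..T}"
  have "((%t. ip (u t) Q) has_real_derivative - \<mu> * ip (u' t) Q + ip (b t) Q) (at t within {0..T})"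
    using s Q t u[OF t] unfolding solves_def by auto
  then show "((%t. ip (u' t) Q) has_real_derivative - \<mu> * ip (u' t) Q + ip (b t) Q) (at t within {0..T})"
    by (rule has_field_derivative_transform_within[of _ _ _ _ 1]) (use t u in auto)
qed

lemma ip_eqI:
  assumes "sph_harm k P" "sph_harm k P'" "!!Q. sph_harm k Q ==> ip P Q = ip P' Q" shows "P = P'"
  by (rule ext) (metis assms ip_reprod sph_harm_reprod)

context doi_cut begin

lemma pic_uniform:
  assumes Q: "sph_harm k Q" and T: "0 <= T"
  shows "uniform_limit {0..T} (%m t. ip (pic m t k) Q) (%t. lim (%m. ip (pic m t k) Q)) sequentially"
    and "t : {0..T} ==> convergent (%m. ip (pic m t k) Q)"
proof -
  obtain M c where M: "0 <= M" "0 <= c" "!!m k t. t : {0..T} ==> sqn (%x. pic (Suc m) t k x - pic m t k x) <= M * (c ^ m / fact m) / hw TYPE('n) s k"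
    using pic_diff[OF T] by blast
  let ?h = "hw TYPE('n) s k"
  have hp: "0 < ?h" by (rule hw_pos[OF n2])
  let ?f = "%m t. ip (pic (Suc m) t k) Q - ip (pic m t k) Q"
  \<comment> \<open>The square root of the bound from \<open>pic_diff\<close>, linearised by
    \<open>sqrt_le_amgm\<close>; the factor 2^m is merged with c^m.\<close>
  let ?B = "%m. (M / ?h * ((2 * c) ^ m / fact m) + (1 / 2) ^ m) * sqrt (sqn Q)"
  have bd: "norm (?f m t) <= ?B m" if t: "t : {0..T}" for m t
  proof -
    have t0: "0 <= t" using t by simp
    have r: "rpf (pic m t k)" for m using good_hseq[OF pic_good t0] sph_harm_rpf by blast
    have rd: "rpf (%x. pic (Suc m) t k x - pic m t k x)" by (rule real_polynomial_function_diff[OF r r])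
    let ?x = "M * (c ^ m / fact m) / ?h"
    have x0: "0 <= ?x" using M hp by simp
    have "norm (?f m t) = \<bar>ip (%x. pic (Suc m) t k x - pic m t k x) Q\<bar>"
      by (simp add: ip_diff_left r sph_harm_rpf[OF Q])
    also have "... <= sqrt (sqn (%x. pic (Suc m) t k x - pic m t k x)) * sqrt (sqn Q)"
      by (rule ip_CS_abs[OF rd sph_harm_rpf[OF Q]])
    also have "... <= sqrt ?x * sqrt (sqn Q)"
      using M(3)[OF t] by (intro mult_right_mono real_sqrt_le_mono) (auto intro: sqn_nonneg sph_harm_rpf[OF Q])
    also have "... <= (2 ^ m * ?x + (1 / 2) ^ m) * sqrt (sqn Q)"
      by (intro mult_right_mono sqrt_le_amgm x0) (auto intro: sqn_nonneg sph_harm_rpf[OF Q])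
    also have "2 ^ m * ?x = M / ?h * ((2 * c) ^ m / fact m)" by (simp add: power_mult_distrib mult_ac)
    finally show ?thesis .
  qed
  have "summable (%m. inverse (fact m) * (2 * c) ^ m)" by (rule summable_exp)
  then have "summable (%m. (2 * c) ^ m / fact m)" by (simp add: divide_inverse mult.commute)
  then have sB: "summable ?B" by (intro summable_mult2 summable_add summable_mult) (auto intro: summable_geometric)
  have tel: "(\<Sum>i<m. ?f i t) = ip (pic m t k) Q" for m t
    using sum_lessThan_telescope[of "%m. ip (pic m t k) Q" m] by (simp add: pic_0)
  have u: "uniform_limit {0..T} (%m t. ip (pic m t k) Q) (%t. suminf (%i. ?f i t)) sequentially"
  proof -
    have "uniform_limit {0..T} (%m t. \<Sum>i<m. ?f i t) (%t. suminf (%i. ?f i t)) sequentially"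
      by (rule Weierstrass_m_test[OF _ sB]) (rule bd)
    then show ?thesis unfolding tel .
  qed
  have p: "(%m. ip (pic m t k) Q) \<longlonglongrightarrow> suminf (%i. ?f i t)" if "t : {0..T}" for t
    by (rule tendsto_uniform_limitI[OF u that])
  show "t : {0..T} ==> convergent (%m. ip (pic m t k) Q)" using p unfolding convergent_def by blast
  have "suminf (%i. ?f i t) = lim (%m. ip (pic m t k) Q)" if "t : {0..T}" for t using limI[OF p[OF that]] by simp
  then show "uniform_limit {0..T} (%m t. ip (pic m t k) Q) (%t. lim (%m. ip (pic m t k) Q)) sequentially"
    using u by (subst (asm) uniform_limit_cong'[of "{0..T}" _ "%m t. ip (pic m t k) Q" _ "%t. lim (%m. ip (pic m t k) Q)"]) auto
qed

text \<open>Taking limits of basis coefficients makes each component a spherical harmonic by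
  construction.\<close>

definition sol :: "real => 'n sdist" where
  "sol t k = (%x. \<Sum>e\<in>hbasis k. lim (%m. ip (pic m t k) e) * e x)"

lemma sol_harm: "sph_harm k (sol t k)" unfolding sol_def by (rule sph_harm_hbasis_sum)

lemma pic_tendsto:
  assumes Q: "sph_harm k Q" and t: "0 <= t" shows "(%m. ip (pic m t k) Q) \<longlonglongrightarrow> ip (sol t k) Q"
proof -
  have c: "(%m. ip (pic m t k) e) \<longlonglongrightarrow> lim (%m. ip (pic m t k) e)" if "e : hbasis k" for e
    using pic_uniform(2)[OF hbasis_harm[OF that] t, of t] t by (simp add: convergent_LIMSEQ_iff)
  have "(%m. \<Sum>e\<in>hbasis k. ip (pic m t k) e * ip e Q) \<longlonglongrightarrow> (\<Sum>e\<in>hbasis k. lim (%m. ip (pic m t k) e) * ip e Q)"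
    by (intro tendsto_sum tendsto_mult_right c)
  moreover have "(%m. \<Sum>e\<in>hbasis k. ip (pic m t k) e * ip e Q) = (%m. ip (pic m t k) Q)"
    using good_hseq[OF pic_good t] by (intro ext ip_hbasis[symmetric] sph_harm_rpf[OF Q]) auto
  moreover have "(\<Sum>e\<in>hbasis k. lim (%m. ip (pic m t k) e) * ip e Q) = ip (sol t k) Q"
    unfolding ip_hbasis[OF sol_harm sph_harm_rpf[OF Q]] by (intro sum.cong refl) (simp add: sol_def ip_hbasis_sum)
  ultimately show ?thesis by simp
qed

lemma sol_cont:
  assumes Q: "sph_harm k Q" and T: "0 <= T" shows "continuous_on {0..T} (%t. ip (sol t k) Q)"
proof -
  have "continuous_on {0..T} (%t. lim (%m. ip (pic m t k) Q))"
    by (rule uniform_limit_theorem[OF _ pic_uniform(1)[OF Q T]]) (auto intro!: always_eventually good_contT pic_good Q)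
  then show ?thesis by (rule continuous_on_eq) (use limI[OF pic_tendsto[OF Q]] in auto)
qed

lemma sol_good: "good sol"
  unfolding good_def using sol_harm by (auto intro!: cont_Ici sol_cont)

lemma sqn_tendsto: "0 <= t ==> (%m. sqn (pic m t k)) \<longlonglongrightarrow> sqn (sol t k)"
proof -
  assume t: "0 <= t"
  have "(%m. \<Sum>e\<in>hbasis k. (ip (pic m t k) e)\<^sup>2) \<longlonglongrightarrow> (\<Sum>e\<in>hbasis k. (ip (sol t k) e)\<^sup>2)"
    by (intro tendsto_sum tendsto_power pic_tendsto hbasis_harm t)
  moreover have "(%m. \<Sum>e\<in>hbasis k. (ip (pic m t k) e)\<^sup>2) = (%m. sqn (pic m t k))"
    using good_hseq[OF pic_good t] by (intro ext sqn_hbasis[symmetric]) auto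
  ultimately show ?thesis unfolding sqn_hbasis[OF sol_harm] by simp
qed

lemma wsum_tendsto: "0 <= t ==> (%m. wsum r \<sigma> a (pic m) K t) \<longlonglongrightarrow> wsum r \<sigma> a sol K t"
  unfolding wsum_def by (intro tendsto_intros sqn_tendsto)

lemma sol_bound:
  assumes a: "0 <= a" and B: "!!t. t : {0..T} ==> R t <= B" and t: "t : {0..T}"
  shows "wsum s \<sigma> a sol K t <= S0 * exp (kap a T * B\<^sup>2 * t)"
  by (rule LIMSEQ_le_const2[OF wsum_tendsto]) (use t pic_bound[OF a B t] in auto)

lemma sol_bound_small:
  assumes a: "0 <= a" and T: "0 <= T" "tcond a T" and t: "t : {0..T}"
  shows "wsum s \<sigma> a sol K t <= 2 * S0 + 1"
  by (rule LIMSEQ_le_const2[OF wsum_tendsto]) (use t pic_bound_small[OF a T t] in auto)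

lemma vj_tendsto: "0 <= t ==> (%m. vj (pic m) t) \<longlonglongrightarrow> vj sol t"
proof -
  assume t: "0 <= t"
  have "(%m. jv (pic m t 1)) \<longlonglongrightarrow> jv (sol t 1)"
    unfolding jv_def by (intro tendsto_vec_lambda pic_tendsto[OF _ t] rpf_jc)
  then have "(%m. 2 * norm (jv (pic m t 1) - jv (sol t 1))) \<longlonglongrightarrow> 2 * 0"
    by (intro tendsto_mult tendsto_const) (simp add: tendsto_norm_zero_iff LIM_zero_iff)
  then have l: "(%m. 2 * norm (jv (pic m t 1) - jv (sol t 1))) \<longlonglongrightarrow> 0" by simp
  have "(%m. vj (pic m) t - vj sol t) \<longlonglongrightarrow> 0"
    by (rule Lim_null_comparison[OF always_eventually l]) (simp add: vj_def radcut_lip[OF Rpos])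
  then show ?thesis by (simp add: LIM_zero_iff)
qed

lemma bt_tendsto:
  assumes t: "0 <= t" and Q: "sph_harm k Q"
  shows "(%m. ip (bt (vj (pic m) t) (pic m t) k) Q) \<longlonglongrightarrow> ip (bt (vj sol t) (sol t) k) Q"
proof (cases k)
  case (Suc j)
  have Q': "sph_harm (Suc j) Q" using Q Suc by simp
  let ?A = "%i f. (real (Suc j) + real CARD('n) - 2) * ip (f j) (Dn (axis i 1) (Suc j) Q) - real (Suc j) * ip (f (Suc (Suc j))) (Up (axis i 1) (Suc j) Q)"
  have "(%m. ?A i (pic m t)) \<longlonglongrightarrow> ?A i (sol t)" for i :: 'n
    by (rule tendsto_diff; rule tendsto_mult_left; rule pic_tendsto[OF _ t]) (rule sph_harm_Dn[OF Q'], rule sph_harm_Up[OF Q' n2])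
  then have "(%m. \<Sum>i\<in>UNIV. vj (pic m) t $ i * ?A i (pic m t)) \<longlonglongrightarrow> (\<Sum>i\<in>UNIV. vj sol t $ i * ?A i (sol t))"
    by (intro tendsto_sum tendsto_mult tendsto_vec_nth vj_tendsto t)
  then show ?thesis unfolding Suc ip_bt[OF n2 good_hseq[OF pic_good t] Q'] ip_bt[OF n2 good_hseq[OF sol_good t] Q'] .
qed simp

text \<open>The limit is taken in the integral form of the iteration: the bounds of
  \<open>pic_bound\<close>, uniform in m, dominate the drift term of the given degree, which
  converges pointwise in time.\<close>

lemma sol_integral_eq:
  assumes t: "0 <= t" and Q: "sph_harm k Q"
  shows "ip (sol t k) Q = ip (pstep sol t k) Q"
proof -
  obtain B where B: "B > 0" "!!ta. ta : {0..t} ==> R ta <= B" using R_bound by blast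
  let ?\<mu> = "\<sigma> * lam TYPE('n) k" let ?h = "hw TYPE('n) s"
  let ?g = "%f ta. exp (?\<mu> * ta) * ip (bt (vj f ta) (f ta) k) Q"
  have hp: "0 < ?h k" for k by (rule hw_pos[OF n2])
  let ?N = "S0 * exp (kap 0 t * B\<^sup>2 * t)"
  have sq: "sqn (pic m ta l) <= ?N / ?h l" if ta: "ta : {0..t}" for m ta l
  proof -
    have "?h l * (th \<sigma> 0 l ta * sqn (pic m ta l)) <= wsum s \<sigma> 0 (pic m) l ta"
      unfolding wsum_def using ta by (intro member_le_sum) (auto intro!: mult_nonneg_nonneg less_imp_le[OF hp] good_sqn_nonneg pic_good)
    also have "... <= S0 * exp (kap 0 t * B\<^sup>2 * ta)" by (rule pic_bound[OF order_refl B(2) ta])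
    also have "... <= ?N" using ta S0_nonneg kap_pos[of 0 t] by (intro mult_left_mono) (auto intro!: mult_left_mono)
    finally show ?thesis using hp[of l] by (simp add: pos_le_divide_eq mult.commute)
  qed
  define W where "W = (if k = 0 then 0 else lam TYPE('n) k * (2 * real CARD('n) * B\<^sup>2 * (?N / ?h (k - 1)) + 2 * real CARD('n) * B\<^sup>2 * (?N / ?h (k + 1))))"
  have sb: "sqn (bt (vj (pic m) ta) (pic m ta) k) <= W" if ta: "ta : {0..t}" for m ta
  proof (cases "k = 0")
    case False
    have ta0: "0 <= ta" using ta by simp
    have v: "(norm (vj (pic m) ta))\<^sup>2 <= B\<^sup>2" using vj_le(1)[of "pic m" ta] B(2)[OF ta] by (intro power_mono) auto
    have "sqn (bt (vj (pic m) ta) (pic m ta) k) <= lam TYPE('n) k * (2 * real CARD('n) * (norm (vj (pic m) ta))\<^sup>2 * sqn (pic m ta (k - 1)) + 2 * real CARD('n) * (norm (vj (pic m) ta))\<^sup>2 * sqn (pic m ta (k + 1)))"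
      using False by (intro sqn_bt[OF n2 good_hseq[OF pic_good ta0]]) auto
    also have "... <= lam TYPE('n) k * (2 * real CARD('n) * B\<^sup>2 * (?N / ?h (k - 1)) + 2 * real CARD('n) * B\<^sup>2 * (?N / ?h (k + 1)))"
      by (intro mult_left_mono add_mono mult_mono v sq[OF ta] good_sqn_nonneg[OF pic_good ta0] lam_nonneg[OF n2] mult_nonneg_nonneg zero_le_power2) auto
    also have "... = W" unfolding W_def using False by simp
    finally show ?thesis .
  qed (simp add: W_def)
  have "(%m. integral {0..t} (?g (pic m))) \<longlonglongrightarrow> integral {0..t} (?g sol)"
  proof (rule dominated_convergence(2))
    show "?g (pic m) integrable_on {0..t}" for m
      by (intro integrable_continuous_interval continuous_intros continuous_on_subset[OF bt_good_cont[OF pic_good Q]]) auto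
    show "(%ta. exp (?\<mu> * ta) * (sqrt W * sqrt (sqn Q))) integrable_on {0..t}"
      by (intro integrable_continuous_interval continuous_intros)
    show "norm (?g (pic m) ta) <= exp (?\<mu> * ta) * (sqrt W * sqrt (sqn Q))" if ta: "ta : {0..t}" for m ta
    proof -
      have ta0: "0 <= ta" using ta by simp
      have "\<bar>ip (bt (vj (pic m) ta) (pic m ta) k) Q\<bar> <= sqrt (sqn (bt (vj (pic m) ta) (pic m ta) k)) * sqrt (sqn Q)"
        by (rule ip_CS_abs[OF sph_harm_rpf[OF bt_good[OF pic_good ta0]] sph_harm_rpf[OF Q]])
      also have "... <= sqrt W * sqrt (sqn Q)"
        using sb[OF ta] by (intro mult_right_mono real_sqrt_le_mono) (auto intro: sqn_nonneg sph_harm_rpf[OF Q])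
      finally show ?thesis by (simp add: abs_mult)
    qed
    show "(%m. ?g (pic m) ta) \<longlonglongrightarrow> ?g sol ta" if "ta : {0..t}" for ta
      using that by (intro tendsto_intros bt_tendsto Q) auto
  qed
  then have "(%m. exp (- ?\<mu> * t) * (ip (f0 k) Q + integral {0..t} (?g (pic m)))) \<longlonglongrightarrow> exp (- ?\<mu> * t) * (ip (f0 k) Q + integral {0..t} (?g sol))"
    by (intro tendsto_mult tendsto_add tendsto_const)
  then have "(%m. ip (pic (Suc m) t k) Q) \<longlonglongrightarrow> ip (pstep sol t k) Q"
    unfolding pic_Suc pstep_props(4)[OF pic_good t Q] pstep_props(4)[OF sol_good t Q] .
  then have "(%m. ip (pic m t k) Q) \<longlonglongrightarrow> ip (pstep sol t k) Q" by (rule LIMSEQ_imp_Suc)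
  then show ?thesis using pic_tendsto[OF Q t] LIMSEQ_unique by blast
qed

lemma sol_pstep: "0 <= t ==> sol t k = pstep sol t k"
  by (rule ip_eqI[OF sol_harm _ sol_integral_eq]) (use good_hseq[OF pstep_props(1)[OF sol_good]] in auto)

lemma sol_solves: "solves T k (\<sigma> * lam TYPE('n) k) (%t. sol t k) (%t. bt (vj sol t) (sol t) k)"
  by (rule solves_cong[OF pstep_props(2)[OF sol_good]]) (simp add: sol_pstep)

lemma sol_init: "sol 0 = f0"
  using sol_pstep[of 0] pstep_props(3)[OF sol_good] by auto

end

section \<open>Decay and a priori bounds\<close>

lemma hw_exp_bound:
  assumes n: "CARD('n::finite) >= 2" and e: "ep > 0"
  shows "\<exists>C>0. \<forall>k. hw TYPE('n) r k <= C * exp (ep * real k)"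
proof -
  let ?n = "real CARD('n)"
  \<comment> \<open>The eigenvalue is at most a constant times exp(2 \<delta> k); raised to |r| this
    stays below exp(ep k). The 1 in the denominator covers r = 0.\<close>
  define \<delta> where "\<delta> = ep / (2 * \<bar>r\<bar> + 1)"
  have d: "\<delta> > 0" unfolding \<delta>_def using e by (intro divide_pos_pos) auto
  have d2: "2 * \<delta> * \<bar>r\<bar> <= ep"
  proof -
    have "2 * \<delta> * \<bar>r\<bar> <= \<delta> * (2 * \<bar>r\<bar> + 1)" using d by (simp add: algebra_simps)
    also have "... = ep" unfolding \<delta>_def by (simp add: add_nonneg_eq_0_iff)
    finally show ?thesis .
  qed
  let ?c = "?n / \<delta>\<^sup>2"
  have c: "?c > 0" using n d by simp
  let ?C = "?c powr \<bar>r\<bar> + 1"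
  have "hw TYPE('n) r k <= ?C * exp (ep * real k)" for k
  proof (cases "k = 0")
    case True then show ?thesis by (simp add: hw_def)
  next
    case False
    let ?l = "lam TYPE('n) k"
    have l1: "?l >= 1" using lam_pos[OF n, of k] False by simp
    have kd: "real k <= exp (\<delta> * real k) / \<delta>"
    proof -
      have "\<delta> * real k <= exp (\<delta> * real k)" using exp_ge_add_one_self[of "\<delta> * real k"] by linarith
      then show ?thesis using d by (simp add: pos_le_divide_eq mult.commute)
    qed
    have "?l <= ?n * (real k)\<^sup>2"
    proof -
      have "0 <= (?n - 2) * (real k - 1)" using n False by simp
      then have "real k + ?n - 2 <= ?n * real k" by (simp add: algebra_simps)
      then show ?thesis unfolding lam_def power2_eq_square using False by (simp add: mult.left_commute)
    qed
    also have "... <= ?n * (exp (\<delta> * real k) / \<delta>)\<^sup>2" using kd by (intro mult_left_mono power_mono) auto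
    also have "... = ?c * exp (2 * \<delta> * real k)" by (simp add: power_divide exp_double[symmetric] mult.assoc)
    finally have l2: "?l <= ?c * exp (2 * \<delta> * real k)" .
    have "hw TYPE('n) r k <= ?l powr \<bar>r\<bar>" unfolding hw_def using False l1 by (simp add: powr_mono)
    also have "... <= (?c * exp (2 * \<delta> * real k)) powr \<bar>r\<bar>" using l1 l2 by (intro powr_mono2) auto
    also have "... = ?c powr \<bar>r\<bar> * exp (2 * \<delta> * \<bar>r\<bar> * real k)" 
    proof -
      have "(?c * exp (2 * \<delta> * real k)) powr \<bar>r\<bar> = ?c powr \<bar>r\<bar> * exp (2 * \<delta> * real k) powr \<bar>r\<bar>"
        by (rule powr_mult)
      then show ?thesis by (simp add: exp_powr_real mult_ac)
    qed
    also have "... <= ?C * exp (ep * real k)" using d2 by (intro mult_mono) (auto intro!: mult_right_mono)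
    finally show ?thesis .
  qed
  moreover have "?C > 0" by (rule add_nonneg_pos) auto
  ultimately show ?thesis by blast
qed

lemma hw_inverse: "CARD('n::finite) >= 2 ==> 1 / hw TYPE('n) r k = hw TYPE('n) (- r) k"
  by (simp add: hw_def powr_minus divide_inverse)

text \<open>This is the source of the smoothing: a bound in the norm weighted by \<open>th\<close>
  is, from time \<open>t1\<close> on, exponential decay in the degree at rate 2 a
  \<open>t1\<close>.\<close>

lemma th_inverse_bound:
  assumes "0 <= a" "t1 <= t" "t <= T" "0 <= t1" "\<sigma> > 0"
  shows "1 / th \<sigma> a k t <= exp (2 * a\<^sup>2 / \<sigma> * T) * exp (- (2 * a * t1) * real k)"
proof -
  have "1 / th \<sigma> a k t = exp (2 * a\<^sup>2 / \<sigma> * t - 2 * a * real k * t)"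
    unfolding th_def by (simp add: exp_minus divide_inverse algebra_simps flip: exp_minus)
  also have "... <= exp (2 * a\<^sup>2 / \<sigma> * T + (- (2 * a * t1) * real k))"
  proof -
    have "2 * a\<^sup>2 / \<sigma> * t <= 2 * a\<^sup>2 / \<sigma> * T" using assms by (intro mult_left_mono) auto
    moreover have "2 * a * real k * t1 <= 2 * a * real k * t" using assms by (intro mult_left_mono) auto
    ultimately show ?thesis by (simp add: algebra_simps)
  qed
  finally show ?thesis unfolding exp_add .
qed

text \<open>Weights for which the drift terms telescope in the energy balance.\<close>

fun cw :: "nat => nat => real" where
  "cw n 0 = 1"
| "cw n (Suc j) = cw n j * (real j + 1) / (real j + real n)"

lemma cw_pos: "n >= 2 ==> 0 < cw n j"
  by (induction j) (auto intro!: divide_pos_pos mult_pos_pos)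

lemma cw_le: "n >= 2 ==> cw n j <= 1"
proof (induction j)
  case (Suc j)
  have "cw n j * (real j + 1) <= 1 * (real j + real n)" using Suc by (intro mult_mono) auto
  then show ?case using Suc by (simp add: divide_le_eq)
qed simp

text \<open>The recursion of \<open>cw\<close> makes the coefficient with which X (j + 1) enters
  from degree j + 1 equal to the one with which it leaves from degree j; only the two ends
  survive.\<close>

lemma cw_telescope:
  assumes "n >= 2"
  shows "(\<Sum>j<K. cw n j * ((real j + real n - 1) * X j - (real j + 1) * X (Suc j)))
    = (real n - 1) * X 0 - cw n K * (real K + real n - 1) * X K"
proof (induction K)
  case (Suc K)
  have "cw n (Suc K) * (real (Suc K) + real n - 1) = cw n K * (real K + 1)" using assms by (simp add: field_simps)
  then have "cw n (Suc K) * (real (Suc K) + real n - 1) * X (Suc K) = cw n K * (real K + 1) * X (Suc K)" by simp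
  then show ?case using Suc by (simp add: algebra_simps del: cw.simps)
qed simp

text \<open>A differential form of Gronwall's lemma with an additive error. In
  \<open>apriori\<close> the error is the flux through degree K and tends to 0, so its linear growth
  in time is harmless.\<close>

lemma exp_growth_bound:
  fixes E :: "real => real"
  assumes t: "t0 <= t" and d: "!!x. x : {t0..t} ==> (E has_real_derivative E' x) (at x within {t0..t})"
    and b: "!!x. x : {t0..t} ==> E' x <= c * E x + ep" and c: "0 <= c" and e: "0 <= ep"
  shows "E t <= exp (c * (t - t0)) * (E t0 + ep * (t - t0))"
proof -
  define y where "y = (%x. exp (- c * (x - t0)) * E x - ep * (x - t0))"
  have "\<exists>x\<in>{t0..t}. y t - y t0 = (exp (- c * (x - t0)) * (E' x - c * E x) - ep) * (t - t0)"
  proof (rule mvt_very_simple[of t0 t y "%x h. (exp (- c * (x - t0)) * (E' x - c * E x) - ep) * h"])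
    fix x assume "t0 <= x" "x <= t"
    then have "(y has_real_derivative exp (- c * (x - t0)) * (E' x - c * E x) - ep) (at x within {t0..t})"
      unfolding y_def by (auto intro!: derivative_eq_intros d simp: algebra_simps)
    then show "(y has_derivative (%h. (exp (- c * (x - t0)) * (E' x - c * E x) - ep) * h)) (at x within {t0..t})"
      by (simp add: has_field_derivative_def)
  qed (use t in auto)
  then obtain x where x: "x : {t0..t}" "y t - y t0 = (exp (- c * (x - t0)) * (E' x - c * E x) - ep) * (t - t0)" by blast
  have "exp (- c * (x - t0)) * (E' x - c * E x) <= exp (- c * (x - t0)) * ep" using b[OF x(1)] by (intro mult_left_mono) auto
  also have "... <= 1 * ep" using c e x(1) by (intro mult_right_mono) auto
  finally have "exp (- c * (x - t0)) * (E' x - c * E x) - ep <= 0" by simp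
  then have "(exp (- c * (x - t0)) * (E' x - c * E x) - ep) * (t - t0) <= 0" using t by (intro mult_nonpos_nonneg) auto
  then have "y t <= y t0" using x(2) by linarith
  then have "exp (- c * (t - t0)) * E t <= E t0 + ep * (t - t0)" unfolding y_def by simp
  then have "exp (c * (t - t0)) * (exp (- c * (t - t0)) * E t) <= exp (c * (t - t0)) * (E t0 + ep * (t - t0))"
    by (intro mult_left_mono) auto
  then show ?thesis by (simp add: mult.assoc[symmetric] exp_minus_inverse flip: exp_add)
qed

context doi_cut begin

lemma tcond_exists: "\<exists>T. 0 < T & T <= 1 & tcond a T" if a: "0 <= a"
proof -
  define g where "g = (%T. real CARD('n) * exp (2 * a\<^sup>2 / \<sigma> * T) / hw TYPE('n) s 1 * (2 * S0 + 1)\<^sup>2)"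
  define c where "c = kap a 1 * g 1"
  have hp: "0 < hw TYPE('n) s 1" by (rule hw_pos[OF n2])
  have g0: "0 < g T" for T unfolding g_def using hp n2 S0_nonneg by (intro mult_pos_pos divide_pos_pos zero_less_power) auto
  have c: "c > 0" unfolding c_def by (intro mult_pos_pos kap_pos g0)
  define T where "T = min 1 ((S0 + 1) / c)"
  have T: "0 < T" "T <= 1" using c S0_nonneg unfolding T_def by auto
  have "kap a T <= kap a 1" unfolding kap_def using T a hwC_ge1[OF n2, of s] sg
    by (intro divide_right_mono mult_left_mono) (auto intro: mult_left_le)
  moreover have "g T <= g 1" unfolding g_def
    using T hp sg by (intro mult_right_mono divide_right_mono mult_left_mono) (auto intro!: mult_left_le divide_right_mono)
  ultimately have "kap a T * g T * T <= c * T" unfolding c_def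
    using T less_imp_le[OF kap_pos] less_imp_le[OF g0] by (intro mult_right_mono mult_mono) auto
  also have "... <= c * ((S0 + 1) / c)" using c unfolding T_def by (intro mult_left_mono) auto
  also have "... = S0 + 1" using c by simp
  finally show ?thesis using T unfolding tcond_def g_def by blast
qed

lemma sqn_le_wsum:
  fixes f :: "real => 'n sdist"
  assumes f: "good f" and t: "0 <= t" and w: "wsum s \<sigma> a f k t <= N"
  shows "sqn (f t k) <= N * (hw TYPE('n) (- s) k * (1 / th \<sigma> a k t))"
proof -
  have "hw TYPE('n) s k * (th \<sigma> a k t * sqn (f t k)) <= wsum s \<sigma> a f k t"
    unfolding wsum_def using good_sqn_nonneg[OF f t]
    by (intro member_le_sum) (auto intro!: mult_nonneg_nonneg less_imp_le[OF hw_pos[OF n2]] less_imp_le[OF th_pos])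
  then have "hw TYPE('n) s k * th \<sigma> a k t * sqn (f t k) <= N" using w by simp
  then have "sqn (f t k) <= N / (hw TYPE('n) s k * th \<sigma> a k t)"
    using hw_pos[OF n2, of s k] th_pos[of \<sigma> a k t] by (simp add: pos_le_divide_eq mult_ac)
  then show ?thesis by (simp add: hw_inverse[OF n2, symmetric])
qed

lemma sol_decay:
  assumes t1: "0 < t1" and a: "0 <= a"
  shows "\<exists>C\<ge>0. \<forall>t\<in>{t1..T}. \<forall>k. sqn (sol t k) <= C * exp (- a * real k)"
proof -
  \<comment> \<open>The surplus 1 in 2 a' \<open>t1\<close> = a + 1 pays for the Sobolev weight of
    order - s, which is at most a multiple of exp(k).\<close>
  define a' where "a' = (a + 1) / (2 * t1)"
  have a': "0 <= a'" "2 * a' * t1 = a + 1" using a t1 by (auto simp: a'_def)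
  obtain B where B: "B > 0" "!!t. t : {0..T} ==> R t <= B" using R_bound by blast
  obtain C1 where C1: "C1 > 0" "!!k. hw TYPE('n) (- s) k <= C1 * exp (1 * real k)" using hw_exp_bound[OF n2, of 1 "- s"] by auto
  let ?N = "S0 * exp (kap a' T * B\<^sup>2 * \<bar>T\<bar>)" let ?D = "exp (2 * a'\<^sup>2 / \<sigma> * T)"
  have N0: "0 <= ?N" using S0_nonneg by simp
  have "sqn (sol t k) <= (?N * (C1 * ?D)) * exp (- a * real k)" if t: "t : {t1..T}" for t k
  proof -
    have tT: "t : {0..T}" using t t1 by auto
    have "wsum s \<sigma> a' sol k t <= S0 * exp (kap a' T * B\<^sup>2 * t)" by (rule sol_bound[OF a'(1) B(2) tT])
    also have "... <= ?N" using tT S0_nonneg kap_pos[of a' T] by (intro mult_left_mono) (auto intro!: mult_left_mono)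
    finally have w: "wsum s \<sigma> a' sol k t <= ?N" .
    have "sqn (sol t k) <= ?N * (hw TYPE('n) (- s) k * (1 / th \<sigma> a' k t))"
      using t t1 by (intro sqn_le_wsum[OF sol_good _ w]) auto
    also have "... <= ?N * ((C1 * exp (1 * real k)) * (?D * exp (- (2 * a' * t1) * real k)))"
      using t t1 C1 a'(1) sg
      by (intro mult_left_mono mult_mono th_inverse_bound N0) (auto intro: less_imp_le[OF th_pos])
    also have "... = (?N * (C1 * ?D)) * (exp (1 * real k) * exp (- (2 * a' * t1) * real k))" by simp
    also have "exp (1 * real k) * exp (- (2 * a' * t1) * real k) = exp (- a * real k)"
      unfolding a'(2) exp_add[symmetric] by (simp add: algebra_simps)
    finally show ?thesis .
  qed
  moreover have "0 <= ?N * (C1 * ?D)" by (rule mult_nonneg_nonneg[OF N0]) (use C1(1) in auto)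
  ultimately show ?thesis by blast
qed

text \<open>The bound at time \<open>t0\<close> for the sum of all squared components that follows
  from \<open>sol_bound_small\<close> with a = 1. It does not contain the cut-off radius.\<close>

definition A2 :: "real => real" where
  "A2 t0 = (2 * S0 + 1) * (\<Sum>k. hw TYPE('n) (- s) k * (1 / th \<sigma> 1 k t0))"

lemma summable_A2: "0 < t0 ==> summable (%k. hw TYPE('n) (- s) k * (1 / th \<sigma> 1 k t0))"
proof -
  assume t0: "0 < t0"
  obtain C1 where C1: "C1 > 0" "!!k. hw TYPE('n) (- s) k <= C1 * exp (t0 * real k)" using hw_exp_bound[OF n2 t0, of "- s"] by auto
  let ?D = "exp (2 * 1\<^sup>2 / \<sigma> * t0)"
  show ?thesis
  proof (rule summable_comparison_test'[of "%k. C1 * ?D * exp (- t0) ^ k" 0])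
    show "summable (%k. C1 * ?D * exp (- t0) ^ k)" using t0 by (intro summable_mult summable_geometric) auto
    fix k
    have "hw TYPE('n) (- s) k * (1 / th \<sigma> 1 k t0) <= (C1 * exp (t0 * real k)) * (?D * exp (- (2 * 1 * t0) * real k))"
      using C1 t0 sg by (intro mult_mono th_inverse_bound) (auto intro: less_imp_le[OF th_pos])
    also have "... = C1 * ?D * (exp (t0 * real k) * exp (- (2 * 1 * t0) * real k))" by simp
    also have "exp (t0 * real k) * exp (- (2 * 1 * t0) * real k) = exp (- t0) ^ k"
      unfolding exp_add[symmetric] exp_of_nat_mult[symmetric] by (simp add: algebra_simps)
    finally show "norm (hw TYPE('n) (- s) k * (1 / th \<sigma> 1 k t0)) <= C1 * ?D * exp (- t0) ^ k"
      using hw_pos[OF n2, of "- s" k] th_pos[of \<sigma> 1 k t0] by simp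
  qed
qed

lemma energy_deriv:
  assumes x: "x : {0..T}"
  shows "((%t. \<Sum>j<K. cw CARD('n) j * sqn (sol t (Suc j))) has_real_derivative
     (\<Sum>j<K. cw CARD('n) j * (- 2 * (\<sigma> * lam TYPE('n) (Suc j)) * sqn (sol x (Suc j)) + 2 * ip (sol x (Suc j)) (bt (vj sol x) (sol x) (Suc j)))))
     (at x within {0..T})"
  by (intro DERIV_sum DERIV_cmult solves_sqn_deriv[OF sol_solves x])

text \<open>X j is the exchange between the degrees j and j + 1, and the telescoping leaves X 0 and
  the flux X K. Degree 0 is conserved and |v| <= |J| under the cut-off, so X 0 is at most
  |\<open>f0 0 0\<close>| |J|^2, a multiple of the energy whatever the radius is. The radius stays
  only in the flux.\<close>

lemma energy_deriv_le:
  assumes x: "0 <= x" and K: "K >= 1"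
  shows "(\<Sum>j<K. cw CARD('n) j * (- 2 * (\<sigma> * lam TYPE('n) (Suc j)) * sqn (sol x (Suc j)) + 2 * ip (sol x (Suc j)) (bt (vj sol x) (sol x) (Suc j))))
    <= (2 * (real CARD('n))\<^sup>2 * \<bar>f0 0 0\<bar>) * (\<Sum>j<K. cw CARD('n) j * sqn (sol x (Suc j)))
      + 2 * ((real K + real CARD('n)) * (R x * (sqn (sol x K) + sqn (sol x (Suc K)))))"
proof -
  let ?n = "real CARD('n)" let ?v = "vj sol x"
  define X where "X = (%j. ip (Up ?v j (sol x j)) (sol x (Suc j)))"
  have h: "sph_harm k (sol x k)" for k by (rule sol_harm)
  have rp: "rpf (sol x k)" for k using sph_harm_rpf[OF h] .
  have sq0: "0 <= sqn (sol x k)" for k by (rule sqn_nonneg[OF rp])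
  have b: "ip (sol x (Suc j)) (bt ?v (sol x) (Suc j)) = (real j + ?n - 1) * X j - (real j + 1) * X (Suc j)" for j
  proof -
    have "ip (sol x (Suc j)) (bt ?v (sol x) (Suc j)) = (real (Suc j) + ?n - 2) * ip (sol x (Suc j)) (Up ?v j (sol x j)) - real (Suc j) * ip (sol x (Suc j)) (Dn ?v (Suc (Suc j)) (sol x (Suc (Suc j))))"
      unfolding bt_Suc by (subst ip_diff_right) (auto intro!: rpf_cmult rpf_Up rpf_Dn rp simp: ip_cmult_right)
    moreover have "ip (sol x (Suc j)) (Dn ?v (Suc (Suc j)) (sol x (Suc (Suc j)))) = X (Suc j)"
      unfolding X_def by (rule ip_Up_Dn[OF n2 h h, symmetric])
    moreover have "ip (sol x (Suc j)) (Up ?v j (sol x j)) = X j" unfolding X_def by (rule ip_commute)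
    ultimately show ?thesis by (simp add: algebra_simps)
  qed
  let ?E = "\<Sum>j<K. cw CARD('n) j * sqn (sol x (Suc j))"
  have XK: "\<bar>X K\<bar> <= R x * (sqn (sol x K) + sqn (sol x (Suc K)))"
  proof -
    have "\<bar>X K\<bar> <= sqrt (sqn (Up ?v K (sol x K))) * sqrt (sqn (sol x (Suc K)))"
      unfolding X_def by (rule ip_CS_abs[OF rpf_Up[OF rp] rp])
    also have "... <= sqrt ((norm ?v)\<^sup>2 * sqn (sol x K)) * sqrt (sqn (sol x (Suc K)))"
      by (intro mult_right_mono real_sqrt_le_mono sqn_Up_Dn[OF n2 h]) (simp add: sq0)
    also have "... = norm ?v * (sqrt (sqn (sol x K)) * sqrt (sqn (sol x (Suc K))))" by (simp add: real_sqrt_mult)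
    also have "... <= R x * (sqn (sol x K) + sqn (sol x (Suc K)))"
    proof (intro mult_mono vj_le(1))
      show "sqrt (sqn (sol x K)) * sqrt (sqn (sol x (Suc K))) <= sqn (sol x K) + sqn (sol x (Suc K))"
        using arith_geo_mean_sqrt[OF sq0[of K] sq0[of "Suc K"]] sq0[of K] sq0[of "Suc K"] by (simp add: real_sqrt_mult)
    qed (auto simp: sq0 less_imp_le[OF Rpos])
    finally show ?thesis .
  qed
  have E1: "sqn (sol x 1) <= ?E"
  proof -
    have "cw CARD('n) 0 * sqn (sol x (Suc 0)) <= ?E"
      using K by (intro member_le_sum) (auto intro!: mult_nonneg_nonneg less_imp_le[OF cw_pos[OF n2]] sq0)
    then show ?thesis by simp
  qed
  have X0: "\<bar>X 0\<bar> <= \<bar>f0 0 0\<bar> * (?n * ?E)"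
  proof -
    have s0: "sol x 0 = f0 0"
    proof -
      have "solves x 0 0 (%t. sol t 0) (%t. bt (vj sol t) (sol t) 0)" using sol_solves[of x 0] by (simp only: lam_0 mult_zero_right)
      from solves_0_const[OF this _, of x] x show ?thesis by (simp add: sol_init)
    qed
    have U: "Up ?v 0 (sol x 0) = (%y. f0 0 0 * (\<Sum>i\<in>UNIV. ?v $ i * y $ i))"
    proof
      fix y
      have "f0 0 y = f0 0 0" using f0_harm homog_0[OF sph_harm_homog[of 0 "f0 0"]] by blast
      then show "Up ?v 0 (sol x 0) y = f0 0 0 * (\<Sum>i\<in>UNIV. ?v $ i * y $ i)"
        unfolding Up_def s0 using Dn_0[of "f0 0"] f0_harm by (simp add: inner_vec_def mult.commute)
    qed
    have "X 0 = f0 0 0 * (\<Sum>i\<in>UNIV. ?v $ i * ip (%y. y $ i) (sol x (Suc 0)))"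
      unfolding X_def U ip_cmult_left by (subst ip_sum_left) (auto intro!: rpf_cmult rpf_coord rp simp: ip_cmult_left)
    also have "(\<Sum>i\<in>UNIV. ?v $ i * ip (%y. y $ i) (sol x (Suc 0))) = ?v \<bullet> jv (sol x 1)"
      by (simp add: inner_vec_def jv_def ip_commute)
    finally have "\<bar>X 0\<bar> = \<bar>f0 0 0\<bar> * \<bar>?v \<bullet> jv (sol x 1)\<bar>" by (simp add: abs_mult)
    also have "... <= \<bar>f0 0 0\<bar> * (?n * ?E)"
    proof (intro mult_left_mono)
      have "\<bar>?v \<bullet> jv (sol x 1)\<bar> <= norm ?v * norm (jv (sol x 1))" by (rule Cauchy_Schwarz_ineq2)
      also have "... <= norm (jv (sol x 1)) * norm (jv (sol x 1))" by (intro mult_right_mono vj_le(2)) auto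
      also have "... <= ?n * sqn (sol x 1)" using norm_jv_le[OF rp, of 1] by (simp add: power2_eq_square)
      also have "... <= ?n * ?E" using E1 by (intro mult_left_mono) auto
      finally show "\<bar>?v \<bullet> jv (sol x 1)\<bar> <= ?n * ?E" .
    qed simp
    finally show ?thesis .
  qed
  have "(\<Sum>j<K. cw CARD('n) j * (- 2 * (\<sigma> * lam TYPE('n) (Suc j)) * sqn (sol x (Suc j)) + 2 * ip (sol x (Suc j)) (bt ?v (sol x) (Suc j))))
     <= (\<Sum>j<K. 2 * (cw CARD('n) j * ((real j + ?n - 1) * X j - (real j + 1) * X (Suc j))))"
  proof (rule sum_mono)
    fix j
    have "0 <= cw CARD('n) j * (2 * (\<sigma> * lam TYPE('n) (Suc j)) * sqn (sol x (Suc j)))"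
      using sg lam_nonneg[OF n2] by (intro mult_nonneg_nonneg less_imp_le[OF cw_pos[OF n2]] sq0) auto
    then show "cw CARD('n) j * (- 2 * (\<sigma> * lam TYPE('n) (Suc j)) * sqn (sol x (Suc j)) + 2 * ip (sol x (Suc j)) (bt ?v (sol x) (Suc j)))
      <= 2 * (cw CARD('n) j * ((real j + ?n - 1) * X j - (real j + 1) * X (Suc j)))"
      unfolding b by (simp add: algebra_simps)
  qed
  also have "... = 2 * ((?n - 1) * X 0 - cw CARD('n) K * (real K + ?n - 1) * X K)"
    unfolding sum_distrib_left[symmetric] cw_telescope[OF n2] ..
  also have "... <= 2 * (?n * (\<bar>f0 0 0\<bar> * (?n * ?E)) + (real K + ?n) * (R x * (sqn (sol x K) + sqn (sol x (Suc K)))))"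
  proof -
    have "(?n - 1) * X 0 <= (?n - 1) * \<bar>X 0\<bar>" using n2 by (intro mult_left_mono) auto
    also have "... <= ?n * (\<bar>f0 0 0\<bar> * (?n * ?E))" using X0 n2 by (intro mult_mono) auto
    finally have 1: "(?n - 1) * X 0 <= ?n * (\<bar>f0 0 0\<bar> * (?n * ?E))" .
    have "- (cw CARD('n) K * (real K + ?n - 1) * X K) <= cw CARD('n) K * (real K + ?n - 1) * \<bar>X K\<bar>"
    proof -
      have "0 <= cw CARD('n) K * (real K + ?n - 1)" using cw_pos[OF n2, of K] n2 by (intro mult_nonneg_nonneg) auto
      then have "cw CARD('n) K * (real K + ?n - 1) * (- X K) <= cw CARD('n) K * (real K + ?n - 1) * \<bar>X K\<bar>" by (intro mult_left_mono) auto
      then show ?thesis by simp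
    qed
    also have "... <= (1 * (real K + ?n)) * (R x * (sqn (sol x K) + sqn (sol x (Suc K))))"
      using cw_le[OF n2, of K] cw_pos[OF n2, of K] n2 XK by (intro mult_mono) auto
    finally have 2: "- (cw CARD('n) K * (real K + ?n - 1) * X K) <= (real K + ?n) * (R x * (sqn (sol x K) + sqn (sol x (Suc K))))" by simp
    have "(?n - 1) * X 0 - cw CARD('n) K * (real K + ?n - 1) * X K <= ?n * (\<bar>f0 0 0\<bar> * (?n * ?E)) + (real K + ?n) * (R x * (sqn (sol x K) + sqn (sol x (Suc K))))"
      using add_mono[OF 1 2] by (simp only: diff_conv_add_uminus)
    then show ?thesis by (rule mult_left_mono) simp
  qed
  finally show ?thesis by (simp add: power2_eq_square algebra_simps)
qed

text \<open>The first summand covers the times up to \<open>t0\<close>, through the short-time bound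
  on the degree-1 component; the second covers the later ones, through the energy started at
  \<open>t0\<close>.\<close>

definition J2 :: "real => real" where
  "J2 t0 = real CARD('n) * (2 * S0 + 1) * exp (2 / \<sigma> * t0) / hw TYPE('n) s 1 + real CARD('n) * A2 t0"

definition cJ :: real where "cJ = 2 * (real CARD('n))\<^sup>2 * \<bar>f0 0 0\<bar>"

lemma A2_nonneg: "0 < t0 ==> 0 <= A2 t0"
  unfolding A2_def using S0_nonneg
  by (intro mult_nonneg_nonneg suminf_nonneg summable_A2) (auto intro: less_imp_le[OF th_pos] less_imp_le[OF hw_pos[OF n2]])

lemma J2_pos: "0 < J2 t0" if t0: "0 < t0"
proof -
  have "0 < real CARD('n) * (2 * S0 + 1)" using S0_nonneg n2 by (intro mult_pos_pos) auto
  then have "0 < real CARD('n) * (2 * S0 + 1) * exp (2 / \<sigma> * t0) / hw TYPE('n) s 1"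
    using hw_pos[OF n2, of s 1] by (intro divide_pos_pos mult_pos_pos[of _ "exp _"]) auto
  moreover have "0 <= real CARD('n) * A2 t0" using A2_nonneg[OF t0] by simp
  ultimately show ?thesis unfolding J2_def by linarith
qed

text \<open>The cut-off radius enters only through \<open>ep K\<close>, where it multiplies an
  exponentially decaying term; letting K tend to infinity at fixed t removes it. Degree 1 has weight
  \<open>cw\<close> = 1 in the energy, which gives back J.\<close>

lemma apriori:
  assumes t0: "0 < t0" "tcond 1 t0" and t: "0 <= t"
  shows "(norm (jv (sol t 1)))\<^sup>2 <= J2 t0 * exp (cJ * t)"
proof -
  let ?n = "real CARD('n)"
  have hp: "0 < hw TYPE('n) s 1" by (rule hw_pos[OF n2])
  have c0: "0 <= cJ" by (simp add: cJ_def)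
  have rp: "rpf (sol t k)" for t k by (rule sph_harm_rpf[OF sol_harm])
  have e1: "1 <= exp (cJ * t)" using c0 t by simp
  show ?thesis
  proof (cases "t <= t0")
    case True
    have "(norm (jv (sol t 1)))\<^sup>2 <= ?n * (wsum s \<sigma> 1 sol (Suc 0) t / (hw TYPE('n) s 1 * th \<sigma> 1 1 t))"
      by (rule sqn1_le_wsum[OF sol_good t])
    also have "... = ?n * wsum s \<sigma> 1 sol (Suc 0) t / hw TYPE('n) s 1 * (1 / th \<sigma> 1 1 t)" by simp
    also have "... <= ?n * (2 * S0 + 1) / hw TYPE('n) s 1 * (exp (2 * 1\<^sup>2 / \<sigma> * t0) * exp (- (2 * 1 * 0) * real 1))"
      using True t sg hp sol_bound_small[OF _ _ t0(2), of t "Suc 0"] t0 wsum_nonneg[OF sol_good t] S0_nonneg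
      by (intro mult_mono divide_right_mono mult_left_mono th_inverse_bound) (auto intro: less_imp_le[OF th_pos])
    also have "... <= J2 t0" unfolding J2_def using A2_nonneg[OF t0(1)] by simp
    also have "... <= J2 t0 * exp (cJ * t)" using J2_pos[OF t0(1)] e1 by simp
    finally show ?thesis .
  next
    case False
    then have tt: "t0 <= t" by simp
    define E where "E = (%K x. \<Sum>j<K. cw CARD('n) j * sqn (sol x (Suc j)))"
    obtain B where B: "B > 0" "!!x. x : {0..t} ==> R x <= B" using R_bound by blast
    obtain C where C: "C >= 0" "!!x k. x : {t0..t} ==> sqn (sol x k) <= C * exp (- 1 * real k)" using sol_decay[OF t0(1), of 1 t] by auto
    define ep where "ep = (%K. 2 * ((real K + ?n) * (B * (2 * C * exp (- 1 * real K)))))"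
    have ep0: "0 <= ep K" for K unfolding ep_def using B C by simp
    have lim: "ep \<longlonglongrightarrow> 0" unfolding ep_def by real_asymp
    have EA: "E K t0 <= A2 t0" for K
    proof -
      have "E K t0 <= (\<Sum>j<K. sqn (sol t0 (Suc j)))" unfolding E_def
        using cw_le[OF n2] sqn_nonneg[OF rp] less_imp_le[OF cw_pos[OF n2]] by (intro sum_mono) (simp add: mult_left_le_one_le)
      also have "... <= sqn (sol t0 0) + (\<Sum>j<K. sqn (sol t0 (Suc j)))" using sqn_nonneg[OF rp] by simp
      also have "... = (\<Sum>k\<le>K. sqn (sol t0 k))" by (rule sum.atMost_shift[symmetric])
      also have "... <= (\<Sum>k\<le>K. (2 * S0 + 1) * (hw TYPE('n) (- s) k * (1 / th \<sigma> 1 k t0)))"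
        using t0 by (intro sum_mono sqn_le_wsum[OF sol_good] sol_bound_small[OF _ _ t0(2)]) auto
      also have "... <= (\<Sum>k. (2 * S0 + 1) * (hw TYPE('n) (- s) k * (1 / th \<sigma> 1 k t0)))"
        using S0_nonneg by (intro sum_le_suminf summable_mult summable_A2[OF t0(1)])
          (auto intro!: divide_nonneg_nonneg mult_nonneg_nonneg less_imp_le[OF th_pos] less_imp_le[OF hw_pos[OF n2]])
      also have "... = A2 t0" unfolding A2_def by (rule suminf_mult[OF summable_A2[OF t0(1)]])
      finally show ?thesis .
    qed
    have main: "(norm (jv (sol t 1)))\<^sup>2 <= ?n * (exp (cJ * (t - t0)) * (A2 t0 + ep K * (t - t0)))" if K: "K >= 1" for K
    proof -
      have "E K t <= exp (cJ * (t - t0)) * (E K t0 + ep K * (t - t0))"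
      proof (rule exp_growth_bound[OF tt _ _ c0 ep0])
        fix x assume x: "x : {t0..t}"
        show "(E K has_real_derivative (\<Sum>j<K. cw CARD('n) j * (- 2 * (\<sigma> * lam TYPE('n) (Suc j)) * sqn (sol x (Suc j)) + 2 * ip (sol x (Suc j)) (bt (vj sol x) (sol x) (Suc j))))) (at x within {t0..t})"
          unfolding E_def by (rule DERIV_subset[OF energy_deriv[of x t]]) (use x t0 in auto)
        have "(\<Sum>j<K. cw CARD('n) j * (- 2 * (\<sigma> * lam TYPE('n) (Suc j)) * sqn (sol x (Suc j)) + 2 * ip (sol x (Suc j)) (bt (vj sol x) (sol x) (Suc j))))
          <= cJ * E K x + 2 * ((real K + ?n) * (R x * (sqn (sol x K) + sqn (sol x (Suc K)))))"
          unfolding cJ_def E_def using energy_deriv_le[of x K] x t0 K by simp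
        also have "... <= cJ * E K x + ep K" unfolding ep_def
        proof (intro add_left_mono mult_left_mono)
          have "C * exp (- 1 * real (Suc K)) <= C * exp (- 1 * real K)" using C(1) by (intro mult_left_mono) auto
          then have "sqn (sol x K) + sqn (sol x (Suc K)) <= 2 * C * exp (- 1 * real K)" using C(2)[OF x, of K] C(2)[OF x, of "Suc K"] by linarith
          then show "R x * (sqn (sol x K) + sqn (sol x (Suc K))) <= B * (2 * C * exp (- 1 * real K))"
            using B(2)[of x] x t0 B(1) sqn_nonneg[OF rp] by (intro mult_mono add_nonneg_nonneg) auto
        qed auto
        finally show "(\<Sum>j<K. cw CARD('n) j * (- 2 * (\<sigma> * lam TYPE('n) (Suc j)) * sqn (sol x (Suc j)) + 2 * ip (sol x (Suc j)) (bt (vj sol x) (sol x) (Suc j)))) <= cJ * E K x + ep K" .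
      qed
      also have "... <= exp (cJ * (t - t0)) * (A2 t0 + ep K * (t - t0))" using EA[of K] by (intro mult_left_mono add_right_mono) auto
      finally have Et: "E K t <= exp (cJ * (t - t0)) * (A2 t0 + ep K * (t - t0))" .
      have "cw CARD('n) 0 * sqn (sol t (Suc 0)) <= E K t" unfolding E_def
        using K by (intro member_le_sum) (auto intro!: mult_nonneg_nonneg less_imp_le[OF cw_pos[OF n2]] sqn_nonneg[OF rp])
      then have "sqn (sol t 1) <= exp (cJ * (t - t0)) * (A2 t0 + ep K * (t - t0))" using Et by simp
      then have "?n * sqn (sol t 1) <= ?n * (exp (cJ * (t - t0)) * (A2 t0 + ep K * (t - t0)))" by (intro mult_left_mono) auto
      then show ?thesis using norm_jv_le[OF rp, of t 1] by linarith
    qed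
    have "(%K. ?n * (exp (cJ * (t - t0)) * (A2 t0 + ep K * (t - t0)))) \<longlonglongrightarrow> ?n * (exp (cJ * (t - t0)) * (A2 t0 + 0 * (t - t0)))"
      by (intro tendsto_intros lim)
    then have "(norm (jv (sol t 1)))\<^sup>2 <= ?n * (exp (cJ * (t - t0)) * (A2 t0 + 0 * (t - t0)))"
      by (rule LIMSEQ_le_const) (use main in blast)
    also have "... = ?n * A2 t0 * exp (cJ * (t - t0))" by simp
    also have "... <= J2 t0 * exp (cJ * t)"
    proof (intro mult_mono)
      show "?n * A2 t0 <= J2 t0" unfolding J2_def using S0_nonneg hp by simp
      show "exp (cJ * (t - t0)) <= exp (cJ * t)" using c0 t0 by (simp add: mult_left_mono)
    qed (use J2_pos[OF t0(1)] in auto)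
    finally show ?thesis .
  qed
qed

end

section \<open>Removal of the cut-off\<close>

lemma doi_solution:
  fixes f0 :: "'n::finite sdist"
  assumes n2: "CARD('n) >= 2" and sg: "\<sigma> > 0" and f0: "in_Hs s f0"
  shows "\<exists>f. (\<forall>t. hseq (f t)) & (\<forall>k Q. sph_harm k Q --> continuous_on UNIV (%t. ip (f t k) Q)) & f 0 = f0
    & (\<forall>T k. solves T k (\<sigma> * lam TYPE('n) k) (%t. f t k) (%t. bt (jv (f t 1)) (f t) k))
    & (\<forall>T. \<exists>N\<ge>0. \<forall>t\<in>{0..T}. \<forall>K. (\<Sum>k\<le>K. hw TYPE('n) s k * sqn (f t k)) <= N)
    & (\<forall>t1>0. \<forall>a\<ge>0. \<forall>T. \<exists>C\<ge>0. \<forall>t\<in>{t1..T}. \<forall>k. sqn (f t k) <= C * exp (- a * real k))"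
proof -
  \<comment> \<open>The radius 1 is a placeholder: \<open>tcond\<close>, \<open>J2\<close> and
    \<open>cJ\<close> depend only on \<sigma>, s and \<open>f0\<close>. The actual radius R is the
    bound that they give, and \<open>apriori\<close> for this R shows that the cut-off acts as the
    identity.\<close>
  interpret d1: doi_cut \<sigma> s f0 "%_. 1" by unfold_locales (use n2 sg f0 in auto)
  obtain t0 where t0: "0 < t0" "d1.tcond 1 t0" using d1.tcond_exists[of 1] by auto
  define R where "R = (%t. sqrt (d1.J2 t0 * exp (d1.cJ * t)))"
  have Rp: "0 < R t" for t unfolding R_def using d1.J2_pos[OF t0(1)] by simp
  have Rc: "continuous_on UNIV R" unfolding R_def by (intro continuous_intros)
  interpret d: doi_cut \<sigma> s f0 R by unfold_locales (use n2 sg f0 Rp Rc in auto)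
  \<comment> \<open>Frozen at its initial value for negative times, which makes the coefficients
    continuous on the whole line.\<close>
  define f where "f = (%t. d.sol (max 0 t))"
  have fe: "f t = d.sol t" if "0 <= t" for t using that by (simp add: f_def)
  have vj: "d.vj d.sol t = jv (d.sol t 1)" if "0 <= t" for t
  proof -
    have "(norm (jv (d.sol t 1)))\<^sup>2 <= d1.J2 t0 * exp (d1.cJ * t)" using d.apriori[OF t0 that] .
    then have "sqrt ((norm (jv (d.sol t 1)))\<^sup>2) <= R t" unfolding R_def by (rule real_sqrt_le_mono)
    then have "norm (jv (d.sol t 1)) <= R t" by simp
    then show ?thesis unfolding d.vj_def by (intro radcut_eq Rp)
  qed
  have h: "hseq (f t)" for t unfolding f_def using d.sol_harm by blast
  have c: "continuous_on UNIV (%t. ip (f t k) Q)" if "sph_harm k Q" for k Q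
    unfolding f_def by (rule continuous_on_compose2[OF good_cont[OF d.sol_good that], of _ "%t. max 0 t"]) (auto intro!: continuous_intros)
  have sv: "solves T k (\<sigma> * lam TYPE('n) k) (%t. f t k) (%t. bt (jv (f t 1)) (f t) k)" for T k
  proof -
    have s1: "solves T k (\<sigma> * lam TYPE('n) k) (%t. f t k) (%t. bt (d.vj d.sol t) (d.sol t) k)"
      by (rule solves_cong[OF d.sol_solves]) (simp add: fe)
    have e: "bt (jv (f t 1)) (f t) k = bt (d.vj d.sol t) (d.sol t) k" if "t : {0..T}" for t using that by (simp add: fe vj)
    show ?thesis unfolding solves_def
    proof (intro conjI ballI allI impI)
      fix t assume t: "t : {0..T}"
      show "sph_harm k (f t k)" "sph_harm k (bt (jv (f t 1)) (f t) k)" using s1 t e[OF t] unfolding solves_def by auto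
    next
      fix Q :: "real^'n => real" assume Q: "sph_harm k Q"
      have "continuous_on {0..T} (%t. ip (bt (d.vj d.sol t) (d.sol t) k) Q)" using s1 Q unfolding solves_def by blast
      then show "continuous_on {0..T} (%t. ip (bt (jv (f t 1)) (f t) k) Q)" by (rule continuous_on_eq) (simp only: e)
      fix t assume t: "t : {0..T}"
      show "((%t. ip (f t k) Q) has_real_derivative - (\<sigma> * lam TYPE('n) k) * ip (f t k) Q + ip (bt (jv (f t 1)) (f t) k) Q) (at t within {0..T})"
        using s1 Q t unfolding solves_def e[OF t] by blast
    qed
  qed
  have bd: "\<exists>N\<ge>0. \<forall>t\<in>{0..T}. \<forall>K. (\<Sum>k\<le>K. hw TYPE('n) s k * sqn (f t k)) <= N" for T
  proof -
    obtain B where B: "B > 0" "!!t. t : {0..T} ==> R t <= B" using d.R_bound by blast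
    let ?N = "d.S0 * exp (d.kap 0 T * B\<^sup>2 * \<bar>T\<bar>)"
    have "(\<Sum>k\<le>K. hw TYPE('n) s k * sqn (f t k)) <= ?N" if t: "t : {0..T}" for t K
    proof -
      have "wsum s \<sigma> 0 d.sol K t <= d.S0 * exp (d.kap 0 T * B\<^sup>2 * t)" by (rule d.sol_bound[OF order_refl B(2) t])
      also have "... <= ?N" using t d.S0_nonneg d.kap_pos[of 0 T] by (intro mult_left_mono) (auto intro!: mult_left_mono)
      finally show ?thesis using t by (simp add: wsum_def fe)
    qed
    moreover have "0 <= ?N" using d.S0_nonneg by simp
    ultimately show ?thesis by blast
  qed
  have dc: "\<exists>C\<ge>0. \<forall>t\<in>{t1..T}. \<forall>k. sqn (f t k) <= C * exp (- a * real k)" if "t1 > 0" "a >= 0" for t1 a T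
    using d.sol_decay[OF that, of T] that(1) fe by auto
  show ?thesis using h c sv bd dc fe[of 0] d.sol_init by (intro exI[of _ f]) auto
qed

section \<open>Rapidly decaying families of harmonics\<close>

text \<open>Components decaying faster than every exponential in the degree, locally uniformly in \<open>t > 0\<close>.\<close>

definition dcl :: "(real => 'n::finite sdist) => bool" where
  "dcl c \<longleftrightarrow> (\<forall>t>0. hseq (c t)) & (\<forall>k Q. sph_harm k Q --> continuous_on {0<..} (%t. ip (c t k) Q)) \<and>
     (\<forall>t1>0. \<forall>T. \<forall>a\<ge>0. \<exists>C\<ge>0. \<forall>t\<in>{t1..T}. \<forall>k. sqn (c t k) <= C * exp (- a * real k))"

definition tder :: "(real => 'n::finite sdist) => (real => 'n sdist) => bool" where
  "tder c c' \<longleftrightarrow> (\<forall>t>0. \<forall>k Q. sph_harm k Q --> ((%t. ip (c t k) Q) has_real_derivative ip (c' t k) Q) (at t))"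

text \<open>Existence of m time derivatives, each of them rapidly decaying. The class is closed
  under all operations that form the right-hand side of the equation, so regularity in time can be
  bootstrapped (\<open>f_DD\<close>).\<close>

fun DD :: "nat => (real => 'n::finite sdist) => bool" where
  "DD 0 c = dcl c"
| "DD (Suc m) c = (dcl c & (\<exists>c'. tder c c' & DD m c'))"

fun SS :: "nat => (real => real) => bool" where
  "SS 0 p = continuous_on {0<..} p"
| "SS (Suc m) p = (\<exists>p'. (\<forall>t>0. (p has_real_derivative p' t) (at t)) & SS m p')"

lemma SS_cont: "SS m p ==> continuous_on {0<..} p"
  by (cases m) (auto intro!: continuous_at_imp_continuous_on dest: DERIV_isCont)

lemma SS_mono: "SS (Suc m) p ==> SS m p"
proof (induction m arbitrary: p)
  case 0 then show ?case using SS_cont[of "Suc 0" p] by simp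
next
  case (Suc m)
  then obtain p' where "\<forall>t>0. (p has_real_derivative p' t) (at t)" "SS (Suc m) p'" by auto
  then show ?case using Suc.IH by auto
qed

lemma DD_dcl: "DD m c ==> dcl c" by (cases m) auto

lemma DD_mono: "DD (Suc m) c ==> DD m c"
proof (induction m arbitrary: c)
  case (Suc m)
  then obtain c' where "dcl c" "tder c c'" "DD (Suc m) c'" by auto
  then show ?case using Suc.IH by auto
qed simp

lemma dcl_hseq: "dcl c ==> t > 0 ==> sph_harm k (c t k)"
  and dcl_cont: "dcl c ==> sph_harm k Q ==> continuous_on {0<..} (%t. ip (c t k) Q)"
  and dcl_decay: "dcl c ==> t1 > 0 ==> a >= 0 ==> \<exists>C\<ge>0. \<forall>t\<in>{t1..T}. \<forall>k. sqn (c t k) <= C * exp (- a * real k)"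
  unfolding dcl_def by blast+

lemma dcl_rpf: "dcl c ==> t > 0 ==> rpf (c t k)"
  using dcl_hseq sph_harm_rpf by blast

lemma dcl_add: "dcl c ==> dcl d ==> dcl (%t k x. c t k x + d t k x)"
proof -
  assume c: "dcl c" and d: "dcl d"
  show ?thesis unfolding dcl_def
  proof (intro conjI allI impI)
    fix k and Q :: "real^'a => real" assume Q: "sph_harm k Q"
    have "continuous_on {0<..} (%t. ip (c t k) Q + ip (d t k) Q)" by (intro continuous_intros dcl_cont c d Q)
    then show "continuous_on {0<..} (%t. ip (%x. c t k x + d t k x) Q)"
      by (rule continuous_on_eq) (simp add: ip_add_left dcl_rpf c d sph_harm_rpf[OF Q])
  next
    fix t1 T a :: real assume p: "t1 > 0" "a >= 0"
    obtain C1 where C1: "C1 >= 0" "!!t k. t : {t1..T} ==> sqn (c t k) <= C1 * exp (- a * real k)" using dcl_decay[OF c p, of T] by auto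
    obtain C2 where C2: "C2 >= 0" "!!t k. t : {t1..T} ==> sqn (d t k) <= C2 * exp (- a * real k)" using dcl_decay[OF d p, of T] by auto
    have "sqn (%x. c t k x + d t k x) <= (2 * C1 + 2 * C2) * exp (- a * real k)" if t: "t : {t1..T}" for t k
      using sqn_add_le[of "c t k" "d t k"] dcl_rpf[OF c, of t] dcl_rpf[OF d, of t] C1(2)[OF t, of k] C2(2)[OF t, of k] t p
      by (auto simp: algebra_simps)
    then show "\<exists>C\<ge>0. \<forall>t\<in>{t1..T}. \<forall>k. sqn (%x. c t k x + d t k x) <= C * exp (- a * real k)"
      using C1(1) C2(1) by (intro exI[of _ "2 * C1 + 2 * C2"]) auto
  qed (rule sph_harm_add[OF dcl_hseq[OF c] dcl_hseq[OF d]])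
qed

lemma dcl_scal: "dcl c ==> continuous_on {0<..} p ==> dcl (%t k x. p t * c t k x)"
proof -
  assume c: "dcl c" and pc: "continuous_on {0<..} p"
  show ?thesis unfolding dcl_def ip_cmult_left sqn_cmult
  proof (intro conjI allI impI)
    fix t1 T a :: real assume p: "t1 > 0" "a >= 0"
    obtain C1 where C1: "C1 >= 0" "!!t k. t : {t1..T} ==> sqn (c t k) <= C1 * exp (- a * real k)" using dcl_decay[OF c p, of T] by auto
    have "compact (p ` {t1..T})" using p by (intro compact_continuous_image continuous_on_subset[OF pc]) auto
    then obtain B where B: "\<forall>y\<in>p ` {t1..T}. norm y <= B" using compact_imp_bounded bounded_iff by metis
    have "(p t)\<^sup>2 * sqn (c t k) <= (B\<^sup>2 * C1) * exp (- a * real k)" if t: "t : {t1..T}" for t k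
    proof -
      have "\<bar>p t\<bar> <= B" using B t by auto
      then have "(p t)\<^sup>2 <= B\<^sup>2" using abs_le_square_iff[of "p t" B] by linarith
      then have "(p t)\<^sup>2 * sqn (c t k) <= B\<^sup>2 * (C1 * exp (- a * real k))"
        using C1(2)[OF t, of k] sqn_nonneg[OF dcl_rpf[OF c]] t p by (intro mult_mono) auto
      then show ?thesis by simp
    qed
    then show "\<exists>C\<ge>0. \<forall>t\<in>{t1..T}. \<forall>k. (p t)\<^sup>2 * sqn (c t k) <= C * exp (- a * real k)"
      using C1(1) by (intro exI[of _ "B\<^sup>2 * C1"]) auto
  qed (auto intro!: sph_harm_cmult dcl_hseq c continuous_intros pc dcl_cont)
qed

text \<open>Multipliers in the degree of at most exponential growth. Rate 1 is enough for
  polynomials in k and is absorbed by the decay in \<open>dcl\<close>, which has every rate.\<close>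

definition ebd :: "(nat => real) => bool" where "ebd m \<longleftrightarrow> (\<exists>C\<ge>0. \<forall>k. \<bar>m k\<bar> <= C * exp (real k))"

lemma ebd_linear: "ebd (%k. p * real k + q)"
proof -
  have "\<bar>p * real k + q\<bar> <= (\<bar>p\<bar> + \<bar>q\<bar>) * exp (real k)" for k
  proof -
    have e: "1 + real k <= exp (real k)" by (rule exp_ge_add_one_self)
    have "\<bar>p * real k + q\<bar> <= \<bar>p\<bar> * real k + \<bar>q\<bar>" using abs_triangle_ineq[of "p * real k" q] by (simp add: abs_mult)
    also have "... <= \<bar>p\<bar> * exp (real k) + \<bar>q\<bar> * exp (real k)"
    proof (rule add_mono)
      have "real k <= exp (real k)" using e by linarith
      then show "\<bar>p\<bar> * real k <= \<bar>p\<bar> * exp (real k)" by (rule mult_left_mono) simp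
      show "\<bar>q\<bar> <= \<bar>q\<bar> * exp (real k)" by (simp add: mult_le_cancel_left1)
    qed
    finally show ?thesis by (simp add: distrib_right)
  qed
  then show ?thesis unfolding ebd_def by (intro exI[of _ "\<bar>p\<bar> + \<bar>q\<bar>"]) auto
qed

lemma ebd_lam: "CARD('n::finite) >= 2 ==> ebd (lam TYPE('n))"
proof -
  assume n: "CARD('n) >= 2"
  obtain C where C: "C > 0" "!!k. hw TYPE('n) 1 k <= C * exp (1 * real k)" using hw_exp_bound[OF n, of 1 1] by auto
  have "\<bar>lam TYPE('n) k\<bar> <= C * exp (real k)" for k
    using C(1) C(2)[of k] lam_nonneg[OF n, of k] by (cases "k = 0") (auto simp: hw_def)
  then show ?thesis unfolding ebd_def using C(1) by (intro exI[of _ C]) auto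
qed

lemma dcl_diag: "dcl c ==> ebd m ==> dcl (%t k x. m k * c t k x)"
proof -
  assume c: "dcl c" and m: "ebd m"
  obtain C0 where C0: "C0 >= 0" "!!k. \<bar>m k\<bar> <= C0 * exp (real k)" using m unfolding ebd_def by auto
  show ?thesis unfolding dcl_def ip_cmult_left sqn_cmult
  proof (intro conjI allI impI)
    fix t1 T a :: real assume p: "t1 > 0" "a >= 0"
    have a2: "0 <= a + 2" using p by simp
    obtain C1 where C1: "C1 >= 0" "!!t k. t : {t1..T} ==> sqn (c t k) <= C1 * exp (- (a + 2) * real k)" using dcl_decay[OF c p(1) a2, of T] by auto
    have "(m k)\<^sup>2 * sqn (c t k) <= (C0\<^sup>2 * C1) * exp (- a * real k)" if t: "t : {t1..T}" for t k
    proof -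
      have "(m k)\<^sup>2 <= (C0 * exp (real k))\<^sup>2" using C0(2)[of k] abs_le_square_iff[of "m k" "C0 * exp (real k)"] C0(1) by simp
      then have "(m k)\<^sup>2 * sqn (c t k) <= (C0 * exp (real k))\<^sup>2 * (C1 * exp (- (a + 2) * real k))"
        using C1(2)[OF t, of k] sqn_nonneg[OF dcl_rpf[OF c]] t p by (intro mult_mono) auto
      also have "... = (C0\<^sup>2 * C1) * (exp (2 * real k) * exp (- (a + 2) * real k))" by (simp add: power_mult_distrib exp_double[symmetric])
      also have "exp (2 * real k) * exp (- (a + 2) * real k) = exp (- a * real k)" unfolding exp_add[symmetric] by (simp add: algebra_simps)
      finally show ?thesis .
    qed
    then show "\<exists>C\<ge>0. \<forall>t\<in>{t1..T}. \<forall>k. (m k)\<^sup>2 * sqn (c t k) <= C * exp (- a * real k)"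
      using C1(1) C0(1) by (intro exI[of _ "C0\<^sup>2 * C1"]) auto
  qed (auto intro!: sph_harm_cmult dcl_hseq c continuous_intros dcl_cont)
qed

text \<open>\<open>Up\<close> on a whole sequence, indexed by the degree of the result;
  \<open>DnS\<close> likewise. Degree 0 receives nothing from below.\<close>

definition UpS :: "real^'n => 'n::finite sdist => 'n sdist" where
  "UpS v c k = (case k of 0 => (%x. 0) | Suc j => Up v j (c j))"

definition DnS :: "real^'n => 'n::finite sdist => 'n sdist" where
  "DnS v c k = Dn v (Suc k) (c (Suc k))"

lemma UpS_simps [simp]: "UpS v c 0 = (%x. 0)" "UpS v c (Suc j) = Up v j (c j)" by (simp_all add: UpS_def)

lemma ip_UpS_DnS:
  fixes c :: "'n::finite sdist"
  assumes n: "CARD('n) >= 2" and c: "!!k. sph_harm k (c k)" and Q: "sph_harm k Q"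
  shows "ip (UpS v c k) Q = (case k of 0 => 0 | Suc j => ip (c j) (Dn v k Q))"
    "ip (DnS v c k) Q = ip (c (Suc k)) (Up v k Q)"
proof -
  show "ip (UpS v c k) Q = (case k of 0 => 0 | Suc j => ip (c j) (Dn v k Q))"
    using ip_Up_Dn[OF n c] Q by (cases k) auto
  show "ip (DnS v c k) Q = ip (c (Suc k)) (Up v k Q)"
    using ip_Up_Dn[OF n Q c] by (simp add: DnS_def ip_commute)
qed

lemma dcl_UpS_DnS:
  fixes c :: "real => 'n::finite sdist"
  assumes n: "CARD('n) >= 2" and c: "dcl c"
  shows "dcl (%t. UpS v (c t))" "dcl (%t. DnS v (c t))"
proof -
  have hU: "sph_harm k (UpS v (c t) k)" if "t > 0" for t k
    using sph_harm_Up[OF dcl_hseq[OF c that] n, where v=v] by (cases k) (auto simp: sph_harm_zero)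
  have hD: "sph_harm k (DnS v (c t) k)" if "t > 0" for t k
    unfolding DnS_def by (rule sph_harm_Dn[OF dcl_hseq[OF c that]])
  have dec: "\<exists>C\<ge>0. \<forall>t\<in>{t1..T}. \<forall>k. sqn (UpS v (c t) k) <= C * exp (- a * real k) & sqn (DnS v (c t) k) <= C * exp (- a * real k)" if p: "t1 > 0" "a >= 0" for t1 a T
  proof -
    obtain C1 where C1: "C1 >= 0" "!!t k. t : {t1..T} ==> sqn (c t k) <= C1 * exp (- a * real k)" using dcl_decay[OF c p, of T] by auto
    let ?C = "(norm v)\<^sup>2 * C1 * exp a"
    have "sqn (UpS v (c t) k) <= ?C * exp (- a * real k) & sqn (DnS v (c t) k) <= ?C * exp (- a * real k)" if t: "t : {t1..T}" for t k
    proof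
      have t0: "t > 0" using t p by auto
      show "sqn (UpS v (c t) k) <= ?C * exp (- a * real k)"
      proof (cases k)
        case 0 then show ?thesis using C1(1) by simp
      next
        case (Suc j)
        have "sqn (Up v j (c t j)) <= (norm v)\<^sup>2 * sqn (c t j)" by (rule sqn_Up_Dn(1)[OF n dcl_hseq[OF c t0]])
        also have "... <= (norm v)\<^sup>2 * (C1 * exp (- a * real j))" by (intro mult_left_mono C1(2)[OF t]) auto
        also have "... = (norm v)\<^sup>2 * C1 * exp a * exp (- a * real k)" using Suc by (simp add: exp_add[symmetric] algebra_simps flip: exp_minus)
        finally show ?thesis using Suc by simp
      qed
      have "sqn (DnS v (c t) k) <= (norm v)\<^sup>2 * sqn (c t (Suc k))" unfolding DnS_def by (rule sqn_Up_Dn(2)[OF n dcl_hseq[OF c t0]])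
      also have "... <= (norm v)\<^sup>2 * (C1 * exp (- a * real (Suc k)))" by (intro mult_left_mono C1(2)[OF t]) auto
      also have "... <= (norm v)\<^sup>2 * (C1 * (exp a * exp (- a * real k)))"
        using p C1(1) by (intro mult_left_mono) (auto simp flip: exp_add simp: algebra_simps)
      finally show "sqn (DnS v (c t) k) <= ?C * exp (- a * real k)" by (simp add: mult.assoc)
    qed
    moreover have "0 <= ?C" using C1(1) by simp
    ultimately show ?thesis by blast
  qed
  show "dcl (%t. UpS v (c t))" unfolding dcl_def
  proof (intro conjI allI impI hU)
    fix k and Q :: "real^'n => real" assume Q: "sph_harm k Q"
    have "continuous_on {0<..} (%t. case k of 0 => 0 | Suc j => ip (c t j) (Dn v k Q))"
      using Q by (cases k) (auto intro!: dcl_cont[OF c] sph_harm_Dn)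
    then show "continuous_on {0<..} (%t. ip (UpS v (c t) k) Q)"
      by (rule continuous_on_eq) (use ip_UpS_DnS(1)[OF n dcl_hseq[OF c] Q] in auto)
  next
    fix t1 T a :: real assume "t1 > 0" "a >= 0"
    from dec[OF this, of T] show "\<exists>C\<ge>0. \<forall>t\<in>{t1..T}. \<forall>k. sqn (UpS v (c t) k) <= C * exp (- a * real k)" by fast
  qed
  show "dcl (%t. DnS v (c t))" unfolding dcl_def
  proof (intro conjI allI impI hD)
    fix k and Q :: "real^'n => real" assume Q: "sph_harm k Q"
    have "continuous_on {0<..} (%t. ip (c t (Suc k)) (Up v k Q))" by (intro dcl_cont[OF c] sph_harm_Up Q n)
    then show "continuous_on {0<..} (%t. ip (DnS v (c t) k) Q)"
      by (rule continuous_on_eq) (use ip_UpS_DnS(2)[OF n dcl_hseq[OF c] Q] in auto)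
  next
    fix t1 T a :: real assume "t1 > 0" "a >= 0"
    from dec[OF this, of T] show "\<exists>C\<ge>0. \<forall>t\<in>{t1..T}. \<forall>k. sqn (DnS v (c t) k) <= C * exp (- a * real k)" by fast
  qed
qed

lemma deriv_pos_transform:
  assumes "(f has_real_derivative D) (at t)" "t > 0" "!!x. x > 0 ==> f x = g x" shows "(g has_real_derivative D) (at t)"
  using has_field_derivative_transform_within_open[of f D t "{0<..}" g] assms by auto

lemma DD_add: "DD m c ==> DD m d ==> DD m (%t k x. c t k x + d t k x)"
proof (induction m arbitrary: c d)
  case (Suc m)
  obtain c' d' where cd: "tder c c'" "DD m c'" "tder d d'" "DD m d'" "dcl c" "dcl d" using Suc.prems by auto
  have "tder (%t k x. c t k x + d t k x) (%t k x. c' t k x + d' t k x)" unfolding tder_def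
  proof (intro allI impI)
    fix t k and Q :: "real^'a => real" assume t: "(0::real) < t" and Q: "sph_harm k Q"
    have "((%t. ip (c t k) Q + ip (d t k) Q) has_real_derivative ip (c' t k) Q + ip (d' t k) Q) (at t)"
      using cd t Q unfolding tder_def by (intro DERIV_add) auto
    then have "((%t. ip (%x. c t k x + d t k x) Q) has_real_derivative ip (c' t k) Q + ip (d' t k) Q) (at t)"
      by (rule deriv_pos_transform[OF _ t]) (simp add: ip_add_left dcl_rpf cd sph_harm_rpf[OF Q])
    then show "((%t. ip (%x. c t k x + d t k x) Q) has_real_derivative ip (%x. c' t k x + d' t k x) Q) (at t)"
      using DD_dcl[OF cd(2)] DD_dcl[OF cd(4)] by (simp add: ip_add_left dcl_rpf t sph_harm_rpf[OF Q])
  qed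
  then show ?case using Suc.IH[OF cd(2,4)] dcl_add[OF cd(5,6)] by auto
qed (simp add: dcl_add)

lemma DD_scal: "DD m c ==> SS m p ==> DD m (%t k x. p t * c t k x)"
proof (induction m arbitrary: c p)
  case (Suc m)
  obtain c' where c: "tder c c'" "DD m c'" "dcl c" using Suc.prems by auto
  obtain p' where p: "!!t. t > 0 ==> (p has_real_derivative p' t) (at t)" "SS m p'" using Suc.prems by auto
  have "tder (%t k x. p t * c t k x) (%t k x. p' t * c t k x + p t * c' t k x)" unfolding tder_def
  proof (intro allI impI)
    fix t k and Q :: "real^'a => real" assume t: "(0::real) < t" and Q: "sph_harm k Q"
    have "((%t. p t * ip (c t k) Q) has_real_derivative p' t * ip (c t k) Q + ip (c' t k) Q * p t) (at t)"
      using c p t Q unfolding tder_def by (intro DERIV_mult) auto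
    moreover have "ip (%x. p' t * c t k x + p t * c' t k x) Q = p' t * ip (c t k) Q + ip (c' t k) Q * p t"
      using dcl_rpf[OF c(3) t, of k] dcl_rpf[OF DD_dcl[OF c(2)] t, of k]
      by (simp add: ip_add_left ip_cmult_left rpf_cmult sph_harm_rpf[OF Q])
    ultimately show "((%t. ip (%x. p t * c t k x) Q) has_real_derivative ip (%x. p' t * c t k x + p t * c' t k x) Q) (at t)"
      by (simp add: ip_cmult_left)
  qed
  moreover have "DD m (%t k x. p' t * c t k x + p t * c' t k x)"
    by (intro DD_add Suc.IH DD_mono[OF Suc.prems(1)] p c SS_mono[OF Suc.prems(2)])
  moreover have "dcl (%t k x. p t * c t k x)" by (rule dcl_scal[OF c(3) SS_cont[OF Suc.prems(2)]])
  ultimately show ?case by auto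
qed (simp add: dcl_scal)

lemma DD_diag: "DD m c ==> ebd q ==> DD m (%t k x. q k * c t k x)"
proof (induction m arbitrary: c)
  case (Suc m)
  obtain c' where c: "tder c c'" "DD m c'" "dcl c" using Suc.prems by auto
  have "tder (%t k x. q k * c t k x) (%t k x. q k * c' t k x)" using c(1) unfolding tder_def ip_cmult_left
    by (auto intro!: DERIV_cmult)
  then show ?case using Suc.IH[OF c(2) Suc.prems(2)] dcl_diag[OF c(3) Suc.prems(2)] by auto
qed (simp add: dcl_diag)

lemma DD_UpS_DnS:
  fixes c :: "real => 'n::finite sdist"
  assumes n: "CARD('n) >= 2"
  shows "DD m c ==> DD m (%t. UpS v (c t)) & DD m (%t. DnS v (c t))"
proof (induction m arbitrary: c)
  case (Suc m)
  obtain c' where c: "tder c c'" "DD m c'" "dcl c" using Suc.prems by auto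
  note c'd = DD_dcl[OF c(2)]
  have 1: "tder (%t. UpS v (c t)) (%t. UpS v (c' t))" unfolding tder_def
  proof (intro allI impI)
    fix t k and Q :: "real^'n => real" assume t: "(0::real) < t" and Q: "sph_harm k Q"
    have "((%t. case k of 0 => 0 | Suc j => ip (c t j) (Dn v k Q)) has_real_derivative (case k of 0 => 0 | Suc j => ip (c' t j) (Dn v k Q))) (at t)"
      using c(1) t Q unfolding tder_def by (cases k) (auto intro!: sph_harm_Dn)
    then have "((%t. ip (UpS v (c t) k) Q) has_real_derivative (case k of 0 => 0 | Suc j => ip (c' t j) (Dn v k Q))) (at t)"
      by (rule deriv_pos_transform[OF _ t]) (use ip_UpS_DnS(1)[OF n dcl_hseq[OF c(3)] Q] in auto)
    then show "((%t. ip (UpS v (c t) k) Q) has_real_derivative ip (UpS v (c' t) k) Q) (at t)"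
      using ip_UpS_DnS(1)[OF n dcl_hseq[OF c'd t] Q] by simp
  qed
  have 2: "tder (%t. DnS v (c t)) (%t. DnS v (c' t))" unfolding tder_def
  proof (intro allI impI)
    fix t k and Q :: "real^'n => real" assume t: "(0::real) < t" and Q: "sph_harm k Q"
    have "((%t. ip (c t (Suc k)) (Up v k Q)) has_real_derivative ip (c' t (Suc k)) (Up v k Q)) (at t)"
      using c(1) t sph_harm_Up[OF Q n, of v] unfolding tder_def by blast
    then have "((%t. ip (DnS v (c t) k) Q) has_real_derivative ip (c' t (Suc k)) (Up v k Q)) (at t)"
      by (rule deriv_pos_transform[OF _ t]) (use ip_UpS_DnS(2)[OF n dcl_hseq[OF c(3)] Q] in auto)
    then show "((%t. ip (DnS v (c t) k) Q) has_real_derivative ip (DnS v (c' t) k) Q) (at t)"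
      using ip_UpS_DnS(2)[OF n dcl_hseq[OF c'd t] Q] by simp
  qed
  show ?case using 1 2 Suc.IH[OF c(2)] dcl_UpS_DnS[OF n c(3)] by auto
qed (simp add: dcl_UpS_DnS[OF n])

section \<open>Termwise differentiation on the punctured space\<close>

text \<open>The summable majorant b makes the tails of the differentiated series small uniformly on
  S and linearly in h, as termwise differentiation requires.\<close>

lemma has_derivative_suminf:
  fixes f :: "nat => 'a::real_normed_vector => real"
  assumes S: "open S" "convex S" "x : S"
    and d: "!!k y. y : S ==> (f k has_derivative f' k y) (at y)"
    and b: "!!k y h. y : S ==> \<bar>f' k y h\<bar> <= b k * norm h" and sb: "summable b"
    and sf: "!!y. y : S ==> summable (%k. f k y)"
  shows "((%y. \<Sum>k. f k y) has_derivative (%h. \<Sum>k. f' k x h)) (at x)"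
proof -
  have sm: "summable (%k. f' k y h)" if "y : S" for y h
    by (rule summable_comparison_test'[OF summable_mult2[OF sb, of "norm h"], of 0]) (use b[OF that] in auto)
  have "\<exists>g. \<forall>y\<in>S. (%n. f n y) sums g y & (g has_derivative (%h. \<Sum>k. f' k y h)) (at y within S)"
  proof (rule has_derivative_series[OF S(2) _ _ S(3)])
    show "(f k has_derivative f' k y) (at y within S)" if "y : S" for k y using d[OF that] by (rule has_derivative_at_withinI)
    show "(%n. f n x) sums (\<Sum>n. f n x)" using sf[OF S(3)] by (rule summable_sums)
    fix e :: real assume e: "0 < e"
    show "\<forall>\<^sub>F n in sequentially. \<forall>y\<in>S. \<forall>h. norm ((\<Sum>i<n. f' i y h) - (\<Sum>k. f' k y h)) <= e * norm h"
    proof -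
      have "(%n. \<Sum>i. b (i + n)) \<longlonglongrightarrow> 0" by (rule suminf_exist_split2[OF sb])
      then have "\<forall>\<^sub>F n in sequentially. (\<Sum>i. b (i + n)) < e" using e by (rule order_tendstoD)
      then show ?thesis
      proof eventually_elim
        case (elim n)
        show ?case
        proof (intro ballI allI)
          fix y h assume y: "y : S"
          have s1: "summable (%i. f' (i + n) y h)" by (rule summable_ignore_initial_segment[OF sm[OF y]])
          have s2: "summable (%i. b (i + n) * norm h)" by (intro summable_mult2 summable_ignore_initial_segment sb)
          have "norm ((\<Sum>i<n. f' i y h) - (\<Sum>k. f' k y h)) = \<bar>\<Sum>i. f' (i + n) y h\<bar>"
            using suminf_minus_initial_segment[OF sm[OF y], of n h] by simp
          also have "... <= (\<Sum>i. b (i + n) * norm h)"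
            using norm_suminf_le[OF _ s2, of "%i. f' (i + n) y h"] b[OF y] by simp
          also have "... = (\<Sum>i. b (i + n)) * norm h" by (rule suminf_mult2[symmetric]) (rule summable_ignore_initial_segment[OF sb])
          also have "... <= e * norm h" using elim by (intro mult_right_mono) auto
          finally show "norm ((\<Sum>i<n. f' i y h) - (\<Sum>k. f' k y h)) <= e * norm h" .
        qed
      qed
    qed
  qed
  then obtain g where g: "!!y. y : S ==> (%n. f n y) sums g y" "!!y. y : S ==> (g has_derivative (%h. \<Sum>k. f' k y h)) (at y within S)" by blast
  have "(g has_derivative (%h. \<Sum>k. f' k x h)) (at x)" using g(2)[OF S(3)] by (simp only: at_within_open[OF S(3,1)])
  then show ?thesis by (rule has_derivative_transform_within_open[OF _ S(1,3)]) (rule sums_unique[OF g(1)])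
qed

text \<open>The function on the punctured space, constant along rays, whose components on the sphere
  are the u k.\<close>

definition ZZ :: "'n::finite sdist => real^'n => real" where
  "ZZ u x = (\<Sum>k. zext (u k) x)"

lemma exp_decay_summable: "summable (%k. C * exp (- real k))"
proof -
  have "(%k. C * exp (- real k)) = (%k. C * exp (-1) ^ k)" by (simp flip: exp_of_nat_mult)
  then show ?thesis by (simp add: summable_mult summable_geometric)
qed

lemma dcl_root_bound:
  fixes c :: "real => 'n::finite sdist"
  assumes c: "dcl c" and t1: "t1 > 0" and b: "b >= 0"
  shows "\<exists>C\<ge>0. \<forall>t\<in>{t1..T}. \<forall>k. (real CARD('n))^(2*k) * sqrt (sqn (c t k)) <= C * exp (- b * real k)"
proof -
  let ?n = "real CARD('n)"
  have n1: "?n >= 1" by simp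
  \<comment> \<open>The term 2 ln n compensates n^(2k), and the factor 2 the square root.\<close>
  define a where "a = 2 * (b + 2 * ln ?n)"
  have a0: "a >= 0" unfolding a_def using b n1 by simp
  obtain C where C: "C >= 0" "!!t k. t : {t1..T} ==> sqn (c t k) <= C * exp (- a * real k)" using dcl_decay[OF c t1 a0, of T] by auto
  have "?n^(2*k) * sqrt (sqn (c t k)) <= sqrt C * exp (- b * real k)" if t: "t : {t1..T}" for t k
  proof -
    have "sqrt (sqn (c t k)) <= sqrt (C * exp (- a * real k))" by (rule real_sqrt_le_mono[OF C(2)[OF t]])
    also have "... = sqrt C * exp (- a * real k / 2)"
    proof -
      have "exp (- a * real k) = (exp (- a * real k / 2))\<^sup>2" by (simp add: exp_double[symmetric])
      then show ?thesis by (simp add: real_sqrt_mult)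
    qed
    finally have "?n^(2*k) * sqrt (sqn (c t k)) <= ?n^(2*k) * (sqrt C * exp (- a * real k / 2))" by (intro mult_left_mono) auto
    also have "?n^(2*k) * (sqrt C * exp (- a * real k / 2)) = sqrt C * exp (- b * real k)"
    proof -
      have "?n^(2*k) = exp (real (2 * k) * ln ?n)" using n1 by (simp add: exp_of_nat_mult del: of_nat_mult)
      moreover have "real (2 * k) * ln ?n + - a * real k / 2 = - b * real k" unfolding a_def by (simp add: field_simps)
      then have "exp (real (2 * k) * ln ?n) * exp (- a * real k / 2) = exp (- b * real k)" unfolding exp_add[symmetric] by (rule arg_cong)
      ultimately show ?thesis by (metis mult.left_commute)
    qed
    finally show ?thesis .
  qed
  then show ?thesis using C(1) by (intro exI[of _ "sqrt C"]) auto
qed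

lemma dcl_sup:
  fixes c :: "real => 'n::finite sdist"
  assumes n: "CARD('n) >= 2" and c: "dcl c" and t1: "t1 > 0" and b: "b >= 0"
  shows "\<exists>C\<ge>0. \<forall>t\<in>{t1..T}. \<forall>k x. norm x = 1 --> \<bar>c t k x\<bar> <= C * exp (- b * real k)"
proof -
  obtain C where C: "C >= 0" "!!t k. t : {t1..T} ==> (real CARD('n))^(2*k) * sqrt (sqn (c t k)) <= C * exp (- b * real k)"
    using dcl_root_bound[OF c t1 b, of T] by auto
  have "\<bar>c t k x\<bar> <= C * exp (- b * real k)" if "t : {t1..T}" "norm x = 1" for t k x
    using harm_sup_bound[OF n dcl_hseq[OF c], of t k x] that C(2)[OF that(1), of k] t1 by simp
  then show ?thesis using C(1) by blast
qed

lemma dcl_summable: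
  fixes c :: "real => 'n::finite sdist"
  assumes n: "CARD('n) >= 2" and c: "dcl c" and t: "t > 0" and x: "norm x = 1"
  shows "summable (%k. c t k x)"
proof -
  obtain C where C: "!!t' k y. t' : {t..t} ==> norm y = 1 ==> \<bar>c t' k y\<bar> <= C * exp (- 1 * real k)"
    using dcl_sup[OF n c t, of 1 t] by auto
  show ?thesis by (rule summable_comparison_test'[OF exp_decay_summable[of C], of 0]) (use C[of t x] x in auto)
qed

text \<open>A term of degree k yields parts of degree k - 1 and k + 1. Rearranging by the degree of
  the result keeps the sum a series of harmonics, one in each degree; the lowest terms
  vanish.\<close>

lemma shift_series:
  fixes c :: "real => 'n::finite sdist"
  assumes n: "CARD('n) >= 2" and c: "dcl c" and t: "t > 0" and x: "norm x = 1"
    and a: "ebd (%k. al (Suc k))" and b: "ebd \<beta>"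
  shows "summable (%k. al k * Dn v k (c t k) x + \<beta> (Suc k) * Up v k (c t k) x)"
    "(\<Sum>k. al k * Dn v k (c t k) x + \<beta> (Suc k) * Up v k (c t k) x) = (\<Sum>k. al (Suc k) * DnS v (c t) k x + \<beta> k * UpS v (c t) k x)"
proof -
  let ?D = "%k. al k * Dn v k (c t k) x" let ?U = "%k. \<beta> k * UpS v (c t) k x"
  have "summable (%k. al (Suc k) * DnS v (c t) k x)"
    by (rule dcl_summable[OF n dcl_diag[OF dcl_UpS_DnS(2)[OF n c] a] t x])
  then have sD': "summable (%k. ?D (Suc k))" by (simp add: DnS_def)
  then have sD: "summable ?D" using summable_Suc_iff[of ?D] by blast
  have sU: "summable ?U" by (rule dcl_summable[OF n dcl_diag[OF dcl_UpS_DnS(1)[OF n c] b] t x])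
  then have sU': "summable (%k. ?U (Suc k))" using summable_Suc_iff[of ?U] by blast
  show "summable (%k. al k * Dn v k (c t k) x + \<beta> (Suc k) * Up v k (c t k) x)"
    using summable_add[OF sD sU'] by simp
  have "(\<Sum>k. al k * Dn v k (c t k) x + \<beta> (Suc k) * Up v k (c t k) x) = (\<Sum>k. ?D k) + (\<Sum>k. ?U (Suc k))"
    using suminf_add[OF sD sU'] by simp
  also have "(\<Sum>k. ?D k) = (\<Sum>k. ?D (Suc k))"
    using suminf_split_head[OF sD] Dn_0[OF dcl_hseq[OF c t]] by simp
  also have "(\<Sum>k. ?U (Suc k)) = (\<Sum>k. ?U k)" using suminf_split_head[OF sU] by simp
  also have "(\<Sum>k. ?D (Suc k)) + (\<Sum>k. ?U k) = (\<Sum>k. al (Suc k) * DnS v (c t) k x + \<beta> k * UpS v (c t) k x)"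
    using suminf_add[OF sD' sU] by (simp add: DnS_def)
  finally show "(\<Sum>k. al k * Dn v k (c t k) x + \<beta> (Suc k) * Up v k (c t k) x) = (\<Sum>k. al (Suc k) * DnS v (c t) k x + \<beta> k * UpS v (c t) k x)" .
qed

text \<open>The derivative of the 0-homogeneous extension of \<open>P\<close> in direction \<open>v\<close>, at a point of the sphere.\<close>

definition TT :: "real^'n => nat => (real^'n => real) => real^'n => real" where
  "TT v k P x = dd v P x - real k * ((v \<bullet> x) * P x)"

lemma TT_Up_Dn:
  fixes P :: "real^'n => real"
  assumes n: "CARD('n) >= 2" and P: "sph_harm k P" and x: "norm x = 1"
  shows "TT v k P x = (real k + real CARD('n) - 2) * Dn v k P x - real k * Up v k P x"
  unfolding TT_def dd_Dn[OF n P] Up_plus_Dn[OF x, of v P k] by (simp add: algebra_simps)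

lemma TT_bound:
  fixes P :: "real^'n => real"
  assumes n: "CARD('n) >= 2" and P: "sph_harm k P" and x: "norm x = 1"
  shows "\<bar>TT v k P x\<bar> <= (2 * real k + real CARD('n)) * (real CARD('n))\<^sup>2 * ((real CARD('n))^(2*k) * sqrt (sqn P)) * norm v"
proof -
  let ?n = "real CARD('n)"
  let ?B = "?n\<^sup>2 * (?n^(2*k) * (norm v * sqrt (sqn P)))"
  have sq: "0 <= sqn P" by (rule sqn_nonneg[OF sph_harm_rpf[OF P]])
  have nv: "sqrt (sqn (Up v k P)) <= norm v * sqrt (sqn P)" "sqrt (sqn (Dn v k P)) <= norm v * sqrt (sqn P)"
    using sqn_Up_Dn[OF n P, of v, THEN real_sqrt_le_mono] by (simp_all add: real_sqrt_mult)
  have "\<bar>Up v k P x\<bar> <= ?n^(2*Suc k) * sqrt (sqn (Up v k P))" using harm_sup_bound[OF n sph_harm_Up[OF P n], of v x] x by simp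
  also have "... <= ?n^(2*Suc k) * (norm v * sqrt (sqn P))" by (intro mult_left_mono nv) auto
  finally have U: "\<bar>Up v k P x\<bar> <= ?B" by (simp add: power2_eq_square mult.assoc)
  have D: "\<bar>Dn v k P x\<bar> <= ?B"
  proof (cases k)
    case 0 then show ?thesis using Dn_0[of P] P sq by simp
  next
    case (Suc j)
    have "\<bar>Dn v k P x\<bar> <= ?n^(2*j) * sqrt (sqn (Dn v k P))" using harm_sup_bound[OF n sph_harm_Dn, of j P v x] P x Suc by simp
    also have "... <= ?n^(2*j) * (norm v * sqrt (sqn P))" by (intro mult_left_mono nv) auto
    also have "... <= (?n\<^sup>2 * ?n^(2*k)) * (norm v * sqrt (sqn P))"
    proof (rule mult_right_mono)
      have "?n^(2*j) <= ?n^(2 + 2*k)" using n Suc by (intro power_increasing) auto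
      then show "?n^(2*j) <= ?n\<^sup>2 * ?n^(2*k)" by (simp only: power_add)
    qed (use sq in simp)
    finally show ?thesis by (simp add: mult.assoc)
  qed
  have "\<bar>TT v k P x\<bar> <= (real k + ?n - 2) * \<bar>Dn v k P x\<bar> + real k * \<bar>Up v k P x\<bar>"
    unfolding TT_Up_Dn[OF n P x]
    using abs_triangle_ineq4[of "(real k + ?n - 2) * Dn v k P x" "real k * Up v k P x"] n by (simp add: abs_mult)
  also have "... <= (real k + ?n) * ?B + real k * ?B"
    using U D n sq by (intro add_mono mult_mono) auto
  finally show ?thesis by (simp add: algebra_simps)
qed

lemma dcl_TT_bound:
  fixes c :: "real => 'n::finite sdist"
  assumes n: "CARD('n) >= 2" and c: "dcl c" and t1: "t1 > 0"
  shows "\<exists>C\<ge>0. \<forall>t\<in>{t1..T}. \<forall>k v x. norm x = 1 --> \<bar>TT v k (c t k) x\<bar> <= C * exp (- real k) * norm v"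
proof -
  let ?n = "real CARD('n)"
  obtain C where C: "C >= 0" "!!t k. t : {t1..T} ==> ?n^(2*k) * sqrt (sqn (c t k)) <= C * exp (- 2 * real k)"
    using dcl_root_bound[OF c t1, of 2 T] by auto
  let ?C = "(2 + ?n) * ?n\<^sup>2 * C"
  have "\<bar>TT v k (c t k) x\<bar> <= ?C * exp (- real k) * norm v" if t: "t : {t1..T}" and x: "norm x = 1" for t k v x
  proof -
    have t0: "t > 0" using t t1 by auto
    have e: "1 + real k <= exp (real k)" by (rule exp_ge_add_one_self)
    have "2 * real k + ?n <= (2 + ?n) * (1 + real k)" by (simp add: algebra_simps)
    also have "... <= (2 + ?n) * exp (real k)" using e by (intro mult_left_mono) auto
    finally have k: "2 * real k + ?n <= (2 + ?n) * exp (real k)" .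
    have sq: "0 <= sqn (c t k)" by (rule sqn_nonneg[OF dcl_rpf[OF c t0]])
    have "\<bar>TT v k (c t k) x\<bar> <= (2 * real k + ?n) * ?n\<^sup>2 * (?n^(2*k) * sqrt (sqn (c t k))) * norm v"
      by (rule TT_bound[OF n dcl_hseq[OF c t0] x])
    also have "... <= ((2 + ?n) * exp (real k)) * ?n\<^sup>2 * (C * exp (- 2 * real k)) * norm v"
      by (intro mult_right_mono mult_mono[OF _ C(2)[OF t]] k) (use sq in auto)
    also have "... = ?C * (exp (real k) * exp (- 2 * real k)) * norm v" by simp
    also have "exp (real k) * exp (- 2 * real k) = exp (- real k)" unfolding exp_add[symmetric] by simp
    finally show ?thesis .
  qed
  moreover have "0 <= ?C" using C(1) by simp
  ultimately show ?thesis by blast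
qed

lemma dd_hbasis:
  assumes "sph_harm k P" shows "(\<Sum>e\<in>hbasis k. ip P e * dd v e x) = dd v P x"
proof -
  have "P = (%x. \<Sum>e\<in>hbasis k. ip P e * e x)" by (rule hbasis_expand'[OF assms])
  then have "dd v P x = dd v (%x. \<Sum>e\<in>hbasis k. ip P e * e x) x" by simp
  also have "... = (\<Sum>e\<in>hbasis k. dd v (%x. ip P e * e x) x)" by (rule dd_sum) (intro rpf_cmult hbasis_rpf)
  finally show ?thesis by (simp add: dd_cmult hbasis_rpf)
qed

text \<open>Expansion in the orthonormal basis separates the variables: finitely many products of a
  function of t and a function of x.\<close>

lemma term_has_derivative:
  fixes c c' :: "real => 'n::finite sdist"
  assumes c: "dcl c" and c': "dcl c'" and td: "tder c c'" and t: "t > 0" and x: "x ~= 0"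
  shows "((%p. zext (c (fst p) k) (snd p)) has_derivative
     (%h. fst h * c' t k (x /\<^sub>R norm x) + TT (snd h) k (c t k) (x /\<^sub>R norm x) / norm x)) (at (t, x))"
proof -
  let ?y = "x /\<^sub>R norm x" let ?E = "hbasis k :: (real^'n => real) set"
  have A: "((%p. ip (c (fst p) k) e) has_derivative (%h. ip (c' t k) e * fst h)) (at (t, x))" if e: "e : ?E" for e
  proof -
    have "((%t. ip (c t k) e) has_real_derivative ip (c' t k) e) (at t)" using td t hbasis_harm[OF e] unfolding tder_def by blast
    then have "((%t. ip (c t k) e) has_derivative (*) (ip (c' t k) e)) (at (fst (t, x)))" by (simp add: has_field_derivative_def)
    from has_derivative_compose[OF has_derivative_fst[OF has_derivative_ident] this] show ?thesis by simp
  qed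
  have B: "((%p. zext e (snd p)) has_derivative (%h. TT (snd h) k e ?y / norm x)) (at (t, x))" if e: "e : ?E" for e
  proof -
    have "(zext e has_derivative (%v. TT v k e ?y / norm x)) (at (snd (t, x)))"
      unfolding TT_def snd_conv by (rule zext_has_derivative[OF hbasis_rpf[OF e] sph_harm_homog[OF hbasis_harm[OF e]] x])
    from has_derivative_compose[OF has_derivative_snd[OF has_derivative_ident] this] show ?thesis by simp
  qed
  have 1: "((%p. \<Sum>e\<in>?E. ip (c (fst p) k) e * zext e (snd p)) has_derivative
      (%h. \<Sum>e\<in>?E. ip (c (fst (t, x)) k) e * (TT (snd h) k e ?y / norm x) + (ip (c' t k) e * fst h) * zext e (snd (t, x)))) (at (t, x))"
    by (intro has_derivative_sum has_derivative_mult A B)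
  have 2: "(\<Sum>e\<in>?E. ip (c t k) e * (TT (snd h) k e ?y / norm x) + (ip (c' t k) e * fst h) * zext e x)
      = fst h * c' t k ?y + TT (snd h) k (c t k) ?y / norm x" for h
  proof -
    have "(\<Sum>e\<in>?E. (ip (c' t k) e * fst h) * zext e x) = fst h * c' t k ?y"
      unfolding hbasis_expand[OF dcl_hseq[OF c' t], of _ ?y] zext_def by (simp add: sum_distrib_left mult_ac)
    moreover have "(\<Sum>e\<in>?E. ip (c t k) e * (TT (snd h) k e ?y / norm x)) = TT (snd h) k (c t k) ?y / norm x"
    proof -
      have "TT (snd h) k (c t k) ?y = (\<Sum>e\<in>?E. ip (c t k) e * dd (snd h) e ?y) - real k * ((snd h \<bullet> ?y) * (\<Sum>e\<in>?E. ip (c t k) e * e ?y))"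
        unfolding TT_def dd_hbasis[OF dcl_hseq[OF c t]] hbasis_expand[OF dcl_hseq[OF c t], of _ ?y, symmetric] ..
      also have "... = (\<Sum>e\<in>?E. ip (c t k) e * TT (snd h) k e ?y)"
        unfolding TT_def by (simp add: right_diff_distrib sum_subtractf sum_distrib_left mult_ac)
      finally show ?thesis by (simp add: sum_divide_distrib)
    qed
    ultimately show ?thesis by (simp add: sum.distrib)
  qed
  have 3: "((%p. \<Sum>e\<in>?E. ip (c (fst p) k) e * zext e (snd p)) has_derivative
      (%h. fst h * c' t k ?y + TT (snd h) k (c t k) ?y / norm x)) (at (t, x))"
    using 1 unfolding fst_conv snd_conv 2 .
  have op: "open ({0<..} \<times> UNIV :: (real \<times> (real^'n)) set)" by (intro open_Times) auto
  show ?thesis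
    by (rule has_derivative_transform_within_open[OF 3 op])
      (use t hbasis_expand[OF dcl_hseq[OF c]] in \<open>auto simp: zext_def\<close>)
qed

lemma ZZ_has_derivative_raw:
  fixes c c' :: "real => 'n::finite sdist"
  assumes n: "CARD('n) >= 2" and c: "dcl c" and c': "dcl c'" and td: "tder c c'" and t: "t > 0" and x: "x ~= 0"
  shows "((%p. ZZ (c (fst p)) (snd p)) has_derivative
     (%h. \<Sum>k. fst h * c' t k (x /\<^sub>R norm x) + TT (snd h) k (c t k) (x /\<^sub>R norm x) / norm x)) (at (t, x))"
proof -
  \<comment> \<open>On this ball time stays in the interval from t/2 to 3t/2 and |x| stays at least
    half of its value at the centre, so the decay estimates are uniform.\<close>
  define r where "r = min (t / 2) (norm x / 2)"
  have r: "r > 0" using t x by (simp add: r_def)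
  let ?S = "ball (t, x) r"
  have S: "t / 2 <= fst p" "fst p <= 3 * t / 2" "norm x / 2 <= norm (snd p)" if p: "p : ?S" for p
  proof -
    have d: "dist (t, x) p < r" using p by simp
    have "dist t (fst p) < t / 2" using dist_fst_le[of "(t, x)" p] d by (simp add: r_def)
    then show "t / 2 <= fst p" "fst p <= 3 * t / 2" unfolding dist_real_def by linarith+
    have "dist x (snd p) < norm x / 2" using dist_snd_le[of "(t, x)" p] d by (simp add: r_def)
    then show "norm x / 2 <= norm (snd p)" using norm_triangle_ineq2[of x "snd p"] by (simp add: dist_norm)
  qed
  have t2: "t / 2 > 0" using t by simp
  obtain C1 where C1: "C1 >= 0" "!!t' k y. t' : {t/2..3*t/2} ==> norm y = 1 ==> \<bar>c' t' k y\<bar> <= C1 * exp (- 1 * real k)"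
    using dcl_sup[OF n c' t2, of 1 "3 * t / 2"] by auto
  obtain C2 where C2: "C2 >= 0" "!!t' k v y. t' : {t/2..3*t/2} ==> norm y = 1 ==> \<bar>TT v k (c t' k) y\<bar> <= C2 * exp (- real k) * norm v"
    using dcl_TT_bound[OF n c t2, of "3 * t / 2"] by auto
  let ?b = "%k. (C1 + C2 * (2 / norm x)) * exp (- real k)"
  let ?f' = "%k p h. fst h * c' (fst p) k (snd p /\<^sub>R norm (snd p)) + TT (snd h) k (c (fst p) k) (snd p /\<^sub>R norm (snd p)) / norm (snd p)"
  have p0: "fst p > 0" "snd p ~= 0" if "p : ?S" for p
  proof -
    show "fst p > 0" using S(1)[OF that] t2 by linarith
    have "0 < norm (snd p)" using S(3)[OF that] x zero_less_norm_iff[of x] by linarith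
    then show "snd p ~= 0" by simp
  qed
  have "((%p. \<Sum>k. zext (c (fst p) k) (snd p)) has_derivative (%h. \<Sum>k. ?f' k (t, x) h)) (at (t, x))"
  proof (rule has_derivative_suminf[of ?S])
    show "((%p. zext (c (fst p) k) (snd p)) has_derivative ?f' k p) (at p)" if p: "p : ?S" for k p
      using term_has_derivative[OF c c' td p0[OF p], of k] by simp
    show "\<bar>?f' k p h\<bar> <= ?b k * norm h" if p: "p : ?S" for k p h
    proof -
      let ?y = "snd p /\<^sub>R norm (snd p)"
      have y: "norm ?y = 1" by (rule sphere_normalized[OF p0(2)[OF p]])
      have tp: "fst p : {t/2..3*t/2}" using S[OF p] by simp
      have h1: "\<bar>fst h\<bar> <= norm h" "norm (snd h) <= norm h" using norm_fst_le[of "fst h" "snd h"] norm_snd_le[of "snd h" "fst h"] by auto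
      have "\<bar>fst h * c' (fst p) k ?y\<bar> <= norm h * (C1 * exp (- real k))"
        unfolding abs_mult using h1 C1(2)[OF tp y, of k] by (intro mult_mono) auto
      moreover have "\<bar>TT (snd h) k (c (fst p) k) ?y / norm (snd p)\<bar> <= (C2 * exp (- real k) * norm h) / (norm x / 2)"
        unfolding abs_divide abs_norm_cancel
      proof (rule frac_le)
        have "\<bar>TT (snd h) k (c (fst p) k) ?y\<bar> <= C2 * exp (- real k) * norm (snd h)" by (rule C2(2)[OF tp y])
        also have "... <= C2 * exp (- real k) * norm h" using h1 C2(1) by (intro mult_left_mono) auto
        finally show "\<bar>TT (snd h) k (c (fst p) k) ?y\<bar> <= C2 * exp (- real k) * norm h" .
      qed (use x S[OF p] C2(1) in auto)
      ultimately have "\<bar>?f' k p h\<bar> <= norm h * (C1 * exp (- real k)) + (C2 * exp (- real k) * norm h) / (norm x / 2)"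
        using abs_triangle_ineq[of "fst h * c' (fst p) k ?y" "TT (snd h) k (c (fst p) k) ?y / norm (snd p)"] by linarith
      also have "... = ?b k * norm h" by (simp add: algebra_simps)
      finally show ?thesis .
    qed
    show "summable ?b" by (rule exp_decay_summable)
    show "summable (%k. zext (c (fst p) k) (snd p))" if p: "p : ?S" for p
      unfolding zext_def using p0[OF p] by (intro dcl_summable[OF n c] sphere_normalized) auto
  qed (use r in auto)
  then show ?thesis unfolding ZZ_def by simp
qed

section \<open>Smoothness of the series in time and space\<close>

lemma frechet_transform_open:
  assumes "open S" "x : S" "!!x. x : S ==> f x = g x" "f differentiable (at x)"
  shows "g differentiable (at x)" "frechet_derivative g (at x) = frechet_derivative f (at x)"
proof -
  have "(f has_derivative frechet_derivative f (at x)) (at x)" using assms(4) frechet_derivative_works by blast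
  then have g: "(g has_derivative frechet_derivative f (at x)) (at x)"
    by (rule has_derivative_transform_within_open[OF _ assms(1,2)]) (use assms(3) in auto)
  then show "g differentiable (at x)" by (auto simp: differentiable_def)
  show "frechet_derivative g (at x) = frechet_derivative f (at x)" using frechet_derivative_at[OF g] by simp
qed

lemma Ck_cong:
  assumes S: "open S" shows "(!!x. x : S ==> f x = g x) ==> Ck k f S ==> Ck k g S"
proof (induction k arbitrary: f g)
  case 0 then show ?case using continuous_on_eq[of S f g] by auto
next
  case (Suc k)
  have d: "f differentiable (at x)" if "x : S" for x using Suc.prems(2) that by auto
  have "Ck k (%x. frechet_derivative g (at x) v) S" for v
  proof (rule Suc.IH)
    show "frechet_derivative f (at x) v = frechet_derivative g (at x) v" if "x : S" for x
      using frechet_transform_open(2)[OF S that Suc.prems(1) d[OF that]] by simp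
    show "Ck k (%x. frechet_derivative f (at x) v) S" using Suc.prems(2) by auto
  qed
  then show ?case using frechet_transform_open(1)[OF S _ Suc.prems(1) d] by auto
qed

lemma Ck_add:
  assumes S: "open S" shows "Ck k f S ==> Ck k g S ==> Ck k (%x. f x + g x) S"
proof (induction k arbitrary: f g)
  case 0 then show ?case by (auto intro: continuous_on_add)
next
  case (Suc k)
  have d: "f differentiable (at x)" "g differentiable (at x)" if "x : S" for x using Suc.prems that by auto
  have e: "frechet_derivative (%x. f x + g x) (at x) = (%v. frechet_derivative f (at x) v + frechet_derivative g (at x) v)" if "x : S" for x
    using has_derivative_add[OF frechet_derivative_works[THEN iffD1, OF d(1)[OF that]] frechet_derivative_works[THEN iffD1, OF d(2)[OF that]]]
    by (rule frechet_derivative_at[symmetric])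
  have "Ck k (%x. frechet_derivative (%x. f x + g x) (at x) v) S" for v
  proof (rule Ck_cong[OF S])
    show "Ck k (%x. frechet_derivative f (at x) v + frechet_derivative g (at x) v) S" by (rule Suc.IH) (use Suc.prems in auto)
  qed (use e in auto)
  then show ?case using d by auto
qed

text \<open>The components of the product with v . x on the sphere (\<open>ZZ_MlS\<close>). The
  factors 1 match the shape of \<open>shift_series\<close>.\<close>

definition MlS :: "real^'n => 'n::finite sdist => 'n sdist" where
  "MlS v u k x = 1 * DnS v u k x + 1 * UpS v u k x"

text \<open>The degree-\<open>k\<close> component of the derivative in direction \<open>v\<close> (see \<open>TT\<close>) of the series \<open>\<Sum>k. u k\<close>.\<close>

definition TS :: "real^'n => 'n::finite sdist => 'n sdist" where
  "TS v u k x = (real (Suc k) + real CARD('n) - 2) * DnS v u k x + (1 - real k) * UpS v u k x"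

lemma ZZ_sphere: "ZZ u x = (\<Sum>k. u k (x /\<^sub>R norm x))" by (simp add: ZZ_def zext_def)

lemma ZZ_normalize: "x ~= 0 ==> ZZ u (x /\<^sub>R norm x) = ZZ u x"
proof -
  assume "x ~= 0"
  then have "norm (x /\<^sub>R norm x) = 1" by (rule sphere_normalized)
  then have "(x /\<^sub>R norm x) /\<^sub>R norm (x /\<^sub>R norm x) = x /\<^sub>R norm x" by (metis inverse_1 scaleR_one)
  then show ?thesis unfolding ZZ_sphere by (rule arg_cong)
qed

lemma ebd_TS: "ebd (%k. real (Suc k) + real N - 2)" "ebd (%k. 1 - real k)" "ebd (%k. 1)"
  using ebd_linear[of 1 "real N - 1"] ebd_linear[of "-1" 1] ebd_linear[of 0 1] by (simp_all add: algebra_simps)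

lemma ZZ_TS:
  fixes c :: "real => 'n::finite sdist"
  assumes n: "CARD('n) >= 2" and c: "dcl c" and t: "t > 0" and x: "x ~= 0"
  shows "summable (%k. TT v k (c t k) (x /\<^sub>R norm x))" "(\<Sum>k. TT v k (c t k) (x /\<^sub>R norm x)) = ZZ (TS v (c t)) x"
proof -
  let ?y = "x /\<^sub>R norm x"
  have y: "norm ?y = 1" by (rule sphere_normalized[OF x])
  have e: "(%k. TT v k (c t k) ?y) = (%k. (real k + real CARD('n) - 2) * Dn v k (c t k) ?y + (1 - real (Suc k)) * Up v k (c t k) ?y)"
    by (rule ext) (simp add: TT_Up_Dn[OF n dcl_hseq[OF c t] y])
  note sh = shift_series[OF n c t y, of "%k. real k + real CARD('n) - 2" "%k. 1 - real k" v, OF ebd_TS(1,2)]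
  show "summable (%k. TT v k (c t k) ?y)" unfolding e by (rule sh(1))
  show "(\<Sum>k. TT v k (c t k) ?y) = ZZ (TS v (c t)) x" unfolding e sh(2) ZZ_sphere TS_def ..
qed

lemma ZZ_MlS:
  fixes c :: "real => 'n::finite sdist"
  assumes n: "CARD('n) >= 2" and c: "dcl c" and t: "t > 0" and x: "x ~= 0"
  shows "(v \<bullet> (x /\<^sub>R norm x)) * ZZ (c t) x = ZZ (MlS v (c t)) x"
proof -
  let ?y = "x /\<^sub>R norm x"
  have y: "norm ?y = 1" by (rule sphere_normalized[OF x])
  have "(v \<bullet> ?y) * ZZ (c t) x = (\<Sum>k. (v \<bullet> ?y) * c t k ?y)" unfolding ZZ_sphere by (rule suminf_mult[OF dcl_summable[OF n c t y], symmetric])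
  also have "... = (\<Sum>k. 1 * Dn v k (c t k) ?y + 1 * Up v k (c t k) ?y)"
  proof (rule suminf_cong)
    show "(v \<bullet> ?y) * c t k ?y = 1 * Dn v k (c t k) ?y + 1 * Up v k (c t k) ?y" for k
      using Up_plus_Dn[OF y, of v "c t k" k] by linarith
  qed
  also have "... = ZZ (MlS v (c t)) x"
    using shift_series(2)[OF n c t y, of "%k. 1" "%k. 1" v, OF ebd_TS(3,3)] unfolding ZZ_sphere MlS_def .
  finally show ?thesis .
qed

lemma ZZ_has_derivative:
  fixes c c' :: "real => 'n::finite sdist"
  assumes n: "CARD('n) >= 2" and c: "dcl c" and c': "dcl c'" and td: "tder c c'" and t: "t > 0" and x: "x ~= 0"
  shows "((%p. ZZ (c (fst p)) (snd p)) has_derivative (%h. fst h * ZZ (c' t) x + ZZ (TS (snd h) (c t)) x / norm x)) (at (t, x))"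
proof -
  let ?y = "x /\<^sub>R norm x"
  have y: "norm ?y = 1" by (rule sphere_normalized[OF x])
  have "(\<Sum>k. fst h * c' t k ?y + TT (snd h) k (c t k) ?y / norm x) = fst h * ZZ (c' t) x + ZZ (TS (snd h) (c t)) x / norm x" for h
  proof -
    have s1: "summable (%k. c' t k ?y)" by (rule dcl_summable[OF n c' t y])
    note s2 = ZZ_TS[OF n c t x, of "snd h"]
    have "(\<Sum>k. fst h * c' t k ?y + TT (snd h) k (c t k) ?y / norm x) = (\<Sum>k. fst h * c' t k ?y) + (\<Sum>k. TT (snd h) k (c t k) ?y / norm x)"
      by (rule suminf_add[symmetric]) (intro summable_mult summable_divide s1 s2(1))+
    then show ?thesis by (simp add: suminf_mult[OF s1] suminf_divide[OF s2(1)] s2(2) ZZ_sphere[of "c' t"])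
  qed
  then show ?thesis using ZZ_has_derivative_raw[OF assms] by simp
qed

lemma DD_zero: "DD m (%t k x. 0)"
proof -
  have d: "dcl (%t k x. 0)" unfolding dcl_def by (auto simp: sph_harm_zero intro!: exI[of _ 0])
  show ?thesis
  proof (induction m)
    case (Suc m)
    have "tder (%t k x. 0) (%t k x. 0)" unfolding tder_def by simp
    then show ?case using Suc d by auto
  qed (simp add: d)
qed

lemma DD_sum: "(!!i. i : I ==> DD m (c i)) ==> DD m (%t k x. \<Sum>i\<in>I. c i t k x)"
  by (induction I rule: infinite_finite_induct) (auto intro: DD_zero DD_add)

lemma dcl_cong: "dcl c ==> (!!t k. t > 0 ==> c t k = d t k) ==> dcl d"
proof -
  assume c: "dcl c" and e: "!!t k. t > 0 ==> c t k = d t k"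
  show ?thesis unfolding dcl_def
  proof (intro conjI allI impI)
    fix t :: real and k assume "t > 0" then show "sph_harm k (d t k)" using dcl_hseq[OF c] e by metis
  next
    fix k and Q :: "real^'a => real" assume Q: "sph_harm k Q"
    show "continuous_on {0<..} (%t. ip (d t k) Q)" using dcl_cont[OF c Q] by (rule continuous_on_eq) (simp add: e)
  next
    fix t1 T a :: real assume p: "t1 > 0" "a >= 0"
    then obtain C where "C >= 0" "!!t k. t : {t1..T} ==> sqn (c t k) <= C * exp (- a * real k)" using dcl_decay[OF c p, of T] by auto
    moreover have "d t k = c t k" if "t : {t1..T}" for t k using e[of t k] p that by simp
    ultimately show "\<exists>C\<ge>0. \<forall>t\<in>{t1..T}. \<forall>k. sqn (d t k) <= C * exp (- a * real k)"
      by (intro exI[of _ C]) simp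
  qed
qed

lemma DD_cong: "DD m c ==> (!!t k. t > 0 ==> c t k = d t k) ==> DD m d"
proof (cases m)
  case (Suc j)
  assume c: "DD m c" and e: "!!t k. t > 0 ==> c t k = d t k"
  then obtain c' where c': "tder c c'" "DD j c'" "dcl c" using Suc by auto
  have "tder d c'" unfolding tder_def
  proof (intro allI impI)
    fix t k and Q :: "real^'a => real" assume t: "(0::real) < t" and Q: "sph_harm k Q"
    have "((%t. ip (c t k) Q) has_real_derivative ip (c' t k) Q) (at t)" using c' t Q unfolding tder_def by blast
    then show "((%t. ip (d t k) Q) has_real_derivative ip (c' t k) Q) (at t)" by (rule deriv_pos_transform[OF _ t]) (simp add: e)
  qed
  then show ?thesis using Suc c' dcl_cong[OF c'(3) e] by auto
qed (use dcl_cong in auto)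

lemma DD_MlS_TS:
  fixes c :: "real => 'n::finite sdist"
  assumes n: "CARD('n) >= 2" and c: "DD m c"
  shows "DD m (%t. MlS v (c t))" "DD m (%t. TS v (c t))"
proof -
  have U: "DD m (%t. UpS v (c t))" and D: "DD m (%t. DnS v (c t))" using DD_UpS_DnS[OF n c] by auto
  show "DD m (%t. MlS v (c t))"
    using DD_add[OF D U] by (rule DD_cong) (simp add: MlS_def fun_eq_iff)
  show "DD m (%t. TS v (c t))"
    using DD_add[OF DD_diag[OF D ebd_TS(1)[where N="CARD('n)"]] DD_diag[OF U ebd_TS(2)]] by (rule DD_cong) (simp add: TS_def fun_eq_iff)
qed

lemma inverse_norm_power_deriv:
  fixes x :: "real^'n" assumes x: "x ~= 0"
  shows "((%x. inverse (norm x) ^ q) has_derivative (%v. - real q * (v \<bullet> (x /\<^sub>R norm x)) * inverse (norm x) ^ Suc q)) (at x)"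
proof -
  have 1: "(norm has_derivative (%h. h \<bullet> sgn x)) (at x)" by (rule has_derivative_norm[OF x])
  have 2: "((%y. inverse (norm y)) has_derivative (%h. - (inverse (norm x) * (h \<bullet> sgn x) * inverse (norm x)))) (at x)"
    by (rule Deriv.has_derivative_inverse[OF _ 1]) (use x in auto)
  have "((%x. inverse (norm x) ^ q) has_derivative (%v. real q * (- (inverse (norm x) * (v \<bullet> sgn x) * inverse (norm x))) * inverse (norm x) ^ (q - 1))) (at x)"
    by (rule has_derivative_power[OF 2])
  moreover have "real q * (- (inverse (norm x) * (v \<bullet> sgn x) * inverse (norm x))) * inverse (norm x) ^ (q - 1) = - real q * (v \<bullet> (x /\<^sub>R norm x)) * inverse (norm x) ^ Suc q" for v
    by (cases q) (auto simp: sgn_div_norm algebra_simps)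
  then have "(%v. real q * (- (inverse (norm x) * (v \<bullet> sgn x) * inverse (norm x))) * inverse (norm x) ^ (q - 1)) = (%v. - real q * (v \<bullet> (x /\<^sub>R norm x)) * inverse (norm x) ^ Suc q)" by (rule ext)
  ultimately show ?thesis by (simp only:)
qed

lemma ZZ_lin:
  fixes c d :: "real => 'n::finite sdist"
  assumes n: "CARD('n) >= 2" and c: "dcl c" and d: "dcl d" and t: "t > 0" and x: "x ~= 0"
  shows "ZZ (%k x. c t k x + a * d t k x) x = ZZ (c t) x + a * ZZ (d t) x"
proof -
  have y: "norm (x /\<^sub>R norm x) = 1" by (rule sphere_normalized[OF x])
  note s = dcl_summable[OF n c t y] dcl_summable[OF n d t y]
  show ?thesis unfolding ZZ_sphere using suminf_add[OF s(1) summable_mult[OF s(2), of a]] suminf_mult[OF s(2), of a] by simp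
qed

lemma open_cyl: "open ({0<..} \<times> - {0} :: (real \<times> (real^'n)) set)"
  by (intro open_Times) auto

text \<open>Space derivatives bring factors 1 / |x|, so the statement carries an arbitrary power q:
  the derivative is a sum of two expressions of the same kind, with powers q and q + 1. One time
  derivative more than m is assumed because continuity of the last one is deduced from
  differentiability.\<close>

lemma Ck_ZZ:
  fixes c :: "real => 'n::finite sdist"
  assumes n: "CARD('n) >= 2"
  shows "DD (Suc m) c ==> Ck m (%p. ZZ (c (fst p)) (snd p) * inverse (norm (snd p)) ^ q) ({0<..} \<times> - {0})"
proof (induction m arbitrary: c q)
  have D: "((%p. ZZ (c (fst p)) (snd p) * inverse (norm (snd p)) ^ q) has_derivative
      (%h. (ZZ (%k x. fst h * c' t k x) x) * inverse (norm x) ^ q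
         + ZZ (%k y. TS (snd h) (c t) k y + (- real q) * MlS (snd h) (c t) k y) x * inverse (norm x) ^ Suc q)) (at (t, x))"
    if c: "dcl c" and c': "dcl c'" and td: "tder c c'" and t: "t > 0" and x: "x ~= 0" for c c' :: "real => 'n sdist" and t x q
  proof -
    have y: "norm (x /\<^sub>R norm x) = 1" by (rule sphere_normalized[OF x])
    have cc: "DD 0 c" using c by simp
    have d1: "dcl (%t. TS v (c t))" "dcl (%t. MlS v (c t))" for v using DD_MlS_TS[OF n cc] by auto
    have i: "((%p. inverse (norm (snd p)) ^ q) has_derivative (%h. - real q * (snd h \<bullet> (x /\<^sub>R norm x)) * inverse (norm x) ^ Suc q)) (at (t, x))"
    proof -
      have "((%x. inverse (norm x) ^ q) has_derivative (%v. - real q * (v \<bullet> (x /\<^sub>R norm x)) * inverse (norm x) ^ Suc q)) (at (snd (t, x)))"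
        using inverse_norm_power_deriv[OF x] by simp
      from has_derivative_compose[OF has_derivative_snd[OF has_derivative_ident] this] show ?thesis by simp
    qed
    have "((%p. ZZ (c (fst p)) (snd p) * inverse (norm (snd p)) ^ q) has_derivative
      (%h. ZZ (c (fst (t, x))) (snd (t, x)) * (- real q * (snd h \<bullet> (x /\<^sub>R norm x)) * inverse (norm x) ^ Suc q)
        + (fst h * ZZ (c' t) x + ZZ (TS (snd h) (c t)) x / norm x) * inverse (norm (snd (t, x))) ^ q)) (at (t, x))"
      by (rule has_derivative_mult[OF ZZ_has_derivative[OF n c c' td t x] i])
    moreover have "ZZ (c t) x * (- real q * (snd h \<bullet> (x /\<^sub>R norm x)) * inverse (norm x) ^ Suc q)
        + (fst h * ZZ (c' t) x + ZZ (TS (snd h) (c t)) x / norm x) * inverse (norm x) ^ q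
      = (ZZ (%k x. fst h * c' t k x) x) * inverse (norm x) ^ q
         + ZZ (%k y. TS (snd h) (c t) k y + (- real q) * MlS (snd h) (c t) k y) x * inverse (norm x) ^ Suc q" for h
    proof -
      have e1: "ZZ (%k x. fst h * c' t k x) x = fst h * ZZ (c' t) x"
        unfolding ZZ_sphere by (rule suminf_mult[OF dcl_summable[OF n c' t y]])
      have e2: "ZZ (%k y. TS (snd h) (c t) k y + (- real q) * MlS (snd h) (c t) k y) x = ZZ (TS (snd h) (c t)) x + (- real q) * ((snd h \<bullet> (x /\<^sub>R norm x)) * ZZ (c t) x)"
        unfolding ZZ_MlS[OF n c t x] by (rule ZZ_lin[OF n d1(1) d1(2) t x])
      show ?thesis unfolding e1 e2 by (simp add: algebra_simps divide_inverse)
    qed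
    ultimately show ?thesis by simp
  qed
  {
    case 0
    then obtain c' where c: "dcl c" "tder c c'" "dcl c'" by auto
    have "isCont (%p. ZZ (c (fst p)) (snd p) * inverse (norm (snd p)) ^ q) p" if pp: "p : {0<..} \<times> - {0}" for p
    proof -
      obtain t x where p: "p = (t, x)" "t > 0" "x ~= 0" using pp by (cases p) auto
      show ?thesis unfolding p(1) by (rule has_derivative_continuous[OF D[OF c(1,3,2) p(2,3)]])
    qed
    then show ?case by (auto intro!: continuous_at_imp_continuous_on)
  next
    case (Suc m)
    obtain c' where c: "dcl c" "tder c c'" "DD (Suc m) c'" using Suc.prems by auto
    note c'd = DD_dcl[OF c(3)]
    let ?G = "%p. ZZ (c (fst p)) (snd p) * inverse (norm (snd p)) ^ q"
    have dif: "?G differentiable (at p)" if pp: "p : {0<..} \<times> - {0}" for p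
    proof -
      obtain t x where p: "p = (t, x)" "t > 0" "x ~= 0" using pp by (cases p) auto
      show ?thesis unfolding p(1) differentiable_def using D[OF c(1) c'd c(2) p(2,3)] by blast
    qed
    have "Ck m (%p. frechet_derivative ?G (at p) v) ({0<..} \<times> - {0})" for v
    proof (rule Ck_cong[OF open_cyl])
      have a: "DD (Suc m) (%t k x. fst v * c' t k x)"
        using DD_diag[OF c(3), of "%_. fst v"] ebd_linear[of 0 "fst v"] by simp
      have b: "DD (Suc m) (%t k y. TS (snd v) (c t) k y + (- real q) * MlS (snd v) (c t) k y)"
        using DD_add[OF DD_MlS_TS(2)[OF n DD_mono[OF Suc.prems], of "snd v"] DD_diag[OF DD_MlS_TS(1)[OF n DD_mono[OF Suc.prems], of "snd v"], of "%_. - real q"]]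
          ebd_linear[of 0 "- real q"] by simp
      show "Ck m (%p. ZZ ((%t k x. fst v * c' t k x) (fst p)) (snd p) * inverse (norm (snd p)) ^ q
         + ZZ ((%t k y. TS (snd v) (c t) k y + (- real q) * MlS (snd v) (c t) k y) (fst p)) (snd p) * inverse (norm (snd p)) ^ Suc q) ({0<..} \<times> - {0})"
        by (rule Ck_add[OF open_cyl Suc.IH[OF a] Suc.IH[OF b]])
      show "ZZ ((%t k x. fst v * c' t k x) (fst p)) (snd p) * inverse (norm (snd p)) ^ q
         + ZZ ((%t k y. TS (snd v) (c t) k y + (- real q) * MlS (snd v) (c t) k y) (fst p)) (snd p) * inverse (norm (snd p)) ^ Suc q
         = frechet_derivative ?G (at p) v" if pp: "p : {0<..} \<times> - {0}" for p
      proof -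
        obtain t x where p: "p = (t, x)" "t > 0" "x ~= 0" using pp by (cases p) auto
        show ?thesis unfolding p(1) fst_conv snd_conv by (rule fun_cong[OF frechet_derivative_at[OF D[OF c(1) c'd c(2) p(2,3)]]])
      qed
    qed
    then show ?case using dif by auto
  }
qed

lemma SS_ip: "DD m c ==> sph_harm k Q ==> SS m (%t. ip (c t k) Q)"
proof (induction m arbitrary: c)
  case 0 then show ?case by (simp add: dcl_cont)
next
  case (Suc m)
  then obtain c' where "tder c c'" "DD m c'" by auto
  then show ?case using Suc.IH Suc.prems(2) unfolding tder_def by (auto intro!: exI[of _ "%t. ip (c' t k) Q"])
qed

lemma bt_UpS_DnS: "bt v u k = (%x. (real k + real CARD('n) - 2) * UpS v u k x + (- real k) * DnS v u k x)" for u :: "'n::finite sdist"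
  by (cases k) (auto simp: bt_def UpS_def DnS_def algebra_simps)

lemma UpS_DnS_coord:
  fixes u :: "'n::finite sdist"
  assumes u: "!!k. rpf (u k)"
  shows "UpS v u k x = (\<Sum>i\<in>UNIV. v $ i * UpS (axis i 1) u k x)" "DnS v u k x = (\<Sum>i\<in>UNIV. v $ i * DnS (axis i 1) u k x)"
proof -
  show "UpS v u k x = (\<Sum>i\<in>UNIV. v $ i * UpS (axis i 1) u k x)" by (cases k) (auto simp: Up_v_coord[OF u, of v])
  show "DnS v u k x = (\<Sum>i\<in>UNIV. v $ i * DnS (axis i 1) u k x)" unfolding DnS_def by (rule Dn_v_coord[OF u])
qed

section \<open>Solutions of the system without cut-off\<close>

locale doi_sol =
  fixes \<sigma> s :: real and f0 :: "'n::finite sdist" and f :: "real => 'n sdist"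
  assumes n2: "CARD('n) >= 2" and sg: "\<sigma> > 0" and f0: "in_Hs s f0"
    and fh: "!!t k. sph_harm k (f t k)" and fc: "!!k Q. sph_harm k Q ==> continuous_on UNIV (%t. ip (f t k) Q)"
    and finit: "f 0 = f0"
    and fsol: "!!T k. solves T k (\<sigma> * lam TYPE('n) k) (%t. f t k) (%t. bt (jv (f t 1)) (f t) k)"
    and fbd: "!!T. \<exists>N\<ge>0. \<forall>t\<in>{0..T}. \<forall>K. (\<Sum>k\<le>K. hw TYPE('n) s k * sqn (f t k)) <= N"
    and fdec: "!!t1 a T. t1 > 0 ==> a >= 0 ==> \<exists>C\<ge>0. \<forall>t\<in>{t1..T}. \<forall>k. sqn (f t k) <= C * exp (- a * real k)"
begin

definition fd :: "real => 'n sdist" where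
  "fd t k = (%x. - (\<sigma> * lam TYPE('n) k) * f t k x + bt (jv (f t 1)) (f t) k x)"

lemma frpf: "rpf (f t k)" using fh sph_harm_rpf by blast

lemma f_dcl: "dcl f"
  unfolding dcl_def using fh fdec continuous_on_subset[OF fc] by auto

lemma fd_harm: "sph_harm k (fd t k)"
  unfolding fd_def by (intro sph_harm_add sph_harm_cmult sph_harm_bt n2) (use fh in auto)

lemma ip_fd: "rpf Q ==> ip (fd t k) Q = - (\<sigma> * lam TYPE('n) k) * ip (f t k) Q + ip (bt (jv (f t 1)) (f t) k) Q"
proof -
  assume "rpf Q"
  moreover have "rpf (bt (jv (f t 1)) (f t) k)" by (rule sph_harm_rpf[OF sph_harm_bt[OF n2]]) (use fh in blast)
  ultimately show ?thesis unfolding fd_def by (simp only: ip_add_left[OF rpf_cmult[OF frpf]] ip_cmult_left)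
qed

lemma f_tder: "tder f fd"
  unfolding tder_def
proof (intro allI impI)
  fix t k and Q :: "real^'n => real" assume t: "(0::real) < t" and Q: "sph_harm k Q"
  have "((%t. ip (f t k) Q) has_real_derivative ip (fd t k) Q) (at t within {0..t + 1})"
    using fsol[of "t + 1" k] Q t unfolding solves_def ip_fd[OF sph_harm_rpf[OF Q]] by auto
  moreover have "at t within {0..t + 1} = at t" using t by (intro at_within_interior) (auto simp: interior_atLeastAtMost_real)
  ultimately show "((%t. ip (f t k) Q) has_real_derivative ip (fd t k) Q) (at t)" by simp
qed

text \<open>The drift is the sum over i of a scalar function of time, the coordinate i of J, times a
  fixed linear shift of f. Since that coordinate is a coefficient of f, it has as many derivatives
  as f.\<close>

lemma fd_DD: "DD m f ==> DD m fd"
proof -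
  assume f: "DD m f"
  let ?A = "%i t k x. (real k + real CARD('n) - 2) * UpS (axis i 1) (f t) k x + (- real k) * DnS (axis i 1) (f t) k x"
  have e: "ebd (%k. real k + real CARD('n) - 2)" "ebd (%k. - real k)"
    using ebd_linear[of 1 "real CARD('n) - 2"] ebd_linear[of "-1" 0] by (simp_all add: algebra_simps)
  have A: "DD m (?A i)" for i
    using DD_UpS_DnS[OF n2 f, of "axis i 1"] by (intro DD_add DD_diag e) auto
  have J: "SS m (%t. jv (f t 1) $ i)" for i unfolding jv_def using SS_ip[OF f rpf_jc, of i] by simp
  have l: "ebd (%k. - (\<sigma> * lam TYPE('n) k))"
  proof -
    obtain C where "C >= 0" "!!k. \<bar>lam TYPE('n) k\<bar> <= C * exp (real k)" using ebd_lam[OF n2] unfolding ebd_def by auto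
    then show ?thesis unfolding ebd_def using sg by (intro exI[of _ "\<sigma> * C"]) (auto simp: abs_mult mult.assoc)
  qed
  have "DD m (%t k x. - (\<sigma> * lam TYPE('n) k) * f t k x + (\<Sum>i\<in>UNIV. jv (f t 1) $ i * ?A i t k x))"
    by (intro DD_add DD_diag[OF f l] DD_sum DD_scal[OF A J])
  then show "DD m fd"
  proof (rule DD_cong)
    fix t :: real and k
    have "bt (jv (f t 1)) (f t) k x = (\<Sum>i\<in>UNIV. jv (f t 1) $ i * ?A i t k x)" for x
      unfolding bt_UpS_DnS UpS_DnS_coord[of "f t" "jv (f t 1)", OF frpf]
      by (simp add: sum_distrib_left distrib_left sum.distrib sum_subtractf right_diff_distrib mult_ac sum_negf)
    then show "(%x. - (\<sigma> * lam TYPE('n) k) * f t k x + (\<Sum>i\<in>UNIV. jv (f t 1) $ i * ?A i t k x)) = fd t k" unfolding fd_def by simp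
  qed
qed

lemma f_DD: "DD m f"
proof (induction m)
  case 0 show ?case using f_dcl by simp
next
  case (Suc m) then show ?case using f_dcl f_tder fd_DD by auto
qed

lemma f_smooth: "smooth_on ({0<..} \<times> - {0}) (%(t, x). ZZ (f t) (x /\<^sub>R norm x))"
  unfolding smooth_on_def
proof
  fix k
  show "Ck k (%(t, x). ZZ (f t) (x /\<^sub>R norm x)) ({0<..} \<times> - {0})"
  proof (rule Ck_cong[OF open_cyl _ Ck_ZZ[OF n2 f_DD, of k 0]])
    fix p :: "real \<times> (real^'n)" assume pp: "p : {0<..} \<times> - {0}"
    then obtain t x where p: "p = (t, x)" "x ~= 0" by (cases p) auto
    show "ZZ (f (fst p)) (snd p) * inverse (norm (snd p)) ^ 0 = (case p of (t, x) => ZZ (f t) (x /\<^sub>R norm x))"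
      unfolding p(1) fst_conv snd_conv prod.case power_0 mult_1_right by (rule ZZ_normalize[OF p(2), symmetric])
  qed
qed

end

section \<open>The Laplacian and the divergence on the sphere\<close>

lemma UD_sums:
  fixes P :: "real^'n => real"
  assumes n: "CARD('n) >= 2" and P: "sph_harm m P"
  defines "e \<equiv> %i::'n. axis i (1::real)"
  shows DnDn_sum: "(\<Sum>i\<in>UNIV. Dn (e i) k (Dn (e i) m P) x) = 0"
    and UpDn_sum: "(\<Sum>i\<in>UNIV. Up (e i) k (Dn (e i) m P) x) = real m / (2 * real m + real CARD('n) - 2) * P x"
    and DnUp_sum: "m > 0 ==> (\<Sum>i\<in>UNIV. Dn (e i) (Suc m) (Up (e i) m P) x) = (real m + real CARD('n) - 2) / (2 * real m + real CARD('n) - 2) * P x"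
    and UpUp_sum: "(\<Sum>i\<in>UNIV. Up (e i) (Suc m) (Up (e i) m P) x) = 0"
proof -
  let ?n = "real CARD('n)" let ?q = "2 * real m + ?n - 2"
  note rp = sph_harm_rpf[OF P]
  have x: "e i \<bullet> x = x $ i" for i x by (simp add: e_def inner_axis')
  have dDn: "dd (e i) (Dn (e i) m P) x = dd (e i) (dd (e i) P) x / ?q" for i x
  proof -
    have "Dn (e i) m P = (%x. inverse ?q * dd (e i) P x)" by (simp add: Dn_def fun_eq_iff divide_inverse mult.commute)
    then show ?thesis using dd_cmult[OF rpf_dd[OF rp], of "e i" "inverse ?q" "e i" x] by (simp add: divide_inverse mult.commute)
  qed
  have DD: "Dn (e i) k (Dn (e i) m P) x = dd (e i) (dd (e i) P) x / ?q / (2 * real k + ?n - 2)" for i k x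
    using dDn[of i x] by (simp add: Dn_def[of _ k])
  \<comment> \<open>Harmonicity of P; with Euler's identity (\<open>E\<close> below) it evaluates
    all four contractions.\<close>
  have L: "(\<Sum>i\<in>UNIV. dd (e i) (dd (e i) P) x) = 0" for x
    using P lap_rpf[OF rp, of x] by (simp add: sph_harm_def e_def)
  have DD0: "(\<Sum>i\<in>UNIV. Dn (e i) k (Dn (e i) m P) x) = 0" for k x
    unfolding DD by (simp add: sum_divide_distrib[symmetric] L)
  have E: "(\<Sum>i\<in>UNIV. x $ i * dd (e i) P x) = real m * P x" for x
    using dd_v_coord[OF rp, of x x] Euler_homog[OF rp sph_harm_homog[OF P], of x] by (simp add: e_def)
  have XD: "(\<Sum>i\<in>UNIV. x $ i * Dn (e i) m P x) = real m / ?q * P x" for x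
    unfolding Dn_def by (simp add: sum_divide_distrib[symmetric] E)
  show "(\<Sum>i\<in>UNIV. Dn (e i) k (Dn (e i) m P) x) = 0" by (rule DD0)
  show "(\<Sum>i\<in>UNIV. Up (e i) k (Dn (e i) m P) x) = real m / ?q * P x"
    unfolding Up_def[of _ k] x by (simp add: sum_subtractf sum_distrib_left[symmetric] DD0 XD)
  have dU: "dd (e i) (Up (e i) m P) x = P x + x $ i * dd (e i) P x - 2 * (x $ i * Dn (e i) m P x) - (x \<bullet> x) * dd (e i) (Dn (e i) m P) x" for i x
  proof -
    have r: "rpf (%x. (e i \<bullet> x) * P x)" "rpf (%x. (x \<bullet> x) * Dn (e i) m P x)" "rpf (Dn (e i) m P)"
      by (intro rpf_mult rpf_inner rpf_sq rp rpf_Dn)+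
    have "dd (e i) (Up (e i) m P) x = dd (e i) (%x. (e i \<bullet> x) * P x) x - dd (e i) (%x. (x \<bullet> x) * Dn (e i) m P x) x"
      unfolding Up_def by (rule dd_diff[OF r(1,2)])
    moreover have "dd (e i) (%x. (e i \<bullet> x) * P x) x = (e i \<bullet> x) * dd (e i) P x + dd (e i) (%x. e i \<bullet> x) x * P x"
      by (rule dd_mult[OF rpf_inner rp])
    moreover have "dd (e i) (%x. (x \<bullet> x) * Dn (e i) m P x) x = (x \<bullet> x) * dd (e i) (Dn (e i) m P) x + dd (e i) (%x. x \<bullet> x) x * Dn (e i) m P x"
      by (rule dd_mult[OF rpf_sq r(3)])
    moreover have "e i \<bullet> e i = 1" by (simp add: e_def inner_axis_axis)
    moreover have "dd (e i) (%x. e i \<bullet> x) x = e i \<bullet> e i" "dd (e i) (%x. x \<bullet> x) x = 2 * x $ i" unfolding dd_inner dd_sq by (simp_all add: x inner_commute[of x "e i"])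
    ultimately show ?thesis using x[of i x] by (simp only:)
  qed
  have dD: "(\<Sum>i\<in>UNIV. dd (e i) (Dn (e i) m P) x) = 0" for x
    unfolding dDn by (simp add: sum_divide_distrib[symmetric] L)
  have DU: "(\<Sum>i\<in>UNIV. Dn (e i) (Suc m) (Up (e i) m P) x) = (?n + real m - 2 * (real m / ?q)) * P x / (2 * real (Suc m) + ?n - 2)" for x
    unfolding Dn_def[of _ "Suc m"] sum_divide_distrib[symmetric] dU
    unfolding sum.distrib sum_subtractf sum_distrib_left[symmetric] XD E dD by (simp add: algebra_simps)
  have DU': "(\<Sum>i\<in>UNIV. Dn (e i) (Suc m) (Up (e i) m P) x) = (real m + ?n - 2) / ?q * P x" if m: "?q > 0" for x
  proof -
    have "(?n + real m - 2 * (real m / ?q)) = (real m + ?n - 2) * (2 * real m + ?n) / ?q" using m by (simp add: field_simps)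
    moreover have "2 * real (Suc m) + ?n - 2 = 2 * real m + ?n" "2 * real m + ?n > 0" using n by auto
    ultimately show ?thesis unfolding DU by simp
  qed
  show "(\<Sum>i\<in>UNIV. Dn (e i) (Suc m) (Up (e i) m P) x) = (real m + ?n - 2) / ?q * P x" if "m > 0"
    by (rule DU') (use n that in linarith)
  have XU: "(\<Sum>i\<in>UNIV. x $ i * Up (e i) m P x) = (x \<bullet> x) * (P x - real m / ?q * P x)" for x
  proof -
    have "(\<Sum>i\<in>UNIV. x $ i * Up (e i) m P x) = (\<Sum>i\<in>UNIV. x $ i * x $ i * P x - (x \<bullet> x) * (x $ i * Dn (e i) m P x))"
      unfolding Up_def x by (simp add: algebra_simps)
    also have "... = (\<Sum>i\<in>UNIV. x $ i * x $ i) * P x - (x \<bullet> x) * (real m / ?q * P x)"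
      by (simp add: sum_subtractf sum_distrib_left[symmetric] sum_distrib_right[symmetric] XD)
    finally show ?thesis by (simp add: inner_vec_def right_diff_distrib)
  qed
  have UU: "(\<Sum>i\<in>UNIV. Up (e i) (Suc m) (Up (e i) m P) x) = (x \<bullet> x) * (P x - real m / ?q * P x - (\<Sum>i\<in>UNIV. Dn (e i) (Suc m) (Up (e i) m P) x))"
    unfolding Up_def[of _ "Suc m"] x by (simp add: sum_subtractf sum_distrib_left[symmetric] XU right_diff_distrib)
  show "(\<Sum>i\<in>UNIV. Up (e i) (Suc m) (Up (e i) m P) x) = 0"
  proof (cases "?q > 0")
    case True
    have "1 - real m / ?q - (real m + ?n - 2) / ?q = 0" using True by (simp add: field_simps)
    then have "(1 - real m / ?q - (real m + ?n - 2) / ?q) * P x = 0" by simp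
    then show ?thesis unfolding UU DU'[OF True] by (simp add: left_diff_distrib)
  next
    \<comment> \<open>Here n = 2 and m = 0, where the denominator is 0 and the quotients are 0 by
      convention; \<open>DU\<close> then evaluates directly to P.\<close>
    case False
    then have "real m = 0" "?n = 2" using n by auto
    then show ?thesis unfolding UU DU by simp
  qed
qed

text \<open>By \<open>UD_sums\<close> the contractions that change the degree by two vanish. The two
  that return to degree k have coefficients that combine, after division by 2k + n - 2, to the
  eigenvalue.\<close>

lemma TS_TS_sum:
  fixes u :: "'n::finite sdist"
  assumes n: "CARD('n) >= 2" and u: "hseq u"
  shows "(\<Sum>i\<in>UNIV. TS (axis i 1) (TS (axis i 1) u) k x) = - lam TYPE('n) k * u k x"
proof -
  let ?n = "real CARD('n)" let ?e = "%i::'n. axis i (1::real)"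
  note r = sph_harm_rpf[OF u[THEN spec]]
  have rU: "rpf (Up v j (u j))" "rpf (Dn v j (u j))" for v j by (intro rpf_Up rpf_Dn r)+
  have rS: "rpf (UpS v u j)" for v j by (cases j) (simp_all add: rU rpf_const)
  have Dn: "DnS v (TS v u) k x = (real k + ?n) * Dn v (Suc k) (Dn v (Suc (Suc k)) (u (Suc (Suc k)))) x - real k * Dn v (Suc k) (Up v k (u k)) x" for v
  proof -
    have "DnS v (TS v u) k x = Dn v (Suc k) (%x. (real k + ?n) * Dn v (Suc (Suc k)) (u (Suc (Suc k))) x - real k * Up v k (u k) x) x"
      unfolding DnS_def TS_def by (rule arg_cong[where f="%P. Dn v (Suc k) P x"]) (simp add: fun_eq_iff)
    then show ?thesis using Dn_diff[OF rpf_cmult[OF rU(2)] rpf_cmult[OF rU(1)]] by (simp add: Dn_cmult[OF rU(1)] Dn_cmult[OF rU(2)])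
  qed
  show ?thesis
  proof (cases k)
    case 0
    have "(\<Sum>i\<in>UNIV. TS (?e i) (TS (?e i) u) k x) = (real (Suc k) + ?n - 2) * ((real k + ?n) * (\<Sum>i\<in>UNIV. Dn (?e i) (Suc k) (Dn (?e i) (Suc (Suc k)) (u (Suc (Suc k)))) x))"
      unfolding TS_def[of _ "TS _ u"] Dn using 0 by (simp add: sum_distrib_left)
    then show ?thesis unfolding DnDn_sum[OF n u[THEN spec]] using 0 by (simp add: lam_def)
  next
    case (Suc j)
    have Up: "UpS v (TS v u) k x = (real k + ?n - 2) * Up v j (Dn v k (u k)) x + (1 - real j) * Up v j (UpS v u j) x" for v
    proof -
      have "UpS v (TS v u) k x = Up v j (%x. (real k + ?n - 2) * Dn v k (u k) x + (1 - real j) * UpS v u j x) x"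
        unfolding Suc UpS_simps TS_def DnS_def ..
      then show ?thesis using Up_add[OF rpf_cmult[OF rU(2)] rpf_cmult[OF rS]] by (simp add: Up_cmult[OF rS] Up_cmult[OF rU(2)])
    qed
    have UU: "(\<Sum>i\<in>UNIV. Up (?e i) j (UpS (?e i) u j) x) = 0"
    proof (cases j)
      case 0 then show ?thesis by (simp add: Up_def Dn_def)
    next
      case (Suc i) show ?thesis unfolding Suc UpS_simps by (rule UpUp_sum[OF n u[THEN spec]])
    qed
    have k: "k > 0" using Suc by simp
    let ?q = "2 * real k + ?n - 2"
    have q: "?q > 0" using k n by simp
    have "(\<Sum>i\<in>UNIV. TS (?e i) (TS (?e i) u) k x) =
       (real (Suc k) + ?n - 2) * ((real k + ?n) * (\<Sum>i\<in>UNIV. Dn (?e i) (Suc k) (Dn (?e i) (Suc (Suc k)) (u (Suc (Suc k)))) x)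
           - real k * (\<Sum>i\<in>UNIV. Dn (?e i) (Suc k) (Up (?e i) k (u k)) x))
       + (1 - real k) * ((real k + ?n - 2) * (\<Sum>i\<in>UNIV. Up (?e i) j (Dn (?e i) k (u k)) x) + (1 - real j) * (\<Sum>i\<in>UNIV. Up (?e i) j (UpS (?e i) u j) x))"
      unfolding TS_def[of _ "TS _ u"] Dn Up unfolding sum.distrib sum_distrib_left[symmetric] sum_subtractf ..
    also have "... = (real (Suc k) + ?n - 2) * (- real k * ((real k + ?n - 2) / ?q * u k x)) + (1 - real k) * ((real k + ?n - 2) * (real k / ?q * u k x))"
      unfolding DnDn_sum[OF n u[THEN spec]] UU DnUp_sum[OF n u[THEN spec] k] UpDn_sum[OF n u[THEN spec]] by simp
    also have "... = - (real k * (real k + ?n - 2)) * u k x * ((real (Suc k) + ?n - 2 - (1 - real k)) / ?q)"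
      by (simp only: divide_inverse) algebra
    also have "(real (Suc k) + ?n - 2 - (1 - real k)) / ?q = 1" using q by simp
    finally show ?thesis by (simp add: lam_def)
  qed
qed

lemma ZZ_space_derivative:
  fixes c :: "real => 'n::finite sdist"
  assumes n: "CARD('n) >= 2" and c: "DD 1 c" and t: "t > 0" and x: "x ~= 0"
  shows "(ZZ (c t) has_derivative (%v. ZZ (TS v (c t)) x / norm x)) (at x)"
proof -
  obtain c' where c': "dcl c" "tder c c'" "dcl c'" using c by auto
  have "((%x. (t, x)) has_derivative (%v. (0, v))) (at x)" by (intro has_derivative_Pair has_derivative_const has_derivative_ident)
  from has_derivative_compose[OF this ZZ_has_derivative[OF n c'(1,3,2) t x]] show ?thesis by simp
qed

lemma ZZ_time_derivative:
  fixes c :: "real => 'n::finite sdist"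
  assumes n: "CARD('n) >= 2" and c: "dcl c" "dcl c'" "tder c c'" and t: "t > 0" and x: "x ~= 0"
  shows "((%ta. ZZ (c ta) x) has_real_derivative ZZ (c' t) x) (at t)"
proof -
  note D = ZZ_has_derivative[OF n c t x]
  have "ZZ (TS 0 (c t)) x / norm x = 0" using linear_0[OF has_derivative_linear[OF D]] by simp
  moreover have "((%ta. (ta, x)) has_derivative (%h. (h, 0))) (at t)" by (intro has_derivative_Pair has_derivative_const has_derivative_ident)
  ultimately show ?thesis using has_derivative_compose[of "%ta. (ta, x)" "%h. (h, 0)" t UNIV, OF _ D]
    using x by (simp add: has_field_derivative_def mult_commute_abs)
qed

context doi_sol begin

lemma f1: "DD 1 f" using f_DD .

lemma TS1: "DD 1 (%t. TS v (f t))" by (rule DD_MlS_TS(2)[OF n2 f1])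

lemma D_linear: assumes t: "t > 0" and w: "\<omega> ~= 0"
  shows "(\<Sum>i\<in>UNIV. v $ i * ZZ (TS (axis i 1) (f t)) \<omega>) = ZZ (TS v (f t)) \<omega>"
proof -
  have l: "linear (%v. ZZ (TS v (f t)) \<omega> / norm \<omega>)" by (rule has_derivative_linear[OF ZZ_space_derivative[OF n2 f1 t w]])
  have "v = (\<Sum>i\<in>UNIV. v $ i *\<^sub>R axis i 1)" by (simp add: vec_eq_iff axis_def if_distrib[of "(*) _"] cong: if_cong)
  then have "ZZ (TS v (f t)) \<omega> / norm \<omega> = (\<Sum>i\<in>UNIV. v $ i *\<^sub>R (ZZ (TS (axis i 1) (f t)) \<omega> / norm \<omega>))"
    using linear_sum[OF l, of "%i. v $ i *\<^sub>R axis i 1" UNIV] linear_scale[OF l] by simp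
  then have "ZZ (TS v (f t)) \<omega> / norm \<omega> = (\<Sum>i\<in>UNIV. v $ i * ZZ (TS (axis i 1) (f t)) \<omega>) / norm \<omega>" by (simp add: sum_divide_distrib)
  then show ?thesis using w by simp
qed

lemma D_radial: assumes t: "t > 0" and w: "norm \<omega> = 1" shows "ZZ (TS \<omega> (f t)) \<omega> = 0"
proof -
  have w0: "\<omega> ~= 0" "\<omega> /\<^sub>R norm \<omega> = \<omega>" using w by auto
  have "TT \<omega> k (f t k) \<omega> = 0" for k
    using Euler_homog[OF frpf sph_harm_homog[OF fh], of \<omega> t k] w by (simp add: TT_def dot_square_norm)
  then show ?thesis using ZZ_TS(2)[OF n2 f_dcl t w0(1), of \<omega>] w0(2) by simp
qed

lemma zext_F: "y ~= 0 ==> zext (ZZ u) y = ZZ u y" unfolding zext_def by (rule ZZ_normalize)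

lemma line_ne0: assumes w: "norm \<omega> = 1" shows "\<forall>\<^sub>F u in nhds (0::real). \<omega> + u *\<^sub>R v ~= 0"
proof -
  have "((%u. \<omega> + u *\<^sub>R v) \<longlongrightarrow> \<omega> + 0 *\<^sub>R v) (nhds 0)" by (intro tendsto_intros filterlim_ident)
  then have "((%u. \<omega> + u *\<^sub>R v) \<longlongrightarrow> \<omega>) (nhds 0)" by simp
  moreover have "\<omega> ~= 0" using w by auto
  ultimately show ?thesis using tendsto_imp_eventually_ne by blast
qed

text \<open>The first derivative of the extension is \<open>ZZ\<close> of the \<open>TS\<close>
  components divided by |x|. Differentiating 1 / |x| leaves a term with factor \<omega>_i, and these
  add up to the radial derivative, which is 0.\<close>

lemma lapS_F:
  assumes t: "t > 0" and w: "norm \<omega> = 1"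
  shows "lapS (ZZ (f t)) \<omega> = ZZ (%k x. - lam TYPE('n) k * f t k x) \<omega>"
proof -
  have w0: "\<omega> ~= 0" using w by auto
  let ?e = "%i::'n. axis i (1::real)" let ?T = "%i. TS (?e i) (f t)"
  have d: "deriv (deriv (%v. zext (ZZ (f t)) (\<omega> + v *\<^sub>R ?e i))) 0 = ZZ (TS (?e i) (?T i)) \<omega> - \<omega> $ i * ZZ (?T i) \<omega>" for i
  proof -
    have 1: "deriv (%v. zext (ZZ (f t)) (\<omega> + v *\<^sub>R ?e i)) u = ZZ (?T i) (\<omega> + u *\<^sub>R ?e i) * inverse (norm (\<omega> + u *\<^sub>R ?e i)) ^ 1" if u: "\<omega> + u *\<^sub>R ?e i ~= 0" for u
    proof -
      let ?x = "\<omega> + u *\<^sub>R ?e i"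
      have "(zext (ZZ (f t)) has_derivative (%v. ZZ (TS v (f t)) ?x / norm ?x)) (at ?x)"
        by (rule has_derivative_transform_within_open[OF ZZ_space_derivative[OF n2 f1 t u], of "-{0}"]) (use u in \<open>auto simp: zext_F[symmetric]\<close>)
      from deriv_line[OF this] show ?thesis by (simp add: DERIV_imp_deriv divide_inverse)
    qed
    have ev: "\<forall>\<^sub>F u in nhds 0. deriv (%v. zext (ZZ (f t)) (\<omega> + v *\<^sub>R ?e i)) u = ZZ (?T i) (\<omega> + u *\<^sub>R ?e i) * inverse (norm (\<omega> + u *\<^sub>R ?e i)) ^ 1"
      using line_ne0[OF w] by (rule eventually_mono) (rule 1)
    have 2: "((%x. ZZ (?T i) x * inverse (norm x) ^ 1) has_derivative (%v. ZZ (?T i) \<omega> * (- real 1 * (v \<bullet> (\<omega> /\<^sub>R norm \<omega>)) * inverse (norm \<omega>) ^ Suc 1) + ZZ (TS v (?T i)) \<omega> / norm \<omega> * inverse (norm \<omega>) ^ 1)) (at \<omega>)"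
      by (rule has_derivative_mult[OF ZZ_space_derivative[OF n2 TS1 t w0] inverse_norm_power_deriv[OF w0]])
    then have "((%x. ZZ (?T i) x * inverse (norm x) ^ 1) has_derivative (%v. ZZ (?T i) \<omega> * (- real 1 * (v \<bullet> (\<omega> /\<^sub>R norm \<omega>)) * inverse (norm \<omega>) ^ Suc 1) + ZZ (TS v (?T i)) \<omega> / norm \<omega> * inverse (norm \<omega>) ^ 1)) (at (\<omega> + 0 *\<^sub>R ?e i))" by simp
    from DERIV_imp_deriv[OF deriv_line[OF this]] deriv_cong_ev[OF ev refl] show ?thesis
      by (simp add: w inner_axis' inner_axis algebra_simps)
  qed
  have "lapS (ZZ (f t)) \<omega> = (\<Sum>i\<in>UNIV. ZZ (TS (?e i) (?T i)) \<omega>) - (\<Sum>i\<in>UNIV. \<omega> $ i * ZZ (?T i) \<omega>)"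
    unfolding lapS_def lap_def d by (simp add: sum_subtractf)
  also have "(\<Sum>i\<in>UNIV. \<omega> $ i * ZZ (?T i) \<omega>) = 0" using D_linear[OF t w0, of \<omega>] D_radial[OF t w] by simp
  also have "(\<Sum>i\<in>UNIV. ZZ (TS (?e i) (?T i)) \<omega>) = (\<Sum>k. \<Sum>i\<in>UNIV. TS (?e i) (?T i) k (\<omega> /\<^sub>R norm \<omega>))"
    unfolding ZZ_sphere
  proof (rule suminf_sum[symmetric])
    fix i
    have "dcl (%t. TS (?e i) (TS (?e i) (f t)))" using DD_MlS_TS(2)[OF n2 TS1] DD_dcl by blast
    then show "summable (%k. TS (?e i) (?T i) k (\<omega> /\<^sub>R norm \<omega>))" by (rule dcl_summable[OF n2 _ t sphere_normalized[OF w0]])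
  qed
  also have "... = ZZ (%k x. - lam TYPE('n) k * f t k x) \<omega>"
    unfolding ZZ_sphere using TS_TS_sum[OF n2, of "f t"] fh by simp
  finally show ?thesis by simp
qed

text \<open>The product rule: the derivative of the density gives \<open>TS\<close> in direction J,
  since the radial part vanishes, and the projected constant field J has divergence - (n - 1) J .
  \<omega> on the sphere.\<close>

lemma tdiv_F:
  assumes t: "t > 0" and w: "norm \<omega> = 1"
  shows "tdiv (%x. ZZ (f t) x *\<^sub>R (J - (x \<bullet> J) *\<^sub>R x)) \<omega> = ZZ (TS J (f t)) \<omega> - (real CARD('n) - 1) * ((J \<bullet> \<omega>) * ZZ (f t) \<omega>)"
proof -
  have w0: "\<omega> ~= 0" using w by auto
  let ?e = "%i::'n. axis i (1::real)" let ?N = "%x::real^'n. x /\<^sub>R norm x" let ?F = "ZZ (f t)"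
  let ?V = "%x. ?F x *\<^sub>R (J - (x \<bullet> J) *\<^sub>R x)"
  let ?dN = "%v. v - (\<omega> \<bullet> v) *\<^sub>R \<omega>"
  have N: "(?N has_derivative ?dN) (at \<omega>)" using has_derivative_normalize[OF w0] w by simp
  have F: "(?F has_derivative (%v. ZZ (TS v (f t)) \<omega>)) (at \<omega>)" using ZZ_space_derivative[OF n2 f1 t w0] w by simp
  have d: "deriv (%u. zext ?V (\<omega> + u *\<^sub>R ?e i) $ i) 0 =
     ?F \<omega> * (- ((\<omega> \<bullet> J) * (1 - \<omega> $ i * \<omega> $ i) + (J $ i - \<omega> $ i * (\<omega> \<bullet> J)) * \<omega> $ i)) + ZZ (TS (?e i) (f t)) \<omega> * (J $ i - (\<omega> \<bullet> J) * \<omega> $ i)" for i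
  proof -
    have c: "((%x. ?N x $ i) has_derivative (%v. ?dN v $ i)) (at \<omega>)" using bounded_linear.has_derivative[OF bounded_linear_vec_nth N] .
    have j: "((%x. ?N x \<bullet> J) has_derivative (%v. ?dN v \<bullet> J)) (at \<omega>)" by (rule has_derivative_inner_left[OF N])
    have "((%x. ?F x * (J $ i - (?N x \<bullet> J) * ?N x $ i)) has_derivative
       (%v. ?F \<omega> * (0 - ((?N \<omega> \<bullet> J) * ?dN v $ i + ?dN v \<bullet> J * ?N \<omega> $ i)) + ZZ (TS v (f t)) \<omega> * (J $ i - (?N \<omega> \<bullet> J) * ?N \<omega> $ i))) (at \<omega>)"
      by (intro has_derivative_mult[OF F] has_derivative_diff[OF has_derivative_const] has_derivative_mult[OF j c])
    then have "((%x. zext ?V x $ i) has_derivative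
       (%v. ?F \<omega> * (0 - ((?N \<omega> \<bullet> J) * ?dN v $ i + ?dN v \<bullet> J * ?N \<omega> $ i)) + ZZ (TS v (f t)) \<omega> * (J $ i - (?N \<omega> \<bullet> J) * ?N \<omega> $ i))) (at \<omega>)"
    proof (rule has_derivative_transform_within_open[of _ _ _ _ "-{0}"])
      fix x :: "real^'n" assume "x : - {0}"
      then have "ZZ (f t) (?N x) = ZZ (f t) x" using ZZ_normalize by blast
      then show "?F x * (J $ i - (?N x \<bullet> J) * ?N x $ i) = zext ?V x $ i" unfolding zext_def by simp
    qed (use w0 in auto)
    then have "((%x. zext ?V x $ i) has_derivative
       (%v. ?F \<omega> * (0 - ((?N \<omega> \<bullet> J) * ?dN v $ i + ?dN v \<bullet> J * ?N \<omega> $ i)) + ZZ (TS v (f t)) \<omega> * (J $ i - (?N \<omega> \<bullet> J) * ?N \<omega> $ i))) (at (\<omega> + 0 *\<^sub>R ?e i))" by simp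
    from DERIV_imp_deriv[OF deriv_line[OF this]] show ?thesis
      by (simp add: w inner_axis inner_axis' inner_diff_left)
  qed
  have w2: "(\<Sum>i\<in>UNIV. \<omega> $ i * \<omega> $ i) = 1" using w dot_square_norm[of \<omega>] by (simp add: inner_vec_def)
  have Jw: "(\<Sum>i\<in>UNIV. J $ i * \<omega> $ i) = \<omega> \<bullet> J" by (simp add: inner_vec_def mult.commute)
  have "tdiv ?V \<omega> = (\<Sum>i\<in>UNIV. - ?F \<omega> * ((\<omega> \<bullet> J) * (1 - \<omega> $ i * \<omega> $ i)) - ?F \<omega> * (J $ i * \<omega> $ i) + ?F \<omega> * ((\<omega> \<bullet> J) * (\<omega> $ i * \<omega> $ i))
     + J $ i * ZZ (TS (?e i) (f t)) \<omega> - (\<omega> \<bullet> J) * (\<omega> $ i * ZZ (TS (?e i) (f t)) \<omega>))"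
    unfolding tdiv_def d by (intro sum.cong refl) (simp add: algebra_simps)
  also have "... = - ?F \<omega> * ((\<omega> \<bullet> J) * (real CARD('n) - 1)) - ?F \<omega> * (\<omega> \<bullet> J) + ?F \<omega> * ((\<omega> \<bullet> J) * 1) + ZZ (TS J (f t)) \<omega> - (\<omega> \<bullet> J) * 0"
    unfolding sum.distrib sum_subtractf sum_distrib_left[symmetric] w2 Jw D_linear[OF t w0] D_radial[OF t w] by simp
  finally show ?thesis by (simp add: inner_commute algebra_simps)
qed

lemma F_pde:
  assumes t: "t > 0" and w: "\<omega> : sphere 0 1"
  shows "deriv (%ta. ZZ (f ta) \<omega>) t = - tdiv (%x. ZZ (f t) x *\<^sub>R (Jv (f t) - (x \<bullet> Jv (f t)) *\<^sub>R x)) \<omega> + \<sigma> * lapS (ZZ (f t)) \<omega>"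
proof -
  have w: "norm \<omega> = 1" using w by simp
  have w0: "\<omega> ~= 0" "\<omega> /\<^sub>R norm \<omega> = \<omega>" using w by auto
  have J: "Jv (f t) = jv (f t 1)" by (rule Jv_jv[OF n2]) (use fh in blast)
  let ?J = "jv (f t 1)" let ?n = "real CARD('n)"
  have D: "deriv (%ta. ZZ (f ta) \<omega>) t = ZZ (fd t) \<omega>"
    by (rule DERIV_imp_deriv[OF ZZ_time_derivative[OF n2 f_dcl DD_dcl[OF fd_DD[OF f1]] f_tder t w0(1)]])
  have ll: "ebd (%k. - lam TYPE('n) k)" using ebd_lam[OF n2] unfolding ebd_def by simp
  have m1: "ebd (%k. - 1)" "ebd (%k. 0)" using ebd_linear[of 0 "-1"] ebd_linear[of 0 0] by simp_all
  have dL: "dcl (%t k x. - lam TYPE('n) k * f t k x)" using DD_dcl[OF DD_diag[OF f1 ll]] .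
  have dT: "dcl (%t. TS v (f t))" for v using DD_dcl[OF TS1] .
  have dM: "dcl (%t. MlS v (f t))" for v using DD_dcl[OF DD_MlS_TS(1)[OF n2 f1]] .
  have d0: "dcl (%t k x. 0)" using DD_dcl[OF DD_zero] .
  have dA: "dcl (%t k x. 0 + (- 1) * TS v (f t) k x)" for v
    using DD_dcl[OF DD_add[OF DD_zero DD_diag[OF TS1 m1(1)]]] .
  have dB: "dcl (%t k x. (0 + (- 1) * TS v (f t) k x) + (?n - 1) * MlS v (f t) k x)" for v
    using DD_dcl[OF DD_add[OF DD_add[OF DD_zero DD_diag[OF TS1 m1(1)]] DD_diag[OF DD_MlS_TS(1)[OF n2 f1] ebd_linear[of 0 "?n - 1"]]]] by simp
  \<comment> \<open>In components the drift equals - \<open>TS\<close> + (n - 1) \<open>MlS\<close>: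
    for \<open>UpS\<close> the coefficient is (k - 1) + (n - 1), for \<open>DnS\<close> it is - (k +
    n - 1) + (n - 1). The leading 0 and the factor - 1 fit the pattern of
    \<open>ZZ_lin\<close>.\<close>
  have "fd t = (%k x. ((0 + (- 1) * TS ?J (f t) k x) + (?n - 1) * MlS ?J (f t) k x) + \<sigma> * (- lam TYPE('n) k * f t k x))"
    by (intro ext) (simp add: fd_def bt_UpS_DnS TS_def MlS_def algebra_simps)
  then have "ZZ (fd t) \<omega> = ZZ (%k x. ((0 + (- 1) * TS ?J (f t) k x) + (?n - 1) * MlS ?J (f t) k x) + \<sigma> * (- lam TYPE('n) k * f t k x)) \<omega>" by (rule arg_cong)
  also have "... = (0 + (- 1) * ZZ (TS ?J (f t)) \<omega>) + (?n - 1) * ZZ (MlS ?J (f t)) \<omega> + \<sigma> * lapS (ZZ (f t)) \<omega>"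
  proof -
    have 0: "ZZ (%k x. 0) \<omega> = 0" by (simp add: ZZ_sphere)
    show ?thesis unfolding ZZ_lin[OF n2 dB dL t w0(1)] ZZ_lin[OF n2 dA dM t w0(1)] ZZ_lin[OF n2 d0 dT t w0(1)] 0 lapS_F[OF t w] ..
  qed
  also have "... = - tdiv (%x. ZZ (f t) x *\<^sub>R (?J - (x \<bullet> ?J) *\<^sub>R x)) \<omega> + \<sigma> * lapS (ZZ (f t)) \<omega>"
    unfolding tdiv_F[OF t w] ZZ_MlS[OF n2 f_dcl t w0(1), symmetric] w0(2) by simp
  finally show ?thesis unfolding D J .
qed

text \<open>This identifies the smooth function with the distribution \<open>f t\<close>:
  exponential decay allows integration term by term, and orthogonality leaves degree l.\<close>

lemma F_coeff:
  assumes t: "t > 0" and Y: "sph_harm l Y"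
  shows "sph_int (%x. ZZ (f t) x * Y x) = sph_int (%x. f t l x * Y x)"
proof -
  obtain C where C: "C >= 0" "!!k x. norm x = 1 ==> \<bar>f t k x\<bar> <= C * exp (- real k)"
    using dcl_sup[OF n2 f_dcl t, of 1 t] by auto
  let ?B = "(real CARD('n))^(2*l) * sqrt (sqn Y)"
  have Yb: "\<bar>Y x\<bar> <= ?B" if "norm x = 1" for x using harm_sup_bound[OF n2 Y, of x] that by simp
  have B: "?B >= 0" using sqn_nonneg[OF sph_harm_rpf[OF Y]] by simp
  let ?g = "%k x. f t k x * Y x"
  have gc: "continuous_on S (?g k)" for k S
    by (rule rpf_continuous_on[OF rpf_mult[OF frpf sph_harm_rpf[OF Y]]])
  have gb: "\<bar>?g k x\<bar> <= (C * ?B) * exp (- real k)" if "norm x = 1" for k x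
    using mult_mono[OF C(2)[OF that] Yb[OF that]] C(1) B by (simp add: abs_mult mult_ac)
  have sm: "summable (%k. \<bar>?g k x\<bar>)" if "norm x = 1" for x
    by (rule summable_comparison_test'[OF exp_decay_summable[of "C * ?B"]]) (use gb[OF that] in simp)
  have "sph_int (%x. ZZ (f t) x * Y x) = sph_int (%x. \<Sum>k. ?g k x)"
  proof (rule sph_int_cong)
    fix x :: "real^'n" assume x: "norm x = 1"
    then show "ZZ (f t) x * Y x = (\<Sum>k. ?g k x)" unfolding ZZ_sphere using suminf_mult2[OF dcl_summable[OF n2 f_dcl t x], of "Y x"] by simp
  qed
  also have "... = (\<Sum>k. sph_int (?g k))"
    unfolding sph_int_def
  proof (rule integral_suminf)
    show "integrable sphere_measure (?g k)" for k by (rule sph_integrable[OF gc])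
    show "AE x in sphere_measure. summable (%k. norm (?g k x))" using sm by (intro AE_I2) simp
    have "norm (sph_int (%x. \<bar>?g k x\<bar>)) <= (C * ?B) * exp (- real k)" for k
    proof -
      have "sph_int (%x. \<bar>?g k x\<bar>) <= sph_int (%x::real^'n. (C * ?B) * exp (- real k))"
        unfolding sph_int_def by (rule integral_mono) (use gb gc in \<open>auto intro!: sph_integrable continuous_on_rabs\<close>)
      moreover have "sph_int (%x. \<bar>?g k x\<bar>) >= 0" unfolding sph_int_def by (rule Bochner_Integration.integral_nonneg) simp
      ultimately show ?thesis unfolding sph_int_const by simp
    qed
    then show "summable (%k. integral\<^sup>L sphere_measure (%x. norm (?g k x)))"
      using summable_comparison_test'[OF exp_decay_summable[of "C * ?B"], of 0 "%k. sph_int (%x. \<bar>?g k x\<bar>)"] by (simp add: sph_int_def)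
  qed
  also have "... = (\<Sum>k\<in>{l}. sph_int (?g k))"
  proof (rule suminf_finite)
    fix k assume "k \<notin> {l}"
    then show "sph_int (?g k) = 0" using ip_orth[OF n2 fh Y] by (simp add: ip_def)
  qed simp
  finally show ?thesis by simp
qed

end

section \<open>Analyticity by majorants\<close>

definition mon :: "real^'n => ('n => nat) => real" where
  "mon h al = (\<Prod>i\<in>UNIV. (h $ i) ^ al i)"

text \<open>Bound on the majorant norm \<open>\<Sum>\<alpha>. |c \<alpha>| r^|\<alpha>|\<close>, which is submultiplicative.\<close>

definition maj :: "real^'n => real => real => (real^'n => real) => bool" where
  "maj x0 r M g \<longleftrightarrow> (\<exists>c. (\<exists>m\<le>M. ((%al. \<bar>c al\<bar> * r ^ sum al UNIV) has_sum m) UNIV) \<and>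
     (\<forall>x\<in>ball x0 r. ((%al. c al * mon (x - x0) al) has_sum g x) UNIV))"

lemma mon_bound: assumes "norm h <= r" shows "\<bar>mon h al\<bar> <= r ^ sum al UNIV"
proof -
  have "\<bar>mon h al\<bar> = (\<Prod>i\<in>UNIV. \<bar>h $ i\<bar> ^ al i)" by (simp add: mon_def abs_prod power_abs)
  also have "... <= (\<Prod>i\<in>UNIV. r ^ al i)"
    by (intro prod_mono conjI power_mono zero_le_power abs_ge_zero) (meson assms component_le_norm_cart order_trans)
  finally show ?thesis by (simp add: power_sum)
qed

lemma has_sum_swap: "(f has_sum S) (A \<times> B) ==> ((%(y, x). f (x, y)) has_sum S) (B \<times> A)"
  by (rule has_sum_reindex_bij_witness[where i=prod.swap and j=prod.swap, THEN iffD1, rotated -1]) auto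

text \<open>Fubini for the double family indexed by i and the multi-index: the majorant norms make
  it absolutely summable, so the coefficients may be summed over i first. The other rules for sums,
  products and compositions rest on this one.\<close>

lemma maj_sum:
  assumes r: "r > 0" and g: "!!i. i : I ==> maj x0 r (M i) (g i)" and M: "(M has_sum N) I"
    and G: "!!x. x : ball x0 r ==> ((%i. g i x) has_sum G x) I"
  shows "maj x0 r N G"
proof -
  let ?R = "%al. r ^ sum al UNIV"
  have "\<forall>i\<in>I. \<exists>c m. m <= M i & ((%al. \<bar>c al\<bar> * ?R al) has_sum m) UNIV & (\<forall>x\<in>ball x0 r. ((%al. c al * mon (x - x0) al) has_sum g i x) UNIV)"
    using g unfolding maj_def by blast
  from bchoice[OF this] obtain c where "\<forall>i\<in>I. \<exists>m. m <= M i & ((%al. \<bar>c i al\<bar> * ?R al) has_sum m) UNIV & (\<forall>x\<in>ball x0 r. ((%al. c i al * mon (x - x0) al) has_sum g i x) UNIV)" by blast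
  from bchoice[OF this] obtain m where c: "!!i. i : I ==> m i <= M i" "!!i. i : I ==> ((%al. \<bar>c i al\<bar> * ?R al) has_sum m i) UNIV"
    "!!i x. i : I ==> x : ball x0 r ==> ((%al. c i al * mon (x - x0) al) has_sum g i x) UNIV"
    by blast
  have m0: "m i >= 0" if "i : I" for i using has_sum_nonneg[OF c(2)[OF that]] r by simp
  let ?A = "%(i, al). \<bar>c i al\<bar> * ?R al"
  have nA: "norm (?A p) = ?A p" for p using r by (auto simp: split_beta abs_mult)
  have nA': "norm (\<bar>c i al\<bar> * ?R al) = \<bar>c i al\<bar> * ?R al" for i al using r by simp
  have mi: "infsum (%al. norm (?A (i, al))) UNIV = m i" if "i : I" for i
    using infsumI[OF c(2)[OF that]] by (simp only: prod.case nA')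
  have ms: "m summable_on I" using M c(1) m0 summable_on_comparison_test[of M I m] by (auto simp: summable_on_def)
  have "(%i. norm (infsum (%al. norm (?A (i, al))) UNIV)) summable_on I"
    using ms by (rule summable_on_cong[THEN iffD1, rotated]) (use mi m0 in simp)
  moreover have "(%al. norm (?A (i, al))) summable_on UNIV" if "i : I" for i
    using c(2)[OF that] unfolding prod.case nA' summable_on_def by blast
  ultimately have Aabs: "(%p. norm (?A p)) summable_on (I \<times> UNIV)" unfolding Infinite_Sum.abs_summable_on_Sigma_iff by blast
  then have "?A summable_on (I \<times> UNIV)" by (simp only: nA)
  then obtain S where S: "(?A has_sum S) (I \<times> UNIV)" by (auto simp: summable_on_def)
  have "(m has_sum S) I" by (rule has_sum_SigmaD[OF S]) (use c(2) in simp)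
  then have SN: "S <= N" using has_sum_mono[OF _ M c(1)] by blast
  note Sw = has_sum_swap[OF S]
  then have "(%(al, i). ?A (i, al)) summable_on (UNIV \<times> I)" by (auto simp: summable_on_def)
  then have "(%p. norm ((%(al, i). ?A (i, al)) p)) summable_on (UNIV \<times> I)" by (rule summable_on_cong[THEN iffD1, rotated]) (use nA' in \<open>simp add: split_beta\<close>)
  then have i1: "(%i. norm (?A (i, al))) summable_on I" for al unfolding Infinite_Sum.abs_summable_on_Sigma_iff by simp
  define a where "a al = infsum (%i. ?A (i, al)) I" for al
  have aS: "(a has_sum S) UNIV"
  proof (rule has_sum_SigmaD[OF Sw])
    fix al show "((%y. case (al, y) of (y, x) => ?A (x, y)) has_sum a al) I"
      unfolding a_def prod.case using has_sum_infsum[OF abs_summable_summable[OF i1]] by simp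
  qed
  have ci: "(%i. norm (c i al)) summable_on I" for al
  proof -
    have "(%i. inverse (?R al) * (\<bar>c i al\<bar> * ?R al)) summable_on I"
      using abs_summable_summable[OF i1, of al] by (intro summable_on_cmult_right) simp
    then show ?thesis using r by (simp add: field_simps)
  qed
  define c' where "c' al = infsum (%i. c i al) I" for al
  have le: "\<bar>c' al\<bar> * ?R al <= a al" for al
  proof -
    have "\<bar>c' al\<bar> * ?R al <= infsum (%i. \<bar>c i al\<bar>) I * ?R al"
      unfolding c'_def using norm_infsum_bound[OF ci, of al] r by (intro mult_right_mono) auto
    also have "... = a al" unfolding a_def prod.case by (rule infsum_cmult_left[symmetric]) (use ci in auto)
    finally show ?thesis .
  qed
  have "(%al. \<bar>c' al\<bar> * ?R al) summable_on UNIV"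
  proof (rule summable_on_comparison_test)
    show "a summable_on UNIV" using aS unfolding summable_on_def by blast
    show "\<bar>c' al\<bar> * ?R al <= a al" for al by (rule le)
    show "0 <= \<bar>c' al\<bar> * ?R al" for al using r by simp
  qed
  then obtain m' where m': "((%al. \<bar>c' al\<bar> * ?R al) has_sum m') UNIV" by (auto simp: summable_on_def)
  then have "m' <= S" using has_sum_mono[OF _ aS] le by blast
  moreover have "((%al. c' al * mon (x - x0) al) has_sum G x) UNIV" if x: "x : ball x0 r" for x
  proof -
    let ?B = "%(i, al). c i al * mon (x - x0) al"
    have xr: "norm (x - x0) <= r" using x by (simp add: dist_norm norm_minus_commute)
    have "(%p. norm (?B p)) summable_on (I \<times> UNIV)"
    proof (rule Infinite_Sum.abs_summable_on_comparison_test[OF Aabs])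
      fix p show "norm (?B p) <= norm (?A p)" using order_trans[OF mon_bound[OF xr] abs_ge_self] by (auto simp: split_beta abs_mult intro!: mult_left_mono)
    qed
    then obtain S' where S': "(?B has_sum S') (I \<times> UNIV)" using abs_summable_summable summable_on_def by blast
    have "((%i. g i x) has_sum S') I" by (rule has_sum_SigmaD[OF S']) (use c(3)[OF _ x] in simp)
    then have "S' = G x" using has_sum_unique[OF _ G[OF x]] by blast
    moreover have "((%al. c' al * mon (x - x0) al) has_sum S') UNIV"
    proof (rule has_sum_SigmaD[OF has_sum_swap[OF S']])
      fix al show "((%y. case (al, y) of (y, x) => ?B (x, y)) has_sum c' al * mon (x - x0) al) I"
        unfolding c'_def prod.case by (rule has_sum_cmult_left[OF has_sum_infsum[OF abs_summable_summable[OF ci]]])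
    qed
    ultimately show ?thesis by simp
  qed
  ultimately show ?thesis unfolding maj_def using m' SN by (intro exI[of _ c'] conjI exI[of _ m']) auto
qed

lemma maj_nonneg: fixes x0 :: "real^'n" assumes "r > 0" "maj x0 r M g" shows "M >= 0"
proof -
  obtain c :: "('n => nat) => real" and m where "m <= M" "((%al. \<bar>c al\<bar> * r ^ sum al UNIV) has_sum m) UNIV" using assms(2) unfolding maj_def by blast
  then show ?thesis using has_sum_nonneg[of "%al. \<bar>c al\<bar> * r ^ sum al UNIV" UNIV m] assms(1) by auto
qed

lemma maj_mono: "maj x0 r M g ==> M <= N ==> maj x0 r N g"
  unfolding maj_def by (meson order_trans)

lemma maj_cong: "maj x0 r M g ==> (!!x. x : ball x0 r ==> g x = h x) ==> maj x0 r M h"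
  unfolding maj_def by simp

lemma maj_bound: assumes "maj x0 r M g" "x : ball x0 r" shows "\<bar>g x\<bar> <= M"
proof -
  obtain c m where c: "m <= M" "((%al. \<bar>c al\<bar> * r ^ sum al UNIV) has_sum m) UNIV" "((%al. c al * mon (x - x0) al) has_sum g x) UNIV"
    using assms unfolding maj_def by blast
  have xr: "norm (x - x0) <= r" using assms(2) by (simp add: dist_norm norm_minus_commute)
  have "norm (g x) <= m"
    by (rule norm_infsum_le[OF c(3,2)]) (use mon_bound[OF xr] in \<open>auto simp: abs_mult intro!: mult_left_mono\<close>)
  then show ?thesis using c(1) by simp
qed

text \<open>The coefficients are only shifted, by the injection that adds \<open>al\<close> to a
  multi-index, and the majorant norm is multiplied by the corresponding power of r.\<close>

lemma maj_monomial:
  assumes r: "r > 0" and g: "maj x0 r M g"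
  shows "maj x0 r (r ^ sum al UNIV * M) (%x. mon (x - x0) al * g x)"
proof -
  obtain c m where c: "m <= M" "((%al. \<bar>c al\<bar> * r ^ sum al UNIV) has_sum m) UNIV" "!!x. x : ball x0 r ==> ((%al. c al * mon (x - x0) al) has_sum g x) UNIV"
    using g unfolding maj_def by blast
  let ?h = "%\<beta> i. al i + \<beta> i :: nat"
  define c' where "c' \<gamma> = (if \<gamma> : range ?h then c (%i. \<gamma> i - al i) else 0)" for \<gamma>
  have inj: "inj ?h" by (auto simp: inj_def fun_eq_iff)
  have c'h: "c' (?h \<beta>) = c \<beta>" for \<beta> unfolding c'_def by auto
  have *: "((%\<gamma>. F (c' \<gamma>) \<gamma>) has_sum S) UNIV" if F: "!!\<gamma>. F 0 \<gamma> = 0" and s: "((%\<beta>. F (c \<beta>) (?h \<beta>)) has_sum S) UNIV" for F :: "real => _ => real" and S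
  proof -
    have "((%\<gamma>. F (c' \<gamma>) \<gamma>) has_sum S) (range ?h)" unfolding has_sum_reindex[OF inj] o_def c'h by (rule s)
    then show ?thesis by (rule has_sum_cong_neutral[THEN iffD1, rotated -1]) (auto simp: c'_def F)
  qed
  have "((%\<gamma>. \<bar>c' \<gamma>\<bar> * r ^ sum \<gamma> UNIV) has_sum r ^ sum al UNIV * m) UNIV"
  proof (rule *)
    show "((%\<beta>. \<bar>c \<beta>\<bar> * r ^ sum (?h \<beta>) UNIV) has_sum r ^ sum al UNIV * m) UNIV"
      using has_sum_cmult_right[OF c(2), of "r ^ sum al UNIV"] by (simp add: sum.distrib power_add mult_ac)
  qed simp
  moreover have "r ^ sum al UNIV * m <= r ^ sum al UNIV * M" using c(1) r by simp
  moreover have "((%\<gamma>. c' \<gamma> * mon (x - x0) \<gamma>) has_sum mon (x - x0) al * g x) UNIV" if x: "x : ball x0 r" for x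
  proof (rule *)
    show "((%\<beta>. c \<beta> * mon (x - x0) (?h \<beta>)) has_sum mon (x - x0) al * g x) UNIV"
      using has_sum_cmult_right[OF c(3)[OF x], of "mon (x - x0) al"] by (simp add: mon_def power_add prod.distrib mult_ac)
  qed simp
  ultimately show ?thesis unfolding maj_def by blast
qed

lemma maj_scale: assumes g: "maj x0 r M g" shows "maj x0 r (\<bar>a\<bar> * M) (%x. a * g x)"
proof -
  obtain c m where c: "m <= M" "((%al. \<bar>c al\<bar> * r ^ sum al UNIV) has_sum m) UNIV" "!!x. x : ball x0 r ==> ((%al. c al * mon (x - x0) al) has_sum g x) UNIV"
    using g unfolding maj_def by blast
  have "((%al. \<bar>a * c al\<bar> * r ^ sum al UNIV) has_sum \<bar>a\<bar> * m) UNIV" using has_sum_cmult_right[OF c(2), of "\<bar>a\<bar>"] by (simp add: abs_mult mult_ac)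
  moreover have "((%al. a * c al * mon (x - x0) al) has_sum a * g x) UNIV" if "x : ball x0 r" for x
    using has_sum_cmult_right[OF c(3)[OF that], of a] by (simp add: mult_ac)
  moreover have "\<bar>a\<bar> * m <= \<bar>a\<bar> * M" using c(1) by (simp add: mult_left_mono)
  ultimately show ?thesis unfolding maj_def by (intro exI[of _ "%al. a * c al"] conjI exI[of _ "\<bar>a\<bar> * m"]) auto
qed

lemma maj_const: fixes x0 :: "real^'n" shows "maj x0 r \<bar>a\<bar> (%x. a)"
proof -
  let ?z = "%i::'n. 0::nat"
  let ?c = "%al. if al = ?z then a else 0"
  have "((%al. \<bar>?c al\<bar> * r ^ sum al UNIV) has_sum (\<Sum>al\<in>{?z}. \<bar>?c al\<bar> * r ^ sum al UNIV)) UNIV"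
    by (rule has_sum_finite_neutralI[of "{?z}"]) auto
  moreover have "((%al. ?c al * mon (x - x0) al) has_sum (\<Sum>al\<in>{?z}. ?c al * mon (x - x0) al)) UNIV" for x
    by (rule has_sum_finite_neutralI[of "{?z}"]) auto
  ultimately show ?thesis unfolding maj_def by (intro exI[of _ ?c] conjI exI[of _ "\<bar>a\<bar>"]) (auto simp: mon_def)
qed

text \<open>Only g is expanded. The product is then a sum of monomials times h, to which
  \<open>maj_sum\<close> applies, and no convolution of coefficients is needed.\<close>

lemma maj_mult:
  assumes r: "r > 0" and g: "maj x0 r M g" and h: "maj x0 r N h"
  shows "maj x0 r (M * N) (%x. g x * h x)"
proof -
  obtain c m where c: "m <= M" "((%al. \<bar>c al\<bar> * r ^ sum al UNIV) has_sum m) UNIV" "!!x. x : ball x0 r ==> ((%al. c al * mon (x - x0) al) has_sum g x) UNIV"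
    using g unfolding maj_def by blast
  have "maj x0 r (m * N) (%x. g x * h x)"
  proof (rule maj_sum[OF r])
    show "maj x0 r (\<bar>c al\<bar> * (r ^ sum al UNIV * N)) (%x. c al * (mon (x - x0) al * h x))" for al
      by (rule maj_scale[OF maj_monomial[OF r h]])
    show "((%al. \<bar>c al\<bar> * (r ^ sum al UNIV * N)) has_sum m * N) UNIV"
      using has_sum_cmult_left[OF c(2), of N] by (simp add: mult_ac)
    show "((%al. c al * (mon (x - x0) al * h x)) has_sum g x * h x) UNIV" if "x : ball x0 r" for x
      using has_sum_cmult_left[OF c(3)[OF that], of "h x"] by (simp add: mult_ac)
  qed
  then show ?thesis by (rule maj_mono) (intro mult_right_mono c(1) maj_nonneg[OF r h])
qed

lemma maj_finsum:
  assumes r: "r > 0" and I: "finite I" and g: "!!i. i : I ==> maj x0 r (M i) (g i)"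
  shows "maj x0 r (\<Sum>i\<in>I. M i) (%x. \<Sum>i\<in>I. g i x)"
  by (rule maj_sum[OF r g]) (use I in auto)

lemma maj_add:
  assumes r: "r > 0" and g: "maj x0 r M g" and h: "maj x0 r N h"
  shows "maj x0 r (M + N) (%x. g x + h x)"
proof -
  have "maj x0 r (\<Sum>b\<in>UNIV. if b then M else N) (%x. \<Sum>b\<in>UNIV. (if b then g else h) x)"
    by (rule maj_finsum[OF r]) (use g h in auto)
  then show ?thesis by (simp add: UNIV_bool add.commute)
qed

lemma maj_power:
  assumes r: "r > 0" and g: "maj x0 r M g" shows "maj x0 r (M ^ j) (%x. g x ^ j)"
proof (induction j)
  case 0 show ?case using maj_const[of x0 r 1] by simp
next
  case (Suc j) then show ?case using maj_mult[OF r g] by simp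
qed

lemma maj_coord: assumes r: "r > 0" shows "maj x0 r r (%x. x $ i - x0 $ i)"
proof -
  let ?d = "%j. if j = i then 1 else 0 :: nat"
  have "maj x0 r (r ^ sum ?d UNIV * \<bar>1\<bar>) (%x. mon (x - x0) ?d * 1)" by (rule maj_monomial[OF r maj_const])
  moreover have "mon h ?d = h $ i" for h :: "real^'a"
  proof -
    have "mon h ?d = (\<Prod>j\<in>UNIV. if j = i then h $ j else 1)" unfolding mon_def by (rule prod.cong) auto
    then show ?thesis by simp
  qed
  ultimately show ?thesis by simp
qed

text \<open>Write x . x = |\<open>x0\<close>|^2 (1 + z) with a quadratic polynomial z that vanishes
  at \<open>x0\<close>, and insert z into the binomial series of exponent -1/2.\<close>

lemma maj_inverse_norm:
  fixes x0 :: "real^'n" assumes x0: "x0 ~= 0"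
  shows "\<exists>r>0. \<exists>N. maj x0 r N (%x. inverse (norm x))"
proof -
  let ?q = "x0 \<bullet> x0" have q: "?q > 0" using x0 by simp
  \<comment> \<open>For r <= 1 the majorant norm of \<open>?z\<close> is at most r K; the choice of
    r makes this at most 1/2.\<close>
  define K where "K = (\<Sum>i\<in>UNIV. \<bar>2 * x0 $ i / ?q\<bar>) + (\<Sum>i\<in>(UNIV::'n set). \<bar>1 / ?q\<bar>)"
  have K: "K >= 0" unfolding K_def by (intro add_nonneg_nonneg sum_nonneg) auto
  define r where "r = 1 / (2 * (K + 1))"
  have r: "r > 0" "r <= 1" "r * K <= 1/2" using K by (auto simp: r_def field_simps)
  let ?z = "%x. (\<Sum>i\<in>UNIV. 2 * x0 $ i / ?q * (x $ i - x0 $ i)) + (\<Sum>i\<in>UNIV. 1 / ?q * ((x $ i - x0 $ i) * (x $ i - x0 $ i)))"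
  have "maj x0 r ((\<Sum>i\<in>UNIV. \<bar>2 * x0 $ i / ?q\<bar> * r) + (\<Sum>i\<in>(UNIV::'n set). \<bar>1 / ?q\<bar> * (r * r))) ?z"
    by (intro maj_add[OF r(1)] maj_finsum[OF r(1)] maj_scale maj_mult[OF r(1)] maj_coord[OF r(1)] finite)
  moreover have "(\<Sum>i\<in>UNIV. \<bar>2 * x0 $ i / ?q\<bar> * r) + (\<Sum>i\<in>(UNIV::'n set). \<bar>1 / ?q\<bar> * (r * r)) <= 1/2"
  proof -
    have "(\<Sum>i\<in>(UNIV::'n set). \<bar>1 / ?q\<bar> * (r * r)) <= (\<Sum>i\<in>(UNIV::'n set). \<bar>1 / ?q\<bar> * r)"
      by (intro sum_mono mult_left_mono) (use r in \<open>auto intro: mult_left_le\<close>)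
    moreover have "(\<Sum>i\<in>UNIV. \<bar>2 * x0 $ i / ?q\<bar> * r) + (\<Sum>i\<in>(UNIV::'n set). \<bar>1 / ?q\<bar> * r) = r * K"
      unfolding K_def distrib_left sum_distrib_left by (simp add: mult.commute)
    ultimately show ?thesis using r(3) by linarith
  qed
  ultimately have z: "maj x0 r (1/2) ?z" by (rule maj_mono)
  have zx: "x \<bullet> x = ?q * (1 + ?z x)" for x
  proof -
    have "?z x = 2 / ?q * (x0 \<bullet> (x - x0)) + 1 / ?q * ((x - x0) \<bullet> (x - x0))"
      unfolding inner_vec_def sum_distrib_left by (intro arg_cong2[where f="(+)"] sum.cong) auto
    then have "?q * (1 + ?z x) = ?q + 2 * (x0 \<bullet> (x - x0)) + (x - x0) \<bullet> (x - x0)" using q by (simp add: field_simps)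
    then show ?thesis by (simp add: inner_diff_left inner_diff_right inner_commute)
  qed
  let ?b = "%j. (- 1/2 :: real) gchoose j"
  have sm: "summable (%j. \<bar>?b j\<bar> * \<bar>y\<bar> ^ j)" if "\<bar>y\<bar> <= 1/2" for y :: real
  proof -
    \<comment> \<open>Convergence at 3/4, inside the unit disc, gives absolute convergence for |y|
      <= 1/2.\<close>
    have "summable (%j. ?b j * (3/4) ^ j)" using gen_binomial_real[of "3/4" "-1/2"] sums_summable by auto
    from powser_insidea[OF this, of y] that show ?thesis by (simp add: abs_mult power_abs)
  qed
  obtain B where B: "((%j. \<bar>?b j\<bar> * (1/2) ^ j) has_sum B) UNIV"
    using sm[of "1/2"] summable_on_UNIV_nonneg_real_iff[of "%j. \<bar>?b j\<bar> * (1/2) ^ j"] by (auto simp: summable_on_def)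
  have "maj x0 r B (%x. (1 + ?z x) powr (-1/2))"
  proof (rule maj_sum[OF r(1) _ B])
    show "maj x0 r (\<bar>?b j\<bar> * (1/2) ^ j) (%x. ?b j * ?z x ^ j)" for j by (rule maj_scale[OF maj_power[OF r(1) z]])
    fix x assume x: "x : ball x0 r"
    have b: "\<bar>?z x\<bar> <= 1/2" by (rule maj_bound[OF z x])
    show "((%j. ?b j * ?z x ^ j) has_sum (1 + ?z x) powr (-1/2)) UNIV"
    proof (rule norm_summable_imp_has_sum)
      show "summable (%j. norm (?b j * ?z x ^ j))" using sm[OF b] by (simp add: abs_mult power_abs)
      show "(%j. ?b j * ?z x ^ j) sums (1 + ?z x) powr (-1/2)" by (rule gen_binomial_real) (use b in linarith)
    qed
  qed
  then have "maj x0 r (\<bar>inverse (norm x0)\<bar> * B) (%x. inverse (norm x0) * (1 + ?z x) powr (-1/2))" by (rule maj_scale)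
  then have "maj x0 r (\<bar>inverse (norm x0)\<bar> * B) (%x. inverse (norm x))"
  proof (rule maj_cong)
    fix x assume x: "x : ball x0 r"
    have p: "1 + ?z x > 0" using maj_bound[OF z x] by linarith
    have "norm x = norm x0 * sqrt (1 + ?z x)" unfolding norm_eq_sqrt_inner zx[of x] by (rule real_sqrt_mult)
    moreover have "sqrt (1 + ?z x) = (1 + ?z x) powr (1/2)" using p by (simp add: powr_half_sqrt)
    moreover have "(1 + ?z x) powr (-1/2) = inverse ((1 + ?z x) powr (1/2))" using powr_minus[of "1 + ?z x" "1/2"] by simp
    ultimately show "inverse (norm x0) * (1 + ?z x) powr (-1/2) = inverse (norm x)" by simp
  qed
  then show ?thesis using r(1) by blast
qed

lemma maj_normalize:
  fixes x0 :: "real^'n" assumes x0: "x0 ~= 0"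
  shows "\<exists>r>0. \<exists>N\<ge>1. \<forall>i. maj x0 r N (%x. (x /\<^sub>R norm x) $ i)"
proof -
  obtain r B where r: "r > 0" and B: "maj x0 r B (%x. inverse (norm x))" using maj_inverse_norm[OF x0] by blast
  let ?N = "1 + (norm x0 + r) * B"
  have B0: "B >= 0" by (rule maj_nonneg[OF r B])
  have "maj x0 r ?N (%x. (x /\<^sub>R norm x) $ i)" for i
  proof (rule maj_cong)
    have "maj x0 r ((\<bar>x0 $ i\<bar> + r) * B) (%x. (x0 $ i + (x $ i - x0 $ i)) * inverse (norm x))"
      by (intro maj_mult[OF r] maj_add[OF r] maj_const maj_coord[OF r] B)
    moreover have "(\<bar>x0 $ i\<bar> + r) * B <= (norm x0 + r) * B" by (intro mult_right_mono add_right_mono component_le_norm_cart B0)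
    ultimately show "maj x0 r ?N (%x. (x0 $ i + (x $ i - x0 $ i)) * inverse (norm x))" by (rule maj_mono[OF _ order_trans]) simp
  qed simp
  moreover have "?N >= 1" using B0 r by simp
  ultimately show ?thesis using r by blast
qed

text \<open>Induction on the degree through Euler's identity \<open>(k+1) P = \<Sum>i. x\<^sub>i \<partial>\<^sub>i P\<close>.\<close>

lemma maj_harm:
  fixes P :: "real^'n => real"
  assumes n: "CARD('n) >= 2" and r: "r > 0" and N: "!!i. maj x0 r N (%x. (x /\<^sub>R norm x) $ i)"
  shows "sph_harm k P ==> maj x0 r ((real CARD('n))^(2*k) * N ^ k * sqrt (sqn P)) (%x. P (x /\<^sub>R norm x))"
proof (induction k arbitrary: P)
  case 0
  then obtain c where "P = (%_. c)" using sph_harm_0_eq by blast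
  then show ?case using maj_const[of x0 r c] by (simp add: sqn_def sph_int_const)
next
  case (Suc k)
  note P = Suc.prems and rp = sph_harm_rpf[OF Suc.prems]
  let ?n = "real CARD('n)" let ?C = "?n ^ (2 * k) * N ^ k"
  have N0: "N >= 0" using maj_nonneg[OF r N] .
  have "maj x0 r (\<bar>1 / real (Suc k)\<bar> * (\<Sum>i\<in>UNIV. N * (?C * sqrt (sqn (dd (axis i 1) P))))) (%x. 1 / real (Suc k) * (\<Sum>i\<in>UNIV. (x /\<^sub>R norm x) $ i * dd (axis i 1) P (x /\<^sub>R norm x)))"
    by (intro maj_scale maj_finsum[OF r] maj_mult[OF r] N Suc.IH sph_harm_dd[OF P] finite)
  moreover have "\<bar>1 / real (Suc k)\<bar> * (\<Sum>i\<in>UNIV. N * (?C * sqrt (sqn (dd (axis i 1) P)))) <= ?n ^ (2 * Suc k) * N ^ Suc k * sqrt (sqn P)"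
  proof -
    have "(\<Sum>i\<in>UNIV. N * (?C * sqrt (sqn (dd (axis i 1) P)))) <= (\<Sum>i\<in>(UNIV::'n set). N * (?C * (?n * real (Suc k) * sqrt (sqn P))))"
      by (intro sum_mono mult_left_mono sqn_dd[OF n P]) (use N0 in auto)
    also have "... = real (Suc k) * (?n ^ (2 * Suc k) * N ^ Suc k * sqrt (sqn P))" by (simp add: power2_eq_square mult_ac)
    finally show ?thesis by (simp add: field_simps)
  qed
  ultimately have "maj x0 r (?n ^ (2 * Suc k) * N ^ Suc k * sqrt (sqn P)) (%x. 1 / real (Suc k) * (\<Sum>i\<in>UNIV. (x /\<^sub>R norm x) $ i * dd (axis i 1) P (x /\<^sub>R norm x)))" by (rule maj_mono)
  then show ?case
  proof (rule maj_cong)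
    fix x
    show "1 / real (Suc k) * (\<Sum>i\<in>UNIV. (x /\<^sub>R norm x) $ i * dd (axis i 1) P (x /\<^sub>R norm x)) = P (x /\<^sub>R norm x)"
      using Euler_homog[OF rp sph_harm_homog[OF P], of "x /\<^sub>R norm x"] dd_v_coord[OF rp, of "x /\<^sub>R norm x" "x /\<^sub>R norm x"] by simp
  qed
qed

context doi_sol begin

lemma F_analytic: assumes t: "t > 0" shows "real_analytic_on (- {0}) (%x. ZZ (f t) (x /\<^sub>R norm x))"
  unfolding real_analytic_on_def
proof
  fix x0 :: "real^'n" assume "x0 : - {0}" then have x0: "x0 ~= 0" by simp
  obtain r N where r: "r > 0" and N1: "N >= 1" and N: "!!i. maj x0 r N (%x. (x /\<^sub>R norm x) $ i)" using maj_normalize[OF x0] by blast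
  \<comment> \<open>The ball must avoid the origin, where x / |x| does not lie on the
    sphere.\<close>
  define \<rho> where "\<rho> = min r (norm x0)"
  let ?n = "real CARD('n)" let ?M = "%k. ?n^(2*k) * N ^ k * sqrt (sqn (f t k))"
  \<comment> \<open>Decay at the rate ln N + 1 beats the growth N^k of the composed harmonics and
    leaves exp(-k).\<close>
  have b0: "ln N + 1 >= 0" using N1 by simp
  obtain C where C: "C >= 0" "!!k. ?n^(2*k) * sqrt (sqn (f t k)) <= C * exp (- (ln N + 1) * real k)"
    using dcl_root_bound[OF f_dcl t b0, of t] by auto
  have sq: "sqrt (sqn (f t k)) >= 0" for k using sqn_nonneg[OF frpf] by simp
  have Mb: "?M k <= C * exp (- real k)" for k
  proof -
    have "N ^ k = exp (ln N * real k)" using N1 by (simp add: exp_of_nat2_mult)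
    moreover have "?M k <= (C * exp (- (ln N + 1) * real k)) * N ^ k" using mult_right_mono[OF C(2)[of k], of "N ^ k"] N1 by (simp add: mult_ac)
    ultimately have "?M k <= C * (exp (- (ln N + 1) * real k) * exp (ln N * real k))" by (simp add: mult_ac)
    then show ?thesis by (simp add: mult_exp_exp algebra_simps)
  qed
  have M0: "?M k >= 0" for k using N1 sq by simp
  have "summable ?M" by (rule summable_comparison_test'[OF exp_decay_summable[of C]]) (use Mb M0 in simp)
  then obtain S where S: "(?M has_sum S) UNIV" using summable_on_UNIV_nonneg_real_iff[of ?M, OF M0] unfolding summable_on_def by blast
  have mk: "maj x0 r (?M k) (%x. f t k (x /\<^sub>R norm x))" for k by (rule maj_harm[OF n2 r N fh])
  have ss: "summable (%k. \<bar>f t k (x /\<^sub>R norm x)\<bar>)" if x: "x : ball x0 r" for x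
    by (rule summable_comparison_test'[OF \<open>summable ?M\<close>]) (use maj_bound[OF mk x] in simp)
  have hs: "((%k. f t k (x /\<^sub>R norm x)) has_sum ZZ (f t) x) UNIV" if x: "x : ball x0 r" for x
    unfolding ZZ_sphere by (rule norm_summable_imp_has_sum) (use ss[OF x] summable_rabs_cancel in \<open>auto intro!: summable_sums\<close>)
  have "maj x0 r S (ZZ (f t))" by (rule maj_sum[OF r mk S hs])
  then obtain c where c: "!!x. x : ball x0 r ==> ((%al. c al * mon (x - x0) al) has_sum ZZ (f t) x) UNIV" unfolding maj_def by blast
  have "((%al. c al * (\<Prod>i\<in>UNIV. (x $ i - x0 $ i) ^ al i)) has_sum ZZ (f t) (x /\<^sub>R norm x)) UNIV" if x: "x : ball x0 \<rho>" for x
  proof -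
    have "x : ball x0 r" "x ~= 0" using x by (auto simp: \<rho>_def dist_norm)
    then show ?thesis using c[of x] ZZ_normalize[of x "f t"] by (simp add: mon_def)
  qed
  moreover have "\<rho> > 0" using r x0 by (simp add: \<rho>_def)
  ultimately show "\<exists>r>0. \<exists>c. \<forall>x\<in>ball x0 r. ((%al. c al * (\<Prod>i\<in>UNIV. (x $ i - x0 $ i) ^ al i)) has_sum ZZ (f t) (x /\<^sub>R norm x)) UNIV" by blast
qed

end

section \<open>The weak formulation\<close>

lemma summable_shift_pred: assumes "summable (a :: nat => real)" shows "summable (%k. a (k - 1))"
  using assms summable_Suc_iff[of "%k. a (k - 1)"] by simp

lemma summable_sandwich:
  assumes "!!k. 0 <= (a k :: real)" "!!k. a k <= b k" "summable b" shows "summable a"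
  by (rule summable_comparison_test'[OF assms(3)]) (use assms(1,2) in auto)

lemma continuous_on_suminf:
  fixes a :: "nat => 'a::topological_space => real"
  assumes c: "!!k. continuous_on A (a k)" and b: "!!k x. x : A ==> \<bar>a k x\<bar> <= M k" and M: "summable M"
  shows "continuous_on A (%x. \<Sum>k. a k x)"
proof -
  have "uniform_limit A (%n x. \<Sum>k<n. a k x) (%x. \<Sum>k. a k x) sequentially"
    by (rule Weierstrass_m_test[OF _ M]) (use b in auto)
  then show ?thesis by (rule uniform_limit_theorem[rotated]) (auto intro!: always_eventually continuous_on_sum c)
qed

lemma set_integrable_open_real:
  fixes q :: "real => real" assumes q: "continuous_on {0..T} q"
  shows "set_integrable lborel {0<..<T} q" "(LBINT t:{0<..<T}. q t) = integral {0..T} q"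
proof -
  have "set_integrable lborel {0..T} q" by (rule borel_integrable_atLeastAtMost') (rule q)
  then show i: "set_integrable lborel {0<..<T} q" by (rule set_integrable_subset) auto
  show "(LBINT t:{0<..<T}. q t) = integral {0..T} q"
    using set_borel_integral_eq_integral(2)[OF i] integral_open_interval_real[of 0 T q] by simp
qed

text \<open>The series of the squared components is integrated term by term; M dominates the
  integrals of its terms.\<close>

lemma L2H_I:
  fixes u :: "real => 'n::finite sdist"
  assumes n: "CARD('n) >= 2" and h: "!!t k. sph_harm k (u t k)"
    and c: "!!k Q. sph_harm k Q ==> continuous_on UNIV (%t. ip (u t k) Q)"
    and H: "!!t. t : {0<..<T} ==> in_Hs r (u t)"
    and M: "summable M" "!!k. hw TYPE('n) r k * integral {0..T} (%t. sqn (u t k)) <= M k"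
  shows "L2H r T u"
  unfolding L2H_def
proof (intro conjI allI)
  fix l x
  have "(%t. u t l x) = (%t. ip (u t l) (reprod l x))" by (simp add: ip_reprod[OF h])
  then show "(%t. u t l x) : borel_measurable borel" using borel_measurable_continuous_onI[OF c[OF sph_harm_reprod]] by simp
next
  show "AE t in lborel. t : {0<..<T} --> in_Hs r (u t)" using H by (intro AE_I2) simp
next
  have sc: "continuous_on {0..T} (%t. hw TYPE('n) r k * sqn (u t k))" for k
    by (intro continuous_on_mult_left cont_sqn[OF h] continuous_on_subset[OF c]) auto
  have nn: "hw TYPE('n) r k * sqn (u t k) >= 0" for t k using hw_pos[OF n, of r k] sqn_nonneg[OF sph_harm_rpf[OF h]] by simp
  let ?g = "%k t. indicator {0<..<T} t *\<^sub>R (hw TYPE('n) r k * sqn (u t k))"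
  have g0: "norm (?g k t) = ?g k t" for k t
    unfolding real_norm_def by (rule abs_of_nonneg) (use nn in simp)
  have "integrable lborel (%t. \<Sum>k. ?g k t)"
  proof (rule integrable_suminf)
    show "integrable lborel (?g k)" for k using set_integrable_open_real(1)[OF sc[of k]] unfolding set_integrable_def .
    show "AE t in lborel. summable (%k. norm (?g k t))"
    proof (rule AE_I2)
      fix t show "summable (%k. norm (?g k t))" unfolding g0
      proof (cases "t : {0<..<T}")
        case True
        have "summable (%k. hw TYPE('n) r k * sqn (u t k))" using H[OF True] unfolding in_Hs_def hs_weight_hw by blast
        then show "summable (%k. ?g k t)" using True by simp
      next
        case False then show "summable (%k. ?g k t)" by simp
      qed
    qed
    have e: "(\<integral>t. norm (?g k t) \<partial>lborel) = hw TYPE('n) r k * integral {0..T} (%t. sqn (u t k))" for k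
      unfolding g0 using set_integrable_open_real(2)[OF sc[of k]] unfolding set_lebesgue_integral_def by simp
    show "summable (%k. \<integral>t. norm (?g k t) \<partial>lborel)"
    proof (rule summable_sandwich[OF _ _ M(1)])
      show "0 <= (\<integral>t. norm (?g k t) \<partial>lborel)" for k by (rule Bochner_Integration.integral_nonneg) simp
      show "(\<integral>t. norm (?g k t) \<partial>lborel) <= M k" for k unfolding e by (rule M(2))
    qed
  qed
  moreover have "(\<Sum>k. ?g k t) = indicator {0<..<T} t *\<^sub>R hs_sq r (u t)" for t
    unfolding hs_sq_def hs_weight_hw by (cases "t : {0<..<T}") auto
  ultimately show "set_integrable lborel {0<..<T} (%t. hs_sq r (u t))" unfolding set_integrable_def by simp
qed

lemma smooth_real_deriv:
  fixes \<phi> :: "real => real" assumes "smooth_on UNIV \<phi>"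
  shows "(\<phi> has_real_derivative deriv \<phi> t) (at t)" "continuous_on UNIV (deriv \<phi>)"
proof -
  have c: "Ck 1 \<phi> UNIV" using assms unfolding smooth_on_def by blast
  then have d: "(\<phi> has_derivative frechet_derivative \<phi> (at t)) (at t)" for t using frechet_derivative_works by auto
  have e: "frechet_derivative \<phi> (at t) = (%v. v * frechet_derivative \<phi> (at t) 1)" for t
  proof
    fix v show "frechet_derivative \<phi> (at t) v = v * frechet_derivative \<phi> (at t) 1"
      using linear_scale[OF has_derivative_linear[OF d[of t]], of v 1] by simp
  qed
  have "(\<phi> has_real_derivative frechet_derivative \<phi> (at t) 1) (at t)" for t
    using d[of t] unfolding has_field_derivative_def by (subst (asm) e) (simp add: mult_commute_abs)
  note DERIV_imp_deriv[OF this] this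
  then have de: "deriv \<phi> = (%t. frechet_derivative \<phi> (at t) 1)" by auto
  show "(\<phi> has_real_derivative deriv \<phi> t) (at t)" unfolding de by fact
  show "continuous_on UNIV (deriv \<phi>)" unfolding de using c by simp
qed

lemma tpair_harm:
  fixes u :: "'n::finite sdist"
  assumes n: "CARD('n) >= 2" and u: "hseq u" and Q: "sph_harm k Q"
  shows "tpair u Q = ip (u k) Q"
proof -
  have "tpair u Q = (\<Sum>l\<in>{k}. ip (u l) Q)" unfolding tpair_def ip_def[symmetric]
    by (rule suminf_finite) (use ip_orth[OF n u[THEN spec] Q] in auto)
  then show ?thesis by simp
qed

text \<open>The tangential gradient of Q is (k + n - 2) \<open>Dn\<close> - k \<open>Up\<close> in
  direction v; moving both operators onto u by adjointness produces the coefficients of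
  \<open>bt\<close>.\<close>

lemma tpair_tgrad:
  fixes u :: "'n::finite sdist"
  assumes n: "CARD('n) >= 2" and u: "hseq u" and Q: "sph_harm k Q"
  shows "tpair u (%x. v \<bullet> tgrad Q x) = ip (bt v u k) Q"
proof -
  let ?n = "real CARD('n)"
  note rq = sph_harm_rpf[OF Q] and ru = sph_harm_rpf[OF u[THEN spec]]
  have e: "sph_int (%x. u l x * (v \<bullet> tgrad Q x)) = (real k + ?n - 2) * ip (u l) (Dn v k Q) - real k * ip (u l) (Up v k Q)" for l
  proof -
    have "sph_int (%x. u l x * (v \<bullet> tgrad Q x)) = ip (u l) (%x. (real k + ?n - 2) * Dn v k Q x - real k * Up v k Q x)"
      unfolding ip_def by (rule sph_int_cong) (simp add: tgrad_Up_Dn[OF n Q])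
    then show ?thesis by (simp add: ip_diff_right[OF rpf_cmult[OF rpf_Dn[OF rq]] rpf_cmult[OF rpf_Up[OF rq]] ru] ip_cmult_right)
  qed
  show ?thesis
  proof (cases k)
    case 0
    then have "Dn v k Q = (%x. 0)" using Q Dn_0[of Q v k] by auto
    then show ?thesis unfolding tpair_def e using 0 by (simp add: ip_def)
  next
    case (Suc j)
    have z: "ip (u l) (Dn v k Q) = 0" if "l ~= j" for l using ip_orth[OF n u[THEN spec] sph_harm_Dn that, of Q v] Q Suc by simp
    have z': "ip (u l) (Up v k Q) = 0" if "l ~= Suc k" for l by (rule ip_orth[OF n u[THEN spec] sph_harm_Up[OF Q n] that])
    have "tpair u (%x. v \<bullet> tgrad Q x) = (\<Sum>l\<in>{j, Suc k}. (real k + ?n - 2) * ip (u l) (Dn v k Q) - real k * ip (u l) (Up v k Q))"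
      unfolding tpair_def e by (rule suminf_finite) (use z z' in auto)
    also have "... = (real k + ?n - 2) * ip (u j) (Dn v k Q) - real k * ip (u (Suc k)) (Up v k Q)"
      using Suc z z' by simp
    also have "ip (u j) (Dn v k Q) = ip (Up v j (u j)) Q" using ip_Up_Dn[OF n u[THEN spec], of j Q v] Q Suc by simp
    also have "ip (u (Suc k)) (Up v k Q) = ip (Dn v (Suc k) (u (Suc k))) Q"
      using ip_Up_Dn[OF n Q u[THEN spec], of v] by (simp add: ip_commute)
    also have "(real k + ?n - 2) * ip (Up v j (u j)) Q - real k * ip (Dn v (Suc k) (u (Suc k))) Q = ip (bt v u k) Q"
      unfolding Suc bt_Suc by (simp add: ip_diff_left[OF rpf_cmult[OF rpf_Up[OF ru]] rpf_cmult[OF rpf_Dn[OF ru]] rq] ip_cmult_left)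
    finally show ?thesis .
  qed
qed

lemma pair_eqs:
  fixes u h :: "'n::finite sdist"
  assumes n: "CARD('n) >= 2" and u: "hseq u" and h: "hseq h"
  shows "dpair u h = (\<Sum>k. ip (u k) (h k))" "gpair u h = (\<Sum>k. lam TYPE('n) k * ip (u k) (h k))"
    "jpair u h = (\<Sum>k. ip (bt (jv (u 1)) u k) (h k))"
proof -
  show "dpair u h = (\<Sum>k. ip (u k) (h k))" unfolding dpair_def by (simp add: tpair_harm[OF n u h[THEN spec]])
  show "jpair u h = (\<Sum>k. ip (bt (jv (u 1)) u k) (h k))" unfolding jpair_def Jv_jv[OF n u] by (simp add: tpair_tgrad[OF n u h[THEN spec]])
  have "(\<Sum>l. sph_int (%x. tgrad (u l) x \<bullet> tgrad (h k) x)) = lam TYPE('n) k * ip (u k) (h k)" for k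
  proof -
    have "(\<Sum>l. sph_int (%x. tgrad (u l) x \<bullet> tgrad (h k) x)) = (\<Sum>l\<in>{k}. sph_int (%x. tgrad (u l) x \<bullet> tgrad (h k) x))"
      by (rule suminf_finite) (use tgrad_tgrad[OF n u[THEN spec] h[THEN spec]] in auto)
    then show ?thesis using tgrad_tgrad[OF n u[THEN spec] h[THEN spec], of k k] by (simp add: lam_def)
  qed
  then show "gpair u h = (\<Sum>k. lam TYPE('n) k * ip (u k) (h k))" unfolding gpair_def by simp
qed

lemma pair_summable:
  fixes u h :: "'n::finite sdist"
  assumes n: "CARD('n) >= 2" and u: "hseq u" and h: "in_Hs r h" and d: "!!k. sqn (u k) <= C * exp (- 3 * real k)"
  shows "summable (%k. ip (u k) (h k))"
proof -
  have hh: "hseq h" and hs: "summable (%k. hw TYPE('n) r k * sqn (h k))" using h unfolding in_Hs_def hs_weight_hw by auto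
  note hw = hw_pos[OF n] and s0 = sqn_nonneg[OF sph_harm_rpf]
  obtain H where H: "!!k. hw TYPE('n) r k * sqn (h k) <= H" "H >= 0"
  proof
    show "hw TYPE('n) r k * sqn (h k) <= (\<Sum>k. hw TYPE('n) r k * sqn (h k))" for k
      using sum_le_suminf[OF hs, of "{k}"] hw s0[OF hh[THEN spec]] by (simp add: less_imp_le)
    show "0 <= (\<Sum>k. hw TYPE('n) r k * sqn (h k))" by (rule suminf_nonneg[OF hs]) (use hw s0[OF hh[THEN spec]] in \<open>simp add: less_imp_le\<close>)
  qed
  obtain B where B: "B > 0" "!!k. hw TYPE('n) (- r) k <= B * exp (1 * real k)" using hw_exp_bound[OF n, of 1 "- r"] by auto
  have C: "C >= 0" using d[of 0] s0[OF u[THEN spec], of 0] by simp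
  have b: "\<bar>ip (u k) (h k)\<bar> <= sqrt (C * (H * B)) * exp (- real k)" for k
  proof -
    have "sqn (h k) = hw TYPE('n) (- r) k * (hw TYPE('n) r k * sqn (h k))" using hw[of r k] by (simp add: hw_inverse[OF n, symmetric])
    also have "... <= (B * exp (1 * real k)) * H" using B H hw[of r k] s0[OF hh[THEN spec], of k] by (intro mult_mono) auto
    finally have sh: "sqn (h k) <= (H * B) * exp (real k)" by (simp add: mult_ac)
    have "(ip (u k) (h k))\<^sup>2 <= sqn (u k) * sqn (h k)" by (rule ip_CS) (use u hh sph_harm_rpf in blast)+
    also have "... <= (C * exp (- 3 * real k)) * ((H * B) * exp (real k))"
      using d sh C s0[OF hh[THEN spec], of k] by (intro mult_mono) auto
    also have "... = C * (H * B) * (exp (- real k))\<^sup>2" by (simp add: power2_eq_square mult_exp_exp)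
    finally have "sqrt ((ip (u k) (h k))\<^sup>2) <= sqrt (C * (H * B) * (exp (- real k))\<^sup>2)" by (rule real_sqrt_le_mono)
    then show ?thesis by (simp add: real_sqrt_mult)
  qed
  show ?thesis by (rule summable_comparison_test'[OF exp_decay_summable[of "sqrt (C * (H * B))"]]) (use b in simp)
qed

section \<open>The constructed solution is a weak solution\<close>

context doi_sol begin

lemma s0: "sqn (f t k) >= 0" by (rule sqn_nonneg[OF frpf])

lemma f_sqn_cont: "continuous_on A (%t. sqn (f t k))"
  by (rule continuous_on_subset[OF cont_sqn[OF fh fc]]) auto

lemma J_cont: "continuous_on UNIV (%t. jv (f t 1))" by (rule jv_cont[OF fc])

lemma J_bound: "\<exists>R\<ge>0. \<forall>t\<in>{0..T}. (norm (jv (f t 1)))\<^sup>2 <= R"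
proof -
  have "compact ((%t. (norm (jv (f t 1)))\<^sup>2) ` {0..T})"
    by (intro compact_continuous_image continuous_intros continuous_on_subset[OF J_cont]) auto
  then obtain R where "\<forall>y\<in>(%t. (norm (jv (f t 1)))\<^sup>2) ` {0..T}. norm y <= R" using compact_imp_bounded bounded_iff by metis
  then show ?thesis by (intro exI[of _ "max R 0"]) auto
qed

definition Ib :: "real => nat => real" where "Ib T k = hw TYPE('n) s k * integral {0..T} (%t. sqn (f t k))"

lemma Ib_nonneg: "0 <= T ==> Ib T k >= 0"
  unfolding Ib_def using hw_pos[OF n2, of s k] s0 by (simp add: Henstock_Kurzweil_Integration.integral_nonneg integrable_continuous_real[OF f_sqn_cont])

lemma Ib_summable: assumes T: "T >= 0" shows "summable (Ib T)"
proof -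
  let ?h = "hw TYPE('n) s"
  obtain N where N: "!!t K. t : {0..T} ==> (\<Sum>k\<le>K. ?h k * sqn (f t k)) <= N" using fbd[of T] by blast
  show ?thesis
  proof (rule bounded_imp_summable)
    show "0 <= Ib T k" for k by (rule Ib_nonneg[OF T])
    fix K
    have c: "continuous_on {0..T} (%t. ?h k * sqn (f t k))" for k by (intro continuous_on_mult_left f_sqn_cont)
    have "(\<Sum>k\<le>K. Ib T k) = integral {0..T} (%t. \<Sum>k\<le>K. ?h k * sqn (f t k))"
      unfolding Ib_def by (subst Henstock_Kurzweil_Integration.integral_sum) (auto intro!: integrable_continuous_real c)
    also have "... <= integral {0..T} (%t. N)"
      by (rule integral_le) (auto intro!: integrable_continuous_real continuous_on_sum c N)
    finally show "(\<Sum>k\<le>K. Ib T k) <= T * N" using T by simp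
  qed
qed

text \<open>The energy estimate of a single degree bounds it by its initial value and the time
  integrals of its two neighbours. These are summable and do not depend on t, so one summable
  sequence bounds all times at once, as continuity in H^s needs, and also the integrals with one
  more power of \<open>lam\<close>, as L2 in H^(s+1) needs.\<close>

lemma M_bound: assumes T: "T >= 0"
  shows "\<exists>M. summable M & (\<forall>t\<in>{0..T}. \<forall>k. hw TYPE('n) s k * sqn (f t k) <= M k) & (\<forall>k. lam TYPE('n) k * Ib T k <= M k)"
proof -
  let ?h = "hw TYPE('n) s"
  obtain R where R: "R >= 0" "!!t. t : {0..T} ==> (norm (jv (f t 1)))\<^sup>2 <= R" using J_bound[of T] by auto
  let ?n = "real CARD('n)" define cc where "cc = hwC TYPE('n) s / \<sigma> * (2 * ?n * R)"
  have c0: "cc >= 0" unfolding cc_def using hwC_ge1[OF n2, of s] sg R by simp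
  define A where "A k = ?h k * sqn (f 0 k) + cc * (Ib T (k - 1) + Ib T (Suc k))" for k
  have hp: "?h k > 0" for k by (rule hw_pos[OF n2])
  have A0: "A k >= 0" for k unfolding A_def using c0 Ib_nonneg[OF T] hp[of k] s0[of 0 k] by (intro add_nonneg_nonneg mult_nonneg_nonneg) auto
  have sA: "summable A" unfolding A_def
  proof (intro summable_add summable_mult)
    show "summable (%k. ?h k * sqn (f 0 k))" using f0 unfolding finit in_Hs_def hs_weight_hw by simp
    show "summable (%k. Ib T (k - 1))" by (rule summable_shift_pred[OF Ib_summable[OF T]])
    show "summable (%k. Ib T (Suc k))" using Ib_summable[OF T] by (simp add: summable_Suc_iff)
  qed
  have E: "?h k * sqn (f t k) + (\<sigma> / 2) * (lam TYPE('n) k * ?h k) * integral {0..t} (%ta. sqn (f ta k)) <= A k" if t: "t : {0..T}" for t k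
  proof (cases k)
    case 0
    have "f t 0 = f 0 0" by (rule solves_0_const[of T "%t. f t 0"]) (use fsol[of T 0] t in auto)
    then show ?thesis using 0 A_def[of 0] c0 Ib_nonneg[OF T, of 0] Ib_nonneg[OF T, of 1] by simp
  next
    case (Suc j)
    let ?g = "%t k. 2 * ?n * R * sqn (f t k)"
    have e: "?h (Suc j) * (th \<sigma> 0 (Suc j) t * sqn (f t (Suc j))) + (\<sigma> / 2) * (lam TYPE('n) (Suc j) * ?h (Suc j)) * integral {0..t} (%ta. th \<sigma> 0 (Suc j) ta * sqn (f ta (Suc j)))
       <= ?h (Suc j) * sqn (f 0 (Suc j)) + hwC TYPE('n) s * exp (2 * 0 * T) / \<sigma> *
       integral {0..t} (%ta. ?h j * (th \<sigma> 0 j ta * ?g ta j) + ?h (Suc (Suc j)) * (th \<sigma> 0 (Suc (Suc j)) ta * ?g ta (Suc (Suc j))))"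
    proof (rule energy_k[OF n2 sg _ fsol _ _ _ t])
      show "continuous_on {0..T} (%t. ?g t k)" for k by (intro continuous_on_mult_left f_sqn_cont)
      show "0 <= ?g t k" for t k using R(1) s0[of t k] by simp
      fix t assume t: "t : {0..T}"
      have "sqn (bt (jv (f t 1)) (f t) (Suc j)) <= lam TYPE('n) (Suc j) * (2 * ?n * (norm (jv (f t 1)))\<^sup>2 * sqn (f t j) + 2 * ?n * (norm (jv (f t 1)))\<^sup>2 * sqn (f t (Suc (Suc j))))"
        using sqn_bt[OF n2, of "f t" "Suc j" "jv (f t 1)"] fh by simp
      also have "... <= lam TYPE('n) (Suc j) * (?g t j + ?g t (Suc (Suc j)))"
        by (intro mult_left_mono add_mono mult_right_mono R(2)[OF t] s0 lam_nonneg[OF n2]) auto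
      finally show "sqn (bt (jv (f t 1)) (f t) (Suc j)) <= lam TYPE('n) (Suc j) * (?g t j + ?g t (Suc (Suc j)))" .
    qed simp
    have c: "(%t. a * sqn (f t k)) integrable_on {x..y}" for a k x y by (intro integrable_continuous_real continuous_on_mult_left f_sqn_cont)
    have i1: "integral {0..t} (%ta. ?h j * ?g ta j + ?h (Suc (Suc j)) * ?g ta (Suc (Suc j))) <= 2 * ?n * R * (Ib T j + Ib T (Suc (Suc j)))"
    proof -
      have c2: "(%ta. ?h j * ?g ta j + ?h (Suc (Suc j)) * ?g ta (Suc (Suc j))) integrable_on {x..y}" for x y
        by (intro integrable_continuous_real continuous_on_add continuous_on_mult_left f_sqn_cont)
      have "integral {0..t} (%ta. ?h j * ?g ta j + ?h (Suc (Suc j)) * ?g ta (Suc (Suc j))) <= integral {0..T} (%ta. ?h j * ?g ta j + ?h (Suc (Suc j)) * ?g ta (Suc (Suc j)))"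
      proof (rule integral_subset_le[OF _ c2 c2])
        show "{0..t} \<subseteq> {0..T}" using t by auto
        show "\<forall>x\<in>{0..T}. 0 <= ?h j * ?g x j + ?h (Suc (Suc j)) * ?g x (Suc (Suc j))"
          using hp[of j] hp[of "Suc (Suc j)"] R(1) s0 by (intro ballI add_nonneg_nonneg mult_nonneg_nonneg) (auto simp: less_imp_le)
      qed
      also have "... = integral {0..T} (%ta. (2 * ?n * R * ?h j) * sqn (f ta j)) + integral {0..T} (%ta. (2 * ?n * R * ?h (Suc (Suc j))) * sqn (f ta (Suc (Suc j))))"
        by (simp only: Henstock_Kurzweil_Integration.integral_add[OF c c, symmetric]) (simp add: mult_ac)
      also have "... = 2 * ?n * R * (Ib T j + Ib T (Suc (Suc j)))" unfolding Ib_def by (simp add: distrib_left)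
      finally show ?thesis .
    qed
    have "hwC TYPE('n) s / \<sigma> * integral {0..t} (%ta. ?h j * ?g ta j + ?h (Suc (Suc j)) * ?g ta (Suc (Suc j))) <= hwC TYPE('n) s / \<sigma> * (2 * ?n * R * (Ib T j + Ib T (Suc (Suc j))))"
      by (intro mult_left_mono i1) (use hwC_ge1[OF n2, of s] sg in simp)
    moreover have "hwC TYPE('n) s / \<sigma> * (2 * ?n * R * (Ib T j + Ib T (Suc (Suc j)))) = cc * (Ib T j + Ib T (Suc (Suc j)))" unfolding cc_def by simp
    ultimately show ?thesis using e unfolding Suc A_def th_0 mult_1_left by simp
  qed
  define M where "M k = (1 + 2 / \<sigma>) * A k" for k
  have AM: "A k <= M k" "2 / \<sigma> * A k <= M k" for k using A0[of k] sg by (simp_all add: M_def distrib_right)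
  have 1: "?h k * sqn (f t k) <= M k" if t: "t : {0..T}" for t k
  proof -
    have "0 <= (\<sigma> / 2) * (lam TYPE('n) k * ?h k) * integral {0..t} (%ta. sqn (f ta k))"
      using sg lam_nonneg[OF n2, of k] hp[of k]
      by (intro mult_nonneg_nonneg Henstock_Kurzweil_Integration.integral_nonneg integrable_continuous_real f_sqn_cont s0) (auto simp: less_imp_le)
    then show ?thesis using E[OF t, of k] AM(1)[of k] by linarith
  qed
  have 2: "lam TYPE('n) k * Ib T k <= M k" for k
  proof -
    have "(\<sigma> / 2) * (lam TYPE('n) k * ?h k) * integral {0..T} (%ta. sqn (f ta k)) <= A k"
    proof -
      have "0 <= ?h k * sqn (f T k)" using hp[of k] s0[of T k] by simp
      moreover have "T : {0..T}" using T by simp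
      ultimately show ?thesis using E[of T k] by linarith
    qed
    then have "2 / \<sigma> * ((\<sigma> / 2) * (lam TYPE('n) k * ?h k) * integral {0..T} (%ta. sqn (f ta k))) <= 2 / \<sigma> * A k" using sg by (intro mult_left_mono) auto
    then show ?thesis using AM(2)[of k] sg unfolding Ib_def by (simp add: mult_ac)
  qed
  have "summable M" unfolding M_def[abs_def] by (rule summable_mult[OF sA])
  then show ?thesis using 1 2 by blast
qed

lemma f_cont_Hs: "cont_Hs s {0..} f"
proof -
  let ?h = "hw TYPE('n) s"
  have H: "in_Hs s (f t)" if t: "t >= 0" for t
  proof -
    obtain M where M: "summable M" "!!k. ?h k * sqn (f t k) <= M k" using M_bound[OF t] t by auto
    have "summable (%k. ?h k * sqn (f t k))" by (rule summable_sandwich[OF _ M(2,1)]) (use hw_pos[OF n2, of s] s0 in \<open>simp add: less_imp_le\<close>)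
    then show ?thesis unfolding in_Hs_def hs_weight_hw using fh by blast
  qed
  have "((%t. hs_sq s (%l. f t l - f t0 l)) \<longlongrightarrow> 0) (at t0 within {0..})" if t0: "t0 >= 0" for t0
  proof -
    have e: "f t l - f t0 l = (%x. f t l x - f t0 l x)" for t l by (simp add: fun_eq_iff)
    have "continuous_on {0..} (%t. \<Sum>k. ?h k * sqn (%x. f t k x - f t0 k x))"
    proof (rule cont_Ici)
      fix T :: real assume T: "0 <= T"
      obtain M where M: "summable M" "!!t k. t : {0..T + t0} ==> ?h k * sqn (f t k) <= M k" using M_bound[of "T + t0"] T t0 by auto
      show "continuous_on {0..T} (%t. \<Sum>k. ?h k * sqn (%x. f t k x - f t0 k x))"
      proof (rule continuous_on_suminf[OF _ _ summable_mult[OF M(1), of 4]])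
        show "continuous_on {0..T} (%t. ?h k * sqn (%x. f t k x - f t0 k x))" for k
        proof (intro continuous_on_mult_left cont_sqn)
          show "sph_harm k (%x. f t k x - f t0 k x)" for t by (rule sph_harm_diff[OF fh fh])
          show "continuous_on {0..T} (%t. ip (%x. f t k x - f t0 k x) Q)" if "sph_harm k Q" for Q
            unfolding ip_diff_left[OF frpf frpf sph_harm_rpf[OF that]] by (intro continuous_intros continuous_on_subset[OF fc[OF that]]) auto
        qed
        fix k t assume t: "t : {0..T}"
        have hp: "?h k > 0" by (rule hw_pos[OF n2])
        have "0 <= ?h k * sqn (%x. f t k x - f t0 k x)" using hp sqn_nonneg[OF sph_harm_rpf[OF sph_harm_diff[OF fh fh]]] by simp
        moreover have "?h k * sqn (%x. f t k x - f t0 k x) <= ?h k * (2 * sqn (f t k) + 2 * sqn (f t0 k))"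
          using hp by (intro mult_left_mono sqn_diff_le frpf) auto
        moreover have "?h k * (2 * sqn (f t k) + 2 * sqn (f t0 k)) <= 4 * M k"
          using M(2)[of t k] M(2)[of t0 k] t T t0 by (simp add: distrib_left)
        ultimately show "\<bar>?h k * sqn (%x. f t k x - f t0 k x)\<bar> <= 4 * M k" by linarith
      qed
    qed
    from bspec[OF this[unfolded continuous_on_def], of t0] t0
    show ?thesis unfolding hs_sq_def hs_weight_hw e by simp
  qed
  then show ?thesis using H unfolding cont_Hs_def by auto
qed

lemma fd_cont: assumes "sph_harm k Q" shows "continuous_on UNIV (%t. ip (fd t k) Q)"
  unfolding ip_fd[OF sph_harm_rpf[OF assms]] by (intro continuous_intros fc[OF assms] bt_cont[OF n2 J_cont _ fc assms]) (use fh in auto)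

lemma dcl_in_Hs:
  fixes c :: "real => 'n sdist"
  assumes c: "dcl c" and t: "t > 0" shows "in_Hs r (c t)"
proof -
  obtain C where C: "C >= 0" "!!k. sqn (c t k) <= C * exp (- 2 * real k)" using dcl_decay[OF c t, of 2 t] by auto
  obtain B where B: "B > 0" "!!k. hw TYPE('n) r k <= B * exp (1 * real k)" using hw_exp_bound[OF n2, of 1 r] by auto
  have s: "sqn (c t k) >= 0" for k by (rule sqn_nonneg[OF sph_harm_rpf[OF dcl_hseq[OF c t]]])
  have "hw TYPE('n) r k * sqn (c t k) <= (C * B) * exp (- real k)" for k
  proof -
    have "hw TYPE('n) r k * sqn (c t k) <= (B * exp (1 * real k)) * (C * exp (- 2 * real k))" using B C s hw_pos[OF n2, of r k] by (intro mult_mono) auto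
    also have "... = (C * B) * exp (- real k)" by (simp add: mult_exp_exp)
    finally show ?thesis .
  qed
  then have "summable (%k. hw TYPE('n) r k * sqn (c t k))"
    by (intro summable_sandwich[OF _ _ exp_decay_summable[of "C * B"]]) (use hw_pos[OF n2, of r] s in \<open>simp_all add: less_imp_le\<close>)
  then show ?thesis unfolding in_Hs_def hs_weight_hw using dcl_hseq[OF c t] by blast
qed

text \<open>The equation holds classically inside the interval and all terms are continuous up to
  the ends, so this is integration by parts; \<open>reprod\<close> turns point values into
  coefficients.\<close>

lemma f_weak_tderiv: assumes T: "T > 0" shows "weak_tderiv T f fd"
  unfolding weak_tderiv_def
proof (intro allI impI)
  fix l and x :: "real^'n" and \<phi> :: "real => real" assume \<phi>: "test_fun T \<phi>"
  then obtain a b where ab: "0 < a" "b < T" "!!t. t \<notin> {a..b} ==> \<phi> t = 0" and sm: "smooth_on UNIV \<phi>" unfolding test_fun_def by blast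
  note d\<phi> = smooth_real_deriv[OF sm]
  let ?R = "reprod l x"
  have fe: "f t l x = ip (f t l) ?R" and ge: "fd t l x = ip (fd t l) ?R" for t by (simp_all add: ip_reprod[OF fh] ip_reprod[OF fd_harm])
  have cf: "continuous_on A (%t. f t l x)" and cg: "continuous_on A (%t. fd t l x)" and c\<phi>: "continuous_on A \<phi>" "continuous_on A (deriv \<phi>)" for A
    unfolding fe ge using continuous_on_subset[OF fc[OF sph_harm_reprod]] continuous_on_subset[OF fd_cont[OF sph_harm_reprod]]
      continuous_on_subset[OF d\<phi>(2)] DERIV_continuous_on[OF has_field_derivative_at_within[OF d\<phi>(1)]] by auto
  have c1: "continuous_on {0..T} (%t. f t l x * deriv \<phi> t)" and c2: "continuous_on {0..T} (%t. fd t l x * \<phi> t)"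
    by (intro continuous_on_mult cf cg c\<phi>)+
  have "((%t. fd t l x * \<phi> t + f t l x * deriv \<phi> t) has_integral f T l x * \<phi> T - f 0 l x * \<phi> 0) {0..T}"
  proof (rule fundamental_theorem_of_calculus_interior)
    show "continuous_on {0..T} (%t. f t l x * \<phi> t)" by (intro continuous_on_mult cf c\<phi>)
    fix t assume "t : {0<..<T}" then have t: "t > 0" by simp
    have "((%t. f t l x) has_real_derivative fd t l x) (at t)"
      unfolding fe ge using f_tder t sph_harm_reprod unfolding tder_def by blast
    from DERIV_mult[OF this d\<phi>(1)[of t]] show "((%t. f t l x * \<phi> t) has_vector_derivative fd t l x * \<phi> t + f t l x * deriv \<phi> t) (at t)"
      by (simp add: has_real_derivative_iff_has_vector_derivative mult.commute add.commute)
  qed (use T in auto)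
  moreover have "\<phi> T = 0" "\<phi> 0 = 0" using ab by auto
  ultimately have "integral {0..T} (%t. fd t l x * \<phi> t + f t l x * deriv \<phi> t) = 0" by (simp add: integral_unique)
  then have "integral {0..T} (%t. fd t l x * \<phi> t) + integral {0..T} (%t. f t l x * deriv \<phi> t) = 0"
    by (subst (asm) Henstock_Kurzweil_Integration.integral_add) (auto intro!: integrable_continuous_real c1 c2)
  then show "(LBINT t:{0<..<T}. f t l x * deriv \<phi> t) = - (LBINT t:{0<..<T}. fd t l x * \<phi> t)"
    unfolding set_integrable_open_real(2)[OF c1] set_integrable_open_real(2)[OF c2] by linarith
qed

lemma f_weak_id:
  assumes t: "t > 0" and h: "in_Hs r h"
  shows "dpair (fd t) h = - \<sigma> * gpair (f t) h + jpair (f t) h"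
proof -
  have hh: "hseq h" using h unfolding in_Hs_def by blast
  have fhs: "hseq (f t)" and fds: "hseq (fd t)" using fh fd_harm by blast+
  have l: "ebd (%k. lam TYPE('n) k)" using ebd_lam[OF n2] by simp
  have dl: "dcl (%t k x. lam TYPE('n) k * f t k x)" using DD_dcl[OF DD_diag[OF f1 l]] .
  have s1: "summable (%k. ip (fd t k) (h k))"
  proof -
    obtain C where "!!k. sqn (fd t k) <= C * exp (- 3 * real k)" using dcl_decay[OF DD_dcl[OF fd_DD[OF f1]] t, of 3 t] t by auto
    then show ?thesis by (rule pair_summable[OF n2 fds h])
  qed
  have "summable (%k. ip (%x. lam TYPE('n) k * f t k x) (h k))"
  proof -
    obtain C where C: "!!k. sqn (%x. lam TYPE('n) k * f t k x) <= C * exp (- 3 * real k)" using dcl_decay[OF dl t, of 3 t] t by auto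
    have "\<forall>k. sph_harm k (%x. lam TYPE('n) k * f t k x)" using dcl_hseq[OF dl t] by blast
    then show ?thesis using pair_summable[OF n2 _ h, of "%k x. lam TYPE('n) k * f t k x" C] C by blast
  qed
  then have s2: "summable (%k. lam TYPE('n) k * ip (f t k) (h k))" by (simp add: ip_cmult_left)
  have e: "ip (fd t k) (h k) = - \<sigma> * (lam TYPE('n) k * ip (f t k) (h k)) + ip (bt (jv (f t 1)) (f t) k) (h k)" for k
    using ip_fd[of "h k" t k] sph_harm_rpf[OF hh[THEN spec]] by simp
  then have b: "ip (bt (jv (f t 1)) (f t) k) (h k) = ip (fd t k) (h k) + \<sigma> * (lam TYPE('n) k * ip (f t k) (h k))" for k by simp
  have "(\<Sum>k. ip (bt (jv (f t 1)) (f t) k) (h k)) = (\<Sum>k. ip (fd t k) (h k)) + \<sigma> * (\<Sum>k. lam TYPE('n) k * ip (f t k) (h k))"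
    unfolding b suminf_mult[OF s2, symmetric] by (rule suminf_add[OF s1 summable_mult[OF s2], symmetric])
  then show ?thesis unfolding pair_eqs(1)[OF n2 fds hh] pair_eqs(2,3)[OF n2 fhs hh] by simp
qed

lemma f_L2H: assumes T: "T > 0" shows "L2H (s + 1) T f"
proof -
  obtain M where M: "summable M" "!!t k. t : {0..T} ==> hw TYPE('n) s k * sqn (f t k) <= M k" "!!k. lam TYPE('n) k * Ib T k <= M k" using M_bound[of T] T by auto
  show ?thesis
  proof (rule L2H_I[OF n2 fh fc])
    show "in_Hs (s + 1) (f t)" if "t : {0<..<T}" for t using dcl_in_Hs[OF f_dcl] that by simp
    show "summable (%k. M k + Ib T k)" by (intro summable_add M(1) Ib_summable) (use T in simp)
    fix k show "hw TYPE('n) (s + 1) k * integral {0..T} (%t. sqn (f t k)) <= M k + Ib T k"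
    proof (cases k)
      case 0
      have "M 0 >= 0" using M(3)[of 0] by simp
      then show ?thesis using 0 by (simp add: hw_def Ib_def)
    next
      case (Suc j)
      have "hw TYPE('n) (s + 1) k * integral {0..T} (%t. sqn (f t k)) = lam TYPE('n) k * Ib T k" using hw_Suc_r[OF n2, of k s] Suc by (simp add: Ib_def)
      then show ?thesis using M(3)[of k] Ib_nonneg[of T k] T by linarith
    qed
  qed
qed

text \<open>In the weight of order s - 1 diffusion costs \<open>lam\<close>^2, which is
  \<open>lam\<close> times the weight of order s, and the drift costs one \<open>lam\<close>, which
  gives the weight of order s in the neighbouring degrees. Both are controlled by
  \<open>M_bound\<close>.\<close>

lemma fd_L2H: assumes T: "T > 0" shows "L2H (s - 1) T fd"
proof -
  let ?h = "hw TYPE('n) s"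
  obtain M where M: "summable M" "!!k. lam TYPE('n) k * Ib T k <= M k" using M_bound[of T] T by auto
  obtain R where R: "R >= 0" "!!t. t : {0..T} ==> (norm (jv (f t 1)))\<^sup>2 <= R" using J_bound[of T] by auto
  let ?n = "real CARD('n)" let ?C = "hwC TYPE('n) s" let ?w = "hw TYPE('n) (s - 1)"
  define B where "B k = 2 * \<sigma>\<^sup>2 * M k + 4 * ?n * R * ?C * (Ib T (k - 1) + Ib T (Suc k))" for k
  have T0: "T >= 0" using T by simp
  show ?thesis
  proof (rule L2H_I[OF n2 fd_harm fd_cont])
    show "in_Hs (s - 1) (fd t)" if "t : {0<..<T}" for t using dcl_in_Hs[OF DD_dcl[OF fd_DD[OF f1]]] that by simp
    show "summable B" unfolding B_def
      by (intro summable_add summable_mult M(1) summable_shift_pred Ib_summable[OF T0])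
        (use Ib_summable[OF T0] in \<open>simp add: summable_Suc_iff\<close>)
    fix k show "?w k * integral {0..T} (%t. sqn (fd t k)) <= B k"
    proof (cases k)
      case 0
      have "fd t 0 = (%x. 0)" for t unfolding fd_def by (simp add: fun_eq_iff)
      moreover have "M 0 >= 0" using M(2)[of 0] by simp
      then have "B 0 >= 0" unfolding B_def using Ib_nonneg[OF T0] R(1) hwC_ge1[OF n2, of s]
        by (intro add_nonneg_nonneg mult_nonneg_nonneg) auto
      ultimately show ?thesis using 0 by simp
    next
      case (Suc j)
      have k: "k >= 1" using Suc by simp
      have hw: "?h k = lam TYPE('n) k * ?w k" using hw_Suc_r[OF n2 k, of "s - 1"] by simp
      have wp: "?w k > 0" by (rule hw_pos[OF n2])
      let ?G = "%t. 2 * (\<sigma> * lam TYPE('n) k)\<^sup>2 * sqn (f t k) + 2 * (lam TYPE('n) k * (2 * ?n * R)) * sqn (f t j) + 2 * (lam TYPE('n) k * (2 * ?n * R)) * sqn (f t (Suc k))"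
      have ci: "(%t. a * sqn (f t k)) integrable_on {0..T}" for a k by (intro integrable_continuous_real continuous_on_mult_left f_sqn_cont)
      have le: "sqn (fd t k) <= ?G t" if t: "t : {0..T}" for t
      proof -
        have rb: "rpf (bt (jv (f t 1)) (f t) k)" by (rule sph_harm_rpf[OF sph_harm_bt[OF n2]]) (use fh in blast)
        have "sqn (fd t k) <= 2 * sqn (%x. - (\<sigma> * lam TYPE('n) k) * f t k x) + 2 * sqn (bt (jv (f t 1)) (f t) k)"
          unfolding fd_def by (rule sqn_add_le[OF rpf_cmult[OF frpf] rb])
        also have "sqn (%x. - (\<sigma> * lam TYPE('n) k) * f t k x) = (\<sigma> * lam TYPE('n) k)\<^sup>2 * sqn (f t k)" unfolding sqn_cmult by simp
        also have "sqn (bt (jv (f t 1)) (f t) k) <= lam TYPE('n) k * (2 * ?n * (norm (jv (f t 1)))\<^sup>2 * sqn (f t j) + 2 * ?n * (norm (jv (f t 1)))\<^sup>2 * sqn (f t (Suc k)))"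
          using sqn_bt[OF n2, of "f t" k "jv (f t 1)"] fh Suc by simp
        also have "... <= lam TYPE('n) k * (2 * ?n * R * sqn (f t j) + 2 * ?n * R * sqn (f t (Suc k)))"
          by (intro mult_left_mono add_mono mult_right_mono R(2)[OF t] s0 lam_nonneg[OF n2]) auto
        finally show ?thesis by (simp add: algebra_simps)
      qed
      have "integral {0..T} (%t. sqn (fd t k)) <= integral {0..T} ?G"
        by (intro integral_le integrable_continuous_real cont_sqn[OF fd_harm] continuous_on_subset[OF fd_cont] continuous_on_add continuous_on_mult_left f_sqn_cont) (use le in auto)
      also have "... = 2 * (\<sigma> * lam TYPE('n) k)\<^sup>2 * integral {0..T} (%t. sqn (f t k)) + 2 * (lam TYPE('n) k * (2 * ?n * R)) * integral {0..T} (%t. sqn (f t j)) + 2 * (lam TYPE('n) k * (2 * ?n * R)) * integral {0..T} (%t. sqn (f t (Suc k)))"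
        by (simp add: Henstock_Kurzweil_Integration.integral_add integrable_add ci)
      finally have "?w k * integral {0..T} (%t. sqn (fd t k)) <= ?w k * (2 * (\<sigma> * lam TYPE('n) k)\<^sup>2 * integral {0..T} (%t. sqn (f t k)) + 2 * (lam TYPE('n) k * (2 * ?n * R)) * integral {0..T} (%t. sqn (f t j)) + 2 * (lam TYPE('n) k * (2 * ?n * R)) * integral {0..T} (%t. sqn (f t (Suc k))))"
        using wp by (intro mult_left_mono) auto
      also have "... = 2 * \<sigma>\<^sup>2 * (lam TYPE('n) k * Ib T k) + 4 * ?n * R * (?h k * integral {0..T} (%t. sqn (f t j)) + ?h k * integral {0..T} (%t. sqn (f t (Suc k))))"
        unfolding Ib_def hw by (simp add: algebra_simps power2_eq_square)
      also have "... <= 2 * \<sigma>\<^sup>2 * M k + 4 * ?n * R * (?C * Ib T j + ?C * Ib T (Suc k))"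
      proof (intro add_mono mult_left_mono M(2))
        have i0: "0 <= integral {0..T} (%t. sqn (f t k))" for k by (intro Henstock_Kurzweil_Integration.integral_nonneg integrable_continuous_real f_sqn_cont s0)
        show "?h k * integral {0..T} (%t. sqn (f t j)) <= ?C * Ib T j"
          using mult_right_mono[OF hw_ratio(1)[OF n2, of s j] i0[of j]] Suc by (simp add: Ib_def mult_ac)
        show "?h k * integral {0..T} (%t. sqn (f t (Suc k))) <= ?C * Ib T (Suc k)"
          using mult_right_mono[OF hw_ratio(2)[OF n2, of s k] i0[of "Suc k"]] by (simp add: Ib_def mult_ac)
      qed (use R(1) in auto)
      also have "... = B k" unfolding B_def Suc by (simp add: algebra_simps)
      finally show ?thesis .
    qed
  qed
qed

lemma f_weak_sol: assumes T: "T > 0" shows "weak_sol \<sigma> s T f"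
  unfolding weak_sol_def
proof (intro conjI exI[of _ fd] f_L2H[OF T] fd_L2H[OF T] f_weak_tderiv[OF T])
  show "AE t in lborel. t : {0<..<T} --> (\<forall>h. in_Hs (1 - s) h --> dpair (fd t) h = - \<sigma> * gpair (f t) h + jpair (f t) h)"
    using f_weak_id by (intro AE_I2) auto
qed

end

section \<open>Uniqueness\<close>

text \<open>The flat function exp(-1/x) with a polynomial in 1/x as a factor. The factor closes the
  class under differentiation, so smoothness follows by induction.\<close>

definition bmp :: "real poly => real => real" where
  "bmp P x = (if x > 0 then poly P (1 / x) * exp (- (1 / x)) else 0)"

lemma poly_exp_decay: "((%y. poly P y * exp (- y)) \<longlongrightarrow> (0::real)) at_top"
proof -
  have "((%y. \<Sum>i\<le>degree P. coeff P i * (y ^ i / exp y)) \<longlongrightarrow> (\<Sum>i\<le>degree P. coeff P i * 0)) at_top"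
    by (intro tendsto_sum tendsto_mult tendsto_const tendsto_power_div_exp_0)
  moreover have "(\<Sum>i\<le>degree P. coeff P i * (y ^ i / exp y)) = poly P y * exp (- y)" for y
    by (simp add: poly_altdef sum_distrib_right exp_minus divide_inverse mult.assoc)
  ultimately show ?thesis by simp
qed

lemma bmp_deriv: "(bmp P has_real_derivative bmp ([:0, 0, 1:] * (P - pderiv P)) x) (at x)"
proof -
  consider "x > 0" | "x < 0" | "x = 0" by linarith
  then show ?thesis
  proof cases
    case 1
    have "((%x. poly P (1 / x) * exp (- (1 / x))) has_real_derivative
       poly (pderiv P) (1 / x) * (- (1 / x\<^sup>2)) * exp (- (1 / x)) + exp (- (1 / x)) * (1 / x\<^sup>2) * poly P (1 / x)) (at x)"
    proof (rule DERIV_mult)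
      have i: "((%x. 1 / x) has_real_derivative - (1 / x\<^sup>2)) (at x)"
        using 1 by (auto intro!: derivative_eq_intros simp: power2_eq_square)
      show "((%x. poly P (1 / x)) has_real_derivative poly (pderiv P) (1 / x) * (- (1 / x\<^sup>2))) (at x)" by (rule DERIV_chain2[OF poly_DERIV i])
      show "((%x. exp (- (1 / x))) has_real_derivative exp (- (1 / x)) * (1 / x\<^sup>2)) (at x)"
        using DERIV_chain2[OF DERIV_exp DERIV_minus[OF i]] by simp
    qed
    then have "(bmp P has_real_derivative
       poly (pderiv P) (1 / x) * (- (1 / x\<^sup>2)) * exp (- (1 / x)) + exp (- (1 / x)) * (1 / x\<^sup>2) * poly P (1 / x)) (at x)"
      by (rule has_field_derivative_transform_within_open[where S="{0<..}"]) (use 1 in \<open>auto simp: bmp_def\<close>)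
    moreover have "poly (pderiv P) (1 / x) * (- (1 / x\<^sup>2)) * exp (- (1 / x)) + exp (- (1 / x)) * (1 / x\<^sup>2) * poly P (1 / x) = bmp ([:0, 0, 1:] * (P - pderiv P)) x"
      using 1 by (simp add: bmp_def algebra_simps power2_eq_square)
    ultimately show ?thesis by simp
  next
    case 2
    have "(bmp P has_real_derivative 0) (at x)"
      by (rule has_field_derivative_transform_within_open[OF DERIV_const, where S="{..<0}"]) (use 2 in \<open>auto simp: bmp_def\<close>)
    then show ?thesis using 2 by (simp add: bmp_def)
  next
    case 3
    have r: "((%h. bmp P h / h) \<longlongrightarrow> 0) (at_right 0)"
    proof -
      have "((%h. poly (pCons 0 P) (inverse h) * exp (- inverse h)) \<longlongrightarrow> 0) (at_right 0)"
        by (rule filterlim_compose[OF poly_exp_decay filterlim_inverse_at_top_right])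
      then show ?thesis
        by (rule Lim_transform_eventually) (auto simp: eventually_at_filter bmp_def divide_inverse intro!: always_eventually)
    qed
    have l: "((%h. bmp P h / h) \<longlongrightarrow> 0) (at_left 0)"
      by (rule Lim_transform_eventually[OF tendsto_const]) (auto simp: eventually_at_filter bmp_def intro!: always_eventually)
    have "((%h. bmp P h / h) \<longlongrightarrow> 0) (at 0)" by (rule filterlim_split_at[OF l r])
    then have "(bmp P has_real_derivative 0) (at 0)" by (simp add: DERIV_def bmp_def[of P 0])
    then show ?thesis using 3 by (simp add: bmp_def)
  qed
qed

text \<open>Differentiability of order k on the line by a chain of real derivatives, which is easier
  to preserve under sums and products; \<open>rs_Ck\<close> leads back to \<open>Ck\<close>.\<close>

fun rs :: "nat => (real => real) => bool" where
  "rs 0 f = continuous_on UNIV f"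
| "rs (Suc k) f = (\<exists>f'. (\<forall>x. (f has_real_derivative f' x) (at x)) & rs k f')"

lemma rs_cont: "rs k f ==> continuous_on UNIV f"
  by (cases k) (auto intro: DERIV_isCont continuous_at_imp_continuous_on)

lemma rs_mono: "rs (Suc k) f ==> rs k f"
proof (induction k arbitrary: f)
  case 0 then show ?case using rs_cont[of 1 f] by simp
next
  case (Suc k)
  then obtain f' where f': "\<forall>x. (f has_real_derivative f' x) (at x)" "rs (Suc k) f'" by auto
  show ?case using f'(1) Suc.IH[OF f'(2)] by auto
qed

lemma rs_bmp: "rs k (bmp P)"
proof (induction k arbitrary: P)
  case 0 show ?case using bmp_deriv by (auto intro: DERIV_isCont continuous_at_imp_continuous_on)
next
  case (Suc k) show ?case using bmp_deriv[of P] Suc by auto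
qed

lemma rs_add: "rs k f ==> rs k g ==> rs k (%x. f x + g x)"
proof (induction k arbitrary: f g)
  case 0 then show ?case by (auto intro: continuous_on_add)
next
  case (Suc k)
  obtain f' g' where d: "\<forall>x. (f has_real_derivative f' x) (at x)" "rs k f'" "\<forall>x. (g has_real_derivative g' x) (at x)" "rs k g'" using Suc.prems by auto
  show ?case unfolding rs.simps
    using DERIV_add[OF d(1)[rule_format] d(3)[rule_format]] Suc.IH[OF d(2,4)] by (intro exI[of _ "%x. f' x + g' x"]) blast
qed

lemma rs_mult: "rs k f ==> rs k g ==> rs k (%x. f x * g x)"
proof (induction k arbitrary: f g)
  case 0 then show ?case by (auto intro: continuous_on_mult)
next
  case (Suc k)
  obtain f' g' where d: "\<forall>x. (f has_real_derivative f' x) (at x)" "rs k f'" "\<forall>x. (g has_real_derivative g' x) (at x)" "rs k g'" using Suc.prems by auto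
  have "rs k (%x. f' x * g x + g' x * f x)" by (rule rs_add[OF Suc.IH[OF d(2) rs_mono[OF Suc.prems(2)]] Suc.IH[OF d(4) rs_mono[OF Suc.prems(1)]]])
  then show ?case unfolding rs.simps
    using DERIV_mult[OF d(1)[rule_format] d(3)[rule_format]] by (intro exI[of _ "%x. f' x * g x + g' x * f x"]) blast
qed

lemma rs_const: "rs k (%x. c)"
proof (induction k arbitrary: c)
  case (Suc k) show ?case using Suc[of 0] by (auto intro!: exI[of _ "%_. 0"])
qed simp

lemma rs_affine: "rs k f ==> rs k (%x. f (c * x + a))"
proof (induction k arbitrary: f)
  case 0
  then have f: "continuous_on UNIV f" by simp
  have "continuous_on UNIV (%x. f (c * x + a))" by (rule continuous_on_compose2[OF f]) (auto intro!: continuous_intros)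
  then show ?case by simp
next
  case (Suc k)
  obtain f' where d: "\<forall>x. (f has_real_derivative f' x) (at x)" "rs k f'" using Suc.prems by auto
  have "((%x. f (c * x + a)) has_real_derivative f' (c * x + a) * c) (at x)" for x
    by (rule DERIV_chain2[OF d(1)[rule_format]]) (auto intro!: derivative_eq_intros)
  moreover have "rs k (%x. f' (c * x + a) * c)" by (rule rs_mult[OF Suc.IH[OF d(2)] rs_const])
  ultimately show ?case unfolding rs.simps by (intro exI[of _ "%x. f' (c * x + a) * c"]) blast
qed

lemma rs_Ck: "rs k f ==> Ck k f UNIV"
proof (induction k arbitrary: f)
  case (Suc k)
  obtain f' where d: "\<forall>x. (f has_real_derivative f' x) (at x)" "rs k f'" using Suc.prems by auto
  have D: "(f has_derivative (*) (f' x)) (at x)" for x using d(1) by (simp add: has_field_derivative_def)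
  have "(%x. frechet_derivative f (at x) v) = (%x. f' x * v)" for v using frechet_derivative_at[OF D] by metis
  then have "Ck k (%x. frechet_derivative f (at x) v) UNIV" for v using Suc.IH[OF rs_mult[OF d(2) rs_const]] by simp
  then show ?case using D by (auto simp: differentiable_def)
qed simp

lemma bump_exists:
  assumes e: "ep > (0::real)"
  shows "\<exists>\<Phi> \<rho>. (\<forall>t. (\<Phi> has_real_derivative \<rho> t) (at t)) & (\<forall>k. rs k \<Phi>) & continuous_on UNIV \<rho> & (\<forall>t. \<rho> t >= 0) \<and>
     (\<forall>t. \<rho> t > 0 \<longleftrightarrow> 0 < t & t < ep) & (\<forall>t\<le>0. \<Phi> t = 0) & (\<forall>t\<ge>ep. \<Phi> t = \<Phi> ep)"
proof -
  define \<rho> where "\<rho> t = bmp 1 t * bmp 1 (- 1 * t + ep)" for t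
  \<comment> \<open>The lower limit -1 makes 0 an interior point of the interval of integration, so
    that a two-sided derivative is obtained there.\<close>
  define \<Phi> where "\<Phi> t = integral {-1..t} \<rho>" for t
  have rr: "rs k \<rho>" for k unfolding \<rho>_def[abs_def] by (intro rs_mult rs_bmp rs_affine)
  have c: "continuous_on A \<rho>" for A using continuous_on_subset[OF rs_cont[OF rr]] by blast
  have pos: "\<rho> t > 0 \<longleftrightarrow> 0 < t & t < ep" and nn: "\<rho> t >= 0" for t by (auto simp: \<rho>_def bmp_def)
  have z: "\<rho> t = 0" if "t <= 0 \<or> t >= ep" for t using pos[of t] nn[of t] that by linarith
  have P0: "\<Phi> t = 0" if "t <= 0" for t
    unfolding \<Phi>_def using z that by (subst Henstock_Kurzweil_Integration.integral_cong[of _ _ "%_. 0"]) auto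
  have D: "(\<Phi> has_real_derivative \<rho> t) (at t)" for t
  proof (cases "t < 0")
    case True
    have "(\<Phi> has_real_derivative 0) (at t)"
      by (rule has_field_derivative_transform_within_open[OF DERIV_const, where S="{..<0}"]) (use True P0 in auto)
    then show ?thesis using z[of t] True by simp
  next
    case False
    have "(\<Phi> has_real_derivative \<rho> t) (at t within {-1..t + 1})"
      unfolding \<Phi>_def[abs_def] by (rule integral_has_real_derivative[OF c]) (use False in auto)
    moreover have "at t within {-1..t + 1} = at t" using False by (intro at_within_interior) (auto simp: interior_atLeastAtMost_real)
    ultimately show ?thesis by simp
  qed
  have "rs k \<Phi>" for k by (rule rs_mono) (use D rr in auto)
  moreover have "\<Phi> t = \<Phi> ep" if "t >= ep" for t
  proof (cases "t = ep")
    case False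
    then have "ep < t" using that by simp
    then obtain y where "ep < y" "y < t" "\<Phi> t - \<Phi> ep = (t - ep) * \<rho> y" using MVT2[of ep t \<Phi> \<rho>] D by blast
    then show ?thesis using z[of y] by simp
  qed simp
  ultimately show ?thesis using D c pos nn P0 by blast
qed

text \<open>If \<open>v = q - \<integral>r\<close> took different values at \<open>a < b\<close>, then testing with a function whose derivative is a bump
  at \<open>a\<close> minus the same bump at \<open>b\<close> would give an integrand of constant sign.\<close>

lemma du_bois_reymond:
  fixes q r :: "real => real"
  assumes T: "T > 0" and q: "continuous_on {0..T} q" and r: "continuous_on {0..T} r"
    and w: "!!\<phi>. test_fun T \<phi> ==> integral {0..T} (%t. q t * deriv \<phi> t) = - integral {0..T} (%t. r t * \<phi> t)"
    and t: "t : {0..T}"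
  shows "q t = q 0 + integral {0..t} r"
proof -
  define I where "I t = integral {0..t} r" for t
  have dI: "(I has_real_derivative r t) (at t within {0..T})" if "t : {0..T}" for t
    unfolding I_def[abs_def] by (rule integral_has_real_derivative[OF r that])
  have cI: "continuous_on {0..T} I" using dI by (rule DERIV_continuous_on)
  define v where "v t = q t - I t" for t
  have cv: "continuous_on {0..T} v" unfolding v_def[abs_def] by (intro continuous_on_diff q cI)
  have W: "integral {0..T} (%t. v t * deriv \<phi> t) = 0" if \<phi>: "test_fun T \<phi>" for \<phi>
  proof -
    have sm: "smooth_on UNIV \<phi>" using \<phi> unfolding test_fun_def by blast
    have z: "\<phi> 0 = 0" "\<phi> T = 0" using \<phi> unfolding test_fun_def by auto
    note d = smooth_real_deriv[OF sm]
    have c\<phi>: "continuous_on {0..T} \<phi>" "continuous_on {0..T} (deriv \<phi>)"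
      using continuous_on_subset[OF d(2)] DERIV_continuous_on[OF has_field_derivative_at_within[OF d(1)]] by auto
    have "((%t. I t * deriv \<phi> t + r t * \<phi> t) has_integral I T * \<phi> T - I 0 * \<phi> 0) {0..T}"
    proof (rule fundamental_theorem_of_calculus)
      fix t assume t: "t : {0..T}"
      from DERIV_mult[OF dI[OF t] has_field_derivative_at_within[OF d(1)]]
      show "((%t. I t * \<phi> t) has_vector_derivative I t * deriv \<phi> t + r t * \<phi> t) (at t within {0..T})"
        by (simp add: has_real_derivative_iff_has_vector_derivative mult.commute add.commute)
    qed (use T in simp)
    then have "integral {0..T} (%t. I t * deriv \<phi> t + r t * \<phi> t) = 0" using z by (simp add: integral_unique)
    moreover have i: "(%t. I t * deriv \<phi> t) integrable_on {0..T}" "(%t. r t * \<phi> t) integrable_on {0..T}" "(%t. q t * deriv \<phi> t) integrable_on {0..T}"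
      by (intro integrable_continuous_real continuous_on_mult cI r q c\<phi>)+
    ultimately have "integral {0..T} (%t. I t * deriv \<phi> t) + integral {0..T} (%t. r t * \<phi> t) = 0"
      using Henstock_Kurzweil_Integration.integral_add[OF i(1,2)] by simp
    moreover have "integral {0..T} (%t. v t * deriv \<phi> t) = integral {0..T} (%t. q t * deriv \<phi> t) - integral {0..T} (%t. I t * deriv \<phi> t)"
      unfolding v_def left_diff_distrib by (rule Henstock_Kurzweil_Integration.integral_diff[OF i(3,1)])
    ultimately show ?thesis using w[OF \<phi>] by linarith
  qed
  have B: "v a = v b" if ab: "0 < a" "a < b" "b < T" for a b
  proof (rule ccontr)
    assume ne: "v a ~= v b"
    define m where "m = \<bar>v a - v b\<bar> / 2"
    have m: "m > 0" using ne by (simp add: m_def)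
    define g where "g = (if v a > v b then 1 else - 1 :: real)"
    \<comment> \<open>The derivative of a test function has integral 0, so a constant may be
      subtracted from v. With the midpoint, and g as sign, v - c is positive near a and negative
      near b after multiplication by g, matching the signs of the two bumps.\<close>
    define c where "c = (v a + v b) / 2"
    have ga: "g * (v a - c) = m" and gb: "g * (v b - c) = - m" and g1: "\<bar>g\<bar> = 1" by (auto simp: g_def m_def c_def field_simps)
    obtain d1 where d1: "d1 > 0" "!!t. t : {0..T} ==> dist t a < d1 ==> dist (v t) (v a) < m"
      using cv[unfolded continuous_on_iff, rule_format, of a m] m ab by auto
    obtain d2 where d2: "d2 > 0" "!!t. t : {0..T} ==> dist t b < d2 ==> dist (v t) (v b) < m"
      using cv[unfolded continuous_on_iff, rule_format, of b m] m ab by auto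
    define ep where "ep = min (min d1 d2) (min (b - a) (T - b)) / 2"
    have e: "ep > 0" "ep < d1" "ep < d2" "a + ep < b" "b + ep < T" using d1(1) d2(1) ab by (auto simp: ep_def min_def field_simps)
    obtain \<Phi> \<rho> where \<Phi>: "!!t. (\<Phi> has_real_derivative \<rho> t) (at t)" "!!k. rs k \<Phi>" "continuous_on UNIV \<rho>" "!!t. \<rho> t >= 0"
      "!!t. \<rho> t > 0 \<longleftrightarrow> 0 < t & t < ep" "!!t. t <= 0 ==> \<Phi> t = 0" "!!t. t >= ep ==> \<Phi> t = \<Phi> ep" using bump_exists[OF e(1)] by auto
    \<comment> \<open>A smooth step up at a and the same step down at b, hence supported between a
      and b + ep.\<close>
    define \<phi> where "\<phi> t = \<Phi> (1 * t + (- a)) + (- 1) * \<Phi> (1 * t + (- b))" for t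
    have D: "(\<phi> has_real_derivative \<rho> (t - a) - \<rho> (t - b)) (at t)" for t
    proof -
      have "((%t. \<Phi> (t - x)) has_real_derivative \<rho> (t - x) * 1) (at t)" for x
        by (rule DERIV_chain2[OF \<Phi>(1)]) (auto intro!: derivative_eq_intros)
      from DERIV_diff[OF this[of a] this[of b]] show ?thesis unfolding \<phi>_def[abs_def] by simp
    qed
    have de: "deriv \<phi> = (%t. \<rho> (t - a) - \<rho> (t - b))" using D DERIV_imp_deriv by blast
    have "rs k \<phi>" for k unfolding \<phi>_def[abs_def] by (intro rs_add rs_mult rs_const rs_affine \<Phi>(2))
    then have "smooth_on UNIV \<phi>" unfolding smooth_on_def using rs_Ck by blast
    moreover have supp: "\<phi> t = 0" if "t \<notin> {a..b + ep}" for t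
    proof (cases "t < a")
      case True then show ?thesis using \<Phi>(6)[of "t - a"] \<Phi>(6)[of "t - b"] ab by (simp add: \<phi>_def)
    next
      case False then have "t > b + ep" using that by auto
      then show ?thesis using \<Phi>(7)[of "t - a"] \<Phi>(7)[of "t - b"] ab by (simp add: \<phi>_def)
    qed
    ultimately have tf: "test_fun T \<phi>" unfolding test_fun_def using ab e(5) by (intro conjI exI[of _ a] exI[of _ "b + ep"]) auto
    have c\<rho>: "continuous_on {0..T} (%t. \<rho> (t - x))" for x by (intro continuous_on_compose2[OF \<Phi>(3)] continuous_intros) auto
    have cd: "continuous_on {0..T} (deriv \<phi>)" unfolding de by (intro continuous_on_diff c\<rho>)
    have i0: "integral {0..T} (deriv \<phi>) = 0"
    proof -
      have "(deriv \<phi> has_integral \<phi> T - \<phi> 0) {0..T}"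
      proof (rule fundamental_theorem_of_calculus)
        show "(\<phi> has_vector_derivative deriv \<phi> t) (at t within {0..T})" for t
          using has_field_derivative_at_within[OF D] unfolding de has_real_derivative_iff_has_vector_derivative .
      qed (use T in simp)
      then show ?thesis using supp[of T] supp[of 0] ab e by (simp add: integral_unique)
    qed
    let ?G = "%t. g * ((v t - c) * deriv \<phi> t)"
    have cG: "continuous_on {0..T} ?G" by (intro continuous_intros cv cd)
    have nnG: "?G t >= 0" if t: "t : {0..T}" for t
    proof -
      have tri: "\<bar>g * (v t - c) - g * (v x - c)\<bar> = dist (v t) (v x)" for x
        using g1 by (simp add: dist_real_def abs_mult flip: right_diff_distrib)
      consider "0 < t - a & t - a < ep" | "0 < t - b & t - b < ep" | "\<not> (0 < t - a & t - a < ep)" "\<not> (0 < t - b & t - b < ep)" by blast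
      then show ?thesis
      proof cases
        case 1
        have "dist (v t) (v a) < m" using d1(2)[OF t] 1 e by (simp add: dist_real_def)
        then have p: "g * (v t - c) >= 0" using tri[of a] ga by linarith
        have "\<rho> (t - b) = 0" using 1 \<Phi>(5)[of "t - b"] \<Phi>(4)[of "t - b"] e by (simp add: less_le)
        then show ?thesis using p \<Phi>(4)[of "t - a"] unfolding de by (simp add: mult.assoc[symmetric])
      next
        case 2
        have "dist (v t) (v b) < m" using d2(2)[OF t] 2 e by (simp add: dist_real_def)
        then have p: "g * (v t - c) <= 0" using tri[of b] gb by linarith
        have "\<rho> (t - a) = 0" using 2 \<Phi>(5)[of "t - a"] \<Phi>(4)[of "t - a"] e by (simp add: less_le)
        then have "?G t = (g * (v t - c)) * (- \<rho> (t - b))" unfolding de by (simp add: mult.assoc)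
        also have "... >= 0" by (rule mult_nonpos_nonpos[OF p]) (use \<Phi>(4) in simp)
        finally show ?thesis .
      next
        case 3
        have "\<rho> (t - a) = 0" "\<rho> (t - b) = 0" using 3 \<Phi>(5)[of "t - a"] \<Phi>(5)[of "t - b"] \<Phi>(4)[of "t - a"] \<Phi>(4)[of "t - b"] by linarith+
        then show ?thesis by (simp add: de)
      qed
    qed
    have iv: "(%t. v t * deriv \<phi> t) integrable_on {0..T}" and ic: "(%t. c * deriv \<phi> t) integrable_on {0..T}"
      by (intro integrable_continuous_real continuous_on_mult cv cd continuous_on_const)+
    have "integral {0..T} ?G = g * (integral {0..T} (%t. v t * deriv \<phi> t) - integral {0..T} (%t. c * deriv \<phi> t))"
      using Henstock_Kurzweil_Integration.integral_diff[OF iv ic] by (simp add: left_diff_distrib)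
    then have "integral {0..T} ?G = 0" using W[OF tf] i0 by simp
    \<comment> \<open>A nonnegative continuous integrand with integral 0 vanishes. At a + ep/2 the
      bump is positive, so v would equal c there, although v stays within m of v a.\<close>
    then have "?G (a + ep / 2) = 0" using integral_eq_0_iff[OF cG T nnG] ab e by auto
    moreover have "\<rho> (a + ep / 2 - b) = 0" using \<Phi>(5)[of "a + ep / 2 - b"] \<Phi>(4)[of "a + ep / 2 - b"] e by linarith
    moreover have "\<rho> (a + ep / 2 - a) > 0" using \<Phi>(5)[of "a + ep / 2 - a"] e by simp
    ultimately have "v (a + ep / 2) = c" using g1 unfolding de by auto
    moreover have "dist (v (a + ep / 2)) (v a) < m" using d1(2)[of "a + ep / 2"] e ab by (simp add: dist_real_def)
    moreover have "\<bar>v a - c\<bar> = m" by (simp add: m_def c_def field_simps abs_if)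
    ultimately show False by (simp add: dist_real_def abs_minus_commute)
  qed
  have mid: "v x = v (T / 2)" if "x : {0<..<T}" for x
  proof (cases x "T / 2" rule: linorder_cases)
    case less then show ?thesis using that T by (intro B) auto
  next
    case greater then show ?thesis using that T by (intro B[symmetric]) auto
  next
    case equal then show ?thesis by (rule arg_cong)
  qed
  have cl: "closure {0<..<T} = {0..T}" using T by simp
  have vc: "v x = v (T / 2)" if "x : {0..T}" for x
    by (rule continuous_constant_on_closure[of "{0<..<T}" v]) (use cv cl that in \<open>simp_all only: mid\<close>)
  have "v t = v (T / 2)" by (rule vc[OF t])
  moreover have "v 0 = v (T / 2)" by (rule vc) (use T in simp)
  ultimately have "v t = v 0" by (simp only:)
  then show ?thesis unfolding v_def I_def by simp
qed

section \<open>Weak solutions satisfy the system of components\<close>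

lemma hs_term_le:
  fixes u :: "'n::finite sdist"
  assumes n: "CARD('n) >= 2" and u: "in_Hs s u"
  shows "(\<Sum>k\<le>K. hw TYPE('n) s k * sqn (u k)) <= hs_sq s u" "hw TYPE('n) s k * sqn (u k) <= hs_sq s u"
proof -
  let ?h = "hw TYPE('n) s"
  have sm: "summable (%k. ?h k * sqn (u k))" and h: "hseq u" using u unfolding in_Hs_def hs_weight_hw by auto
  have nn: "0 <= ?h k * sqn (u k)" for k using hw_pos[OF n, of s k] sqn_nonneg[OF sph_harm_rpf[OF h[THEN spec]]] by simp
  show "(\<Sum>k\<le>K. ?h k * sqn (u k)) <= hs_sq s u" unfolding hs_sq_def hs_weight_hw by (rule sum_le_suminf[OF sm]) (use nn in auto)
  show "?h k * sqn (u k) <= hs_sq s u" unfolding hs_sq_def hs_weight_hw using sum_le_suminf[OF sm, of "{k}"] nn by simp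
qed

lemma in_Hs_diff:
  fixes u w :: "'n::finite sdist"
  assumes n: "CARD('n) >= 2" and u: "in_Hs s u" and w: "in_Hs s w" shows "in_Hs s (%k. u k - w k)"
proof -
  let ?h = "hw TYPE('n) s"
  have e: "u k - w k = (%x. u k x - w k x)" for k by (simp add: fun_eq_iff)
  have h: "hseq u" "hseq w" using u w unfolding in_Hs_def by auto
  have "summable (%k. ?h k * sqn (%x. u k x - w k x))"
  proof (rule summable_sandwich)
    fix k
    have hp: "?h k > 0" by (rule hw_pos[OF n])
    show "0 <= ?h k * sqn (%x. u k x - w k x)" using hp sqn_nonneg[OF sph_harm_rpf[OF sph_harm_diff[OF h(1)[THEN spec] h(2)[THEN spec]]]] by simp
    have "?h k * sqn (%x. u k x - w k x) <= ?h k * (2 * sqn (u k) + 2 * sqn (w k))"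
      using hp h sph_harm_rpf by (intro mult_left_mono sqn_diff_le) (auto simp: less_imp_le)
    then show "?h k * sqn (%x. u k x - w k x) <= 2 * (?h k * sqn (u k)) + 2 * (?h k * sqn (w k))" by (simp add: algebra_simps)
    show "summable (%k. 2 * (?h k * sqn (u k)) + 2 * (?h k * sqn (w k)))"
      using u w unfolding in_Hs_def hs_weight_hw by (intro summable_add summable_mult) auto
  qed
  then show ?thesis unfolding in_Hs_def hs_weight_hw e using h sph_harm_diff by blast
qed

lemma cont_Hs_ip:
  fixes g :: "real => 'n::finite sdist"
  assumes n: "CARD('n) >= 2" and g: "cont_Hs s A g" and Q: "sph_harm k Q"
  shows "continuous_on A (%t. ip (g t k) Q)"
  unfolding continuous_on_def
proof
  fix t0 assume t0: "t0 : A"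
  have H: "in_Hs s (g t)" if "t : A" for t using g that unfolding cont_Hs_def by blast
  have h: "sph_harm k (g t k)" if "t : A" for t using H[OF that] unfolding in_Hs_def by blast
  have e: "g t k - g t0 k = (%x. g t k x - g t0 k x)" for t by (simp add: fun_eq_iff)
  have hp: "hw TYPE('n) s k > 0" by (rule hw_pos[OF n])
  have "((%t. sqrt (hs_sq s (%l. g t l - g t0 l) / hw TYPE('n) s k * sqn Q)) \<longlongrightarrow> sqrt (0 / hw TYPE('n) s k * sqn Q)) (at t0 within A)"
    using g t0 hp unfolding cont_Hs_def by (intro tendsto_intros) auto
  then have l: "((%t. sqrt (hs_sq s (%l. g t l - g t0 l) / hw TYPE('n) s k * sqn Q)) \<longlongrightarrow> 0) (at t0 within A)" by simp
  have b: "\<bar>ip (g t k) Q - ip (g t0 k) Q\<bar> <= sqrt (hs_sq s (%l. g t l - g t0 l) / hw TYPE('n) s k * sqn Q)" if t: "t : A" for t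
  proof -
    have r: "rpf (g t k)" "rpf (g t0 k)" "rpf Q" using h[OF t] h[OF t0] Q sph_harm_rpf by blast+
    have "hw TYPE('n) s k * sqn (%x. g t k x - g t0 k x) <= hs_sq s (%l. g t l - g t0 l)"
      using hs_term_le(2)[OF n in_Hs_diff[OF n H[OF t] H[OF t0]], of k] unfolding e .
    then have s: "sqn (%x. g t k x - g t0 k x) <= hs_sq s (%l. g t l - g t0 l) / hw TYPE('n) s k" using hp by (simp add: pos_le_divide_eq mult.commute)
    have "(ip (%x. g t k x - g t0 k x) Q)\<^sup>2 <= sqn (%x. g t k x - g t0 k x) * sqn Q"
      by (rule ip_CS[OF sph_harm_rpf[OF sph_harm_diff[OF h[OF t] h[OF t0]]] r(3)])
    also have "... <= hs_sq s (%l. g t l - g t0 l) / hw TYPE('n) s k * sqn Q" by (rule mult_right_mono[OF s sqn_nonneg[OF r(3)]])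
    finally have "sqrt ((ip (%x. g t k x - g t0 k x) Q)\<^sup>2) <= sqrt (hs_sq s (%l. g t l - g t0 l) / hw TYPE('n) s k * sqn Q)" by (rule real_sqrt_le_mono)
    then show ?thesis unfolding ip_diff_left[OF r] by simp
  qed
  have "\<forall>\<^sub>F t in at t0 within A. norm (ip (g t k) Q - ip (g t0 k) Q) <= sqrt (hs_sq s (%l. g t l - g t0 l) / hw TYPE('n) s k * sqn Q)"
    unfolding eventually_at_filter using b by (intro always_eventually) auto
  then have "((%t. ip (g t k) Q - ip (g t0 k) Q) \<longlongrightarrow> 0) (at t0 within A)" by (rule Lim_null_comparison[OF _ l])
  then show "((%t. ip (g t k) Q) \<longlongrightarrow> ip (g t0 k) Q) (at t0 within A)" by (simp add: LIM_zero_iff)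
qed

text \<open>Compactness of the time interval: finitely many neighbourhoods cover it, in each of
  which the solution has squared distance less than 1 from its value at the centre.\<close>

lemma cont_Hs_bounded:
  fixes g :: "real => 'n::finite sdist"
  assumes n: "CARD('n) >= 2" and g: "cont_Hs s {0..T} g"
  shows "\<exists>N. \<forall>t\<in>{0..T}. \<forall>K. (\<Sum>k\<le>K. hw TYPE('n) s k * sqn (g t k)) <= N"
proof -
  let ?h = "hw TYPE('n) s"
  have H: "in_Hs s (g t)" if "t : {0..T}" for t using g that unfolding cont_Hs_def by blast
  have h: "sph_harm k (g t k)" if "t : {0..T}" for t k using H[OF that] unfolding in_Hs_def by blast
  have "\<exists>U. open U & t0 : U & (\<forall>t\<in>U \<inter> {0..T}. hs_sq s (%l. g t l - g t0 l) < 1)" if t0: "t0 : {0..T}" for t0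
  proof -
    have "\<forall>\<^sub>F t in at t0 within {0..T}. hs_sq s (%l. g t l - g t0 l) < 1"
      using g t0 unfolding cont_Hs_def by (intro order_tendstoD(2)[of _ 0]) auto
    then obtain U where U: "open U" "t0 : U" "!!t. t : U ==> t ~= t0 ==> t : {0..T} ==> hs_sq s (%l. g t l - g t0 l) < 1"
      unfolding eventually_at_topological by blast
    have "g t0 l - g t0 l = (%x. 0)" for l by (simp add: fun_eq_iff)
    then have "hs_sq s (%l. g t0 l - g t0 l) = 0" unfolding hs_sq_def by (simp only: sqn_zero mult_zero_right suminf_zero)
    then have 0: "hs_sq s (%l. g t0 l - g t0 l) < 1" by (simp only: zero_less_one)
    have "hs_sq s (%l. g t l - g t0 l) < 1" if "t : U \<inter> {0..T}" for t using U(3)[of t] 0 that by (cases "t = t0") auto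
    then show ?thesis using U(1,2) by blast
  qed
  then have "\<forall>t0\<in>{0..T}. \<exists>U. open U & t0 : U & (\<forall>t\<in>U \<inter> {0..T}. hs_sq s (%l. g t l - g t0 l) < 1)" by blast
  from bchoice[OF this] obtain U where U: "!!t0. t0 : {0..T} ==> open (U t0)" "!!t0. t0 : {0..T} ==> t0 : U t0"
    "!!t0 t. t0 : {0..T} ==> t : U t0 ==> t : {0..T} ==> hs_sq s (%l. g t l - g t0 l) < 1" by blast
  have cov: "{0..T} \<subseteq> (\<Union>t\<in>{0..T}. U t)" using U(2) by blast
  obtain C where C: "C \<subseteq> {0..T}" "finite C" "{0..T} \<subseteq> (\<Union>t\<in>C. U t)"
    by (rule compactE_image[OF compact_Icc[of 0 T], of "{0..T}" U]) (use U(1) cov in auto)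
  have q0: "hs_sq s (g t) >= 0" if "t : {0..T}" for t
    using hs_term_le(2)[OF n H[OF that], of 0] hw_pos[OF n, of s 0] sqn_nonneg[OF sph_harm_rpf[OF h[OF that]], of 0]
    by (meson less_imp_le mult_nonneg_nonneg order_trans)
  have "(\<Sum>k\<le>K. ?h k * sqn (g t k)) <= 2 + 2 * (\<Sum>t0\<in>C. hs_sq s (g t0))" if t: "t : {0..T}" for t K
  proof -
    obtain t0 where t0: "t0 : C" "t : U t0" using C(3) t by blast
    have t0T: "t0 : {0..T}" using t0 C by blast
    have e: "g t k - g t0 k = (%x. g t k x - g t0 k x)" for k by (simp add: fun_eq_iff)
    have "?h k * sqn (g t k) <= 2 * (?h k * sqn (g t k - g t0 k)) + 2 * (?h k * sqn (g t0 k))" for k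
    proof -
      have r: "rpf (%x. g t k x - g t0 k x)" "rpf (g t0 k)" using sph_harm_diff[OF h[OF t] h[OF t0T], of k] h[OF t0T] sph_harm_rpf by blast+
      have "sqn (g t k) <= 2 * sqn (%x. g t k x - g t0 k x) + 2 * sqn (g t0 k)" using sqn_add_le[OF r] by simp
      then have "?h k * sqn (g t k) <= ?h k * (2 * sqn (%x. g t k x - g t0 k x) + 2 * sqn (g t0 k))"
        using hw_pos[OF n, of s k] by (intro mult_left_mono) auto
      then show ?thesis unfolding e by (simp add: algebra_simps)
    qed
    then have "(\<Sum>k\<le>K. ?h k * sqn (g t k)) <= (\<Sum>k\<le>K. 2 * (?h k * sqn (g t k - g t0 k)) + 2 * (?h k * sqn (g t0 k)))" by (rule sum_mono)
    also have "... = 2 * (\<Sum>k\<le>K. ?h k * sqn (g t k - g t0 k)) + 2 * (\<Sum>k\<le>K. ?h k * sqn (g t0 k))" by (simp add: sum.distrib sum_distrib_left)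
    also have "... <= 2 * 1 + 2 * hs_sq s (g t0)"
      using hs_term_le(1)[OF n in_Hs_diff[OF n H[OF t] H[OF t0T]], of K] U(3)[OF t0T t0(2) t] hs_term_le(1)[OF n H[OF t0T], of K] by linarith
    also have "hs_sq s (g t0) <= (\<Sum>t0\<in>C. hs_sq s (g t0))" by (rule member_le_sum[OF t0(1) _ C(2)]) (use q0 C(1) in auto)
    finally show ?thesis by simp
  qed
  then show ?thesis by blast
qed

text \<open>Testing with a reproducing kernel identifies the weak derivative, for almost every t,
  with the right-hand side at a point x. The \<open>du_bois_reymond\<close> lemma then gives the
  integral equation for every t, because both sides are continuous, and differentiation in t gives
  the claim.\<close>

lemma weak_sol_solves:
  fixes g :: "real => 'n::finite sdist"
  assumes n: "CARD('n) >= 2" and T: "T > 0" and ws: "weak_sol \<sigma> s T g" and g: "cont_Hs s {0..T} g"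
  shows "solves T k (\<sigma> * lam TYPE('n) k) (%t. g t k) (%t. bt (jv (g t 1)) (g t) k)"
proof -
  let ?\<mu> = "\<sigma> * lam TYPE('n) k" let ?b = "%t. bt (jv (g t 1)) (g t) k"
  have H: "in_Hs s (g t)" if "t : {0..T}" for t using g that unfolding cont_Hs_def by blast
  have h: "hseq (g t)" if "t : {0..T}" for t using H[OF that] unfolding in_Hs_def by blast
  have hk: "sph_harm k (g t k)" if "t : {0..T}" for t k using h[OF that] by blast
  have hb: "sph_harm k (?b t)" if "t : {0..T}" for t by (rule sph_harm_bt[OF n h[OF that]])
  have ci: "continuous_on {0..T} (%t. ip (g t k) Q)" if "sph_harm k Q" for k Q by (rule cont_Hs_ip[OF n g that])
  have cb: "continuous_on {0..T} (%t. ip (?b t) Q)" if "sph_harm k Q" for Q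
    by (rule bt_cont[OF n jv_cont[OF ci] h ci that])
  define R where "R t x = - ?\<mu> * g t k x + ?b t x" for t x
  have hR: "sph_harm k (R t)" if "t : {0..T}" for t
    unfolding R_def[abs_def] by (rule sph_harm_add[OF sph_harm_cmult[OF hk[OF that]] hb[OF that]])
  have iR: "ip (R t) Q = - ?\<mu> * ip (g t k) Q + ip (?b t) Q" if "t : {0..T}" "rpf Q" for t Q
    unfolding R_def[abs_def] by (simp only: ip_add_left[OF rpf_cmult[OF sph_harm_rpf[OF hk[OF that(1)]]] sph_harm_rpf[OF hb[OF that(1)]] that(2)] ip_cmult_left)
  have cR: "continuous_on {0..T} (%t. ip (R t) Q)" if Q: "sph_harm k Q" for Q
  proof -
    have "continuous_on {0..T} (%t. - ?\<mu> * ip (g t k) Q + ip (?b t) Q)" by (intro continuous_intros ci[OF Q] cb[OF Q])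
    then show ?thesis by (rule continuous_on_eq) (simp add: iR sph_harm_rpf[OF Q])
  qed
  obtain d where dL: "L2H (s - 1) T d" and dw: "weak_tderiv T g d"
    and dA: "AE t in lborel. t : {0<..<T} --> (\<forall>h. in_Hs (1 - s) h --> dpair (d t) h = - \<sigma> * gpair (g t) h + jpair (g t) h)"
    using ws unfolding weak_sol_def by blast
  have dh: "AE t in lborel. t : {0<..<T} --> in_Hs (s - 1) (d t)" and dm: "(%t. d t l x) : borel_measurable borel" for l x using dL unfolding L2H_def by blast+
  have AEd: "AE t in lborel. t : {0<..<T} --> d t k x = R t x" for x
    using dA dh
  proof eventually_elim
    case (elim t)
    show ?case
    proof
      assume t: "t : {0<..<T}"
      then have tT: "t : {0..T}" by auto
      have hd: "hseq (d t)" using elim(2) t unfolding in_Hs_def by blast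
      \<comment> \<open>A test sequence with one nonzero component belongs to every Sobolev space
        and reduces each pairing to degree k.\<close>
      let ?Q = "reprod k x" let ?h = "%l. if l = k then ?Q else (%x. 0)"
      have Q: "sph_harm k ?Q" by (rule sph_harm_reprod)
      have hh: "hseq ?h" using Q sph_harm_zero by auto
      have z: "summable (%l. hw TYPE('n) (1 - s) l * sqn (?h l))"
        by (rule summable_finite[of "{k}"]) auto
      have iH: "in_Hs (1 - s) ?h" unfolding in_Hs_def hs_weight_hw using hh z by blast
      have sf: "(\<Sum>l. F l (?h l)) = F k ?Q" if "!!l. F l (%x. 0) = 0" for F :: "nat => (real^'n => real) => real"
      proof -
        have "(\<Sum>l. F l (?h l)) = (\<Sum>l\<in>{k}. F l (?h l))" by (rule suminf_finite) (use that in auto)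
        then show ?thesis by simp
      qed
      have i0: "ip P (%x. 0) = 0" for P :: "real^'n => real" by (simp add: ip_def)
      have p1: "dpair (d t) ?h = ip (d t k) ?Q"
        unfolding pair_eqs(1)[OF n hd hh] by (rule sf[of "%l. ip (d t l)"]) (rule i0)
      have p2: "gpair (g t) ?h = lam TYPE('n) k * ip (g t k) ?Q"
        unfolding pair_eqs(2)[OF n h[OF tT] hh] by (rule sf[of "%l P. lam TYPE('n) l * ip (g t l) P"]) (simp only: i0 mult_zero_right)
      have p3: "jpair (g t) ?h = ip (?b t) ?Q"
        unfolding pair_eqs(3)[OF n h[OF tT] hh] by (rule sf[of "%l. ip (bt (jv (g t 1)) (g t) l)"]) (rule i0)
      have "dpair (d t) ?h = - \<sigma> * gpair (g t) ?h + jpair (g t) ?h" using elim(1) t iH by blast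
      then have "ip (d t k) ?Q = - \<sigma> * (lam TYPE('n) k * ip (g t k) ?Q) + ip (?b t) ?Q" unfolding p1 p2 p3 .
      then have "ip (d t k) ?Q = ip (R t) ?Q" by (simp add: iR[OF tT sph_harm_rpf[OF Q]])
      then show "d t k x = R t x" using ip_reprod[OF hd[THEN spec], of k x] ip_reprod[OF hR[OF tT], of x] by simp
    qed
  qed
  have px: "g t k x = g 0 k x + integral {0..t} (%ta. R ta x)" if t: "t : {0..T}" for t x
  proof (rule du_bois_reymond[OF T _ _ _ t])
    show cg: "continuous_on {0..T} (%t. g t k x)" by (rule continuous_on_eq[OF ci[OF sph_harm_reprod[of k x]]]) (rule ip_reprod[OF hk])
    show cr: "continuous_on {0..T} (%t. R t x)" by (rule continuous_on_eq[OF cR[OF sph_harm_reprod[of k x]]]) (rule ip_reprod[OF hR])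
    fix \<phi> assume \<phi>: "test_fun T \<phi>"
    then have sm: "smooth_on UNIV \<phi>" unfolding test_fun_def by blast
    have c\<phi>: "continuous_on A \<phi>" "continuous_on A (deriv \<phi>)" for A
      using continuous_on_subset[OF smooth_real_deriv(2)[OF sm]] DERIV_continuous_on[OF has_field_derivative_at_within[OF smooth_real_deriv(1)[OF sm]]] by auto
    have c1: "continuous_on {0..T} (%t. g t k x * deriv \<phi> t)" and c2: "continuous_on {0..T} (%t. R t x * \<phi> t)" by (intro continuous_on_mult cg cr c\<phi>)+
    have "(LBINT t:{0<..<T}. d t k x * \<phi> t) = (LBINT t:{0<..<T}. R t x * \<phi> t)"
      unfolding set_lebesgue_integral_def
    proof (rule integral_cong_AE)
      have "\<phi> : borel_measurable borel" by (rule borel_measurable_continuous_onI[OF c\<phi>(1)])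
      then show "(%t. indicat_real {0<..<T} t *\<^sub>R (d t k x * \<phi> t)) : borel_measurable lborel" using dm[of k x] by simp
      show "(%t. indicat_real {0<..<T} t *\<^sub>R (R t x * \<phi> t)) : borel_measurable lborel"
        using set_integrable_open_real(1)[OF c2] unfolding set_integrable_def by (rule borel_measurable_integrable)
      show "AE t in lborel. indicat_real {0<..<T} t *\<^sub>R (d t k x * \<phi> t) = indicat_real {0<..<T} t *\<^sub>R (R t x * \<phi> t)"
        using AEd[of x] by eventually_elim (auto simp: indicator_def)
    qed
    moreover have "(LBINT t:{0<..<T}. g t k x * deriv \<phi> t) = - (LBINT t:{0<..<T}. d t k x * \<phi> t)" using dw \<phi> unfolding weak_tderiv_def by blast
    ultimately show "integral {0..T} (%t. g t k x * deriv \<phi> t) = - integral {0..T} (%t. R t x * \<phi> t)"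
      unfolding set_integrable_open_real(2)[OF c1] set_integrable_open_real(2)[OF c2] by simp
  qed
  have ipt: "ip (g t k) Q = ip (g 0 k) Q + integral {0..t} (%ta. ip (R ta) Q)" if t: "t : {0..T}" and Q: "sph_harm k Q" for t Q
  proof -
    have sub: "{0..t} \<subseteq> {0..T}" using t by auto
    have hR': "!!ta. ta : {0..t} ==> sph_harm k (R ta)" using hR sub by blast
    have i1: "sph_harm k (%x. integral {0..t} (%ta. 1 * R ta x))" "ip (%x. integral {0..t} (%ta. 1 * R ta x)) Q = integral {0..t} (%ta. 1 * ip (R ta) Q)"
      by (rule harm_integral[OF hR' continuous_on_subset[OF cR sub] continuous_on_const]; (assumption | rule sph_harm_rpf[OF Q] Q))+
    have "g t k = (%x. g 0 k x + integral {0..t} (%ta. 1 * R ta x))" using px[OF t] by (simp add: fun_eq_iff)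
    then have "ip (g t k) Q = ip (%x. g 0 k x + integral {0..t} (%ta. 1 * R ta x)) Q" by (rule arg_cong)
    also have "... = ip (g 0 k) Q + ip (%x. integral {0..t} (%ta. 1 * R ta x)) Q"
      by (rule ip_add_left) (use sph_harm_rpf[OF hk[of 0 k]] sph_harm_rpf[OF i1(1)] sph_harm_rpf[OF Q] T in auto)
    finally show ?thesis unfolding i1(2) by simp
  qed
  show ?thesis unfolding solves_def
  proof (intro conjI ballI allI impI)
    fix t assume "t : {0..T}" then show "sph_harm k (g t k)" "sph_harm k (?b t)" using hk hb by auto
  next
    fix Q :: "real^'n => real" assume Q: "sph_harm k Q"
    show "continuous_on {0..T} (%t. ip (?b t) Q)" by (rule cb[OF Q])
    fix t assume t: "t : {0..T}"
    have "((%t. ip (g 0 k) Q + integral {0..t} (%ta. ip (R ta) Q)) has_real_derivative 0 + ip (R t) Q) (at t within {0..T})"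
      by (intro DERIV_add DERIV_const integral_has_real_derivative[OF cR[OF Q] t])
    then have "((%t. ip (g t k) Q) has_real_derivative 0 + ip (R t) Q) (at t within {0..T})"
    proof (rule has_field_derivative_transform_within[of _ _ _ _ 1])
      show "ip (g 0 k) Q + integral {0..t'} (%ta. ip (R ta) Q) = ip (g t' k) Q" if "t' : {0..T}" for t' by (rule ipt[OF that Q, symmetric])
    qed (use t in simp_all)
    then show "((%t. ip (g t k) Q) has_real_derivative - ?\<mu> * ip (g t k) Q + ip (?b t) Q) (at t within {0..T})"
      unfolding iR[OF t sph_harm_rpf[OF Q]] by simp
  qed
qed

context doi_sol begin

text \<open>The partial sums of the squared difference are bounded uniformly in K, for g by
  \<open>cont_Hs_bounded\<close>. After m iterations they are at most a term of an exponential
  series, which vanishes as m grows.\<close>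

lemma f_unique:
  assumes T: "T > 0" and ws: "weak_sol \<sigma> s T g" and g: "cont_Hs s {0..T} g" and g0: "g 0 = f0" and t: "t : {0..T}"
  shows "g t = f t"
proof -
  let ?h = "hw TYPE('n) s"
  note sg' = weak_sol_solves[OF n2 T ws g]
  have h: "hseq (g t)" if "t : {0..T}" for t using g that unfolding cont_Hs_def in_Hs_def by blast
  have hf: "hseq (f t)" for t using fh by blast
  have ci: "continuous_on {0..T} (%t. ip (g t k) Q)" if "sph_harm k Q" for k Q by (rule cont_Hs_ip[OF n2 g that])
  have cf: "continuous_on {0..T} (%t. ip (f t k) Q)" if "sph_harm k Q" for k Q by (rule continuous_on_subset[OF fc[OF that]]) simp
  note cJ = jv_cont[of "{0..T}" "%t. g t 1", OF ci] and cJf = continuous_on_subset[OF J_cont, of "{0..T}", OF subset_UNIV]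
  have "compact ((%t. (norm (jv (g t 1)))\<^sup>2) ` {0..T})" by (intro compact_continuous_image continuous_intros cJ) auto
  then obtain RR where "\<forall>y\<in>(%t. (norm (jv (g t 1)))\<^sup>2) ` {0..T}. norm y <= RR" using compact_imp_bounded bounded_iff by metis
  then have RR: "(norm (jv (g t 1)))\<^sup>2 <= RR" if "t : {0..T}" for t using that by auto
  have L: "(norm (jv (g t 1) - jv (f t 1)))\<^sup>2 <= real CARD('n) * sqn (%x. g t 1 x - f t 1 x)" if t: "t : {0..T}" for t
  proof -
    have r: "rpf (g t 1)" using h[OF t] sph_harm_rpf by blast
    have "rpf (%x. g t 1 x - f t 1 x)" using sph_harm_rpf[OF sph_harm_diff[OF h[OF t, THEN spec] fh]] .
    from norm_jv_le[OF this] show ?thesis unfolding jv_diff[OF r frpf] .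
  qed
  obtain N where N: "N >= 0" "!!t K. t : {0..T} ==> (\<Sum>k\<le>K. ?h k * sqn (f t k)) <= N" using fbd[of T] by blast
  obtain N' where N': "!!t K. t : {0..T} ==> (\<Sum>k\<le>K. ?h k * sqn (g t k)) <= N'" using cont_Hs_bounded[OF n2 g] by blast
  let ?D = "%K t. \<Sum>k\<le>K. ?h k * sqn (%x. g t k x - f t k x)"
  define \<kappa> where "\<kappa> = 2 * hwC TYPE('n) s / \<sigma> * (4 * real CARD('n) * (RR + real CARD('n) * N / ?h 1))"
  have "RR >= 0" using RR[OF t] zero_le_power2 order_trans by blast
  then have \<kappa>: "\<kappa> >= 0" unfolding \<kappa>_def using hwC_ge1[OF n2, of s] sg N(1) hw_pos[OF n2, of s 1] by (intro mult_nonneg_nonneg add_nonneg_nonneg divide_nonneg_nonneg) auto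
  have st: "?D K t <= \<kappa> * integral {0..t} (?D (Suc K))" if t: "t : {0..T}" for K t
    unfolding \<kappa>_def
    by (rule diff_energy[OF n2 sg sg' fsol _ h hf ci cf cJ cJf RR _ L N t]) (use g0 finit in auto)
  have hd: "sph_harm k (%x. g t k x - f t k x)" if "t : {0..T}" for t k by (rule sph_harm_diff[OF h[OF that, THEN spec] fh])
  have cD: "continuous_on {0..T} (?D K)" for K
  proof (intro continuous_on_sum continuous_on_mult_left cont_sqn[OF hd])
    fix k Q assume Q: "sph_harm k (Q :: real^'n => real)"
    have "continuous_on {0..T} (%t. ip (g t k) Q - ip (f t k) Q)" by (intro continuous_on_diff ci[OF Q] cf[OF Q])
    then show "continuous_on {0..T} (%t. ip (%x. g t k x - f t k x) Q)"
      by (rule continuous_on_eq) (rule ip_diff_left[OF sph_harm_rpf[OF h[THEN spec]] frpf sph_harm_rpf[OF Q], symmetric])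
  qed auto
  have M: "?D K t <= 2 * N' + 2 * N" if t: "t : {0..T}" for K t
  proof -
    have "?D K t <= (\<Sum>k\<le>K. 2 * (?h k * sqn (g t k)) + 2 * (?h k * sqn (f t k)))"
    proof (rule sum_mono)
      fix k
      have "?h k * sqn (%x. g t k x - f t k x) <= ?h k * (2 * sqn (g t k) + 2 * sqn (f t k))"
        using hw_pos[OF n2, of s k] by (intro mult_left_mono sqn_diff_le sph_harm_rpf[OF h[OF t, THEN spec]] frpf) auto
      then show "?h k * sqn (%x. g t k x - f t k x) <= 2 * (?h k * sqn (g t k)) + 2 * (?h k * sqn (f t k))" by (simp add: algebra_simps)
    qed
    also have "... <= 2 * N' + 2 * N" using N'[OF t, of K] N(2)[OF t, of K] by (simp add: sum.distrib sum_distrib_left[symmetric])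
    finally show ?thesis .
  qed
  have it: "?D K t <= (2 * N' + 2 * N) * ((\<kappa> * t) ^ m / fact m)" for K m
    by (rule factorial_iteration[of T "%m. ?D", OF cD \<kappa> M st t])
  have D0: "?D K t <= 0" for K
  proof -
    have "(%m. inverse (fact m) * (\<kappa> * t) ^ m) \<longlonglongrightarrow> 0" by (rule summable_LIMSEQ_zero[OF summable_exp])
    then have "(%m. (2 * N' + 2 * N) * (inverse (fact m) * (\<kappa> * t) ^ m)) \<longlonglongrightarrow> (2 * N' + 2 * N) * 0" by (rule tendsto_mult_left)
    then have "(%m. (2 * N' + 2 * N) * ((\<kappa> * t) ^ m / fact m)) \<longlonglongrightarrow> 0" by (simp add: divide_inverse mult.commute)
    then show ?thesis by (rule LIMSEQ_le_const) (use it in blast)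
  qed
  have nn: "0 <= ?h k * sqn (%x. g t k x - f t k x)" for k
    using hw_pos[OF n2, of s k] sqn_nonneg[OF sph_harm_rpf[OF hd[OF t]]] by simp
  have "g t k = f t k" for k
  proof -
    have "?h k * sqn (%x. g t k x - f t k x) <= ?D k t" by (rule member_le_sum) (use nn in auto)
    then have "?h k * sqn (%x. g t k x - f t k x) = 0" using D0[of k] nn[of k] by linarith
    then have "sqn (%x. g t k x - f t k x) = 0" using hw_pos[OF n2, of s k] by simp
    then have "(%x. g t k x - f t k x) = (%x. 0)" by (rule sqn_eq_0[OF sph_harm_rpf[OF hd[OF t]] sph_harm_homog[OF hd[OF t]]])
    then show ?thesis by (simp add: fun_eq_iff)
  qed
  then show ?thesis by (simp add: fun_eq_iff)
qed

end

theorem theorem3: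
  fixes \<sigma> s :: real and f0 :: "'n::finite sdist"
  assumes "CARD('n) \<ge> 2" and "\<sigma> > 0" and "in_Hs s f0"
  shows "\<exists>f :: real \<Rightarrow> 'n sdist.
     f 0 = f0 \<and> cont_Hs s {0..} f \<and> (\<forall>T>0. weak_sol \<sigma> s T f) \<and>
     (\<forall>T>0. \<forall>g. weak_sol \<sigma> s T g \<and> cont_Hs s {0..T} g \<and> g 0 = f0 \<longrightarrow>
                 (\<forall>t\<in>{0..T}. g t = f t)) \<and>
     (\<exists>F :: real \<Rightarrow> real^'n \<Rightarrow> real.
        smooth_on ({0<..} \<times> - {0}) (\<lambda>(t, x). F t (x /\<^sub>R norm x)) \<and>
        (\<forall>t>0. \<forall>l Y. sph_harm l Y \<longrightarrow> sph_int (\<lambda>x. F t x * Y x) = sph_int (\<lambda>x. f t l x * Y x)) \<and>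
        (\<forall>t>0. \<forall>\<omega>\<in>sphere 0 1.
            deriv (\<lambda>\<tau>. F \<tau> \<omega>) t =
              - tdiv (\<lambda>x. F t x *\<^sub>R (Jv (f t) - (x \<bullet> Jv (f t)) *\<^sub>R x)) \<omega> + \<sigma> * lapS (F t) \<omega>) \<and>
        (\<forall>t>0. real_analytic_on (- {0}) (\<lambda>x. F t (x /\<^sub>R norm x))))"
proof -
  obtain f :: "real => 'n sdist" where "doi_sol \<sigma> s f0 f"
    using doi_solution[OF assms] by (auto simp: doi_sol_def assms)
  then interpret doi_sol \<sigma> s f0 f .
  show ?thesis
    by (intro exI[of _ f] conjI allI impI ballI exI[of _ "%t. ZZ (f t)"] finit f_cont_Hs f_weak_sol f_smooth F_coeff F_pde F_analytic)
      (auto intro: f_unique)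
qed

end
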